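(* Let $S$ be a $\boldsymbol{T}$-algebra. The following are equivalent: (a) there exists a tropical curve with parallel rays $\Gamma_{\operatorname{par}}$ whose rational function semifield $\operatorname{Rat}(\Gamma_{\operatorname{par}})$ is isomorphic to $S$ as a $\boldsymbol{T}$-algebra; (b) there exists a surjective $\boldsymbol{T}$-algebra homomorphism $\psi$ from a tropical rational function semifield $\overline{\boldsymbol{T}(\boldsymbol{X})}_n$ to $S$ satisfying the following four conditions: (1) $\operatorname{Ker}(\psi)$ is finitely generated as a congruence, (2) $\operatorname{Ker}(\psi)=\boldsymbol{E}(\boldsymbol{V}(\operatorname{Ker}(\psi)))$ holds, (3) $\boldsymbol{V}(\operatorname{Ker}(\psi))$ is connected, and (4) $\boldsymbol{V}(\operatorname{Ker}(\psi))$ is of dimension zero or one; (c) any surjective $\boldsymbol{T}$-algebra homomorphism $\psi$ from a tropical rational function semifield to $S$ satisfies the four conditions (1)–(4) above.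
   Context: **Algebra.** $\boldsymbol{T}=\mathbb{R}\cup\{-\infty\}$ with $a\oplus b=\max\{a,b\}$, $a\odot b=a+b$. Semirings are commutative with absorbing additive identity and multiplicative identity. A $\boldsymbol{T}$-algebra is a semiring $S$ with a semiring homomorphism $\boldsymbol{T}\to S$; $\boldsymbol{T}$-algebra homomorphisms are semiring homomorphisms compatible with the structure maps. **Congruences.** The tropical rational function semifield $\overline{\boldsymbol{T}(\boldsymbol{X})}_n$ consists of $-\infty$ and all functions $\mathbb{R}^n\to\mathbb{R}$ of the form $P-Q$, with $P,Q$ functions defined by tropical Laurent polynomials $\neq-\infty$ in $n$ variables (finite maxima of affine functions with integer slopes and real constants), with pointwise $\oplus,\odot$. A congruence on a semiring is an equivalence relation compatible with both operations; it is finitely generated if it is the smallest congruence containing some finite subset of it. $\operatorname{Ker}(\psi)=\{(x,y):\psi(x)=\psi(y)\}$. For $V\subset\mathbb{R}^n$, $\boldsymbol{E}(V)=\{(f,g)\in\overline{\boldsymbol{T}(\boldsymbol{X})}_n^2: f(x)=g(x)\ \forall x\in V\}$; for $T\subset\overline{\boldsymbol{T}(\boldsymbol{X})}_n^2$, $\boldsymbol{V}(T)=\{x\in\mathbb{R}^n: f(x)=g(x)\ \forall (f,g)\in T\}$. For a finitely generated congruence $E$ the set $\boldsymbol{V}(E)$ is known to be a finite union of $\mathbb{R}$-rational polyhedral sets (sets $\{x: Ax\ge b\}$ with $A$ a rational matrix and $b$ a real vector); the dimension of such a union is the maximal dimension of its members ($-1$ for the empty set). **Tropical curves.** A tropical curve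 $\Gamma$ is the underlying topological space of a pair $(G,l)$ (a model of $\Gamma$), where $G$ is a finite connected nonempty undirected multigraph (loops allowed) and $l:E(G)\to\mathbb{R}_{>0}\cup\{\infty\}$ takes the value $\infty$ only on leaf edges (non-loop edges having an end, called a leaf end, incident to no other edge), together with an identification of each edge $e$ with $[0,l(e)]$; here $[0,\infty]$ is the one-point compactification of $[0,\infty)$ with $\infty$ at infinite distance from all other points, and if $l(e)=\infty$ a leaf end of $e$ is identified with $\infty$. A curve has many models. Points identified with $\infty$ are points at infinity; the others are finite points. A ray of $\Gamma$ is an edge of length $\infty$ of some model. **Rational functions.** $\operatorname{Rat}(\Gamma)$ is the set consisting of the constant function $-\infty$ and all continuous $f:\Gamma\to\mathbb{R}\cup\{\pm\infty\}$ that are piecewise affine with integer slopes and finitely many pieces and take values $\pm\infty$ only at points at infinity; with pointwise $\max$ and $+$ on finite points (extended continuously) it is a semifield containing $\boldsymbol{T}$ as the constants. **Parallel rays.** A tropical curve with parallel rays $\Gamma_{\operatorname{par}}$ is a tropical curve $\Gamma$ (its underlying tropical curve) with an equivalence relation $\sim$ on its rays such that $L_1\subset L_2$ implies $L_1\sim L_2$; rays equivalent under $\sim$ are called parallel. Its rational function semifield $\operatorname{Rat}(\Gamma_{\operatorname{par}})\subset\operatorname{Rat}(\Gamma)$ consists of $-\infty$ and of those $f\in\operatorname{Rat}(\Gamma)\setminus\{-\infty\}$ that have the same slope at infinity along any two parallel rays; it is a $\boldsymbol{T}$-algebra with the operations of $\operatorname{Rat}(\Gamma)$.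
   Formalization: Condition (c) also requires that at least one surjective T-algebra homomorphism from a tropical rational function semifield to S exists; otherwise (c) holds vacuously, e.g. for S = T[x], while (a) and (b) fail. *)

theory Defs
  imports
    "HOL-Analysis.Analysis"
    "HOL-Algebra.Ring"
    "HOL-Library.Function_Algebras"
    "Graph_Theory.Digraph_Component"
begin

section \<open>Semirings, algebras over the tropical semifield, congruences\<close>

definition comm_semiring :: "('a, 'm) ring_scheme \<Rightarrow> bool" where
  "comm_semiring R \<longleftrightarrow> semiring R \<and> comm_monoid R"

text \<open>Unlike for rings, preservation of zero has to be required separately.\<close>

definition semiring_hom :: "('a, 'm) ring_scheme \<Rightarrow> ('b, 'k) ring_scheme \<Rightarrow> ('a \<Rightarrow> 'b) set" where
  "semiring_hom R S = {h \<in> ring_hom R S. h \<zero>\<^bsub>R\<^esub> = \<zero>\<^bsub>S\<^esub>}"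

definition trop :: "ereal ring" where
  "trop = \<lparr>carrier = {a. a \<noteq> \<infinity>}, monoid.mult = (+), one = 0, zero = -\<infinity>, add = max\<rparr>"

definition T_algebra :: "('a, 'm) ring_scheme \<Rightarrow> (ereal \<Rightarrow> 'a) \<Rightarrow> bool" where
  "T_algebra S \<iota> \<longleftrightarrow> comm_semiring S \<and> \<iota> \<in> semiring_hom trop S"

definition T_algebra_hom ::
  "('a, 'm) ring_scheme \<Rightarrow> (ereal \<Rightarrow> 'a) \<Rightarrow> ('b, 'k) ring_scheme \<Rightarrow> (ereal \<Rightarrow> 'b) \<Rightarrow> ('a \<Rightarrow> 'b) set" where
  "T_algebra_hom R \<iota>R S \<iota>S =
     {h \<in> semiring_hom R S. \<forall>a \<in> carrier trop. h (\<iota>R a) = \<iota>S a}"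

definition T_algebra_surj ::
  "('a, 'm) ring_scheme \<Rightarrow> (ereal \<Rightarrow> 'a) \<Rightarrow> ('b, 'k) ring_scheme \<Rightarrow> (ereal \<Rightarrow> 'b) \<Rightarrow> ('a \<Rightarrow> 'b) set" where
  "T_algebra_surj R \<iota>R S \<iota>S =
     {h \<in> T_algebra_hom R \<iota>R S \<iota>S. h ` carrier R = carrier S}"

definition T_algebra_iso ::
  "('a, 'm) ring_scheme \<Rightarrow> (ereal \<Rightarrow> 'a) \<Rightarrow> ('b, 'k) ring_scheme \<Rightarrow> (ereal \<Rightarrow> 'b) \<Rightarrow> ('a \<Rightarrow> 'b) set" where
  "T_algebra_iso R \<iota>R S \<iota>S =
     {h \<in> T_algebra_hom R \<iota>R S \<iota>S. bij_betw h (carrier R) (carrier S)}"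

definition congruence :: "('a, 'm) ring_scheme \<Rightarrow> ('a \<times> 'a) set \<Rightarrow> bool" where
  "congruence R E \<longleftrightarrow> equiv (carrier R) E \<and>
     (\<forall>(a, b) \<in> E. \<forall>(c, d) \<in> E.
        (a \<oplus>\<^bsub>R\<^esub> c, b \<oplus>\<^bsub>R\<^esub> d) \<in> E \<and> (a \<otimes>\<^bsub>R\<^esub> c, b \<otimes>\<^bsub>R\<^esub> d) \<in> E)"

definition fin_gen_congruence :: "('a, 'm) ring_scheme \<Rightarrow> ('a \<times> 'a) set \<Rightarrow> bool" where
  "fin_gen_congruence R E \<longleftrightarrow> congruence R E \<and>
     (\<exists>F. finite F \<and> F \<subseteq> E \<and> (\<forall>C. congruence R C \<and> F \<subseteq> C \<longrightarrow> E \<subseteq> C))"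

definition Ker :: "('a, 'm) ring_scheme \<Rightarrow> ('a \<Rightarrow> 'b) \<Rightarrow> ('a \<times> 'a) set" where
  "Ker R \<psi> = {(f, g) \<in> carrier R \<times> carrier R. \<psi> f = \<psi> g}"


section \<open>The tropical rational function semifield in n variables\<close>

text \<open>Real n-space is the library's \<^const>\<open>Euclidean_space\<close> n: the functions
  \<^typ>\<open>nat \<Rightarrow> real\<close> that vanish at all indices from n on.\<close>

abbreviation Rn :: "nat \<Rightarrow> (nat \<Rightarrow> real) set" where
  "Rn n \<equiv> topspace (Euclidean_space n)"

definition laurent_fun :: "nat \<Rightarrow> ((nat \<Rightarrow> real) \<Rightarrow> real) set" where
  "laurent_fun n =
     {\<lambda>x. Max ((\<lambda>(a, c). c + (\<Sum>i<n. real_of_int (a i) * x i)) ` F) |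
        F :: ((nat \<Rightarrow> int) \<times> real) set. finite F \<and> F \<noteq> {}}"

definition trop_rat :: "nat \<Rightarrow> ((nat \<Rightarrow> real) \<Rightarrow> ereal) ring" where
  "trop_rat n =
     \<lparr>carrier = {\<lambda>x\<in>Rn n. -\<infinity>} \<union>
        {\<lambda>x\<in>Rn n. ereal (P x - Q x) | P Q. P \<in> laurent_fun n \<and> Q \<in> laurent_fun n},
      monoid.mult = (\<lambda>f g. \<lambda>x\<in>Rn n. f x + g x),
      one = (\<lambda>x\<in>Rn n. 0),
      zero = (\<lambda>x\<in>Rn n. -\<infinity>),
      add = (\<lambda>f g. \<lambda>x\<in>Rn n. max (f x) (g x))\<rparr>"

definition trop_rat_const :: "nat \<Rightarrow> ereal \<Rightarrow> (nat \<Rightarrow> real) \<Rightarrow> ereal" where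
  "trop_rat_const n a = (\<lambda>x\<in>Rn n. a)"

definition cong_of :: "nat \<Rightarrow> (nat \<Rightarrow> real) set \<Rightarrow> (((nat \<Rightarrow> real) \<Rightarrow> ereal) \<times> ((nat \<Rightarrow> real) \<Rightarrow> ereal)) set" where
  "cong_of n V = {(f, g) \<in> carrier (trop_rat n) \<times> carrier (trop_rat n). \<forall>x\<in>V. f x = g x}"

definition variety_of :: "nat \<Rightarrow> (((nat \<Rightarrow> real) \<Rightarrow> ereal) \<times> ((nat \<Rightarrow> real) \<Rightarrow> ereal)) set \<Rightarrow> (nat \<Rightarrow> real) set" where
  "variety_of n T = {x \<in> Rn n. \<forall>(f, g) \<in> T. f x = g x}"


section \<open>Polyhedral sets and dimension\<close>

definition rational_polyhedral :: "nat \<Rightarrow> (nat \<Rightarrow> real) set \<Rightarrow> bool" where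
  "rational_polyhedral n P \<longleftrightarrow>
     (\<exists>(k :: nat) (A :: nat \<Rightarrow> nat \<Rightarrow> rat) (b :: nat \<Rightarrow> real).
        P = {x \<in> Rn n. \<forall>j<k. (\<Sum>i<n. real_of_rat (A j i) * x i) \<ge> b j})"

text \<open>The dimension of the affine hull, i.e. the linear dimension of the span of all
  differences of points, with value -1 for the empty set.  The library's affine dimension is
  only available on Euclidean types.\<close>

definition polyhedral_dim :: "(nat \<Rightarrow> real) set \<Rightarrow> int" where
  "polyhedral_dim P =
     (if P = {} then -1
      else int (vector_space.dim (\<lambda>(c :: real) x i. c * x i) {x - y | x y. x \<in> P \<and> y \<in> P}))"

definition has_dim :: "nat \<Rightarrow> (nat \<Rightarrow> real) set \<Rightarrow> int \<Rightarrow> bool" where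
  "has_dim n V d \<longleftrightarrow>
     (\<exists>\<P>. finite \<P> \<and> (\<forall>P\<in>\<P>. rational_polyhedral n P) \<and> V = \<Union>\<P> \<and>
        d = Max (insert (-1) (polyhedral_dim ` \<P>)))"


section \<open>Tropical curves\<close>

text \<open>A tropical curve is given by one of its models: a finite connected multigraph together
  with edge lengths.  All notions below depend on the curve only, not on the chosen model.
  An arc of the directed multigraph is an undirected edge \<open>e\<close> together with the direction in
  which it is identified with \<open>[0, l e]\<close>; the tail sits at 0 and the head at \<open>l e\<close>, so that for
  an infinite edge the head is the leaf end identified with infinity.  As the graphs are finite,
  natural numbers suffice as names of vertices and edges.\<close>

type_synonym curve = "(nat, nat) pre_digraph \<times> (nat \<Rightarrow> ereal)"

definition is_curve :: "curve \<Rightarrow> bool" where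
  "is_curve = (\<lambda>(G, l). fin_digraph G \<and> Digraph_Component.connected G \<and>
     (\<forall>e \<in> arcs G. l e > 0) \<and>
     (\<forall>e \<in> arcs G. l e = \<infinity> \<longrightarrow> head G e \<noteq> tail G e \<and>
        (\<forall>e' \<in> arcs G. e' \<noteq> e \<longrightarrow> head G e \<noteq> tail G e' \<and> head G e \<noteq> head G e')))"

text \<open>\<open>Inner e t\<close> is the point with coordinate \<open>t\<close> in the interior of the edge \<open>e\<close>.\<close>

datatype point = Vert nat | Inner nat real

definition points :: "curve \<Rightarrow> point set" where
  "points = (\<lambda>(G, l). Vert ` verts G \<union>
     {Inner e t | e t. e \<in> arcs G \<and> 0 < t \<and> ereal t < l e})"

definition infinite_points :: "curve \<Rightarrow> point set" where
  "infinite_points = (\<lambda>(G, l). {Vert (head G e) | e. e \<in> arcs G \<and> l e = \<infinity>})"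

definition finite_points :: "curve \<Rightarrow> point set" where
  "finite_points \<Gamma> = points \<Gamma> - infinite_points \<Gamma>"

text \<open>The identification of \<open>[0, l e]\<close> with the closed edge \<open>e\<close>.\<close>

definition edge_point :: "curve \<Rightarrow> nat \<Rightarrow> ereal \<Rightarrow> point" where
  "edge_point = (\<lambda>(G, l) e t.
     if t = 0 then Vert (tail G e)
     else if t = l e then Vert (head G e)
     else Inner e (real_of_ereal t))"

text \<open>The quotient topology obtained by gluing the intervals \<open>[0, l e]\<close>.  As a subspace of the
  extended reals, \<open>[0, \<infinity>]\<close> is the one-point compactification of \<open>[0, \<infinity>)\<close>.\<close>

definition curve_top :: "curve \<Rightarrow> point topology" where
  "curve_top = (\<lambda>(G, l). topology (\<lambda>U. U \<subseteq> points (G, l) \<and>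
     (\<forall>e \<in> arcs G. openin (top_of_set {0..l e}) {t \<in> {0..l e}. edge_point (G, l) e t \<in> U})))"

text \<open>\<open>\<Phi>\<close> identifies the space of the model \<open>\<Gamma>'\<close> with the curve \<open>\<Gamma>\<close>: it is a homeomorphism
  which preserves lengths along edges, i.e. wherever it maps the interior of an edge of \<open>\<Gamma>'\<close> to
  the interior of an edge of \<open>\<Gamma>\<close>, it is locally \<open>s \<mapsto> \<plusminus>s + const\<close> in the coordinates.
  So \<open>\<Gamma>'\<close>, together with \<open>\<Phi>\<close>, is another model of the curve \<open>\<Gamma>\<close>.\<close>

definition model_of :: "curve \<Rightarrow> curve \<Rightarrow> (point \<Rightarrow> point) \<Rightarrow> bool" where
  "model_of \<Gamma> \<Gamma>' \<Phi> \<longleftrightarrow> is_curve \<Gamma>' \<and>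
     homeomorphic_map (curve_top \<Gamma>') (curve_top \<Gamma>) \<Phi> \<and>
     (\<forall>e' s e t. Inner e' s \<in> points \<Gamma>' \<and> Inner e t \<in> points \<Gamma> \<and> \<Phi> (Inner e' s) = Inner e t \<longrightarrow>
        (\<exists>\<sigma> \<in> {1, -1}. \<forall>\<^sub>F h in nhds 0. \<Phi> (Inner e' (s + h)) = Inner e (t + \<sigma> * h)))"

text \<open>A ray is an edge of infinite length of some model; \<open>p\<close> is its identification with
  \<open>[0, \<infinity>]\<close>.\<close>

definition ray_param :: "curve \<Rightarrow> (ereal \<Rightarrow> point) \<Rightarrow> bool" where
  "ray_param \<Gamma> p \<longleftrightarrow>
     (\<exists>G' l' \<Phi> e. model_of \<Gamma> (G', l') \<Phi> \<and> e \<in> arcs G' \<and> l' e = \<infinity> \<and>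
        p = \<Phi> \<circ> edge_point (G', l') e)"

definition rays :: "curve \<Rightarrow> point set set" where
  "rays \<Gamma> = {p ` {0..\<infinity>} | p. ray_param \<Gamma> p}"


section \<open>Rational functions\<close>

definition edge_piecewise_affine :: "curve \<Rightarrow> (point \<Rightarrow> ereal) \<Rightarrow> nat \<Rightarrow> bool" where
  "edge_piecewise_affine \<Gamma> f e \<longleftrightarrow>
     (\<exists>\<I> :: real set set. finite \<I> \<and> \<Union>\<I> = {t. 0 \<le> t \<and> ereal t \<le> snd \<Gamma> e} \<and>
        (\<forall>I \<in> \<I>. is_interval I \<and>
           (\<exists>(m :: int) (c :: real). \<forall>t \<in> I.
              f (edge_point \<Gamma> e (ereal t)) = ereal (of_int m * t + c))))"

definition Rat_nonzero :: "curve \<Rightarrow> (point \<Rightarrow> ereal) set" where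
  "Rat_nonzero \<Gamma> =
     {f. f \<in> extensional (points \<Gamma>) \<and> continuous_map (curve_top \<Gamma>) euclidean f \<and>
         (\<forall>e \<in> arcs (fst \<Gamma>). edge_piecewise_affine \<Gamma> f e) \<and>
         (\<forall>x \<in> finite_points \<Gamma>. f x \<noteq> \<infinity> \<and> f x \<noteq> -\<infinity>)}"

definition Rat_const :: "curve \<Rightarrow> ereal \<Rightarrow> point \<Rightarrow> ereal" where
  "Rat_const \<Gamma> a = (\<lambda>x \<in> points \<Gamma>. a)"

definition Rat :: "curve \<Rightarrow> (point \<Rightarrow> ereal) set" where
  "Rat \<Gamma> = insert (Rat_const \<Gamma> (-\<infinity>)) (Rat_nonzero \<Gamma>)"

text \<open>Operations are pointwise on finite points and extended continuously; a pointwise sum at a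
  point at infinity could be \<open>\<infinity> - \<infinity>\<close>.\<close>

definition Rat_lift :: "curve \<Rightarrow> (ereal \<Rightarrow> ereal \<Rightarrow> ereal) \<Rightarrow>
    (point \<Rightarrow> ereal) \<Rightarrow> (point \<Rightarrow> ereal) \<Rightarrow> point \<Rightarrow> ereal" where
  "Rat_lift \<Gamma> opn f g = (THE h. h \<in> Rat \<Gamma> \<and> (\<forall>x \<in> finite_points \<Gamma>. h x = opn (f x) (g x)))"

definition slope_at_infinity :: "curve \<Rightarrow> (point \<Rightarrow> ereal) \<Rightarrow> point set \<Rightarrow> int" where
  "slope_at_infinity \<Gamma> f L =
     (THE m. \<exists>p c. ray_param \<Gamma> p \<and> L = p ` {0..\<infinity>} \<and>
        (\<forall>\<^sub>F t in at_top. f (p (ereal t)) = ereal (of_int m * t + c)))"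


section \<open>Tropical curves with parallel rays\<close>

definition is_curve_with_parallel_rays :: "curve \<Rightarrow> (point set \<times> point set) set \<Rightarrow> bool" where
  "is_curve_with_parallel_rays \<Gamma> par \<longleftrightarrow> is_curve \<Gamma> \<and> equiv (rays \<Gamma>) par \<and>
     (\<forall>L1 \<in> rays \<Gamma>. \<forall>L2 \<in> rays \<Gamma>. L1 \<subseteq> L2 \<longrightarrow> (L1, L2) \<in> par)"

definition Rat_par :: "curve \<Rightarrow> (point set \<times> point set) set \<Rightarrow> (point \<Rightarrow> ereal) ring" where
  "Rat_par \<Gamma> par =
     \<lparr>carrier = insert (Rat_const \<Gamma> (-\<infinity>))
        {f \<in> Rat_nonzero \<Gamma>. \<forall>(L1, L2) \<in> par. slope_at_infinity \<Gamma> f L1 = slope_at_infinity \<Gamma> f L2},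
      monoid.mult = Rat_lift \<Gamma> (+),
      one = Rat_const \<Gamma> 0,
      zero = Rat_const \<Gamma> (-\<infinity>),
      add = Rat_lift \<Gamma> max\<rparr>"


section \<open>The four conditions on a kernel\<close>

definition four_conditions :: "nat \<Rightarrow> (((nat \<Rightarrow> real) \<Rightarrow> ereal) \<Rightarrow> 's) \<Rightarrow> bool" where
  "four_conditions n \<psi> \<longleftrightarrow>
     (let K = Ker (trop_rat n) \<psi>; V = variety_of n K in
        fin_gen_congruence (trop_rat n) K \<and>
        K = cong_of n V \<and>
        connectedin (Euclidean_space n) V \<and>
        (has_dim n V 0 \<or> has_dim n V 1))"

end

theory Submission
  imports Defs
begin

text \<open>The proof reduces the three conditions to a statement about subsets of real n-space.  Call a set
  a union of segments if it is a finite union of points, segments and rays with integral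
  directions.  Rational polyhedral sets of dimension at most one are of this kind
  (\<open>polyhedral_seg_union\<close>), and conversely the functions that agree on a given nonempty union of
  segments \<open>V\<close> form a finitely generated congruence whose variety is \<open>V\<close>
  (\<open>fin_gen_seg_union\<close>, \<open>variety_cong_of\<close>): an integral piecewise linear substitute for the
  distance to \<open>V\<close> dominates every function that vanishes on \<open>V\<close>, and the pair of this function
  and 0 generates.  So the four conditions say that the kernel of \<open>\<psi>\<close> is the congruence of a
  nonempty connected union of segments (\<open>four_conditions_iff\<close>), and (b) says that \<open>S\<close> consists of the
  restrictions of tropical rational functions to such a set.

  This does not depend on the presentation.  If \<open>\<psi>\<close> is a surjection with the four conditions for
  \<open>V\<close>, then any other homomorphism \<open>\<phi>\<close> from a tropical rational function semifield to \<open>S\<close> is the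
  composition of \<open>\<psi>\<close> with the substitution of a piecewise linear map \<open>F\<close> whose coordinates are lifts
  of the images of the variables.  Its kernel is the congruence of \<open>F ` V\<close>, which is again a
  connected union of segments (\<open>hom_four_conditions\<close>).

  The link with curves is an extension property (\<open>extension\<close>): a function on a union of segments
  is the restriction of a tropical rational function if and only if it is continuous and
  piecewise affine with integer slopes with respect to primitive directions, and rays in the same
  direction have the same slope at infinity.  The latter is precisely the condition imposed by
  parallel rays.  Hence an injective map from the finite points of a curve with parallel rays to
  real n-space, given by rational functions, of primitive direction everywhere, and such that
  equal directions at infinity occur exactly on parallel rays, identifies the rational functions
  of the curve with the restrictions of tropical rational functions to the image (the locale
  \<open>realization\<close>).  Every curve has such a realization, built from tent functions on its edges
  (\<open>curve_realization\<close>), and every connected union of segments is the image of one, after it has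
  been cut at the ends and the crossings of its segments (\<open>realization_\<Gamma>\<close> in the locale
  \<open>seg_system\<close>).\<close>

section \<open>Piecewise affine functions of one variable\<close>

text \<open>Right ends are extended reals, so that bounded intervals and half-lines are treated
  alike. In particular \<open>icc 0 (l e)\<close> is the set of coordinates of the finite points on
  a closed edge \<open>e\<close>.\<close>

definition icc :: "real \<Rightarrow> ereal \<Rightarrow> real set" where
  "icc a b = {t. a \<le> t \<and> ereal t \<le> b}"

definition ioo :: "real \<Rightarrow> ereal \<Rightarrow> real set" where
  "ioo a b = {t. a < t \<and> ereal t < b}"

definition pwa :: "(real \<Rightarrow> real) \<Rightarrow> real set \<Rightarrow> bool" where
  "pwa g D \<longleftrightarrow> (\<exists>\<I>. finite \<I> \<and> \<Union>\<I> = D \<and>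
     (\<forall>I\<in>\<I>. is_interval I \<and> (\<exists>(m::int) c. \<forall>t\<in>I. g t = of_int m * t + c)))"

lemma is_interval_icc [simp]: "is_interval (icc a b)"
  unfolding is_interval_1 icc_def by (auto intro: order_trans simp: ereal_less_eq(3)[symmetric] simp del: ereal_less_eq(3))

lemma is_interval_ioo [simp]: "is_interval (ioo a b)"
proof -
  have "ereal x < b" if "x \<le> y" "ereal y < b" for x y
    using that by (meson ereal_less_eq(3) le_less_trans)
  then show ?thesis unfolding is_interval_1 ioo_def by auto
qed

lemma pwa_affine:
  assumes "is_interval D" "\<And>t. t \<in> D \<Longrightarrow> g t = of_int m * t + c"
  shows "pwa g D"
  unfolding pwa_def by (rule exI[of _ "{D}"]) (use assms in auto)

lemma pwa_glue:
  assumes "finite \<I>" "\<Union>\<I> = D" "\<And>I. I \<in> \<I> \<Longrightarrow> pwa h I"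
  shows "pwa h D"
proof -
  define Q where "Q I K \<longleftrightarrow> finite K \<and> \<Union>K = I \<and>
     (\<forall>I\<in>K. is_interval I \<and> (\<exists>(m::int) c. \<forall>t\<in>I. h t = of_int m * t + c))" for I K
  have "\<forall>I\<in>\<I>. \<exists>K. Q I K" using assms(3) unfolding pwa_def Q_def by blast
  then obtain K where K: "\<forall>I\<in>\<I>. Q I (K I)" by metis
  have "Q D (\<Union>I\<in>\<I>. K I)" using K assms(1,2) unfolding Q_def by fastforce
  then show ?thesis unfolding pwa_def Q_def by blast
qed

lemma pwa_combine:
  assumes "pwa f D" "pwa g D"
    and "\<And>I m c m' c'. \<lbrakk>is_interval I; \<And>t. t \<in> I \<Longrightarrow> f t = of_int m * t + c;
           \<And>t. t \<in> I \<Longrightarrow> g t = of_int m' * t + c'\<rbrakk> \<Longrightarrow> pwa h I"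
  shows "pwa h D"
proof -
  obtain A where A: "finite A" "\<Union>A = D"
    "\<forall>I\<in>A. is_interval I \<and> (\<exists>(m::int) c. \<forall>t\<in>I. f t = of_int m * t + c)"
    using assms(1) unfolding pwa_def by blast
  obtain B where B: "finite B" "\<Union>B = D"
    "\<forall>I\<in>B. is_interval I \<and> (\<exists>(m::int) c. \<forall>t\<in>I. g t = of_int m * t + c)"
    using assms(2) unfolding pwa_def by blast
  show ?thesis
  proof (rule pwa_glue[of "(\<lambda>(I,J). I \<inter> J) ` (A \<times> B)"])
    show "\<Union> ((\<lambda>(I, J). I \<inter> J) ` (A \<times> B)) = D" using A(2) B(2) by fastforce
    fix X assume "X \<in> (\<lambda>(I, J). I \<inter> J) ` (A \<times> B)"
    then obtain I J where IJ: "I \<in> A" "J \<in> B" "X = I \<inter> J" by auto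
    obtain m c where 1: "\<forall>t\<in>I. f t = of_int m * t + c" using A(3) IJ by blast
    obtain m' c' where 2: "\<forall>t\<in>J. g t = of_int m' * t + c'" using B(3) IJ by blast
    show "pwa h X"
      by (rule assms(3)[of X m c m' c']) (use 1 2 IJ A B in \<open>auto intro!: is_interval_Int\<close>)
  qed (use A B in auto)
qed

lemma pwa_add: assumes "pwa f D" "pwa g D" shows "pwa (\<lambda>t. f t + g t) D"
proof (rule pwa_combine[OF assms])
  fix I m c m' c' assume "is_interval I" "\<And>t. t \<in> I \<Longrightarrow> f t = of_int m * t + c"
     "\<And>t. t \<in> I \<Longrightarrow> g t = of_int m' * t + c'"
  then show "pwa (\<lambda>t. f t + g t) I"
    by (intro pwa_affine[where m="m+m'" and c="c+c'"]) (auto simp: algebra_simps)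
qed

lemma pwa_neg: assumes "pwa f D" shows "pwa (\<lambda>t. - f t) D"
proof (rule pwa_combine[OF assms assms])
  fix I m c m' c' assume "is_interval I" "\<And>t. t \<in> I \<Longrightarrow> f t = of_int m * t + c"
  then show "pwa (\<lambda>t. - f t) I"
    by (intro pwa_affine[where m="-m" and c="-c"]) (auto simp: algebra_simps)
qed

lemma pwa_cong: assumes "pwa f D" "\<And>t. t \<in> D \<Longrightarrow> g t = f t" shows "pwa g D"
  using assms unfolding pwa_def by (metis UnionI)

lemma is_interval_half:
  "is_interval {t::real. 0 \<le> m * t + c}" "is_interval {t::real. m * t + c < 0}"
proof -
  have "is_interval {t::real. m * t \<ge> - c}" "is_interval {t::real. m * t < - c}"
    using convex_halfspace_ge[of "-c" m] convex_halfspace_lt[of m "-c"]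
    unfolding is_interval_convex_1 by (simp_all add: inner_real_def mult.commute)
  moreover have "(0 \<le> m * t + c) = (m * t \<ge> - c)" "(m * t + c < 0) = (m * t < - c)" for t by linarith+
  ultimately show "is_interval {t::real. 0 \<le> m * t + c}" "is_interval {t::real. m * t + c < 0}"
    by simp_all
qed

text \<open>On a common interval of affinity the set where one of the functions dominates is again
  an interval, so it is enough to cut each of these intervals once more.\<close>

lemma pwa_max: assumes "pwa f D" "pwa g D" shows "pwa (\<lambda>t. max (f t) (g t)) D"
proof (rule pwa_combine[OF assms])
  fix I m c m' c' assume I: "is_interval I" "\<And>t. t \<in> I \<Longrightarrow> f t = of_int m * t + c"
     "\<And>t. t \<in> I \<Longrightarrow> g t = of_int m' * t + c'"
  let ?A = "I \<inter> {t. 0 \<le> of_int (m - m') * t + (c - c')}"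
  let ?B = "I \<inter> {t. of_int (m - m') * t + (c - c') < 0}"
  show "pwa (\<lambda>t. max (f t) (g t)) I"
  proof (rule pwa_glue[of "{?A, ?B}"])
    have "pwa (\<lambda>t. max (f t) (g t)) ?A"
      by (rule pwa_affine[where m=m and c=c], intro is_interval_Int I(1) is_interval_half)
         (auto simp: I algebra_simps)
    moreover have "pwa (\<lambda>t. max (f t) (g t)) ?B"
      by (rule pwa_affine[where m=m' and c=c'], intro is_interval_Int I(1) is_interval_half)
         (auto simp: I algebra_simps)
    ultimately show "pwa (\<lambda>t. max (f t) (g t)) J" if "J \<in> {?A, ?B}" for J using that by auto
  qed auto
qed

text \<open>The ends of the intervals of affinity serve as break points. If an interval
  \<open>J\<close> meets a piece but is not contained in it, then an end of the piece lies between
  two points of \<open>J\<close>.\<close>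

lemma pwa_breaks:
  assumes "pwa g D"
  obtains B where "finite B"
    "\<And>J. \<lbrakk>is_interval J; J \<subseteq> D; J \<inter> B = {}\<rbrakk> \<Longrightarrow> \<exists>(m::int) c. \<forall>t\<in>J. g t = of_int m * t + c"
proof -
  obtain A where A: "finite A" "\<Union>A = D"
    "\<forall>I\<in>A. is_interval I \<and> (\<exists>(m::int) c. \<forall>t\<in>I. g t = of_int m * t + c)"
    using assms unfolding pwa_def by blast
  let ?B = "Inf ` A \<union> Sup ` A"
  have "\<exists>(m::int) c. \<forall>t\<in>J. g t = of_int m * t + c"
    if J: "is_interval J" "J \<subseteq> D" "J \<inter> ?B = {}" for J
  proof (cases "J = {}")
    case False
    then obtain t where t: "t \<in> J" by auto
    then obtain I where I: "t \<in> I" "I \<in> A" using A(2) J(2) by auto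
    then have iI: "is_interval I" using A(3) by auto
    have "J \<subseteq> I"
    proof
      fix s assume s: "s \<in> J"
      show "s \<in> I"
      proof (rule ccontr)
        assume ns: "s \<notin> I"
        consider "s < t" | "t < s" using ns I(1) by (metis linorder_neqE_linordered_idom)
        then show False
        proof cases
          case 1
          have lb: "\<forall>x\<in>I. s \<le> x"
            using 1 I(1) iI ns unfolding is_interval_1 by (meson linear order_less_imp_le)
          then have "s \<le> Inf I" "Inf I \<le> t"
            using I(1) by (auto intro!: cInf_greatest cInf_lower bdd_belowI[of _ s])
          then have "Inf I \<in> J" using J(1) s t unfolding is_interval_1 by blast
          then show False using J(3) I(2) by auto
        next
          case 2
          have ub: "\<forall>x\<in>I. x \<le> s"
            using 2 I(1) iI ns unfolding is_interval_1 by (meson linear order_less_imp_le)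
          then have "Sup I \<le> s" "t \<le> Sup I"
            using I(1) by (auto intro!: cSup_least cSup_upper bdd_aboveI[of _ s])
          then have "Sup I \<in> J" using J(1) s t unfolding is_interval_1 by blast
          then show False using J(3) I(2) by auto
        qed
      qed
    qed
    then show ?thesis using A(3) I(2) by blast
  qed auto
  then show thesis using that[of ?B] A(1) by auto
qed

lemma closure_ioo: assumes "ereal a < b" shows "closure (ioo a b) = icc a b"
proof (cases b)
  case (real r)
  then have "ioo a b = {a<..<r}" "icc a b = {a..r}" by (auto simp: ioo_def icc_def)
  then show ?thesis using assms real by auto
next
  case PInf
  then have "ioo a b = {a<..}" "icc a b = {a..}" by (auto simp: ioo_def icc_def)
  then show ?thesis by auto
qed (use assms in auto)

lemma ioo_nonempty: assumes "ereal a < b" shows "ioo a b \<noteq> {}"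
  using closure_ioo[OF assms] assms unfolding icc_def by force

lemma affine_on_closure:
  assumes "continuous_on (icc a b) (g :: real \<Rightarrow> real)" "ereal a < b" "\<And>t. t \<in> ioo a b \<Longrightarrow> g t = m * t + c" "t \<in> icc a b"
  shows "g t = m * t + c"
proof -
  have "g t - m * t = c"
  proof (rule continuous_constant_on_closure[where S="ioo a b" and f="\<lambda>t. g t - m * t"])
    show "continuous_on (closure (ioo a b)) (\<lambda>t. g t - m * t)"
      unfolding closure_ioo[OF assms(2)] by (intro continuous_intros assms)
  qed (use assms closure_ioo in auto)
  then show ?thesis by simp
qed

lemma icc_mono: "a' \<le> a \<Longrightarrow> b \<le> b' \<Longrightarrow> icc a b \<subseteq> icc a' b'"
  by (auto simp: icc_def)

lemma ioo_subset_icc: "ioo a b \<subseteq> icc a b"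
  by (auto simp: icc_def ioo_def)

lemma pwa_cont_breaks:
  assumes "pwa g (icc 0 l)" "continuous_on (icc 0 l) g"
  obtains B where "finite B"
    "\<And>a b. \<lbrakk>0 \<le> a; ereal a < b; b \<le> l; ioo a b \<inter> B = {}\<rbrakk> \<Longrightarrow> \<exists>(m::int) c. \<forall>t\<in>icc a b. g t = of_int m * t + c"
proof -
  obtain B where B: "finite B"
    "\<And>J. \<lbrakk>is_interval J; J \<subseteq> icc 0 l; J \<inter> B = {}\<rbrakk> \<Longrightarrow> \<exists>(m::int) c. \<forall>t\<in>J. g t = of_int m * t + c"
    using pwa_breaks[OF assms(1)] by blast
  have "\<exists>(m::int) c. \<forall>t\<in>icc a b. g t = of_int m * t + c"
    if *: "0 \<le> a" "ereal a < b" "b \<le> l" "ioo a b \<inter> B = {}" for a b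
  proof -
    have sub: "icc a b \<subseteq> icc 0 l" using icc_mono * by blast
    have "ioo a b \<subseteq> icc 0 l" using sub ioo_subset_icc by blast
    then obtain m :: int and c where "\<forall>t\<in>ioo a b. g t = of_int m * t + c" using B(2) * is_interval_ioo by blast
    then have "\<forall>t\<in>icc a b. g t = of_int m * t + c"
      using affine_on_closure[OF continuous_on_subset[OF assms(2) sub] *(2)] by blast
    then show ?thesis by blast
  qed
  then show thesis using that B(1) by blast
qed

text \<open>The intervals into which the points of \<open>B\<close> cut \<open>[0, l]\<close>. The
  last of them ends at \<open>l\<close>, which may be infinite.\<close>

definition pieces :: "real set \<Rightarrow> ereal \<Rightarrow> (real \<times> ereal) set" where
  "pieces B l = (let E = insert 0 {b\<in>B. 0 < b \<and> ereal b < l} in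
     {(a, b). a \<in> E \<and> b \<in> insert l (ereal ` E) \<and> ereal a < b \<and> ioo a b \<inter> B = {}})"

lemma finite_pieces: assumes "finite B" shows "finite (pieces B l)"
proof -
  let ?E = "insert 0 {b\<in>B. 0 < b \<and> ereal b < l}"
  have "pieces B l \<subseteq> ?E \<times> insert l (ereal ` ?E)" unfolding pieces_def Let_def by auto
  then show ?thesis by (rule finite_subset) (use assms in auto)
qed

lemma piecesD:
  assumes "(a, b) \<in> pieces B l" "0 < l"
  shows "0 \<le> a" "ereal a < b" "b \<le> l" "ioo a b \<inter> B = {}"
  using assms unfolding pieces_def Let_def by (auto intro: order.strict_implies_order simp: zero_ereal_def)

lemma pieces_cover:
  assumes "finite B" "0 < l" "t \<in> icc 0 l"
  obtains a b where "(a, b) \<in> pieces B l" "t \<in> icc a b" "ereal t < l \<Longrightarrow> ereal t < b"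
proof -
  let ?E = "insert 0 {b\<in>B. 0 < b \<and> ereal b < l}"
  have fE: "finite ?E" using assms by auto
  have t0: "0 \<le> t" "ereal t \<le> l" using assms by (auto simp: icc_def)
  have E: "ereal x < l" if "x \<in> ?E" for x using that assms by (auto simp: zero_ereal_def)
  show thesis
  proof (cases "ereal t < l")
    case True
    let ?a = "Max {x\<in>?E. x \<le> t}" and ?b = "Min {y\<in>insert l (ereal ` ?E). ereal t < y}"
    have a: "?a \<in> {x\<in>?E. x \<le> t}" by (rule Max_in) (use fE t0 in auto)
    have b: "?b \<in> {y\<in>insert l (ereal ` ?E). ereal t < y}" by (rule Min_in) (use fE True in auto)
    have am: "x \<le> ?a" if "x \<in> ?E" "x \<le> t" for x by (rule Max_ge) (use fE that in auto)
    have bm: "?b \<le> y" if "y \<in> insert l (ereal ` ?E)" "ereal t < y" for y by (rule Min_le) (use fE that in auto)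
    have tb: "ereal t < ?b" using b by blast
    have at: "?a \<le> t" "?a \<in> ?E" using a by blast+
    have bl: "?b \<le> l" using bm[of l] True by auto
    have "ioo ?a ?b \<inter> B = {}"
    proof (rule ccontr)
      assume "ioo ?a ?b \<inter> B \<noteq> {}"
      then obtain x where x: "?a < x" "ereal x < ?b" "x \<in> B" unfolding ioo_def by blast
      have "0 \<le> ?a" using at by auto
      then have xE: "x \<in> ?E" using x bl by auto
      show False
      proof (cases "x \<le> t")
        case True then show False using am[OF xE] x by linarith
      next
        case False
          then have tx: "ereal t < ereal x" by simp
          have "?b \<le> ereal x" by (rule bm[OF _ tx]) (use xE in blast)
        then show False using x by (meson not_less)
      qed
    qed
    moreover have "ereal ?a < ?b" using at tb by (meson ereal_less_eq(3) le_less_trans)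
    ultimately have "(?a, ?b) \<in> pieces B l" using at b unfolding pieces_def Let_def by blast
    moreover have "t \<in> icc ?a ?b" using at tb unfolding icc_def by auto
    ultimately show thesis using that tb by blast
  next
    case False
    then have tl: "ereal t = l" using t0 by auto
    let ?a = "Max ?E"
    have a: "?a \<in> ?E" by (rule Max_in) (use fE in auto)
    have am: "x \<le> ?a" if "x \<in> ?E" for x by (rule Max_ge) (use fE that in auto)
    have "ioo ?a l \<inter> B = {}"
    proof (rule ccontr)
      assume "ioo ?a l \<inter> B \<noteq> {}"
      then obtain x where x: "?a < x" "ereal x < l" "x \<in> B" unfolding ioo_def by blast
      have "0 \<le> ?a" using am by auto
      then have xE: "x \<in> ?E" using x by auto
      then show False using am[OF xE] x by linarith
    qed
    then have "(?a, l) \<in> pieces B l" using a E[OF a] unfolding pieces_def Let_def by blast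
    moreover have "t \<in> icc ?a l" using E[OF a] tl unfolding icc_def by auto
    ultimately show thesis using that False by blast
  qed
qed

lemma icc_zero_zero: "icc 0 0 = {0}" by (auto simp: icc_def zero_ereal_def)

text \<open>Both sides are affine, so it suffices to compare them at the two ends of the interval.
  At an infinite end the comparison is one of slopes.\<close>

lemma affine_dominated_on_piece:
  assumes ab: "ereal a < b" and D: "\<And>t. t \<in> icc a b \<Longrightarrow> D t = \<alpha> * t + \<beta>" "\<And>t. t \<in> icc a b \<Longrightarrow> (0::real) \<le> D t"
    and u: "\<And>t. t \<in> icc a b \<Longrightarrow> D t = 0 \<Longrightarrow> \<mu> * t + \<nu> \<le> 0"
    and inf: "b = \<infinity> \<Longrightarrow> \<alpha> = 0 \<Longrightarrow> \<mu> \<le> 0"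
  shows "\<exists>k::nat. \<forall>t\<in>icc a b. \<mu> * t + \<nu> \<le> real k * D t"
proof -
  have *: "\<exists>k::nat. y \<le> real k * x" if "0 \<le> x" "x = 0 \<Longrightarrow> y \<le> 0" for x y :: real
  proof (cases "x = 0")
    case False
    then obtain k::nat where "y / x \<le> real k" using real_arch_simple by blast
    then show ?thesis using False that(1) by (metis divide_le_eq order_le_less)
  qed (use that in auto)
  have mono: "y \<le> real k' * x" if "y \<le> real k * x" "k \<le> k'" "0 \<le> x" for x y k k'
    using that by (meson mult_right_mono of_nat_le_iff order_trans)
  have a: "a \<in> icc a b" using ab by (auto simp: icc_def)
  obtain k1 where k1: "\<mu> * a + \<nu> \<le> real k1 * D a" using *[OF D(2)[OF a]] u[OF a] by blast
  show ?thesis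
  proof (cases b)
    case (real r)
    have r: "r \<in> icc a b" using ab real by (auto simp: icc_def)
    obtain k2 where k2: "\<mu> * r + \<nu> \<le> real k2 * D r" using *[OF D(2)[OF r]] u[OF r] by blast
    define k where "k = max k1 k2"
    have ka: "\<mu> * a + \<nu> \<le> real k * (\<alpha> * a + \<beta>)" and kr: "\<mu> * r + \<nu> \<le> real k * (\<alpha> * r + \<beta>)"
      using mono[OF k1, of k] mono[OF k2, of k] D a r unfolding k_def by auto
    have "\<mu> * t + \<nu> \<le> real k * D t" if t: "t \<in> icc a b" for t
    proof -
      have art: "a < r" "a \<le> t" "t \<le> r" using ab real t by (auto simp: icc_def)
      have "0 \<le> (r - t) * (real k * (\<alpha> * a + \<beta>) - (\<mu> * a + \<nu>)) + (t - a) * (real k * (\<alpha> * r + \<beta>) - (\<mu> * r + \<nu>))"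
        using art ka kr by (intro add_nonneg_nonneg mult_nonneg_nonneg) auto
      also have "\<dots> = (r - a) * (real k * (\<alpha> * t + \<beta>) - (\<mu> * t + \<nu>))" by (simp add: algebra_simps)
      finally have "0 \<le> real k * (\<alpha> * t + \<beta>) - (\<mu> * t + \<nu>)" using art by (simp add: zero_le_mult_iff)
      then show ?thesis using D(1)[OF t] by simp
    qed
    then show ?thesis by blast
  next
    case PInf
    have al: "0 \<le> \<alpha>"
    proof (rule ccontr)
      assume "\<not> 0 \<le> \<alpha>"
      define t where "t = max a ((- \<beta> - 1) / \<alpha>)"
      have t: "t \<in> icc a b" unfolding t_def icc_def PInf by auto
      have "\<alpha> * t \<le> \<alpha> * ((- \<beta> - 1) / \<alpha>)" using \<open>\<not> 0 \<le> \<alpha>\<close> unfolding t_def by (intro mult_left_mono_neg) auto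
      then have "\<alpha> * t + \<beta> < 0" using \<open>\<not> 0 \<le> \<alpha>\<close> by auto
      then show False using D t by fastforce
    qed
    then obtain k2 where k2: "\<mu> \<le> real k2 * \<alpha>" using * inf[OF PInf] by metis
    define k where "k = max k1 k2"
    have ka: "\<mu> * a + \<nu> \<le> real k * (\<alpha> * a + \<beta>)" and kr: "\<mu> \<le> real k * \<alpha>"
      using mono[OF k1, of k] mono[OF k2, of k] D a al unfolding k_def by auto
    have "\<mu> * t + \<nu> \<le> real k * D t" if t: "t \<in> icc a b" for t
    proof -
      have "0 \<le> (t - a) * (real k * \<alpha> - \<mu>)" using t kr by (auto simp: icc_def)
      then have "\<mu> * t + \<nu> \<le> real k * (\<alpha> * t + \<beta>)" using ka by (simp add: algebra_simps)
      then show ?thesis using D(1)[OF t] by simp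
    qed
    then show ?thesis by blast
  qed (use ab in auto)
qed

text \<open>The quantitative core of the extension property. Up to a factor, a nonnegative piecewise
  affine function \<open>D\<close> dominates every affine function that is nonpositive on the zeros
  of \<open>D\<close>; this is checked at the break points. On a half-line a bounded
  \<open>D\<close> can only dominate functions of nonpositive slope.\<close>

lemma affine_dominated:
  assumes l: "0 \<le> l" and D: "pwa D (icc 0 l)" "continuous_on (icc 0 l) D" "\<And>t. t \<in> icc 0 l \<Longrightarrow> 0 \<le> D t"
    and u: "\<And>t. t \<in> icc 0 l \<Longrightarrow> D t = 0 \<Longrightarrow> \<mu> * t + \<nu> \<le> (0::real)"
    and inf: "\<And>K. l = \<infinity> \<Longrightarrow> (\<And>t. t \<ge> 0 \<Longrightarrow> D t \<le> K) \<Longrightarrow> \<mu> \<le> 0"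
  shows "\<exists>k::nat. \<forall>t\<in>icc 0 l. \<mu> * t + \<nu> \<le> real k * D t"
proof (cases "l = 0")
  case True
  have "\<exists>k::nat. \<nu> \<le> real k * D 0"
  proof (cases "D 0 = 0")
    case True then show ?thesis using u[of 0] \<open>l = 0\<close> by (auto simp: icc_zero_zero)
  next
    case False
    then have D0: "D 0 > 0" using D(3)[of 0] \<open>l = 0\<close> by (auto simp: icc_zero_zero order_le_less)
    obtain k::nat where "\<nu> / D 0 \<le> real k" using real_arch_simple by blast
    then show ?thesis using D0 by (metis divide_le_eq)
  qed
  then show ?thesis using True by (auto simp: icc_zero_zero)
next
  case False
  then have l0: "0 < l" using l by auto
  obtain B where B: "finite B"
    "\<And>a b. \<lbrakk>0 \<le> a; ereal a < b; b \<le> l; ioo a b \<inter> B = {}\<rbrakk> \<Longrightarrow> \<exists>(m::int) c. \<forall>t\<in>icc a b. D t = of_int m * t + c"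
    using pwa_cont_breaks[OF D(1,2)] by blast
  have "\<exists>k::nat. \<forall>t\<in>icc (fst p) (snd p). \<mu> * t + \<nu> \<le> real k * D t" if "p \<in> pieces B l" for p
  proof -
    obtain a b where p: "p = (a, b)" by force
    note ab = piecesD[OF that[unfolded p] l0]
    obtain m :: int and c where mc: "\<forall>t\<in>icc a b. D t = of_int m * t + c" using B(2) ab by blast
    have sub: "icc a b \<subseteq> icc 0 l" using ab icc_mono by blast
    have "\<exists>k::nat. \<forall>t\<in>icc a b. \<mu> * t + \<nu> \<le> real k * D t"
    proof (rule affine_dominated_on_piece[OF ab(2), where \<alpha>="of_int m" and \<beta>=c])
      assume b: "b = \<infinity>" and m0: "of_int m = (0::real)"
      then have li: "l = \<infinity>" using ab(3) by auto
      have Dc: "D t = c" if "t \<ge> a" for t using mc m0 that b by (auto simp: icc_def)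
      have "compact {0..a}" by auto
      have "continuous_on {0..a} D" by (rule continuous_on_subset[OF D(2)]) (auto simp: icc_def li)
      then have "compact (D ` {0..a})" using compact_continuous_image by blast
      then have "bounded (D ` {0..a})" by (rule compact_imp_bounded)
      then obtain K0 where K0: "\<And>t. t \<in> {0..a} \<Longrightarrow> norm (D t) \<le> K0" unfolding bounded_iff by blast
      have "D t \<le> max K0 c" if "t \<ge> 0" for t
      proof (cases "t \<ge> a")
        case True then show ?thesis using Dc by auto
      next
        case False then show ?thesis using K0[of t] that by auto
      qed
      then show "\<mu> \<le> 0" using inf[OF li] by blast
    qed (use mc sub D(3) u in blast)+
    then show ?thesis using p by simp
  qed
  then obtain k where k: "\<And>p. p \<in> pieces B l \<Longrightarrow> \<forall>t\<in>icc (fst p) (snd p). \<mu> * t + \<nu> \<le> real (k p :: nat) * D t"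
    by metis
  define K where "K = (\<Sum>p\<in>pieces B l. k p)"
  have "\<mu> * t + \<nu> \<le> real K * D t" if t: "t \<in> icc 0 l" for t
  proof -
    obtain a b where ab: "(a, b) \<in> pieces B l" "t \<in> icc a b" using pieces_cover[OF B(1) l0 t] by blast
    have "k (a, b) \<le> K" unfolding K_def by (rule member_le_sum) (use ab finite_pieces B in auto)
    then have "real (k (a,b)) * D t \<le> real K * D t" using D(3)[OF t] by (intro mult_right_mono) auto
    then show ?thesis using k[OF ab(1)] ab(2) by fastforce
  qed
  then show ?thesis by blast
qed

section \<open>Integral piecewise linear functions on real n-space\<close>

text \<open>The real-valued elements of the tropical rational function semifield. The inductive
  generation provides proofs by induction over the operations.\<close>

inductive_set PL :: "nat \<Rightarrow> ((nat \<Rightarrow> real) \<Rightarrow> real) set" for n where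
  PL_const: "(\<lambda>x. c) \<in> PL n"
| PL_coord: "i < n \<Longrightarrow> (\<lambda>x. x i) \<in> PL n"
| PL_add: "f \<in> PL n \<Longrightarrow> g \<in> PL n \<Longrightarrow> (\<lambda>x. f x + g x) \<in> PL n"
| PL_neg: "f \<in> PL n \<Longrightarrow> (\<lambda>x. - f x) \<in> PL n"
| PL_max: "f \<in> PL n \<Longrightarrow> g \<in> PL n \<Longrightarrow> (\<lambda>x. max (f x) (g x)) \<in> PL n"

lemma PL_diff: "f \<in> PL n \<Longrightarrow> g \<in> PL n \<Longrightarrow> (\<lambda>x. f x - g x) \<in> PL n"
  using PL_add[OF _ PL_neg, of f n g] by simp

lemma PL_min: assumes "f \<in> PL n" "g \<in> PL n" shows "(\<lambda>x. min (f x) (g x)) \<in> PL n"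
proof -
  have "(\<lambda>x. min (f x) (g x)) = (\<lambda>x. - max (- f x) (- g x))" by (auto simp: fun_eq_iff min_def max_def)
  then show ?thesis using PL_neg[OF PL_max[OF PL_neg PL_neg]] assms by metis
qed

lemma PL_abs: assumes "f \<in> PL n" shows "(\<lambda>x. \<bar>f x\<bar>) \<in> PL n"
proof -
  have "(\<lambda>x. \<bar>f x\<bar>) = (\<lambda>x. max (f x) (- f x))" by (auto simp: fun_eq_iff)
  then show ?thesis using PL_max[OF assms PL_neg[OF assms]] by simp
qed

lemma PL_sum: "finite I \<Longrightarrow> (\<And>i. i \<in> I \<Longrightarrow> f i \<in> PL n) \<Longrightarrow> (\<lambda>x. \<Sum>i\<in>I. f i x) \<in> PL n"
  by (induction I rule: finite_induct) (auto intro: PL_const PL_add)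

lemma PL_nat_mult: "f \<in> PL n \<Longrightarrow> (\<lambda>x. real k * f x) \<in> PL n"
  by (induction k) (auto simp: algebra_simps intro: PL_const PL_add)

lemma PL_int_mult: assumes "f \<in> PL n" shows "(\<lambda>x. real_of_int k * f x) \<in> PL n"
proof (cases "0 \<le> k")
  case True
  then show ?thesis using PL_nat_mult[OF assms, of "nat k"] by simp
next
  case False
  then show ?thesis using PL_neg[OF PL_nat_mult[OF assms, of "nat (- k)"]] by simp
qed

lemma PL_Min:
  assumes "finite I" "I \<noteq> {}" "\<And>i. i \<in> I \<Longrightarrow> f i \<in> PL n"
  shows "(\<lambda>x. Min ((\<lambda>i. f i x) ` I)) \<in> PL n"
  using assms
proof (induction I rule: finite_ne_induct)
  case (insert i I)
  have "(\<lambda>x. Min ((\<lambda>i. f i x) ` insert i I)) = (\<lambda>x. min (f i x) (Min ((\<lambda>i. f i x) ` I)))"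
    using insert by auto
  then show ?case using PL_min[OF insert(5)[of i] insert(4)] insert(5) by simp
qed auto

lemma PL_Max:
  assumes "finite I" "I \<noteq> {}" "\<And>i. i \<in> I \<Longrightarrow> f i \<in> PL n"
  shows "(\<lambda>x. Max ((\<lambda>i. f i x) ` I)) \<in> PL n"
  using assms
proof (induction I rule: finite_ne_induct)
  case (insert i I)
  have "(\<lambda>x. Max ((\<lambda>i. f i x) ` insert i I)) = (\<lambda>x. max (f i x) (Max ((\<lambda>i. f i x) ` I)))"
    using insert by auto
  then show ?case using PL_max[OF insert(5)[of i] insert(4)] insert(5) by simp
qed auto

definition aff :: "nat \<Rightarrow> (nat \<Rightarrow> int) \<times> real \<Rightarrow> (nat \<Rightarrow> real) \<Rightarrow> real" where
  "aff n = (\<lambda>(a, c) x. c + (\<Sum>i<n. real_of_int (a i) * x i))"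

lemma laurent_fun_aff: "laurent_fun n = {\<lambda>x. Max ((\<lambda>p. aff n p x) ` F) | F. finite F \<and> F \<noteq> {}}"
  unfolding laurent_fun_def aff_def by (simp add: case_prod_unfold)

lemma aff_PL: "aff n p \<in> PL n"
  unfolding aff_def case_prod_unfold by (intro PL_add PL_const PL_sum PL_int_mult PL_coord) auto

lemma laurent_PL: "P \<in> laurent_fun n \<Longrightarrow> P \<in> PL n"
  unfolding laurent_fun_aff using PL_Max[of _ "aff n" n] aff_PL by auto

lemma laurent_aff: "aff n p \<in> laurent_fun n"
  unfolding laurent_fun_aff by (rule CollectI, rule exI[of _ "{p}"]) auto

lemma laurent_max:
  assumes "P \<in> laurent_fun n" "Q \<in> laurent_fun n" shows "(\<lambda>x. max (P x) (Q x)) \<in> laurent_fun n"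
proof -
  obtain F F' where F: "finite F" "F \<noteq> {}" "P = (\<lambda>x. Max ((\<lambda>p. aff n p x) ` F))"
    "finite F'" "F' \<noteq> {}" "Q = (\<lambda>x. Max ((\<lambda>p. aff n p x) ` F'))"
    using assms unfolding laurent_fun_aff by blast
  have "(\<lambda>x. max (P x) (Q x)) = (\<lambda>x. Max ((\<lambda>p. aff n p x) ` (F \<union> F')))"
    using F by (simp add: image_Un Max_Un)
  then show ?thesis unfolding laurent_fun_aff using F by blast
qed

text \<open>The sum of two maxima is the maximum of all pairwise sums.\<close>

lemma laurent_add:
  assumes "P \<in> laurent_fun n" "Q \<in> laurent_fun n" shows "(\<lambda>x. P x + Q x) \<in> laurent_fun n"
proof -
  obtain F F' where F: "finite F" "F \<noteq> {}" "P = (\<lambda>x. Max ((\<lambda>p. aff n p x) ` F))"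
    "finite F'" "F' \<noteq> {}" "Q = (\<lambda>x. Max ((\<lambda>p. aff n p x) ` F'))"
    using assms unfolding laurent_fun_aff by blast
  let ?s = "\<lambda>(p, q). (\<lambda>i. fst p i + fst q i, snd p + snd q) :: (nat \<Rightarrow> int) \<times> real"
  let ?G = "?s ` (F \<times> F')"
  have s: "aff n (?s (p, q)) x = aff n p x + aff n q x" for p q x
    by (cases p; cases q) (simp add: aff_def sum.distrib algebra_simps)
  have "P x + Q x = Max ((\<lambda>p. aff n p x) ` ?G)" for x
  proof (rule Max_eqI[symmetric])
    show "finite ((\<lambda>p. aff n p x) ` ?G)" using F by auto
    have "P x \<in> (\<lambda>p. aff n p x) ` F" "Q x \<in> (\<lambda>p. aff n p x) ` F'"
      unfolding F(3,6) by (rule Max_in; use F in simp)+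
    then obtain p q where p: "p \<in> F" "P x = aff n p x" and q: "q \<in> F'" "Q x = aff n q x" by blast
    show "P x + Q x \<in> (\<lambda>p. aff n p x) ` ?G"
      using p q s[of p q x] by (intro image_eqI[where x="?s (p, q)"]) auto
    fix y assume "y \<in> (\<lambda>p. aff n p x) ` ?G"
    then obtain p q where "p \<in> F" "q \<in> F'" "y = aff n (?s (p, q)) x" by auto
    then have "p \<in> F" "q \<in> F'" "y = aff n p x + aff n q x" using s by metis+
    moreover have "aff n p x \<le> P x" "aff n q x \<le> Q x" using F calculation by auto
    ultimately show "y \<le> P x + Q x" by linarith
  qed
  then have "(\<lambda>x. P x + Q x) = (\<lambda>x. Max ((\<lambda>p. aff n p x) ` ?G))" by auto
  moreover have "finite ?G" "?G \<noteq> {}" using F by auto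
  ultimately show ?thesis unfolding laurent_fun_aff by blast
qed

lemma laurent_diffI:
  "P \<in> laurent_fun n \<Longrightarrow> Q \<in> laurent_fun n \<Longrightarrow> (\<And>x. f x = P x - Q x) \<Longrightarrow>
    \<exists>P\<in>laurent_fun n. \<exists>Q\<in>laurent_fun n. f = (\<lambda>x. P x - Q x)"
  by blast

text \<open>Differences of tropical Laurent polynomials are closed under maxima, because
  \<open>max (P - Q) (P' - Q') = max (P + Q') (P' + Q) - (Q + Q')\<close>.\<close>

lemma PL_laurent_diff:
  assumes "f \<in> PL n" shows "\<exists>P\<in>laurent_fun n. \<exists>Q\<in>laurent_fun n. f = (\<lambda>x. P x - Q x)"
  using assms
proof (induction rule: PL.induct)
  case (PL_const c)
  show ?case
    by (rule laurent_diffI[OF laurent_aff[of n "(\<lambda>_. 0, c)"] laurent_aff[of n "(\<lambda>_. 0, 0)"]]) (simp add: aff_def)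
next
  case (PL_coord i)
  have "aff n (\<lambda>j. if j = i then 1 else 0, 0) = (\<lambda>x. x i)"
    using PL_coord by (simp add: aff_def fun_eq_iff if_distrib[of real_of_int] if_distrib[of "\<lambda>z. z * _"] sum.delta cong: if_cong)
  then show ?case
    by (intro laurent_diffI[OF laurent_aff[of n "(\<lambda>j. if j = i then 1 else 0, 0)"] laurent_aff[of n "(\<lambda>_. 0, 0)"]])
       (simp add: aff_def[of n] fun_eq_iff)
next
  case (PL_add f g)
  then obtain P Q P' Q' where *: "P \<in> laurent_fun n" "Q \<in> laurent_fun n" "f = (\<lambda>x. P x - Q x)"
    "P' \<in> laurent_fun n" "Q' \<in> laurent_fun n" "g = (\<lambda>x. P' x - Q' x)" by blast
  show ?case
    by (rule laurent_diffI[OF laurent_add[OF *(1,4)] laurent_add[OF *(2,5)]]) (simp add: *)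
next
  case (PL_neg f)
  then obtain P Q where *: "P \<in> laurent_fun n" "Q \<in> laurent_fun n" "f = (\<lambda>x. P x - Q x)" by blast
  show ?case by (rule laurent_diffI[OF *(2) *(1)]) (simp add: *)
next
  case (PL_max f g)
  then obtain P Q P' Q' where *: "P \<in> laurent_fun n" "Q \<in> laurent_fun n" "f = (\<lambda>x. P x - Q x)"
    "P' \<in> laurent_fun n" "Q' \<in> laurent_fun n" "g = (\<lambda>x. P' x - Q' x)" by blast
  show ?case
    by (rule laurent_diffI[OF laurent_max[OF laurent_add[OF *(1,5)] laurent_add[OF *(4,2)]] laurent_add[OF *(2,5)]])
       (auto simp: * fun_eq_iff max_def)
qed

definition emb :: "nat \<Rightarrow> ((nat \<Rightarrow> real) \<Rightarrow> real) \<Rightarrow> (nat \<Rightarrow> real) \<Rightarrow> ereal" where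
  "emb n f = (\<lambda>x\<in>Rn n. ereal (f x))"

abbreviation neginf :: "nat \<Rightarrow> (nat \<Rightarrow> real) \<Rightarrow> ereal" where
  "neginf n \<equiv> (\<lambda>x\<in>Rn n. -\<infinity>)"

lemma Rn_iff: "x \<in> Rn n \<longleftrightarrow> (\<forall>i\<ge>n. x i = 0)"
  by (simp add: topspace_Euclidean_space)

lemma Rn_zero: "(\<lambda>i. 0) \<in> Rn n" by (simp add: Rn_iff)

lemma carrier_trop_rat: "carrier (trop_rat n) = insert (neginf n) (emb n ` PL n)"
proof -
  have "{\<lambda>x\<in>Rn n. ereal (P x - Q x) | P Q. P \<in> laurent_fun n \<and> Q \<in> laurent_fun n} = emb n ` PL n"
  proof (rule equalityI; rule subsetI)
    fix y assume "y \<in> {\<lambda>x\<in>Rn n. ereal (P x - Q x) | P Q. P \<in> laurent_fun n \<and> Q \<in> laurent_fun n}"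
    then obtain P Q where *: "P \<in> laurent_fun n" "Q \<in> laurent_fun n" "y = (\<lambda>x\<in>Rn n. ereal (P x - Q x))" by blast
    show "y \<in> emb n ` PL n"
      by (rule image_eqI[of _ _ "\<lambda>x. P x - Q x"]) (use * in \<open>simp_all add: emb_def PL_diff laurent_PL\<close>)
  next
    fix y assume "y \<in> emb n ` PL n"
    then obtain f where "f \<in> PL n" "y = emb n f" by blast
    then show "y \<in> {\<lambda>x\<in>Rn n. ereal (P x - Q x) | P Q. P \<in> laurent_fun n \<and> Q \<in> laurent_fun n}"
      using PL_laurent_diff[of f n] unfolding emb_def by blast
  qed
  then show ?thesis unfolding trop_rat_def by simp
qed

lemma emb_eq_iff: "emb n f = emb n g \<longleftrightarrow> (\<forall>x\<in>Rn n. f x = g x)"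
  unfolding emb_def restrict_def fun_eq_iff by auto

lemma emb_neq_neginf: "emb n f \<noteq> neginf n"
proof
  assume "emb n f = neginf n"
  then have "emb n f (\<lambda>i. 0) = neginf n (\<lambda>i. 0)" by simp
  then show False using Rn_zero[of n] by (simp add: emb_def)
qed

lemma trop_rat_simps:
  "emb n f \<otimes>\<^bsub>trop_rat n\<^esub> emb n g = emb n (\<lambda>x. f x + g x)"
  "emb n f \<oplus>\<^bsub>trop_rat n\<^esub> emb n g = emb n (\<lambda>x. max (f x) (g x))"
  "neginf n \<otimes>\<^bsub>trop_rat n\<^esub> emb n g = neginf n"
  "emb n f \<otimes>\<^bsub>trop_rat n\<^esub> neginf n = neginf n"
  "neginf n \<oplus>\<^bsub>trop_rat n\<^esub> emb n g = emb n g"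
  "emb n f \<oplus>\<^bsub>trop_rat n\<^esub> neginf n = emb n f"
  "neginf n \<otimes>\<^bsub>trop_rat n\<^esub> neginf n = neginf n"
  "neginf n \<oplus>\<^bsub>trop_rat n\<^esub> neginf n = neginf n"
  "\<one>\<^bsub>trop_rat n\<^esub> = emb n (\<lambda>x. 0)" "\<zero>\<^bsub>trop_rat n\<^esub> = neginf n"
  by (auto simp: trop_rat_def emb_def restrict_def fun_eq_iff max_def)

lemma trop_rat_const_simps:
  "trop_rat_const n (ereal c) = emb n (\<lambda>x. c)" "trop_rat_const n (-\<infinity>) = neginf n"
  by (auto simp: trop_rat_const_def emb_def)

lemma trop_rat_cases:
  assumes "f \<in> carrier (trop_rat n)"
  obtains "f = neginf n" | a where "a \<in> PL n" "f = emb n a"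
  using assms unfolding carrier_trop_rat by blast

lemma trop_rat_closed:
  assumes "f \<in> carrier (trop_rat n)" "g \<in> carrier (trop_rat n)"
  shows "f \<otimes>\<^bsub>trop_rat n\<^esub> g \<in> carrier (trop_rat n)" "f \<oplus>\<^bsub>trop_rat n\<^esub> g \<in> carrier (trop_rat n)"
proof -
  show "f \<otimes>\<^bsub>trop_rat n\<^esub> g \<in> carrier (trop_rat n)"
    by (rule trop_rat_cases[OF assms(1)]; rule trop_rat_cases[OF assms(2)])
       (auto simp: trop_rat_simps carrier_trop_rat intro: PL_add)
  show "f \<oplus>\<^bsub>trop_rat n\<^esub> g \<in> carrier (trop_rat n)"
    by (rule trop_rat_cases[OF assms(1)]; rule trop_rat_cases[OF assms(2)])
       (auto simp: trop_rat_simps carrier_trop_rat intro: PL_max)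
qed

lemma trop_rat_op_point:
  "x \<in> Rn n \<Longrightarrow> (f \<otimes>\<^bsub>trop_rat n\<^esub> g) x = f x + g x"
  "x \<in> Rn n \<Longrightarrow> (f \<oplus>\<^bsub>trop_rat n\<^esub> g) x = max (f x) (g x)"
  by (simp_all add: trop_rat_def)

lemma congruence_cong_of:
  assumes "V \<subseteq> Rn n" shows "congruence (trop_rat n) (cong_of n V)"
  unfolding congruence_def
proof
  show "equiv (carrier (trop_rat n)) (cong_of n V)"
    by (rule equivI) (auto simp: cong_of_def refl_on_def sym_def trans_def)
  show "\<forall>(a, b)\<in>cong_of n V. \<forall>(c, d)\<in>cong_of n V.
      (a \<oplus>\<^bsub>trop_rat n\<^esub> c, b \<oplus>\<^bsub>trop_rat n\<^esub> d) \<in> cong_of n V \<and> (a \<otimes>\<^bsub>trop_rat n\<^esub> c, b \<otimes>\<^bsub>trop_rat n\<^esub> d) \<in> cong_of n V"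
    using assms unfolding cong_of_def by (auto simp: trop_rat_closed trop_rat_op_point subsetD)
qed

subsection \<open>Regularity\<close>

definition l1 :: "nat \<Rightarrow> (nat \<Rightarrow> real) \<Rightarrow> (nat \<Rightarrow> real) \<Rightarrow> real" where
  "l1 n x y = (\<Sum>i<n. \<bar>x i - y i\<bar>)"

text \<open>The Lipschitz property bounds a function that vanishes on a set by the distance to this
  set, and it forces equal slopes at infinity along two rays of bounded distance.\<close>

lemma PL_lipschitz:
  assumes "f \<in> PL n" shows "\<exists>L\<ge>0. \<forall>x y. \<bar>f x - f y\<bar> \<le> L * l1 n x y"
  using assms
proof (induction rule: PL.induct)
  case (PL_const c) show ?case by (rule exI[of _ 0]) auto
next
  case (PL_coord i)
  have "\<bar>x i - y i\<bar> \<le> l1 n x y" for x y :: "nat \<Rightarrow> real"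
    unfolding l1_def by (rule member_le_sum[of i "{..<n}" "\<lambda>i. \<bar>x i - y i\<bar>"]) (use PL_coord in auto)
  then show ?case by (intro exI[of _ 1]) auto
next
  case (PL_add f g)
  then obtain L L' where L: "L \<ge> 0" "\<forall>x y. \<bar>f x - f y\<bar> \<le> L * l1 n x y" "L' \<ge> 0" "\<forall>x y. \<bar>g x - g y\<bar> \<le> L' * l1 n x y" by blast
  have "\<bar>f x + g x - (f y + g y)\<bar> \<le> (L + L') * l1 n x y" for x y
    using L(2)[rule_format, of x y] L(4)[rule_format, of x y] by (simp add: distrib_right)
  then show ?case using L by (intro exI[of _ "L + L'"]) auto
next
  case (PL_neg f)
  then obtain L where L: "L \<ge> 0" "\<forall>x y. \<bar>f x - f y\<bar> \<le> L * l1 n x y" by blast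
  have "\<bar>- f x - - f y\<bar> \<le> L * l1 n x y" for x y using L(2)[rule_format, of x y] by (simp add: abs_minus_commute)
  then show ?case using L by blast
next
  case (PL_max f g)
  then obtain L L' where L: "L \<ge> 0" "\<forall>x y. \<bar>f x - f y\<bar> \<le> L * l1 n x y" "L' \<ge> 0" "\<forall>x y. \<bar>g x - g y\<bar> \<le> L' * l1 n x y" by blast
  have "\<bar>max (f x) (g x) - max (f y) (g y)\<bar> \<le> (L + L') * l1 n x y" for x y
  proof -
    have "0 \<le> l1 n x y" unfolding l1_def by (rule sum_nonneg) auto
    then have "0 \<le> L * l1 n x y" "0 \<le> L' * l1 n x y" using L by auto
    then show ?thesis using L(2)[rule_format, of x y] L(4)[rule_format, of x y] by (simp add: distrib_right)
  qed
  then show ?case using L by (intro exI[of _ "L + L'"]) auto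
qed

lemma PL_subst:
  assumes "f \<in> PL m" "\<And>i. i < m \<Longrightarrow> (\<lambda>x. F x i) \<in> PL n"
  shows "(\<lambda>x. f (F x)) \<in> PL n"
  using assms(1) by (induction rule: PL.induct) (auto intro: PL.intros assms)

lemma PL_pwa:
  assumes "f \<in> PL n" "is_interval D" "\<And>i. i < n \<Longrightarrow> pwa (\<lambda>t. \<gamma> t i) D"
  shows "pwa (\<lambda>t. f (\<gamma> t)) D"
  using assms(1)
proof (induction rule: PL.induct)
  case (PL_const c) show ?case by (rule pwa_affine[OF assms(2), where m=0 and c=c]) auto
qed (auto intro: assms pwa_add pwa_neg pwa_max)

lemma PL_continuous_on:
  assumes "f \<in> PL n" "\<And>i. i < n \<Longrightarrow> continuous_on D (\<lambda>t. \<gamma> t i)"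
  shows "continuous_on D (\<lambda>t. f (\<gamma> t))"
  using assms(1) by (induction rule: PL.induct) (auto intro!: continuous_intros assms)

lemma Euclidean_space_coord: "continuous_map (Euclidean_space n) euclideanreal (\<lambda>x. x i)"
  unfolding Euclidean_space_def
  by (intro continuous_map_from_subtopology continuous_map_product_projection UNIV_I)

lemma PL_continuous_map: "f \<in> PL n \<Longrightarrow> continuous_map (Euclidean_space n) euclideanreal f"
  by (induction rule: PL.induct) (auto intro!: Euclidean_space_coord continuous_map_add continuous_map_minus continuous_map_real_max)

lemma continuous_map_into_Euclidean_space:
  assumes "\<And>i. i < n \<Longrightarrow> continuous_map X euclideanreal (\<lambda>x. F x i)" "\<And>x. x \<in> topspace X \<Longrightarrow> F x \<in> Rn n"
  shows "continuous_map X (Euclidean_space n) F"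
  unfolding Euclidean_space_def continuous_map_in_subtopology
proof (intro conjI)
  show "F \<in> topspace X \<rightarrow> {x. \<forall>i\<ge>n. x i = 0}" using assms(2) by (auto simp: Rn_iff)
  show "continuous_map X (powertop_real UNIV) F"
    unfolding continuous_map_componentwise_UNIV
  proof
    fix i show "continuous_map X euclideanreal (\<lambda>x. F x i)"
    proof (cases "i < n")
      case False
      then have "\<And>x. x \<in> topspace X \<Longrightarrow> F x i = 0" using assms(2) by (auto simp: Rn_iff)
      then show ?thesis using continuous_map_eq[of X euclideanreal "\<lambda>x. 0" "\<lambda>x. F x i"] by auto
    qed (rule assms)
  qed
qed

section \<open>Rational segments and rays\<close>

definition pt :: "(nat \<Rightarrow> real) \<Rightarrow> (nat \<Rightarrow> int) \<Rightarrow> real \<Rightarrow> nat \<Rightarrow> real" where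
  "pt p v t = (\<lambda>i. p i + t * real_of_int (v i))"

text \<open>A segment starts at \<open>sp\<close>, runs in the integral direction \<open>sv\<close>
  and ends after \<open>sl\<close> multiples of \<open>sv\<close>. The vector \<open>sw\<close>
  certifies that \<open>sv\<close> is primitive.\<close>

datatype seg = Seg (sp: "nat \<Rightarrow> real") (sv: "nat \<Rightarrow> int") (sw: "nat \<Rightarrow> int") (sl: ereal)

definition seg_pts :: "seg \<Rightarrow> (nat \<Rightarrow> real) set" where
  "seg_pts s = pt (sp s) (sv s) ` icc 0 (sl s)"

text \<open>By Bezout's identity, a vector \<open>w\<close> as below exists if and only if the
  entries of \<open>v\<close> are coprime. The integral linear function with coefficients
  \<open>w\<close> has slope one in direction \<open>v\<close>.\<close>

definition prim :: "nat \<Rightarrow> (nat \<Rightarrow> int) \<Rightarrow> (nat \<Rightarrow> int) \<Rightarrow> bool" where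
  "prim n v w \<longleftrightarrow> (\<forall>i\<ge>n. v i = 0) \<and> (\<Sum>i<n. w i * v i) = 1"

text \<open>Segments of length 0 represent single points; they exist also for \<open>n = 0\<close>,
  where there are no primitive vectors.\<close>

definition seg_ok :: "nat \<Rightarrow> seg \<Rightarrow> bool" where
  "seg_ok n s \<longleftrightarrow> sp s \<in> Rn n \<and> (\<forall>i\<ge>n. sv s i = 0) \<and> 0 \<le> sl s \<and> (sl s = 0 \<or> prim n (sv s) (sw s))"

definition seg_union :: "nat \<Rightarrow> (nat \<Rightarrow> real) set \<Rightarrow> bool" where
  "seg_union n V \<longleftrightarrow> (\<exists>\<S>. finite \<S> \<and> (\<forall>s\<in>\<S>. seg_ok n s) \<and> V = \<Union>(seg_pts ` \<S>))"

lemma pt_Rn: "p \<in> Rn n \<Longrightarrow> (\<forall>i\<ge>n. v i = 0) \<Longrightarrow> pt p v t \<in> Rn n"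
  by (simp add: Rn_iff pt_def)

lemma seg_pts_Rn: "seg_ok n s \<Longrightarrow> seg_pts s \<subseteq> Rn n"
  unfolding seg_ok_def seg_pts_def using pt_Rn by blast

lemma seg_union_Rn: "seg_union n V \<Longrightarrow> V \<subseteq> Rn n"
  unfolding seg_union_def using seg_pts_Rn by blast

lemma sp_in_seg: "seg_ok n s \<Longrightarrow> sp s \<in> seg_pts s"
  unfolding seg_ok_def seg_pts_def by (rule image_eqI[of _ _ 0]) (auto simp: pt_def icc_def zero_ereal_def[symmetric])

lemma seg_union_empty: "seg_union n {}"
  unfolding seg_union_def by (rule exI[of _ "{}"]) auto

lemma seg_union_Un: assumes "seg_union n V" "seg_union n W" shows "seg_union n (V \<union> W)"
proof -
  obtain S T where "finite S" "\<forall>s\<in>S. seg_ok n s" "V = \<Union>(seg_pts ` S)" "finite T" "\<forall>s\<in>T. seg_ok n s" "W = \<Union>(seg_pts ` T)"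
    using assms unfolding seg_union_def by blast
  then show ?thesis unfolding seg_union_def by (intro exI[of _ "S \<union> T"]) auto
qed

lemma seg_union_UN: "finite I \<Longrightarrow> (\<And>i. i \<in> I \<Longrightarrow> seg_union n (V i)) \<Longrightarrow> seg_union n (\<Union>i\<in>I. V i)"
  by (induction I rule: finite_induct) (auto intro: seg_union_empty seg_union_Un)

lemma seg_union_seg: "seg_ok n s \<Longrightarrow> seg_union n (seg_pts s)"
  unfolding seg_union_def by (rule exI[of _ "{s}"]) auto

lemma seg_union_point: assumes "x \<in> Rn n" shows "seg_union n {x}"
proof -
  have "seg_ok n (Seg x (\<lambda>_. 0) (\<lambda>_. 0) 0)" using assms by (simp add: seg_ok_def)
  moreover have "seg_pts (Seg x (\<lambda>_. 0) (\<lambda>_. 0) 0) = {x}" by (simp add: seg_pts_def icc_zero_zero pt_def)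
  ultimately show ?thesis using seg_union_seg by metis
qed

text \<open>The affine coordinate that measures the parameter of a point of the segment.\<close>

definition seg_coord :: "nat \<Rightarrow> seg \<Rightarrow> (nat \<Rightarrow> real) \<Rightarrow> real" where
  "seg_coord n s x = (\<Sum>i<n. real_of_int (sw s i) * (x i - sp s i))"

text \<open>An integral piecewise linear substitute for the distance to a segment. The summands
  measure the overshoot at the two ends and the deviation from the line that contains the
  segment.\<close>

definition seg_dist :: "nat \<Rightarrow> seg \<Rightarrow> (nat \<Rightarrow> real) \<Rightarrow> real" where
  "seg_dist n s x = max 0 (- seg_coord n s x)
     + (if sl s = \<infinity> then 0 else max 0 (seg_coord n s x - real_of_ereal (sl s)))
     + (\<Sum>i<n. \<bar>x i - sp s i - real_of_int (sv s i) * seg_coord n s x\<bar>)"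

lemma seg_coord_PL: "seg_coord n s \<in> PL n"
  unfolding seg_coord_def by (intro PL_sum PL_int_mult PL_diff PL_coord PL_const) auto

lemma seg_dist_PL: "seg_dist n s \<in> PL n"
proof -
  have "(\<lambda>x. if sl s = \<infinity> then 0 else max 0 (seg_coord n s x - real_of_ereal (sl s))) \<in> PL n"
    by (cases "sl s = \<infinity>") (auto intro!: PL_const PL_max PL_diff seg_coord_PL)
  then show ?thesis unfolding seg_dist_def
    by (intro PL_add PL_max PL_const PL_neg seg_coord_PL PL_sum PL_abs PL_diff PL_coord PL_int_mult) auto
qed

lemma seg_dist_nonneg: "0 \<le> seg_dist n s x"
  unfolding seg_dist_def by (intro add_nonneg_nonneg sum_nonneg) auto

lemma seg_coord_pt:
  "seg_coord n s (pt p v t) = seg_coord n s p + t * real_of_int (\<Sum>i<n. sw s i * v i)"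
  by (simp add: seg_coord_def pt_def algebra_simps sum.distrib sum_distrib_left sum_subtractf)

lemma seg_coord_sp [simp]: "seg_coord n s (sp s) = 0" by (simp add: seg_coord_def)

lemma seg_coord_own:
  assumes "seg_ok n s" "t \<in> icc 0 (sl s)" shows "seg_coord n s (pt (sp s) (sv s) t) = t"
proof (cases "sl s = 0")
  case True
  then show ?thesis using assms by (simp add: icc_zero_zero seg_coord_pt)
next
  case False
  then show ?thesis using assms by (simp add: seg_ok_def prim_def seg_coord_pt)
qed

text \<open>The point of the segment whose parameter is the coordinate of \<open>x\<close>, clamped
  to the interval of parameters, is near \<open>x\<close>.\<close>

lemma seg_dist_near:
  assumes "seg_ok n s" "x \<in> Rn n"
  shows "\<exists>y\<in>seg_pts s. l1 n x y \<le> (1 + (\<Sum>i<n. \<bar>real_of_int (sv s i)\<bar>)) * seg_dist n s x"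
proof -
  define S where "S = seg_coord n s x"
  define t where "t = (if sl s = \<infinity> then max 0 S else max 0 (min S (real_of_ereal (sl s))))"
  have l0: "0 \<le> sl s" using assms by (simp add: seg_ok_def)
  have t: "t \<in> icc 0 (sl s)"
    using l0 unfolding t_def icc_def by (cases "sl s") auto
  define A where "A = max 0 (- S) + (if sl s = \<infinity> then 0 else max 0 (S - real_of_ereal (sl s)))"
  define C where "C = (\<Sum>i<n. \<bar>x i - sp s i - real_of_int (sv s i) * S\<bar>)"
  have D: "seg_dist n s x = A + C" by (simp add: seg_dist_def A_def C_def S_def)
  have St: "\<bar>S - t\<bar> \<le> A" using l0 unfolding t_def A_def by (cases "sl s") auto
  have C0: "0 \<le> C" unfolding C_def by (rule sum_nonneg) auto
  have V0: "0 \<le> (\<Sum>i<n. \<bar>real_of_int (sv s i)\<bar>)" by (rule sum_nonneg) auto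
  have "l1 n x (pt (sp s) (sv s) t) \<le> (\<Sum>i<n. \<bar>x i - sp s i - real_of_int (sv s i) * S\<bar> + \<bar>real_of_int (sv s i)\<bar> * \<bar>S - t\<bar>)"
    unfolding l1_def
  proof (rule sum_mono)
    fix i
    have "x i - pt (sp s) (sv s) t i = (x i - sp s i - real_of_int (sv s i) * S) + real_of_int (sv s i) * (S - t)"
      by (simp add: pt_def algebra_simps)
    then show "\<bar>x i - pt (sp s) (sv s) t i\<bar> \<le> \<bar>x i - sp s i - real_of_int (sv s i) * S\<bar> + \<bar>real_of_int (sv s i)\<bar> * \<bar>S - t\<bar>"
      by (metis abs_mult abs_triangle_ineq)
  qed
  also have "\<dots> = C + (\<Sum>i<n. \<bar>real_of_int (sv s i)\<bar>) * \<bar>S - t\<bar>"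
    by (simp add: sum.distrib C_def sum_distrib_right)
  also have "\<dots> \<le> C + (\<Sum>i<n. \<bar>real_of_int (sv s i)\<bar>) * A"
    using St V0 by (intro add_left_mono mult_left_mono)
  also have "\<dots> \<le> (1 + (\<Sum>i<n. \<bar>real_of_int (sv s i)\<bar>)) * (A + C)"
  proof -
    have "0 \<le> A" using St by linarith
    moreover have "0 \<le> (\<Sum>i<n. \<bar>real_of_int (sv s i)\<bar>) * C" using V0 C0 by simp
    ultimately show ?thesis by (simp add: algebra_simps)
  qed
  finally show ?thesis using t D unfolding seg_pts_def by auto
qed

lemma l1_zero: assumes "l1 n x y \<le> 0" "x \<in> Rn n" "y \<in> Rn n" shows "x = y"
proof
  fix i show "x i = y i"
  proof (cases "i < n")
    case True
    have "\<bar>x i - y i\<bar> \<le> l1 n x y"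
      unfolding l1_def by (rule member_le_sum[of i "{..<n}" "\<lambda>i. \<bar>x i - y i\<bar>"]) (use True in auto)
    then show ?thesis using assms by auto
  qed (use assms in \<open>auto simp: Rn_iff\<close>)
qed

lemma seg_dist_zero_iff:
  assumes "seg_ok n s" "x \<in> Rn n" shows "seg_dist n s x = 0 \<longleftrightarrow> x \<in> seg_pts s"
proof
  assume "seg_dist n s x = 0"
  then obtain y where y: "y \<in> seg_pts s" "l1 n x y \<le> 0" using seg_dist_near[OF assms] by auto
  then have "x = y" using l1_zero assms seg_pts_Rn by blast
  then show "x \<in> seg_pts s" using y by simp
next
  assume "x \<in> seg_pts s"
  then obtain t where t: "t \<in> icc 0 (sl s)" "x = pt (sp s) (sv s) t" unfolding seg_pts_def by auto
  have S: "seg_coord n s x = t" using seg_coord_own assms t by simp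
  have "0 \<le> t" "sl s \<noteq> \<infinity> \<Longrightarrow> t \<le> real_of_ereal (sl s)" using t(1) unfolding icc_def by (cases "sl s"; auto)+
  moreover have "(\<Sum>i<n. \<bar>x i - sp s i - real_of_int (sv s i) * t\<bar>) = 0"
    using t(2) by (simp add: pt_def)
  ultimately show "seg_dist n s x = 0" unfolding seg_dist_def S by auto
qed

subsection \<open>Finite unions of segments are closed and have finitely generated congruences\<close>

definition union_dist :: "nat \<Rightarrow> seg set \<Rightarrow> (nat \<Rightarrow> real) \<Rightarrow> real" where
  "union_dist n \<S> x = Min ((\<lambda>s. seg_dist n s x) ` \<S>)"

lemma union_dist_PL: "finite \<S> \<Longrightarrow> \<S> \<noteq> {} \<Longrightarrow> union_dist n \<S> \<in> PL n"
  using PL_Min[of \<S> "seg_dist n" n] seg_dist_PL unfolding union_dist_def by blast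

lemma union_dist_attained:
  assumes "finite \<S>" "\<S> \<noteq> {}" obtains s where "s \<in> \<S>" "union_dist n \<S> x = seg_dist n s x"
proof -
  have "union_dist n \<S> x \<in> (\<lambda>s. seg_dist n s x) ` \<S>"
    unfolding union_dist_def by (rule Min_in) (use assms in auto)
  then show thesis using that by blast
qed

lemma union_dist_zero_iff:
  assumes "finite \<S>" "\<S> \<noteq> {}" "\<forall>s\<in>\<S>. seg_ok n s" "x \<in> Rn n"
  shows "union_dist n \<S> x = 0 \<longleftrightarrow> x \<in> \<Union>(seg_pts ` \<S>)"
proof
  assume *: "union_dist n \<S> x = 0"
  obtain s where "s \<in> \<S>" "union_dist n \<S> x = seg_dist n s x" using union_dist_attained assms by metis
  then show "x \<in> \<Union>(seg_pts ` \<S>)" using * seg_dist_zero_iff assms by auto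
next
  assume "x \<in> \<Union>(seg_pts ` \<S>)"
  then obtain s where s: "s \<in> \<S>" "x \<in> seg_pts s" by auto
  then have "seg_dist n s x = 0" using seg_dist_zero_iff assms by auto
  then have "union_dist n \<S> x \<le> 0" using s assms unfolding union_dist_def by (metis Min_le finite_imageI imageI)
  moreover obtain s' where "union_dist n \<S> x = seg_dist n s' x" using union_dist_attained assms by metis
  ultimately show "union_dist n \<S> x = 0" using seg_dist_nonneg by (metis order_antisym)
qed

text \<open>The piecewise linear distance to \<open>V\<close> agrees with 0 on \<open>V\<close>, so
  it is congruent to 0, and it is positive outside \<open>V\<close>.\<close>

lemma variety_cong_of:
  assumes "seg_union n V" "V \<noteq> {}" shows "variety_of n (cong_of n V) = V"
proof
  obtain \<S> where S: "finite \<S>" "\<forall>s\<in>\<S>. seg_ok n s" "V = \<Union>(seg_pts ` \<S>)" using assms unfolding seg_union_def by blast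
  then have ne: "\<S> \<noteq> {}" using assms by auto
  show "V \<subseteq> variety_of n (cong_of n V)"
    using seg_union_Rn[OF assms(1)] unfolding variety_of_def cong_of_def by auto
  show "variety_of n (cong_of n V) \<subseteq> V"
  proof
    fix x assume x: "x \<in> variety_of n (cong_of n V)"
    then have xR: "x \<in> Rn n" unfolding variety_of_def by auto
    have "\<forall>y\<in>V. emb n (union_dist n \<S>) y = emb n (\<lambda>_. 0) y"
      using union_dist_zero_iff[OF S(1) ne S(2)] S(3) seg_union_Rn[OF assms(1)] unfolding emb_def by auto
    then have "(emb n (union_dist n \<S>), emb n (\<lambda>_. 0)) \<in> cong_of n V"
      using union_dist_PL[OF S(1) ne] PL_const unfolding cong_of_def carrier_trop_rat by auto
    then have "emb n (union_dist n \<S>) x = emb n (\<lambda>_. 0) x" using x unfolding variety_of_def by auto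
    then show "x \<in> V" using union_dist_zero_iff[OF S(1) ne S(2) xR] S(3) xR unfolding emb_def by auto
  qed
qed

text \<open>A Lipschitz function that vanishes on all segments is bounded by a multiple of the
  distance to each of them.\<close>

lemma union_dist_dominates:
  assumes "finite \<S>" "\<S> \<noteq> {}" "\<forall>s\<in>\<S>. seg_ok n s" "f \<in> PL n" "\<And>x. x \<in> \<Union>(seg_pts ` \<S>) \<Longrightarrow> f x = 0"
  shows "\<exists>k::nat. \<forall>x\<in>Rn n. \<bar>f x\<bar> \<le> real k * union_dist n \<S> x"
proof -
  obtain L where L: "L \<ge> 0" "\<forall>x y. \<bar>f x - f y\<bar> \<le> L * l1 n x y" using PL_lipschitz[OF assms(4)] by blast
  define C where "C s = 1 + (\<Sum>i<n. \<bar>real_of_int (sv s i)\<bar>)" for s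
  have C0: "0 \<le> C s" for s unfolding C_def by (intro add_nonneg_nonneg sum_nonneg) auto
  obtain k :: nat where k: "L * (\<Sum>s\<in>\<S>. C s) \<le> real k" using real_arch_simple by blast
  have "\<bar>f x\<bar> \<le> real k * union_dist n \<S> x" if x: "x \<in> Rn n" for x
  proof -
    obtain s where s: "s \<in> \<S>" "union_dist n \<S> x = seg_dist n s x" using union_dist_attained assms by metis
    obtain y where y: "y \<in> seg_pts s" "l1 n x y \<le> C s * seg_dist n s x"
      using seg_dist_near[of n s x] assms(3) s x unfolding C_def by auto
    have "f y = 0" using assms(5) s y by auto
    then have "\<bar>f x\<bar> \<le> L * l1 n x y" using L(2)[rule_format, of x y] by simp
    also have "\<dots> \<le> L * (C s * seg_dist n s x)" using y L by (intro mult_left_mono)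
    also have "\<dots> = (L * C s) * seg_dist n s x" by simp
    also have "\<dots> \<le> real k * seg_dist n s x"
    proof (rule mult_right_mono[OF _ seg_dist_nonneg])
      have "C s \<le> (\<Sum>s\<in>\<S>. C s)" by (rule member_le_sum) (use s C0 assms in auto)
      then show "L * C s \<le> real k" using k L by (meson mult_left_mono order_trans)
    qed
    finally show ?thesis using s by simp
  qed
  then show ?thesis by blast
qed

text \<open>Congruences correspond to convex subgroups of the lattice-ordered group of real-valued
  elements: if \<open>d \<ge> 0\<close> is congruent to 0 and \<open>u \<le> k d\<close>, then the
  positive part \<open>p\<close> of \<open>u\<close> satisfies
  \<open>p = max p 0 \<sim> max p (k d) = k d \<sim> 0\<close>. So the single pair of
  \<open>d\<close> and 0 generates the congruence of \<open>W\<close> as soon as \<open>d\<close>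
  dominates all functions that vanish on \<open>W\<close>.\<close>

lemma fin_gen_cong_of:
  assumes W: "W \<subseteq> Rn n" "W \<noteq> {}" and d: "d \<in> PL n" "\<And>x. x \<in> W \<Longrightarrow> d x = 0"
    and dom: "\<And>f. f \<in> PL n \<Longrightarrow> (\<And>x. x \<in> W \<Longrightarrow> f x = 0) \<Longrightarrow> \<exists>k::nat. \<forall>x\<in>Rn n. \<bar>f x\<bar> \<le> real k * d x"
  shows "fin_gen_congruence (trop_rat n) (cong_of n W)"
  unfolding fin_gen_congruence_def
proof (intro conjI exI allI impI)
  show "congruence (trop_rat n) (cong_of n W)" by (rule congruence_cong_of[OF W(1)])
  let ?F = "{(emb n d, emb n (\<lambda>_. 0))}"
  show "finite ?F" by simp
  show "?F \<subseteq> cong_of n W" using d PL_const W(1) unfolding cong_of_def carrier_trop_rat emb_def by auto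
  fix C assume C: "congruence (trop_rat n) C \<and> ?F \<subseteq> C"
  have eqv: "equiv (carrier (trop_rat n)) C" using C unfolding congruence_def by auto
  define R where "R a b \<longleftrightarrow> (emb n a, emb n b) \<in> C" for a b
  have refl: "R a a" if "a \<in> PL n" for a
    using eqv that unfolding R_def equiv_def refl_on_def carrier_trop_rat by auto
  have sym: "R b a" if "R a b" for a b using eqv that unfolding R_def equiv_def sym_def by blast
  have trans: "R a c" if "R a b" "R b c" for a b c using eqv that unfolding R_def equiv_def trans_def by blast
  have C': "(a \<oplus>\<^bsub>trop_rat n\<^esub> c, b \<oplus>\<^bsub>trop_rat n\<^esub> d) \<in> C" "(a \<otimes>\<^bsub>trop_rat n\<^esub> c, b \<otimes>\<^bsub>trop_rat n\<^esub> d) \<in> C"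
    if "(a, b) \<in> C" "(c, d) \<in> C" for a b c d
    using C that unfolding congruence_def by blast+
  have add: "R (\<lambda>x. a x + a' x) (\<lambda>x. b x + b' x)" and mx: "R (\<lambda>x. max (a x) (a' x)) (\<lambda>x. max (b x) (b' x))"
    if "R a b" "R a' b'" for a b a' b'
    using C'[of "emb n a" "emb n b" "emb n a'" "emb n b'"] that unfolding R_def trop_rat_simps by auto
  have cong: "R a b \<longleftrightarrow> R a' b'" if "\<And>x. x \<in> Rn n \<Longrightarrow> a x = a' x" "\<And>x. x \<in> Rn n \<Longrightarrow> b x = b' x" for a b a' b'
  proof -
    have "emb n a = emb n a'" "emb n b = emb n b'" using that emb_eq_iff by blast+
    then show ?thesis unfolding R_def by simp
  qed
  have kd: "R (\<lambda>x. real k * d x) (\<lambda>x. 0)" for k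
  proof (induction k)
    case 0 show ?case using refl[OF PL_const[of 0]] by simp
  next
    case (Suc k)
    have "R d (\<lambda>_. 0)" using C unfolding R_def by auto
    then show ?case using add[OF Suc, of d "\<lambda>_. 0"] by (simp add: algebra_simps)
  qed
  have small: "R (\<lambda>x. max (u x) 0) (\<lambda>x. 0)" if u: "u \<in> PL n" "\<And>x. x \<in> Rn n \<Longrightarrow> u x \<le> real k * d x" "\<And>x. x \<in> Rn n \<Longrightarrow> 0 \<le> d x" for u k
  proof -
    have "R (\<lambda>x. max (u x) (real k * d x)) (\<lambda>x. max (u x) 0)" using mx[OF refl[OF u(1)] kd] .
    then have "R (\<lambda>x. real k * d x) (\<lambda>x. max (u x) 0)"
      using u by (subst cong[where a'="\<lambda>x. max (u x) (real k * d x)" and b'="\<lambda>x. max (u x) 0"]) (auto simp: max_def antisym)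
    then show ?thesis using trans[OF sym kd] by blast
  qed
  show "cong_of n W \<subseteq> C"
  proof clarify
    fix f g assume fg: "(f, g) \<in> cong_of n W"
    then have fc: "f \<in> carrier (trop_rat n)" and gc: "g \<in> carrier (trop_rat n)" and eq: "\<And>x. x \<in> W \<Longrightarrow> f x = g x"
      unfolding cong_of_def by auto
    obtain w where w: "w \<in> W" using W by auto
    then have wR: "w \<in> Rn n" using W by auto
    show "(f, g) \<in> C"
    proof (rule trop_rat_cases[OF fc]; rule trop_rat_cases[OF gc])
      assume "f = neginf n" "g = neginf n"
      then show ?thesis using eqv fc unfolding equiv_def refl_on_def by auto
    next
      fix a assume "f = neginf n" "g = emb n a"
      then show ?thesis using eq[OF w] wR unfolding emb_def by simp
    next
      fix a assume "g = neginf n" "f = emb n a"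
      then show ?thesis using eq[OF w] wR unfolding emb_def by simp
    next
      fix a b assume ab: "a \<in> PL n" "f = emb n a" "b \<in> PL n" "g = emb n b"
      have "a x - b x = 0" if "x \<in> W" for x using eq[OF that] ab W that unfolding emb_def by auto
      then obtain k where k: "\<And>x. x \<in> Rn n \<Longrightarrow> \<bar>a x - b x\<bar> \<le> real k * d x" using dom[OF PL_diff[OF ab(1,3)]] by blast
      have PL_d: "\<exists>k::nat. \<forall>x\<in>Rn n. \<bar>d x\<bar> \<le> real k * d x" using dom[OF d] .
      then have d0: "0 \<le> d x" if "x \<in> Rn n" for x
        using that by (metis abs_ge_zero abs_le_zero_iff mult_eq_0_iff mult_nonneg_nonpos nle_le of_nat_0_le_iff order_trans)
      have 1: "R (\<lambda>x. max (a x - b x) 0) (\<lambda>x. 0)"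
        using small[OF PL_diff[OF ab(1,3)], of k] k d0 by (meson abs_le_D1)
      have 2: "R (\<lambda>x. max (b x - a x) 0) (\<lambda>x. 0)"
        by (rule small[OF PL_diff[OF ab(3,1)], of k]) (use k d0 in \<open>auto simp: abs_le_iff\<close>)
      have 3: "R (\<lambda>x. max (a x - b x) 0 + b x) b" using add[OF 1 refl[OF ab(3)]] by simp
      have 4: "R (\<lambda>x. max (b x - a x) 0 + a x) a" using add[OF 2 refl[OF ab(1)]] by simp
      have "(\<lambda>x. max (b x - a x) 0 + a x) = (\<lambda>x. max (a x - b x) 0 + b x)" by auto
      then have "R a b" using trans[OF sym[OF 4]] 3 by simp
      then show ?thesis using ab unfolding R_def by simp
    qed
  qed
qed

lemma fin_gen_seg_union:
  assumes "seg_union n V" "V \<noteq> {}" shows "fin_gen_congruence (trop_rat n) (cong_of n V)"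
proof -
  obtain \<S> where S: "finite \<S>" "\<forall>s\<in>\<S>. seg_ok n s" "V = \<Union>(seg_pts ` \<S>)" using assms unfolding seg_union_def by blast
  then have ne: "\<S> \<noteq> {}" using assms by auto
  show ?thesis
  proof (rule fin_gen_cong_of[OF seg_union_Rn[OF assms(1)] assms(2) union_dist_PL[OF S(1) ne]])
    show "union_dist n \<S> x = 0" if "x \<in> V" for x
      using union_dist_zero_iff[OF S(1) ne S(2)] that S(3) seg_union_Rn[OF assms(1)] by blast
    show "\<exists>k::nat. \<forall>x\<in>Rn n. \<bar>f x\<bar> \<le> real k * union_dist n \<S> x"
      if "f \<in> PL n" "\<And>x. x \<in> V \<Longrightarrow> f x = 0" for f
      using union_dist_dominates[OF S(1) ne S(2) that(1)] that(2) S(3) by blast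
  qed
qed

subsection \<open>Extending functions from a union of segments\<close>

lemma seg_dist_along_pwa:
  "pwa (\<lambda>t. seg_dist n s (pt p v t)) (icc 0 l)" "continuous_on (icc 0 l) (\<lambda>t. seg_dist n s (pt p v t))"
proof -
  have "pwa (\<lambda>t. pt p v t i) (icc 0 l)" for i
    unfolding pt_def by (rule pwa_affine[where m="v i" and c="p i"]) auto
  then show "pwa (\<lambda>t. seg_dist n s (pt p v t)) (icc 0 l)" by (intro PL_pwa[OF seg_dist_PL]) auto
  show "continuous_on (icc 0 l) (\<lambda>t. seg_dist n s (pt p v t))"
    by (intro PL_continuous_on[OF seg_dist_PL]) (auto simp: pt_def intro!: continuous_intros)
qed

lemma bounded_affine_nonpos:
  fixes c d K :: real assumes "\<And>t. 0 \<le> t \<Longrightarrow> c + t * d \<le> K" shows "d \<le> 0"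
proof (rule ccontr)
  assume "\<not> d \<le> 0"
  then have d: "d > 0" by simp
  have "c + ((\<bar>K\<bar> + \<bar>c\<bar> + 1) / d) * d \<le> K" using d by (intro assms) auto
  then show False using d by simp
qed

text \<open>If a ray stays within bounded distance of a segment, then the segment is a ray in the
  same direction. Boundedness of the summands of the distance makes \<open>v\<close> a nonnegative
  integral multiple of the direction of the segment; as \<open>v\<close> is primitive, the factor is
  1, and then the segment cannot end.\<close>

lemma ray_near_segment:
  assumes s: "seg_ok n s" and r: "prim n v w"
    and bd: "\<And>t. t \<ge> 0 \<Longrightarrow> seg_dist n s (pt p v t) \<le> K"
  shows "sl s = \<infinity> \<and> sv s = v"
proof -
  define c where "c = (\<Sum>i<n. sw s i * v i)"
  define S where "S t = seg_coord n s p + t * real_of_int c" for t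
  have S: "seg_coord n s (pt p v t) = S t" for t by (simp add: seg_coord_pt c_def S_def)
  have D: "seg_dist n s (pt p v t) = max 0 (- S t) + (if sl s = \<infinity> then 0 else max 0 (S t - real_of_ereal (sl s)))
     + (\<Sum>i<n. \<bar>pt p v t i - sp s i - real_of_int (sv s i) * S t\<bar>)" for t by (simp add: seg_dist_def S)
  have sn: "0 \<le> (\<Sum>i<n. \<bar>pt p v t i - sp s i - real_of_int (sv s i) * S t\<bar>)" for t by (rule sum_nonneg) auto
  have "- seg_coord n s p + t * - real_of_int c \<le> K" if "t \<ge> 0" for t
  proof -
    have "- S t \<le> K"
    proof -
      have "0 \<le> (if sl s = \<infinity> then 0 else max 0 (S t - real_of_ereal (sl s)))" by simp
      then show ?thesis using bd[OF that] D[of t] sn[of t] by linarith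
    qed
    then show ?thesis unfolding S_def by simp
  qed
  then have "- real_of_int c \<le> 0" by (rule bounded_affine_nonpos)
  then have c0: "0 \<le> c" by simp
  have vc: "v i = sv s i * c" if i: "i < n" for i
  proof -
    define A where "A = p i - sp s i - real_of_int (sv s i) * seg_coord n s p"
    define B where "B = real_of_int (v i - sv s i * c)"
    have AB: "\<bar>A + t * B\<bar> \<le> K" if "t \<ge> 0" for t
    proof -
      have "pt p v t i - sp s i - real_of_int (sv s i) * S t = A + t * B"
        unfolding A_def B_def S_def pt_def by (simp add: algebra_simps)
      moreover have "\<bar>pt p v t i - sp s i - real_of_int (sv s i) * S t\<bar> \<le> (\<Sum>i<n. \<bar>pt p v t i - sp s i - real_of_int (sv s i) * S t\<bar>)"
        by (rule member_le_sum[of i "{..<n}" "\<lambda>i. \<bar>pt p v t i - sp s i - real_of_int (sv s i) * S t\<bar>"]) (use i in auto)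
      ultimately show ?thesis using bd[OF that] D[of t] by (auto split: if_splits)
    qed
    have "B \<le> 0" by (rule bounded_affine_nonpos[of A _ K]) (use AB in \<open>auto simp: abs_le_iff\<close>)
    moreover have "- B \<le> 0" by (rule bounded_affine_nonpos[of "- A" _ K]) (use AB in \<open>fastforce simp: abs_le_iff\<close>)
    ultimately have "B = 0" by simp
    then show ?thesis unfolding B_def by linarith
  qed
  have one: "(\<Sum>i<n. w i * v i) = 1" using r by (simp add: prim_def)
  have "c * (\<Sum>i<n. w i * sv s i) = (\<Sum>i<n. w i * v i)" using vc by (simp add: sum_distrib_left mult_ac)
  then have "c dvd 1" using one by (metis dvd_triv_left)
  then have c1: "c = 1" using c0 by simp
  have "sl s = \<infinity>"
  proof (rule ccontr)
    assume fin: "sl s \<noteq> \<infinity>"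
    have "(seg_coord n s p - real_of_ereal (sl s)) + t * real_of_int c \<le> K" if "t \<ge> 0" for t
    proof -
      have "S t - real_of_ereal (sl s) \<le> K"
      proof -
        have "(if sl s = \<infinity> then 0 else max 0 (S t - real_of_ereal (sl s))) = max 0 (S t - real_of_ereal (sl s))"
          using fin by simp
        then show ?thesis using bd[OF that] D[of t] sn[of t] by linarith
      qed
      then show ?thesis unfolding S_def by simp
    qed
    then have "real_of_int c \<le> 0" by (rule bounded_affine_nonpos)
    then show False using c1 by simp
  qed
  moreover have "sv s i = v i" for i
    using vc[of i] c1 s r by (cases "i < n") (auto simp: seg_ok_def prim_def)
  ultimately show ?thesis by auto
qed

text \<open>Since \<open>s\<close> is a point or its direction is primitive, the values on
  \<open>s\<close> extend to an integral affine function on the whole space. Subtracting a large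
  multiple of the distance to \<open>s\<close> pushes it below \<open>g\<close> on \<open>r\<close>.
  The only obstruction is a ray \<open>r\<close> along which the distance to \<open>s\<close> is
  bounded, and then the slopes at infinity agree by assumption.\<close>

lemma extension_two_segments:
  assumes s: "seg_ok n s" and r: "seg_ok n r"
    and gs: "\<And>t. t \<in> icc 0 (sl s) \<Longrightarrow> g (pt (sp s) (sv s) t) = of_int m * t + c"
    and gr: "\<And>t. t \<in> icc 0 (sl r) \<Longrightarrow> g (pt (sp r) (sv r) t) = of_int m' * t + c'"
    and par: "sl s = \<infinity> \<Longrightarrow> sl r = \<infinity> \<Longrightarrow> sv s = sv r \<Longrightarrow> m = m'"
  shows "\<exists>h\<in>PL n. (\<forall>x\<in>seg_pts s. h x = g x) \<and> (\<forall>x\<in>seg_pts r. h x \<le> g x)"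
proof -
  define a where "a x = of_int m * seg_coord n s x + c" for x
  define D where "D t = seg_dist n s (pt (sp r) (sv r) t)" for t
  define q where "q = of_int m * (\<Sum>i<n. sw s i * sv r i) - m'"
  define b where "b = of_int m * seg_coord n s (sp r) + c - c'"
  have u: "a (pt (sp r) (sv r) t) - g (pt (sp r) (sv r) t) = of_int q * t + b" if "t \<in> icc 0 (sl r)" for t
    using gr[OF that] unfolding a_def seg_coord_pt q_def b_def by (simp add: algebra_simps)
  have as: "a x = g x" if "x \<in> seg_pts s" for x
    using that gs seg_coord_own[OF s] unfolding a_def seg_pts_def by auto
  have "\<exists>k::nat. \<forall>t\<in>icc 0 (sl r). of_int q * t + b \<le> real k * D t"
  proof (rule affine_dominated)
    show "0 \<le> sl r" using r by (simp add: seg_ok_def)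
    show "pwa D (icc 0 (sl r))" "continuous_on (icc 0 (sl r)) D" unfolding D_def by (rule seg_dist_along_pwa)+
    show "0 \<le> D t" for t unfolding D_def by (rule seg_dist_nonneg)
    show "of_int q * t + b \<le> 0" if t: "t \<in> icc 0 (sl r)" "D t = 0" for t
    proof -
      have "pt (sp r) (sv r) t \<in> Rn n" using r by (intro pt_Rn) (auto simp: seg_ok_def)
      then have "pt (sp r) (sv r) t \<in> seg_pts s" using t(2) seg_dist_zero_iff[OF s] unfolding D_def by blast
      then show ?thesis using u[OF t(1)] as by simp
    qed
    show "real_of_int q \<le> 0" if "sl r = \<infinity>" "\<And>t. t \<ge> 0 \<Longrightarrow> D t \<le> K" for K
    proof -
      have rp: "prim n (sv r) (sw r)" using r that by (auto simp: seg_ok_def)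
      have *: "sl s = \<infinity> \<and> sv s = sv r" using ray_near_segment[OF s rp] that(2) unfolding D_def by blast
      then have "prim n (sv r) (sw s)" using s by (auto simp: seg_ok_def)
      then show ?thesis using par * that unfolding q_def prim_def by simp
    qed
  qed
  then obtain k :: nat where k: "\<And>t. t \<in> icc 0 (sl r) \<Longrightarrow> of_int q * t + b \<le> real k * D t" by blast
  show ?thesis
  proof (intro bexI conjI ballI)
    show "(\<lambda>x. a x - real k * seg_dist n s x) \<in> PL n"
      unfolding a_def by (intro PL_diff PL_add PL_const PL_int_mult PL_nat_mult seg_coord_PL seg_dist_PL)
    show "a x - real k * seg_dist n s x = g x" if "x \<in> seg_pts s" for x
      using as[OF that] seg_dist_zero_iff[OF s] that seg_pts_Rn[OF s] by auto
    fix x assume "x \<in> seg_pts r"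
    then obtain t where t: "t \<in> icc 0 (sl r)" "x = pt (sp r) (sv r) t" unfolding seg_pts_def by auto
    then show "a x - real k * seg_dist n s x \<le> g x" using k[OF t(1)] u[OF t(1)] unfolding D_def by simp
  qed
qed

text \<open>The minimum over all \<open>r\<close> of the functions for the pairs
  \<open>(s, r)\<close> agrees with \<open>g\<close> on \<open>s\<close> and is at most
  \<open>g\<close> everywhere; so the maximum of these minima over all \<open>s\<close> agrees with
  \<open>g\<close> on every segment.\<close>

lemma extension:
  assumes fin: "finite \<S>" "\<S> \<noteq> {}" and ok: "\<And>s. s \<in> \<S> \<Longrightarrow> seg_ok n s"
    and g: "\<And>s t. s \<in> \<S> \<Longrightarrow> t \<in> icc 0 (sl s) \<Longrightarrow> g (pt (sp s) (sv s) t) = of_int (m s :: int) * t + c s"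
    and par: "\<And>s r. s \<in> \<S> \<Longrightarrow> r \<in> \<S> \<Longrightarrow> sl s = \<infinity> \<Longrightarrow> sl r = \<infinity> \<Longrightarrow> sv s = sv r \<Longrightarrow> m s = m r"
  shows "\<exists>h\<in>PL n. \<forall>x\<in>\<Union>(seg_pts ` \<S>). h x = g x"
proof -
  have "\<forall>s\<in>\<S>. \<forall>r\<in>\<S>. \<exists>h. h \<in> PL n \<and> (\<forall>x\<in>seg_pts s. h x = g x) \<and> (\<forall>x\<in>seg_pts r. h x \<le> g x)"
  proof (intro ballI)
    fix s r assume sr: "s \<in> \<S>" "r \<in> \<S>"
    show "\<exists>h. h \<in> PL n \<and> (\<forall>x\<in>seg_pts s. h x = g x) \<and> (\<forall>x\<in>seg_pts r. h x \<le> g x)"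
      using extension_two_segments[OF ok[OF sr(1)] ok[OF sr(2)] g[OF sr(1)] g[OF sr(2)] par[OF sr]] by blast
  qed
  then obtain h where h: "\<And>s r. s \<in> \<S> \<Longrightarrow> r \<in> \<S> \<Longrightarrow>
     h s r \<in> PL n \<and> (\<forall>x\<in>seg_pts s. h s r x = g x) \<and> (\<forall>x\<in>seg_pts r. h s r x \<le> g x)" by metis
  define k where "k s x = Min ((\<lambda>r. h s r x) ` \<S>)" for s x
  have kP: "k s \<in> PL n" if "s \<in> \<S>" for s
    using PL_Min[OF fin, of "h s" n] h that unfolding k_def by blast
  have ks: "k s x = g x" if "s \<in> \<S>" "x \<in> seg_pts s" for s x
  proof -
    have "(\<lambda>r. h s r x) ` \<S> = {g x}" using h that fin by auto
    then show ?thesis unfolding k_def by simp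
  qed
  have kr: "k s x \<le> g x" if "s \<in> \<S>" "r \<in> \<S>" "x \<in> seg_pts r" for s r x
  proof -
    have "k s x \<le> h s r x" unfolding k_def by (rule Min_le) (use that fin in auto)
    also have "\<dots> \<le> g x" using h that by blast
    finally show ?thesis .
  qed
  have "Max ((\<lambda>s. k s x) ` \<S>) = g x" if "x \<in> \<Union>(seg_pts ` \<S>)" for x
  proof -
    obtain s where s: "s \<in> \<S>" "x \<in> seg_pts s" using \<open>x \<in> _\<close> by auto
    show ?thesis
      by (rule Max_eqI) (use s fin kr ks in \<open>auto intro!: image_eqI[where x=s]\<close>)
  qed
  moreover have "(\<lambda>x. Max ((\<lambda>s. k s x) ` \<S>)) \<in> PL n" using PL_Max[OF fin, of k n] kP by blast
  ultimately show ?thesis by (intro bexI[where x="\<lambda>x. Max ((\<lambda>s. k s x) ` \<S>)"]) auto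
qed

section \<open>Polyhedral sets of dimension at most one\<close>

lemma bezout_finite: "\<exists>w. (\<Sum>i<n. w i * z i) = Gcd (z ` {..<n})" for z :: "nat \<Rightarrow> int"
proof (induction n)
  case (Suc n)
  then obtain w where w: "(\<Sum>i<n. w i * z i) = Gcd (z ` {..<n})" by blast
  obtain u v where uv: "u * z n + v * Gcd (z ` {..<n}) = gcd (z n) (Gcd (z ` {..<n}))" using bezout_int by blast
  have "(\<Sum>i<Suc n. (if i < n then v * w i else u) * z i) = v * (\<Sum>i<n. w i * z i) + u * z n"
    by (simp add: sum_distrib_left mult_ac)
  also have "\<dots> = Gcd (z ` {..<Suc n})" using w uv by (simp add: lessThan_Suc)
  finally show ?case by (intro exI[of _ "\<lambda>i. if i < n then v * w i else u"])
qed simp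

lemma primitive_multiple:
  assumes "\<forall>i\<ge>n. z i = 0" "i < n" "z i \<noteq> (0::int)"
  obtains g v w where "g > 0" "\<And>i. z i = g * v i" "prim n v w"
proof -
  define g where "g = Gcd (z ` {..<n})"
  obtain w where w: "(\<Sum>i<n. w i * z i) = g" using bezout_finite unfolding g_def by blast
  have dv: "g dvd z i" for i
    using assms(1) unfolding g_def by (cases "i < n") (auto intro: Gcd_dvd)
  have "g \<noteq> 0" using dv[of i] assms by auto
  then have g: "g > 0" unfolding g_def by (metis Gcd_int_greater_eq_0 order_le_less)
  have z: "z i = g * (z i div g)" for i using dv by simp
  have "g * (\<Sum>i<n. w i * (z i div g)) = (\<Sum>i<n. w i * z i)"
    unfolding sum_distrib_left using z by (intro sum.cong) (auto simp: mult.left_commute)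
  then have "(\<Sum>i<n. w i * (z i div g)) = 1" using w g by simp
  then have "prim n (\<lambda>i. z i div g) w" using assms(1) unfolding prim_def by simp
  then show thesis using that[of g "\<lambda>i. z i div g" w] g z by blast
qed

text \<open>Dividing the direction by the greatest common divisor of its entries makes it
  primitive.\<close>

lemma seg_union_interval:
  assumes q: "q \<in> Rn n" and z: "\<forall>i\<ge>n. z i = 0" and ab: "ereal a \<le> b"
  shows "seg_union n (pt q z ` icc a b)"
proof (cases "\<exists>i<n. z i \<noteq> 0")
  case False
  then have "z i = 0" for i using z by (cases "i < n") auto
  then have "pt q z ` icc a b = {q}" using ab by (auto simp: pt_def icc_def intro!: exI[of _ a])
  then show ?thesis using seg_union_point[OF q] by simp
next
  case True
  then obtain g v w where g: "g > 0" "\<And>i. z i = g * v i" "prim n v w" using primitive_multiple[OF z] by metis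
  have g': "real_of_int g > 0" using g by simp
  define l where "l = (if b = \<infinity> then \<infinity> else ereal (real_of_int g * (real_of_ereal b - a)))"
  have b: "b = \<infinity> \<or> (\<exists>r. b = ereal r \<and> a \<le> r)" using ab by (cases b) auto
  have icc: "t \<in> icc a b \<longleftrightarrow> real_of_int g * (t - a) \<in> icc 0 l" for t
    using g' b unfolding icc_def l_def by (auto simp: zero_le_mult_iff)
  have pt: "pt q z t = pt (pt q z a) v (real_of_int g * (t - a))" for t
    by (simp add: pt_def g(2) algebra_simps)
  have "pt q z ` icc a b = pt (pt q z a) v ` icc 0 l"
  proof (intro equalityI subsetI)
    fix x assume "x \<in> pt q z ` icc a b"
    then obtain t where t: "t \<in> icc a b" "x = pt q z t" by blast
    show "x \<in> pt (pt q z a) v ` icc 0 l"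
      by (rule image_eqI[of _ _ "real_of_int g * (t - a)"]) (use icc[of t] pt[of t] t in simp_all)
  next
    fix x assume "x \<in> pt (pt q z a) v ` icc 0 l"
    then obtain s where s: "s \<in> icc 0 l" "x = pt (pt q z a) v s" by auto
    define t where "t = a + s / real_of_int g"
    have t: "real_of_int g * (t - a) = s" using g' by (simp add: t_def)
    show "x \<in> pt q z ` icc a b"
      by (rule image_eqI[of _ _ t]) (use s icc[of t] pt[of t] in \<open>simp_all add: t\<close>)
  qed
  moreover have "seg_ok n (Seg (pt q z a) v w l)"
    using pt_Rn[OF q z, of a] g(3) b g' by (auto simp: seg_ok_def prim_def l_def)
  ultimately show ?thesis using seg_union_seg[of n "Seg (pt q z a) v w l"] by (simp add: seg_pts_def)
qed

subsection \<open>Rational directions\<close>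

text \<open>A functional that is linear over the rationals turns real solutions of a rational system
  of linear equations into rational ones.\<close>

lemma rat_linear_functional:
  fixes x :: real assumes "x \<noteq> 0"
  obtains \<phi> :: "real \<Rightarrow> rat" where "\<And>a b. \<phi> (a + b) = \<phi> a + \<phi> b" "\<And>q a. \<phi> (of_rat q * a) = q * \<phi> a" "\<phi> x = 1"
proof -
  interpret vector_space_pair "\<lambda>(q::rat) (x::real). of_rat q * x" "(*) :: rat \<Rightarrow> rat \<Rightarrow> rat"
    by unfold_locales (auto simp: algebra_simps of_rat_add of_rat_mult)
  have "vs1.independent {x}" using assms by (simp add: vs1.dependent_single)
  then obtain \<phi> where \<phi>: "Vector_Spaces.linear (\<lambda>(q::rat) (x::real). of_rat q * x) (*) \<phi>" "\<forall>y\<in>{x}. \<phi> y = 1"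
    using linear_independent_extend[of "{x}" "\<lambda>_. 1"] by blast
  interpret l: Vector_Spaces.linear "\<lambda>(q::rat) (x::real). of_rat q * x" "(*)" \<phi> by (rule \<phi>(1))
  show thesis using that[of \<phi>] l.add l.scale \<phi>(2) by auto
qed

text \<open>The vector space structure to which the dimension of polyhedral sets refers.\<close>

interpretation fn: vector_space "\<lambda>(c :: real) (x :: nat \<Rightarrow> real) i. c * x i"
  by unfold_locales (auto simp: fun_eq_iff algebra_simps)

lemma Rn_finite_span: "\<exists>E. finite E \<and> Rn n \<subseteq> fn.span E"
proof (induction n)
  case 0
  have "Rn 0 = {0}" by (auto simp: Rn_iff fun_eq_iff)
  then show ?case by (intro exI[of _ "{}"]) auto
next
  case (Suc n)
  then obtain E where E: "finite E" "Rn n \<subseteq> fn.span E" by blast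
  let ?e = "\<lambda>j. if j = n then 1 else 0 :: real"
  have "x \<in> fn.span (insert ?e E)" if x: "x \<in> Rn (Suc n)" for x
  proof -
    have "x(n := 0) \<in> Rn n" using x by (auto simp: Rn_iff le_Suc_eq Suc_le_eq)
    then have 1: "x(n := 0) \<in> fn.span (insert ?e E)" using E fn.span_mono[of E "insert ?e E"] by blast
    have 2: "(\<lambda>i. x n * ?e i) \<in> fn.span (insert ?e E)" by (intro fn.span_scale fn.span_base) simp
    have "x = x(n := 0) + (\<lambda>i. x n * ?e i)" by (auto simp: fun_eq_iff)
    then show ?thesis using fn.span_add[OF 1 2] by simp
  qed
  then show ?case using E(1) by (intro exI[of _ "insert ?e E"]) auto
qed

lemma dim_le_1_line:
  assumes "D \<subseteq> Rn n" "fn.dim D \<le> 1"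
  obtains b where "\<And>d. d \<in> D \<Longrightarrow> \<exists>c. d = (\<lambda>i. c * b i)"
proof -
  obtain B where B: "B \<subseteq> D" "fn.independent B" "D \<subseteq> fn.span B" "card B = fn.dim D" using fn.basis_exists by blast
  obtain E where E: "finite E" "Rn n \<subseteq> fn.span E" using Rn_finite_span by blast
  have "finite B" using fn.independent_span_bound[OF E(1) B(2)] B(1) assms(1) E(2) by auto
  then consider "B = {}" | b where "B = {b}" using B(4) assms(2)
    by (metis One_nat_def card_0_eq card_1_singletonE le_Suc_eq le_zero_eq)
  then show thesis
  proof cases
    case 1
    then have "D \<subseteq> {0}" using B(3) by simp
    then have "d = (\<lambda>i. 0 * 0)" if "d \<in> D" for d using that by (auto simp: zero_fun_def)
    then show thesis using that[of "\<lambda>i. 0"] by simp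
  next
    case 2
    then have "D \<subseteq> range (\<lambda>c i. c * b i)" using B(3) fn.span_singleton by auto
    then show thesis using that[of b] by auto
  qed
qed

lemma common_denominator: "\<exists>N>0::int. \<forall>i<n::nat. \<exists>m::int. of_int N * r i = (of_int m :: rat)"
proof (induction n)
  case 0 show ?case by (rule exI[of _ 1]) simp
next
  case (Suc n)
  then obtain N where N: "N > 0" "\<forall>i<n. \<exists>m::int. of_int N * r i = (of_int m :: rat)" by blast
  obtain a b where ab: "quotient_of (r n) = (a, b)" by force
  then have b: "b > 0" "r n = of_int a / of_int b" using quotient_of_denom_pos quotient_of_div by auto
  have "\<exists>m::int. of_int (N * b) * r i = (of_int m :: rat)" if i: "i < Suc n" for i
  proof (cases "i = n")
    case True
    have "of_int (N * b) * r i = (of_int (N * a) :: rat)" using b True by simp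
    then show ?thesis by blast
  next
    case False
    then obtain m :: int where "of_int N * r i = (of_int m :: rat)" using N(2) i less_antisym by blast
    then have "of_int (N * b) * r i = (of_int (m * b) :: rat)" by (simp add: mult_ac)
    then show ?thesis by blast
  qed
  then show ?case using N b by (intro exI[of _ "N * b"]) auto
qed

lemma closed_interval_from_zero:
  assumes "closed J" "is_interval J" "(0::real) \<in> J"
  obtains l where "0 \<le> l" "J \<inter> {0..} = icc 0 l"
proof (cases "bdd_above J")
  case True
  have S: "Sup J \<in> J" using closed_contains_Sup[of J] assms True by auto
  have "0 \<le> Sup J" using assms True by (intro cSup_upper)
  moreover have "J \<inter> {0..} = icc 0 (ereal (Sup J))"
  proof (intro equalityI subsetI)
    fix t assume "t \<in> J \<inter> {0..}"
    then show "t \<in> icc 0 (ereal (Sup J))" using True by (auto simp: icc_def intro: cSup_upper)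
  next
    fix t assume "t \<in> icc 0 (ereal (Sup J))"
    then have t: "0 \<le> t" "t \<le> Sup J" by (auto simp: icc_def)
    then have "t \<in> J" using S assms(2,3) unfolding is_interval_1 by blast
    then show "t \<in> J \<inter> {0..}" using t by simp
  qed
  ultimately show thesis using that[of "ereal (Sup J)"] by auto
next
  case False
  have "J \<inter> {0..} = icc 0 \<infinity>"
  proof (intro equalityI subsetI)
    fix t assume "t \<in> icc 0 \<infinity>"
    then have "0 \<le> t" by (simp add: icc_def)
    obtain s where "s \<in> J" "s > t" using False unfolding bdd_above_def by (meson not_le)
    then have "t \<in> J" using assms(2,3) \<open>0 \<le> t\<close> less_imp_le unfolding is_interval_1 by blast
    then show "t \<in> J \<inter> {0..}" using \<open>0 \<le> t\<close> by simp
  qed (auto simp: icc_def)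
  then show thesis using that[of \<infinity>] by simp
qed

text \<open>Let \<open>z\<close> be the midpoint of two distinct points of \<open>P\<close>. The
  defining inequalities that are not constant along the line through these points are strict at
  \<open>z\<close>, so in every direction that solves the remaining, rational, equations one can
  move a little from \<open>z\<close> within \<open>P\<close>. A functional on the reals that is
  linear over the rationals produces a nonzero rational solution. As \<open>P\<close> has dimension
  one, this is the direction of the line, and \<open>P\<close> is a closed interval on it.\<close>

lemma polyhedral_seg_union:
  assumes P: "rational_polyhedral n P" and dim: "polyhedral_dim P \<le> 1"
  shows "seg_union n P"
proof (cases "\<exists>x\<in>P. \<exists>y\<in>P. x \<noteq> y")
  case False
  obtain k :: nat and A :: "nat \<Rightarrow> nat \<Rightarrow> rat" and b where Pd:
    "P = {x \<in> Rn n. \<forall>j<k. (\<Sum>i<n. real_of_rat (A j i) * x i) \<ge> b j}" using P unfolding rational_polyhedral_def by blast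
  consider "P = {}" | x where "P = {x}" using False by (metis is_singletonI' is_singleton_def)
  then show ?thesis
  proof cases
    case 2 then show ?thesis using seg_union_point[of x n] Pd by auto
  qed (auto intro: seg_union_empty)
next
  case True
  then obtain x y where xy: "x \<in> P" "y \<in> P" "x \<noteq> y" by blast
  obtain k :: nat and A :: "nat \<Rightarrow> nat \<Rightarrow> rat" and b where Pd:
    "P = {x \<in> Rn n. \<forall>j<k. (\<Sum>i<n. real_of_rat (A j i) * x i) \<ge> b j}" using P unfolding rational_polyhedral_def by blast
  define L where "L j x = (\<Sum>i<n. real_of_rat (A j i) * x i)" for j and x :: "nat \<Rightarrow> real"
  have PL: "x \<in> P \<longleftrightarrow> x \<in> Rn n \<and> (\<forall>j<k. L j x \<ge> b j)" for x unfolding Pd L_def by auto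
  have L_lin: "L j (\<lambda>i. x i + t * z i) = L j x + t * L j z" for j t and x z :: "nat \<Rightarrow> real"
    unfolding L_def by (simp add: algebra_simps sum.distrib sum_distrib_left)
  define D where "D = {x - y | x y. x \<in> P \<and> y \<in> P}"
  have "D \<subseteq> Rn n" unfolding D_def using PL by (auto simp: Rn_iff)
  moreover have "fn.dim D \<le> 1"
  proof -
    have "P \<noteq> {}" using xy by auto
    then show ?thesis using dim unfolding polyhedral_dim_def D_def by simp
  qed
  ultimately obtain b0 where b0: "\<And>d. d \<in> D \<Longrightarrow> \<exists>c. d = (\<lambda>i. c * b0 i)" using dim_le_1_line by blast
  define u where "u = (\<lambda>i. y i - x i)"
  have "u \<in> D" unfolding D_def u_def using xy by (auto simp: fun_eq_iff)
  then obtain c0 where c0: "u = (\<lambda>i. c0 * b0 i)" using b0 by blast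
  obtain i0 where i0: "u i0 \<noteq> 0" using xy(3) unfolding u_def by (metis eq_iff_diff_eq_0 ext)
  then have "c0 \<noteq> 0" using c0 by auto
  have uD: "\<exists>c. d = (\<lambda>i. c * u i)" if dD: "d \<in> D" for d
  proof -
    obtain c where "d = (\<lambda>i. c * b0 i)" using b0[OF dD] by blast
    then have "d = (\<lambda>i. (c / c0) * u i)" using c0 \<open>c0 \<noteq> 0\<close> by auto
    then show ?thesis by blast
  qed
  have uR: "u i = 0" if "i \<ge> n" for i using xy PL that unfolding u_def Rn_iff by simp
  then have i0n: "i0 < n" using i0 by (meson not_le)
  define z where "z = (\<lambda>i. x i + (1/2) * u i)"
  have zR: "z \<in> Rn n" using xy PL uR unfolding z_def Rn_iff by simp
  have Lz: "L j z = L j x / 2 + L j y / 2" for j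
    unfolding L_def z_def u_def by (simp add: sum.distrib[symmetric] sum_divide_distrib algebra_simps) (intro sum.cong, auto simp: field_simps)
  have Lu: "L j y = L j x + L j u" for j
    unfolding L_def u_def by (simp add: sum.distrib[symmetric] algebra_simps)
  have zP: "z \<in> P"
  proof -
    have "b j \<le> L j z" if "j < k" for j
    proof -
      have "b j \<le> L j x" "b j \<le> L j y" using xy PL that by auto
      then show ?thesis unfolding Lz by linarith
    qed
    then show ?thesis using PL zR by blast
  qed
  have strict: "L j z > b j" if "j < k" "L j u \<noteq> 0" for j
  proof -
    have "b j \<le> L j x" "b j \<le> L j y" "L j x \<noteq> L j y" using xy PL that Lu by auto
    then show ?thesis unfolding Lz by linarith
  qed
  \<comment> \<open>The functional is normalized so that the resulting rational vector \<open>r\<close> is nonzero.\<close>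
  obtain \<phi> :: "real \<Rightarrow> rat" where \<phi>: "\<And>a b. \<phi> (a + b) = \<phi> a + \<phi> b" "\<And>q a. \<phi> (of_rat q * a) = q * \<phi> a" "\<phi> (u i0) = 1"
    using rat_linear_functional[OF i0] by blast
  have \<phi>0: "\<phi> 0 = 0" using \<phi>(1)[of 0 0] by simp
  define r where "r i = \<phi> (u i)" for i
  have \<phi>s: "\<phi> (\<Sum>i\<in>I. of_rat (A j i) * u i) = (\<Sum>i\<in>I. A j i * r i)" if "finite I" for I j
    using that by (induction I rule: finite_induct) (auto simp: \<phi> \<phi>0 r_def)
  have Lr: "L j (\<lambda>i. real_of_rat (r i)) = 0" if "L j u = 0" for j
  proof -
    have "(\<Sum>i<n. A j i * r i) = 0" using \<phi>s[of "{..<n}" j] that \<phi>0 unfolding L_def by simp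
    then have "real_of_rat (\<Sum>i<n. A j i * r i) = 0" by simp
    then show ?thesis unfolding L_def by (simp add: of_rat_sum of_rat_mult)
  qed
  have "\<forall>\<^sub>F \<epsilon> in at_right 0. L j (\<lambda>i. z i + \<epsilon> * real_of_rat (r i)) \<ge> b j" if "j < k" for j
  proof (cases "L j u = 0")
    case True
    then show ?thesis using Lr[OF True] zP PL that unfolding L_lin by simp
  next
    case False
    have "((\<lambda>\<epsilon>. L j z + \<epsilon> * L j (\<lambda>i. real_of_rat (r i))) \<longlongrightarrow> L j z + 0 * L j (\<lambda>i. real_of_rat (r i))) (at_right 0)"
      by (intro tendsto_intros)
    then have "\<forall>\<^sub>F \<epsilon> in at_right 0. b j < L j z + \<epsilon> * L j (\<lambda>i. real_of_rat (r i))"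
      using order_tendstoD(1) strict[OF that False] by force
    then show ?thesis unfolding L_lin by (rule eventually_mono) simp
  qed
  then have "\<forall>\<^sub>F \<epsilon> in at_right 0. \<forall>j\<in>{..<k}. L j (\<lambda>i. z i + \<epsilon> * real_of_rat (r i)) \<ge> b j"
    by (intro eventually_ball_finite) auto
  moreover have "\<forall>\<^sub>F \<epsilon> in at_right (0::real). \<epsilon> > 0" by (simp add: eventually_at_right_less)
  ultimately have "\<forall>\<^sub>F \<epsilon> in at_right 0. \<epsilon> > 0 \<and> (\<forall>j\<in>{..<k}. L j (\<lambda>i. z i + \<epsilon> * real_of_rat (r i)) \<ge> b j)"
    by (simp add: eventually_conj_iff)
  then obtain \<epsilon> where \<epsilon>: "\<epsilon> > 0" "\<forall>j<k. L j (\<lambda>i. z i + \<epsilon> * real_of_rat (r i)) \<ge> b j"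
    using eventually_happens'[OF trivial_limit_at_right_real] by (metis (no_types, lifting) lessThan_iff)
  have rR: "r i = 0" if "i \<ge> n" for i using uR[OF that] \<phi>0 unfolding r_def by simp
  have "(\<lambda>i. z i + \<epsilon> * real_of_rat (r i)) \<in> P"
    using PL \<epsilon> zR rR by (auto simp: Rn_iff)
  then have "(\<lambda>i. z i + \<epsilon> * real_of_rat (r i)) - z \<in> D" unfolding D_def using zP by blast
  then obtain c1 where c1: "(\<lambda>i. \<epsilon> * real_of_rat (r i)) = (\<lambda>i. c1 * u i)" using uD[of "(\<lambda>i. z i + \<epsilon> * real_of_rat (r i)) - z"]
    by (auto simp: fun_eq_iff)
  have "r i0 = 1" using \<phi>(3) by (simp add: r_def)
  then have c1i: "\<epsilon> = c1 * u i0" using c1 by (auto dest: fun_cong[of _ _ i0])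
  then have "c1 \<noteq> 0" using \<epsilon> by auto
  obtain N where N: "N > (0::int)" "\<forall>i<n. \<exists>m::int. of_int N * r i = (of_int m :: rat)" using common_denominator by blast
  have "\<exists>m::int. of_int N * r i = (of_int m :: rat)" for i
    using N(2) rR by (cases "i < n") (auto intro: exI[of _ 0])
  then obtain v where v: "\<And>i. of_int N * r i = (of_int (v i) :: rat)" by metis
  have v': "real_of_int (v i) = real_of_int N * real_of_rat (r i)" for i
    using v[of i] by (metis of_rat_mult of_rat_of_int_eq)
  have vR: "\<forall>i\<ge>n. v i = 0" using v rR by (metis mult_zero_right of_int_eq_0_iff)
  have u: "u i = (\<epsilon> / (c1 * N)) * real_of_int (v i)" for i
    using fun_cong[OF c1, of i] \<open>c1 \<noteq> 0\<close> N unfolding v' by (simp add: field_simps)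
  have Pz: "\<exists>t. x = pt z v t" if "x \<in> P" for x
  proof -
    have "x - z \<in> D" unfolding D_def using zP that by blast
    then obtain c where "x - z = (\<lambda>i. c * u i)" using uD by blast
    then have "x i - z i = c * u i" for i by (metis minus_apply)
    then have "x = pt z v (c * (\<epsilon> / (c1 * N)))" unfolding pt_def u by (auto simp: fun_eq_iff algebra_simps)
    then show ?thesis by blast
  qed
  define J where "J = {t. pt z v t \<in> P}"
  have J: "J = (\<Inter>j\<in>{..<k}. {t. L j z + t * L j (\<lambda>i. real_of_int (v i)) \<ge> b j})"
    unfolding J_def PL using pt_Rn[OF zR vR] by (auto simp: pt_def L_lin)
  have J0: "0 \<in> J" unfolding J_def using zP by (simp add: pt_def)
  have clJ: "closed J" unfolding J by (intro closed_INT ballI closed_Collect_le continuous_intros)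
  have half: "is_interval {t. b j \<le> L j z + t * L j (\<lambda>i. real_of_int (v i))}" for j
    using is_interval_half(1)[of "L j (\<lambda>i. real_of_int (v i))" "L j z - b j"]
    by (rule back_subst[of is_interval]) (auto simp: algebra_simps)
  have iJ: "is_interval J"
  proof -
    have "s \<in> J" if "s1 \<in> J" "s2 \<in> J" "s1 \<le> s" "s \<le> s2" for s1 s2 s
      using that half unfolding J is_interval_1 by blast
    then show ?thesis unfolding is_interval_1 by blast
  qed
  obtain l1 where l1: "0 \<le> l1" "J \<inter> {0..} = icc 0 l1" using closed_interval_from_zero[OF clJ iJ J0] by blast
  have "closed (uminus ` J)" "is_interval (uminus ` J)" "0 \<in> uminus ` J"
    using clJ iJ J0 by (auto simp: closed_negations is_interval_neg_translationI)
  then obtain l2 where l2: "0 \<le> l2" "uminus ` J \<inter> {0..} = icc 0 l2" using closed_interval_from_zero by blast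
  have neg: "pt z (\<lambda>i. - v i) t = pt z v (- t)" for t by (simp add: pt_def)
  have "P = pt z v ` icc 0 l1 \<union> pt z (\<lambda>i. - v i) ` icc 0 l2"
  proof (intro equalityI subsetI)
    fix x assume x: "x \<in> P"
    then obtain t where t: "x = pt z v t" using Pz by blast
    then have tJ: "t \<in> J" using x J_def by simp
    show "x \<in> pt z v ` icc 0 l1 \<union> pt z (\<lambda>i. - v i) ` icc 0 l2"
    proof (cases "0 \<le> t")
      case True
      then have "t \<in> icc 0 l1" using tJ l1(2) by blast
      then show ?thesis using t by blast
    next
      case False
      then have "- t \<in> uminus ` J \<inter> {0..}" using tJ by auto
      then have "- t \<in> icc 0 l2" unfolding l2(2) .
      moreover have "x = pt z (\<lambda>i. - v i) (- t)" using t neg by simp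
      ultimately show ?thesis by blast
    qed
  next
    fix x assume "x \<in> pt z v ` icc 0 l1 \<union> pt z (\<lambda>i. - v i) ` icc 0 l2"
    then consider t where "t \<in> icc 0 l1" "x = pt z v t" | t where "t \<in> icc 0 l2" "x = pt z v (- t)" using neg by auto
    then show "x \<in> P"
    proof cases
      case 1 then show ?thesis using l1(2) unfolding J_def by blast
    next
      case 2
      then have "t \<in> uminus ` J" using l2(2) by blast
      then have "- t \<in> J" by auto
      then show ?thesis using 2 unfolding J_def by simp
    qed
  qed
  moreover have "seg_union n (pt z v ` icc 0 l1)" using seg_union_interval[OF zR vR] l1(1) by (simp add: zero_ereal_def)
  moreover have "seg_union n (pt z (\<lambda>i. - v i) ` icc 0 l2)" using seg_union_interval[OF zR, of "\<lambda>i. - v i"] vR l2(1) by (simp add: zero_ereal_def)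
  ultimately show ?thesis using seg_union_Un by simp
qed

lemma has_dim_imp_seg_union:
  assumes "has_dim n V 0 \<or> has_dim n V 1" shows "seg_union n V" "V \<noteq> {}"
proof -
  obtain d where d: "has_dim n V d" "0 \<le> d" "d \<le> 1" using assms by auto
  obtain \<P> where P: "finite \<P>" "\<forall>P\<in>\<P>. rational_polyhedral n P" "V = \<Union>\<P>" "d = Max (insert (-1) (polyhedral_dim ` \<P>))"
    using d(1) unfolding has_dim_def by blast
  have "polyhedral_dim P \<le> 1" if "P \<in> \<P>" for P
  proof -
    have "polyhedral_dim P \<le> d" unfolding P(4) by (rule Max_ge) (use that P in auto)
    then show ?thesis using d by simp
  qed
  then have "seg_union n (\<Union>P\<in>\<P>. P)" using P by (intro seg_union_UN) (auto intro: polyhedral_seg_union)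
  then show "seg_union n V" using P by simp
  have "d \<in> insert (-1) (polyhedral_dim ` \<P>)" unfolding P(4) by (rule Max_in) (use P in auto)
  then obtain P' where "P' \<in> \<P>" "polyhedral_dim P' = d" using d by auto
  then show "V \<noteq> {}" using P(3) d unfolding polyhedral_dim_def by (auto split: if_splits)
qed

lemma rational_polyhedral_finite:
  fixes C :: "((nat \<Rightarrow> rat) \<times> real) set"
  assumes "finite C" "P = {x \<in> Rn n. \<forall>(a, b)\<in>C. (\<Sum>i<n. real_of_rat (a i) * x i) \<ge> b}"
  shows "rational_polyhedral n P"
proof -
  obtain cs where cs: "set cs = C" using assms(1) finite_list by blast
  have "P = {x \<in> Rn n. \<forall>j<length cs. (\<Sum>i<n. real_of_rat (fst (cs ! j) i) * x i) \<ge> snd (cs ! j)}"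
    unfolding assms(2) cs[symmetric] by (auto simp: all_set_conv_all_nth case_prod_unfold)
  then show ?thesis unfolding rational_polyhedral_def
    by (intro exI[of _ "length cs"] exI[of _ "\<lambda>j. fst (cs ! j)"] exI[of _ "\<lambda>j. snd (cs ! j)"])
qed

lemma seg_pts_iff:
  assumes "seg_ok n s" "x \<in> Rn n"
  shows "x \<in> seg_pts s \<longleftrightarrow> 0 \<le> seg_coord n s x \<and> (sl s = \<infinity> \<or> seg_coord n s x \<le> real_of_ereal (sl s)) \<and>
    (\<forall>i<n. x i - sp s i - real_of_int (sv s i) * seg_coord n s x = 0)"
proof -
  define S where "S = seg_coord n s x"
  define a where "a = max 0 (- S)"
  define b where "b = (if sl s = \<infinity> then 0 else max 0 (S - real_of_ereal (sl s)))"
  define c where "c = (\<Sum>i<n. \<bar>x i - sp s i - real_of_int (sv s i) * S\<bar>)"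
  have "0 \<le> a" "0 \<le> b" "0 \<le> c" unfolding a_def b_def c_def by (auto intro: sum_nonneg)
  then have "a + b + c = 0 \<longleftrightarrow> a = 0 \<and> b = 0 \<and> c = 0" by linarith
  moreover have "a = 0 \<longleftrightarrow> 0 \<le> S" unfolding a_def by auto
  moreover have "b = 0 \<longleftrightarrow> sl s = \<infinity> \<or> S \<le> real_of_ereal (sl s)" unfolding b_def by auto
  moreover have "c = 0 \<longleftrightarrow> (\<forall>i<n. x i - sp s i - real_of_int (sv s i) * S = 0)"
    unfolding c_def by (subst sum_nonneg_eq_0_iff) auto
  moreover have "seg_dist n s x = a + b + c" unfolding seg_dist_def a_def b_def c_def S_def by simp
  ultimately show ?thesis using seg_dist_zero_iff[OF assms] unfolding S_def by metis
qed

lemma seg_rational_polyhedral: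
  assumes s: "seg_ok n s" shows "rational_polyhedral n (seg_pts s)"
proof -
  define wp where "wp = (\<Sum>i<n. real_of_int (sw s i) * sp s i)"
  have S: "seg_coord n s x = (\<Sum>i<n. real_of_int (sw s i) * x i) - wp" for x
    unfolding seg_coord_def wp_def by (simp add: algebra_simps sum_subtractf)
  define e :: "nat \<Rightarrow> nat \<Rightarrow> rat" where "e i j = (if j = i then 1 else 0) - of_int (sv s i * sw s j)" for i j
  define c where "c i = sp s i - real_of_int (sv s i) * wp" for i
  have e: "(\<Sum>j<n. real_of_rat (e i j) * x j) = x i - real_of_int (sv s i) * (seg_coord n s x + wp)" if "i < n" for i x
  proof -
    have "(\<Sum>j<n. real_of_rat (e i j) * x j) = (\<Sum>j<n. (if j = i then x j else 0) - real_of_int (sv s i) * (real_of_int (sw s j) * x j))"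
      unfolding e_def by (intro sum.cong) (auto simp: of_rat_diff of_rat_mult algebra_simps)
    then show ?thesis using that unfolding S by (simp add: sum_subtractf sum_distrib_left)
  qed
  define C where "C = {(\<lambda>i. of_int (sw s i), wp)} \<union> (if sl s = \<infinity> then {} else {(\<lambda>i. - of_int (sw s i), - wp - real_of_ereal (sl s))})
     \<union> (\<lambda>i. (e i, c i)) ` {..<n} \<union> (\<lambda>i. (\<lambda>j. - e i j, - c i)) ` {..<n}"
  have "(\<forall>(a, b)\<in>C. (\<Sum>i<n. real_of_rat (a i) * x i) \<ge> b) \<longleftrightarrow> 0 \<le> seg_coord n s x \<and> (sl s = \<infinity> \<or> seg_coord n s x \<le> real_of_ereal (sl s)) \<and>
    (\<forall>i<n. x i - sp s i - real_of_int (sv s i) * seg_coord n s x = 0)" (is "?L \<longleftrightarrow> ?R") for x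
  proof -
    have "?L \<longleftrightarrow> wp \<le> (\<Sum>i<n. real_of_int (sw s i) * x i) \<and> (sl s = \<infinity> \<or> - wp - real_of_ereal (sl s) \<le> - (\<Sum>i<n. real_of_int (sw s i) * x i))
      \<and> (\<forall>i<n. c i \<le> (\<Sum>j<n. real_of_rat (e i j) * x j)) \<and> (\<forall>i<n. - c i \<le> - (\<Sum>j<n. real_of_rat (e i j) * x j))"
      unfolding C_def ball_Un by (auto simp: of_rat_minus sum_negf)
    also have "\<dots> \<longleftrightarrow> ?R"
    proof -
      have "(c i \<le> (\<Sum>j<n. real_of_rat (e i j) * x j) \<and> - c i \<le> - (\<Sum>j<n. real_of_rat (e i j) * x j)) \<longleftrightarrow>
         x i - sp s i - real_of_int (sv s i) * seg_coord n s x = 0" if "i < n" for i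
        unfolding e[OF that] c_def by (auto simp: algebra_simps)
      then have 1: "(\<forall>i<n. c i \<le> (\<Sum>j<n. real_of_rat (e i j) * x j)) \<and> (\<forall>i<n. - c i \<le> - (\<Sum>j<n. real_of_rat (e i j) * x j))
        \<longleftrightarrow> (\<forall>i<n. x i - sp s i - real_of_int (sv s i) * seg_coord n s x = 0)" by blast
      have 2: "wp \<le> (\<Sum>i<n. real_of_int (sw s i) * x i) \<longleftrightarrow> 0 \<le> seg_coord n s x"
        "- wp - real_of_ereal (sl s) \<le> - (\<Sum>i<n. real_of_int (sw s i) * x i) \<longleftrightarrow> seg_coord n s x \<le> real_of_ereal (sl s)"
        unfolding S by linarith+
      show ?thesis unfolding 1 2 ..
    qed
    finally show ?thesis .
  qed
  then have "seg_pts s = {x \<in> Rn n. \<forall>(a, b)\<in>C. (\<Sum>i<n. real_of_rat (a i) * x i) \<ge> b}"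
    using seg_pts_iff[OF s] seg_pts_Rn[OF s] by blast
  moreover have "finite C" unfolding C_def by simp
  ultimately show ?thesis using rational_polyhedral_finite by blast
qed

lemma seg_polyhedral_dim:
  assumes s: "seg_ok n s" shows "polyhedral_dim (seg_pts s) \<in> {0, 1}"
proof -
  let ?v = "\<lambda>i. real_of_int (sv s i)"
  have "{x - y | x y. x \<in> seg_pts s \<and> y \<in> seg_pts s} \<subseteq> fn.span {?v}"
  proof
    fix d assume "d \<in> {x - y | x y. x \<in> seg_pts s \<and> y \<in> seg_pts s}"
    then obtain t t' where "d = pt (sp s) (sv s) t - pt (sp s) (sv s) t'" unfolding seg_pts_def by blast
    then have "d = (\<lambda>i. (t - t') * ?v i)" by (auto simp: pt_def fun_eq_iff algebra_simps)
    then show "d \<in> fn.span {?v}" using fn.span_singleton by auto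
  qed
  then have "fn.dim {x - y | x y. x \<in> seg_pts s \<and> y \<in> seg_pts s} \<le> 1" using fn.dim_le_card[of _ "{?v}"] by simp
  moreover have "seg_pts s \<noteq> {}" using sp_in_seg[OF s] by auto
  ultimately show ?thesis unfolding polyhedral_dim_def by auto
qed

lemma seg_union_has_dim:
  assumes "seg_union n V" "V \<noteq> {}" shows "has_dim n V 0 \<or> has_dim n V 1"
proof -
  obtain \<S> where S: "finite \<S>" "\<forall>s\<in>\<S>. seg_ok n s" "V = \<Union>(seg_pts ` \<S>)" using assms unfolding seg_union_def by blast
  let ?D = "insert (-1) (polyhedral_dim ` seg_pts ` \<S>)"
  have d: "has_dim n V (Max ?D)" unfolding has_dim_def
    by (rule exI[of _ "seg_pts ` \<S>"]) (use S seg_rational_polyhedral in auto)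
  obtain s where s: "s \<in> \<S>" using S assms by auto
  have sub: "?D \<subseteq> {-1, 0, 1}" using S seg_polyhedral_dim by fastforce
  have "Max ?D \<in> ?D" by (rule Max_in) (use S in auto)
  moreover have "polyhedral_dim (seg_pts s) \<le> Max ?D" by (rule Max_ge) (use S s in auto)
  moreover have "0 \<le> polyhedral_dim (seg_pts s)" using seg_polyhedral_dim S s by fastforce
  ultimately have "Max ?D = 0 \<or> Max ?D = 1" using sub by (smt (verit) insertE singletonD subset_iff)
  then show ?thesis using d by metis
qed

text \<open>The dimension condition turns the variety into a nonempty union of segments; for such a
  set finite generation and the condition on the dimension hold automatically.\<close>

lemma four_conditions_iff:
  "four_conditions n \<psi> \<longleftrightarrow>
    (\<exists>V. seg_union n V \<and> V \<noteq> {} \<and> connectedin (Euclidean_space n) V \<and> Ker (trop_rat n) \<psi> = cong_of n V)"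
proof
  assume "four_conditions n \<psi>"
  then show "\<exists>V. seg_union n V \<and> V \<noteq> {} \<and> connectedin (Euclidean_space n) V \<and> Ker (trop_rat n) \<psi> = cong_of n V"
    unfolding four_conditions_def Let_def using has_dim_imp_seg_union by metis
next
  assume "\<exists>V. seg_union n V \<and> V \<noteq> {} \<and> connectedin (Euclidean_space n) V \<and> Ker (trop_rat n) \<psi> = cong_of n V"
  then obtain V where V: "seg_union n V" "V \<noteq> {}" "connectedin (Euclidean_space n) V" "Ker (trop_rat n) \<psi> = cong_of n V" by blast
  show "four_conditions n \<psi>" unfolding four_conditions_def Let_def V(4) variety_cong_of[OF V(1,2)]
    using V fin_gen_seg_union seg_union_has_dim by blast
qed

section \<open>Piecewise linear images of unions of segments\<close>

text \<open>Between the break points of all its coordinates the path runs on a line with integral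
  direction.\<close>

lemma path_common_breaks:
  fixes \<gamma> :: "real \<Rightarrow> nat \<Rightarrow> real"
  assumes "\<And>i. i < m \<Longrightarrow> pwa (\<lambda>t. \<gamma> t i) (icc 0 l)" "\<And>i. i < m \<Longrightarrow> continuous_on (icc 0 l) (\<lambda>t. \<gamma> t i)"
    and "\<And>t. \<gamma> t \<in> Rn m"
  obtains B where "finite B"
    "\<And>a b. \<lbrakk>0 \<le> a; ereal a < b; b \<le> l; ioo a b \<inter> B = {}\<rbrakk> \<Longrightarrow>
      \<exists>q z. q \<in> Rn m \<and> (\<forall>i\<ge>m. z i = 0) \<and> (\<forall>t\<in>icc a b. \<gamma> t = pt q z t)"
proof -
  have "\<exists>B. finite B \<and> (\<forall>a b. 0 \<le> a \<longrightarrow> ereal a < b \<longrightarrow> b \<le> l \<longrightarrow> ioo a b \<inter> B = {} \<longrightarrow>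
    (\<exists>(k::int) c. \<forall>t\<in>icc a b. \<gamma> t i = of_int k * t + c))" if "i < m" for i
    by (rule pwa_cont_breaks[OF assms(1)[OF that] assms(2)[OF that]]) blast
  then obtain B where B: "\<And>i. i < m \<Longrightarrow> finite (B i)"
    "\<And>i a b. i < m \<Longrightarrow> 0 \<le> a \<Longrightarrow> ereal a < b \<Longrightarrow> b \<le> l \<Longrightarrow> ioo a b \<inter> B i = {} \<Longrightarrow>
       \<exists>(k::int) c. \<forall>t\<in>icc a b. \<gamma> t i = of_int k * t + c" by metis
  have "\<exists>q z. q \<in> Rn m \<and> (\<forall>i\<ge>m. z i = 0) \<and> (\<forall>t\<in>icc a b. \<gamma> t = pt q z t)"
    if ab: "0 \<le> a" "ereal a < b" "b \<le> l" "ioo a b \<inter> (\<Union>i<m. B i) = {}" for a b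
  proof -
    have "\<exists>(k::int) c. \<forall>t\<in>icc a b. \<gamma> t i = of_int k * t + c" if "i < m" for i
      by (rule B(2)[OF that ab(1-3)]) (use ab(4) that in blast)
    then obtain k :: "nat \<Rightarrow> int" and c where kc: "\<And>i t. i < m \<Longrightarrow> t \<in> icc a b \<Longrightarrow> \<gamma> t i = of_int (k i) * t + c i" by metis
    have "\<gamma> t = pt (\<lambda>i. if i < m then c i else 0) (\<lambda>i. if i < m then k i else 0) t" if "t \<in> icc a b" for t
      using kc[OF _ that] assms(3)[of t] by (auto simp: pt_def fun_eq_iff Rn_iff)
    then show ?thesis
      by (intro exI[of _ "\<lambda>i. if i < m then c i else 0"] exI[of _ "\<lambda>i. if i < m then k i else 0"]) (auto simp: Rn_iff)
  qed
  then show thesis using that[of "\<Union>i<m. B i"] B(1) by blast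
qed

lemma seg_union_path_image:
  fixes \<gamma> :: "real \<Rightarrow> nat \<Rightarrow> real"
  assumes "\<And>i. i < m \<Longrightarrow> pwa (\<lambda>t. \<gamma> t i) (icc 0 l)" "\<And>i. i < m \<Longrightarrow> continuous_on (icc 0 l) (\<lambda>t. \<gamma> t i)"
    and "\<And>t. \<gamma> t \<in> Rn m" "0 \<le> l"
  shows "seg_union m (\<gamma> ` icc 0 l)"
proof (cases "l = 0")
  case True
  then show ?thesis using seg_union_point[OF assms(3)] by (simp add: icc_zero_zero)
next
  case False
  then have l: "0 < l" using assms by auto
  obtain B where B: "finite B"
    "\<And>a b. \<lbrakk>0 \<le> a; ereal a < b; b \<le> l; ioo a b \<inter> B = {}\<rbrakk> \<Longrightarrow>
      \<exists>q z. q \<in> Rn m \<and> (\<forall>i\<ge>m. z i = 0) \<and> (\<forall>t\<in>icc a b. \<gamma> t = pt q z t)"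
    using path_common_breaks[OF assms(1,2,3)] by blast
  have "\<gamma> ` icc 0 l = (\<Union>p\<in>pieces B l. \<gamma> ` icc (fst p) (snd p))"
  proof (intro equalityI subsetI)
    fix x assume "x \<in> \<gamma> ` icc 0 l"
    then obtain t where t: "t \<in> icc 0 l" "x = \<gamma> t" by auto
    obtain a b where "(a, b) \<in> pieces B l" "t \<in> icc a b" using pieces_cover[OF B(1) l t(1)] by blast
    then show "x \<in> (\<Union>p\<in>pieces B l. \<gamma> ` icc (fst p) (snd p))" using t by force
  next
    fix x assume "x \<in> (\<Union>p\<in>pieces B l. \<gamma> ` icc (fst p) (snd p))"
    then obtain a b where ab: "(a, b) \<in> pieces B l" "x \<in> \<gamma> ` icc a b" by auto
    then show "x \<in> \<gamma> ` icc 0 l" using piecesD[OF ab(1) l] icc_mono by blast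
  qed
  moreover have "seg_union m (\<gamma> ` icc (fst p) (snd p))" if "p \<in> pieces B l" for p
  proof -
    obtain a b where p: "p = (a, b)" by force
    note ab = piecesD[OF that[unfolded p] l]
    obtain q z where qz: "q \<in> Rn m" "\<forall>i\<ge>m. z i = 0" "\<forall>t\<in>icc a b. \<gamma> t = pt q z t" using B(2)[OF ab] by blast
    then have "\<gamma> ` icc a b = pt q z ` icc a b" by auto
    then show ?thesis using seg_union_interval[OF qz(1,2)] ab(2) p by (simp add: order.strict_implies_order)
  qed
  ultimately show ?thesis using seg_union_UN[OF finite_pieces[OF B(1)]] by simp
qed

lemma seg_union_PL_image:
  assumes V: "seg_union n V" and F: "\<And>i. i < m \<Longrightarrow> (\<lambda>x. F x i) \<in> PL n" "\<And>x. F x \<in> Rn m"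
  shows "seg_union m (F ` V)"
proof -
  obtain \<S> where S: "finite \<S>" "\<forall>s\<in>\<S>. seg_ok n s" "V = \<Union>(seg_pts ` \<S>)" using V unfolding seg_union_def by blast
  have "seg_union m (F ` seg_pts s)" if "s \<in> \<S>" for s
  proof -
    let ?\<gamma> = "pt (sp s) (sv s)"
    have \<gamma>: "pwa (\<lambda>t. ?\<gamma> t i) (icc 0 (sl s))" "continuous_on (icc 0 (sl s)) (\<lambda>t. ?\<gamma> t i)" for i
      unfolding pt_def by (rule pwa_affine[where m="sv s i" and c="sp s i"], simp, simp) (intro continuous_intros)
    have "seg_union m ((\<lambda>t. F (?\<gamma> t)) ` icc 0 (sl s))"
    proof (rule seg_union_path_image)
      fix i assume i: "i < m"
      show "pwa (\<lambda>t. F (?\<gamma> t) i) (icc 0 (sl s))" by (rule PL_pwa[OF F(1)[OF i] is_interval_icc \<gamma>(1)])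
      show "continuous_on (icc 0 (sl s)) (\<lambda>t. F (?\<gamma> t) i)" by (rule PL_continuous_on[OF F(1)[OF i] \<gamma>(2)])
    qed (use F S(2) that in \<open>auto simp: seg_ok_def\<close>)
    then show ?thesis unfolding seg_pts_def image_image .
  qed
  moreover have "F ` V = (\<Union>s\<in>\<S>. F ` seg_pts s)" using S(3) by auto
  ultimately show ?thesis using seg_union_UN[OF S(1)] by simp
qed

section \<open>Homomorphisms\<close>

lemma T_algebra_homD:
  assumes "h \<in> T_algebra_hom R \<iota>R S \<iota>S"
  shows "x \<in> carrier R \<Longrightarrow> h x \<in> carrier S"
    "x \<in> carrier R \<Longrightarrow> y \<in> carrier R \<Longrightarrow> h (x \<otimes>\<^bsub>R\<^esub> y) = h x \<otimes>\<^bsub>S\<^esub> h y"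
    "x \<in> carrier R \<Longrightarrow> y \<in> carrier R \<Longrightarrow> h (x \<oplus>\<^bsub>R\<^esub> y) = h x \<oplus>\<^bsub>S\<^esub> h y"
    "h \<one>\<^bsub>R\<^esub> = \<one>\<^bsub>S\<^esub>" "h \<zero>\<^bsub>R\<^esub> = \<zero>\<^bsub>S\<^esub>"
    "a \<noteq> \<infinity> \<Longrightarrow> h (\<iota>R a) = \<iota>S a"
  using assms unfolding T_algebra_hom_def semiring_hom_def ring_hom_def trop_def by auto

lemma T_algebra_homI:
  assumes "\<And>x. x \<in> carrier R \<Longrightarrow> h x \<in> carrier S"
    "\<And>x y. x \<in> carrier R \<Longrightarrow> y \<in> carrier R \<Longrightarrow> h (x \<otimes>\<^bsub>R\<^esub> y) = h x \<otimes>\<^bsub>S\<^esub> h y"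
    "\<And>x y. x \<in> carrier R \<Longrightarrow> y \<in> carrier R \<Longrightarrow> h (x \<oplus>\<^bsub>R\<^esub> y) = h x \<oplus>\<^bsub>S\<^esub> h y"
    "h \<one>\<^bsub>R\<^esub> = \<one>\<^bsub>S\<^esub>" "h \<zero>\<^bsub>R\<^esub> = \<zero>\<^bsub>S\<^esub>"
    "\<And>a. a \<noteq> \<infinity> \<Longrightarrow> h (\<iota>R a) = \<iota>S a"
  shows "h \<in> T_algebra_hom R \<iota>R S \<iota>S"
  using assms unfolding T_algebra_hom_def semiring_hom_def ring_hom_def trop_def by auto

lemma emb_carrier: "f \<in> PL n \<Longrightarrow> emb n f \<in> carrier (trop_rat n)" by (simp add: carrier_trop_rat)
lemma neginf_carrier: "neginf n \<in> carrier (trop_rat n)" by (simp add: carrier_trop_rat)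

text \<open>Both sides are homomorphisms that agree on constants and on the coordinate functions,
  and multiplicative inverses in \<open>S\<close> are unique.\<close>

lemma hom_factorization:
  assumes S: "T_algebra S \<iota>"
    and \<psi>: "\<psi> \<in> T_algebra_hom (trop_rat n) (trop_rat_const n) S \<iota>"
    and \<phi>: "\<phi> \<in> T_algebra_hom (trop_rat m) (trop_rat_const m) S \<iota>"
    and F: "\<And>i. i < m \<Longrightarrow> (\<lambda>x. F x i) \<in> PL n"
    and eq: "\<And>i. i < m \<Longrightarrow> \<phi> (emb m (\<lambda>x. x i)) = \<psi> (emb n (\<lambda>x. F x i))"
    and h: "h \<in> PL m"
  shows "\<phi> (emb m h) = \<psi> (emb n (\<lambda>x. h (F x)))"
  using h
proof (induction rule: PL.induct)
  case (PL_const c)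
  show ?case
    using T_algebra_homD(6)[OF \<phi>, of "ereal c"] T_algebra_homD(6)[OF \<psi>, of "ereal c"] by (simp add: trop_rat_const_simps)
next
  case (PL_coord i) then show ?case using eq by simp
next
  case (PL_add f g)
  note PL_subst[OF PL_add(1) F] PL_subst[OF PL_add(2) F]
  with PL_add show ?case
    using T_algebra_homD(2)[OF \<phi>, of "emb m f" "emb m g"]
      T_algebra_homD(2)[OF \<psi>, of "emb n (\<lambda>x. f (F x))" "emb n (\<lambda>x. g (F x))"]
    by (simp add: trop_rat_simps emb_carrier)
next
  case (PL_max f g)
  note PL_subst[OF PL_max(1) F] PL_subst[OF PL_max(2) F]
  with PL_max show ?case
    using T_algebra_homD(3)[OF \<phi>, of "emb m f" "emb m g"]
      T_algebra_homD(3)[OF \<psi>, of "emb n (\<lambda>x. f (F x))" "emb n (\<lambda>x. g (F x))"]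
    by (simp add: trop_rat_simps emb_carrier)
next
  case (PL_neg f)
  interpret comm_monoid S using S unfolding T_algebra_def comm_semiring_def by auto
  have f': "(\<lambda>x. f (F x)) \<in> PL n" by (rule PL_subst[OF PL_neg(1) F])
  have 1: "\<phi> (emb m (\<lambda>x. - f x)) \<otimes>\<^bsub>S\<^esub> \<phi> (emb m f) = \<one>\<^bsub>S\<^esub>"
    using T_algebra_homD(2)[OF \<phi>, of "emb m (\<lambda>x. - f x)" "emb m f"] T_algebra_homD(4)[OF \<phi>] PL_neg PL.PL_neg[of f m]
    by (simp add: trop_rat_simps emb_carrier)
  have 2: "\<phi> (emb m f) \<otimes>\<^bsub>S\<^esub> \<psi> (emb n (\<lambda>x. - f (F x))) = \<one>\<^bsub>S\<^esub>"
    using T_algebra_homD(2)[OF \<psi>, of "emb n (\<lambda>x. f (F x))" "emb n (\<lambda>x. - f (F x))"] T_algebra_homD(4)[OF \<psi>]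
      PL.PL_neg[OF f'] PL_neg f'
    by (simp add: trop_rat_simps emb_carrier)
  show ?case
    by (rule inv_unique[OF 1 2])
      (use PL_neg f' in \<open>simp_all add: T_algebra_homD(1)[OF \<phi>] T_algebra_homD(1)[OF \<psi>] PL.PL_neg emb_carrier\<close>)
qed

text \<open>The homomorphism \<open>\<phi>\<close> factors through \<open>\<psi>\<close> by
  substitution of a piecewise linear map \<open>F\<close>, so its kernel consists of the pairs of
  functions that agree on \<open>F ` V\<close>.\<close>

lemma hom_four_conditions:
  assumes S: "T_algebra S \<iota>"
    and \<psi>: "\<psi> \<in> T_algebra_surj (trop_rat n) (trop_rat_const n) S \<iota>"
    and four: "four_conditions n \<psi>"
    and \<phi>: "\<phi> \<in> T_algebra_hom (trop_rat m) (trop_rat_const m) S \<iota>"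
  shows "four_conditions m \<phi>"
proof -
  obtain V where V: "seg_union n V" "V \<noteq> {}" "connectedin (Euclidean_space n) V" "Ker (trop_rat n) \<psi> = cong_of n V"
    using four unfolding four_conditions_iff by blast
  have \<psi>h: "\<psi> \<in> T_algebra_hom (trop_rat n) (trop_rat_const n) S \<iota>" and \<psi>s: "\<psi> ` carrier (trop_rat n) = carrier S"
    using \<psi> unfolding T_algebra_surj_def by auto
  interpret semiring S using S unfolding T_algebra_def comm_semiring_def by auto
  obtain w where w: "w \<in> V" using V by auto
  have VR: "V \<subseteq> Rn n" using seg_union_Rn V by blast
  have \<psi>eq: "\<psi> f = \<psi> g \<longleftrightarrow> (\<forall>x\<in>V. f x = g x)" if "f \<in> carrier (trop_rat n)" "g \<in> carrier (trop_rat n)" for f g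
    using V(4) that unfolding Ker_def cong_of_def by blast
  \<comment> \<open>As \<open>V\<close> is nonempty, \<open>S\<close> is not trivial, so the lift of an invertible element is not \<open>-\<infinity>\<close>.\<close>
  have nontriv: "\<psi> (emb n f) \<noteq> \<zero>\<^bsub>S\<^esub>" if "f \<in> PL n" for f
    using \<psi>eq[OF emb_carrier[OF that] neginf_carrier] T_algebra_homD(5)[OF \<psi>h] w VR
    by (auto simp: trop_rat_simps emb_def subsetD)
  have "\<exists>f. f \<in> PL n \<and> \<phi> (emb m (\<lambda>x. x i)) = \<psi> (emb n f)" if i: "i < m" for i
  proof -
    have c: "emb m (\<lambda>x. x i) \<in> carrier (trop_rat m)" "emb m (\<lambda>x. - x i) \<in> carrier (trop_rat m)"
      using PL_coord[OF i] PL_neg[OF PL_coord[OF i]] by (auto intro: emb_carrier)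
    have "\<phi> (emb m (\<lambda>x. x i)) \<in> \<psi> ` carrier (trop_rat n)" using \<psi>s T_algebra_homD(1)[OF \<phi> c(1)] by simp
    then obtain f where f: "f \<in> carrier (trop_rat n)" "\<phi> (emb m (\<lambda>x. x i)) = \<psi> f" by auto
    show ?thesis
    proof (rule trop_rat_cases[OF f(1)])
      assume "f = neginf n"
      then have "\<phi> (emb m (\<lambda>x. x i)) = \<zero>\<^bsub>S\<^esub>" using f T_algebra_homD(5)[OF \<psi>h] by (simp add: trop_rat_simps)
      then have "\<one>\<^bsub>S\<^esub> = \<zero>\<^bsub>S\<^esub> \<otimes>\<^bsub>S\<^esub> \<phi> (emb m (\<lambda>x. - x i))"
        using T_algebra_homD(2)[OF \<phi> c] T_algebra_homD(4)[OF \<phi>] by (simp add: trop_rat_simps)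
      then have "\<one>\<^bsub>S\<^esub> = \<zero>\<^bsub>S\<^esub>" using T_algebra_homD(1)[OF \<phi> c(2)] by simp
      moreover have "\<psi> (emb n (\<lambda>x. 0)) = \<one>\<^bsub>S\<^esub>" using T_algebra_homD(4)[OF \<psi>h] by (simp add: trop_rat_simps)
      ultimately show ?thesis using nontriv[OF PL_const] by metis
    next
      fix a assume "a \<in> PL n" "f = emb n a"
      then show ?thesis using f by blast
    qed
  qed
  then obtain f where f: "\<And>i. i < m \<Longrightarrow> f i \<in> PL n" "\<And>i. i < m \<Longrightarrow> \<phi> (emb m (\<lambda>x. x i)) = \<psi> (emb n (f i))" by metis
  define F where "F x = (\<lambda>i. if i < m then f i x else 0)" for x
  have F: "(\<lambda>x. F x i) \<in> PL n" if "i < m" for i using f(1)[OF that] that by (simp add: F_def)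
  have FR: "F x \<in> Rn m" for x by (simp add: F_def Rn_iff)
  have \<phi>F: "\<phi> (emb m h) = \<psi> (emb n (\<lambda>x. h (F x)))" if "h \<in> PL m" for h
    by (rule hom_factorization[OF S \<psi>h \<phi> F _ that]) (use f(2) in \<open>auto simp: F_def\<close>)
  have \<phi>0: "\<phi> (neginf m) = \<zero>\<^bsub>S\<^esub>" using T_algebra_homD(5)[OF \<phi>] by (simp add: trop_rat_simps)
  have \<phi>nontriv: "\<phi> (emb m h) \<noteq> \<zero>\<^bsub>S\<^esub>" if "h \<in> PL m" for h
    using \<phi>F[OF that] nontriv[OF PL_subst[OF that F]] by simp
  have key: "\<phi> h = \<phi> k \<longleftrightarrow> (\<forall>x\<in>F ` V. h x = k x)" if h: "h \<in> carrier (trop_rat m)" and k: "k \<in> carrier (trop_rat m)" for h k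
  proof (rule trop_rat_cases[OF h]; rule trop_rat_cases[OF k])
    fix a assume "h = neginf m" "a \<in> PL m" "k = emb m a"
    then show ?thesis using \<phi>0 \<phi>nontriv[of a] w FR by (auto simp: emb_def)
  next
    fix a assume "k = neginf m" "a \<in> PL m" "h = emb m a"
    then show ?thesis using \<phi>0 \<phi>nontriv[of a] w FR by (auto simp: emb_def)
  next
    fix a b assume ab: "a \<in> PL m" "h = emb m a" "b \<in> PL m" "k = emb m b"
    have "\<phi> h = \<phi> k \<longleftrightarrow> (\<forall>x\<in>V. emb n (\<lambda>x. a (F x)) x = emb n (\<lambda>x. b (F x)) x)"
      using \<phi>F ab \<psi>eq[OF emb_carrier[OF PL_subst[OF ab(1) F]] emb_carrier[OF PL_subst[OF ab(3) F]]] by simp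
    also have "\<dots> \<longleftrightarrow> (\<forall>x\<in>F ` V. h x = k x)" using VR FR ab by (auto simp: emb_def subsetD)
    finally show ?thesis .
  qed auto
  then have "Ker (trop_rat m) \<phi> = cong_of m (F ` V)" unfolding Ker_def cong_of_def by blast
  moreover have "seg_union m (F ` V)" by (rule seg_union_PL_image[OF V(1) F FR])
  moreover have "continuous_map (Euclidean_space n) (Euclidean_space m) F"
    by (rule continuous_map_into_Euclidean_space) (use F FR PL_continuous_map in auto)
  then have "connectedin (Euclidean_space m) (F ` V)" using V(3) connectedin_continuous_map_image by blast
  ultimately show ?thesis unfolding four_conditions_iff using V(2) by blast
qed

lemma surj_comp_iso:
  assumes \<kappa>: "\<kappa> \<in> T_algebra_surj R \<iota>R A \<iota>A" and \<theta>: "\<theta> \<in> T_algebra_iso A \<iota>A S \<iota>"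
    and c: "\<And>a. a \<noteq> \<infinity> \<Longrightarrow> \<iota>R a \<in> carrier R"
  shows "\<theta> \<circ> \<kappa> \<in> T_algebra_surj R \<iota>R S \<iota>" "Ker R (\<theta> \<circ> \<kappa>) = Ker R \<kappa>"
proof -
  have \<kappa>h: "\<kappa> \<in> T_algebra_hom R \<iota>R A \<iota>A" and \<kappa>s: "\<kappa> ` carrier R = carrier A" using \<kappa> unfolding T_algebra_surj_def by auto
  have \<theta>h: "\<theta> \<in> T_algebra_hom A \<iota>A S \<iota>" and \<theta>b: "bij_betw \<theta> (carrier A) (carrier S)" using \<theta> unfolding T_algebra_iso_def by auto
  have "\<theta> \<circ> \<kappa> \<in> T_algebra_hom R \<iota>R S \<iota>"
    by (rule T_algebra_homI) (auto simp: T_algebra_homD[OF \<kappa>h] T_algebra_homD[OF \<theta>h])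
  moreover have "(\<theta> \<circ> \<kappa>) ` carrier R = carrier S" using \<kappa>s \<theta>b unfolding bij_betw_def by (metis image_comp)
  ultimately show "\<theta> \<circ> \<kappa> \<in> T_algebra_surj R \<iota>R S \<iota>" unfolding T_algebra_surj_def by blast
  show "Ker R (\<theta> \<circ> \<kappa>) = Ker R \<kappa>"
    using \<theta>b T_algebra_homD(1)[OF \<kappa>h] unfolding Ker_def bij_betw_def inj_on_def by auto
qed

lemma same_kernel_iso:
  assumes \<kappa>: "\<kappa> \<in> T_algebra_surj R \<iota>R A \<iota>A" and \<psi>: "\<psi> \<in> T_algebra_surj R \<iota>R S \<iota>"
    and ker: "Ker R \<kappa> = Ker R \<psi>"
    and cl: "\<And>x y. x \<in> carrier R \<Longrightarrow> y \<in> carrier R \<Longrightarrow> x \<otimes>\<^bsub>R\<^esub> y \<in> carrier R \<and> x \<oplus>\<^bsub>R\<^esub> y \<in> carrier R"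
      "\<one>\<^bsub>R\<^esub> \<in> carrier R" "\<zero>\<^bsub>R\<^esub> \<in> carrier R" "\<And>a. a \<noteq> \<infinity> \<Longrightarrow> \<iota>R a \<in> carrier R"
  shows "T_algebra_iso A \<iota>A S \<iota> \<noteq> {}"
proof -
  have \<kappa>h: "\<kappa> \<in> T_algebra_hom R \<iota>R A \<iota>A" and \<kappa>s: "\<kappa> ` carrier R = carrier A" using \<kappa> unfolding T_algebra_surj_def by auto
  have \<psi>h: "\<psi> \<in> T_algebra_hom R \<iota>R S \<iota>" and \<psi>s: "\<psi> ` carrier R = carrier S" using \<psi> unfolding T_algebra_surj_def by auto
  have eq: "\<kappa> x = \<kappa> y \<longleftrightarrow> \<psi> x = \<psi> y" if "x \<in> carrier R" "y \<in> carrier R" for x y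
    using ker that unfolding Ker_def by blast
  define r where "r a = (SOME x. x \<in> carrier R \<and> \<kappa> x = a)" for a
  have r: "r a \<in> carrier R \<and> \<kappa> (r a) = a" if "a \<in> carrier A" for a
    unfolding r_def by (rule someI_ex) (use that \<kappa>s[symmetric] in auto)
  define \<theta> where "\<theta> a = \<psi> (r a)" for a
  have \<theta>: "\<theta> (\<kappa> x) = \<psi> x" if "x \<in> carrier R" for x
    using r[of "\<kappa> x"] eq that T_algebra_homD(1)[OF \<kappa>h] unfolding \<theta>_def by blast
  have "\<theta> \<in> T_algebra_hom A \<iota>A S \<iota>"
  proof (rule T_algebra_homI)
    show "\<theta> x \<in> carrier S" if "x \<in> carrier A" for x using r[OF that] T_algebra_homD(1)[OF \<psi>h] unfolding \<theta>_def by blast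
    fix a b assume ab: "a \<in> carrier A" "b \<in> carrier A"
    obtain x y where xy: "x \<in> carrier R" "a = \<kappa> x" "y \<in> carrier R" "b = \<kappa> y" using \<kappa>s ab by blast
    show "\<theta> (a \<otimes>\<^bsub>A\<^esub> b) = \<theta> a \<otimes>\<^bsub>S\<^esub> \<theta> b" using \<theta>[of "x \<otimes>\<^bsub>R\<^esub> y"] \<theta> xy cl T_algebra_homD(2)[OF \<kappa>h] T_algebra_homD(2)[OF \<psi>h] by simp
    show "\<theta> (a \<oplus>\<^bsub>A\<^esub> b) = \<theta> a \<oplus>\<^bsub>S\<^esub> \<theta> b" using \<theta>[of "x \<oplus>\<^bsub>R\<^esub> y"] \<theta> xy cl T_algebra_homD(3)[OF \<kappa>h] T_algebra_homD(3)[OF \<psi>h] by simp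
  next
    show "\<theta> \<one>\<^bsub>A\<^esub> = \<one>\<^bsub>S\<^esub>" using \<theta>[OF cl(2)] T_algebra_homD(4)[OF \<kappa>h] T_algebra_homD(4)[OF \<psi>h] by simp
    show "\<theta> \<zero>\<^bsub>A\<^esub> = \<zero>\<^bsub>S\<^esub>" using \<theta>[OF cl(3)] T_algebra_homD(5)[OF \<kappa>h] T_algebra_homD(5)[OF \<psi>h] by simp
    show "\<theta> (\<iota>A a) = \<iota> a" if "a \<noteq> \<infinity>" for a
      using \<theta>[OF cl(4)[OF that]] T_algebra_homD(6)[OF \<kappa>h that] T_algebra_homD(6)[OF \<psi>h that] by simp
  qed
  moreover have "bij_betw \<theta> (carrier A) (carrier S)" unfolding bij_betw_def
  proof
    show "inj_on \<theta> (carrier A)" unfolding inj_on_def \<theta>_def using r eq by metis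
    show "\<theta> ` carrier A = carrier S" using \<theta> \<kappa>s \<psi>s by (metis (no_types, lifting) image_cong image_image)
  qed
  ultimately show ?thesis unfolding T_algebra_iso_def by blast
qed

section \<open>Points and topology of a tropical curve\<close>

abbreviation ep :: "curve \<Rightarrow> nat \<Rightarrow> real \<Rightarrow> point" where
  "ep \<Gamma> e t \<equiv> edge_point \<Gamma> e (ereal t)"

abbreviation carcs :: "curve \<Rightarrow> nat set" where "carcs \<Gamma> \<equiv> arcs (fst \<Gamma>)"
abbreviation len :: "curve \<Rightarrow> nat \<Rightarrow> ereal" where "len \<Gamma> \<equiv> snd \<Gamma>"
abbreviation ctail :: "curve \<Rightarrow> nat \<Rightarrow> nat" where "ctail \<Gamma> \<equiv> tail (fst \<Gamma>)"
abbreviation chead :: "curve \<Rightarrow> nat \<Rightarrow> nat" where "chead \<Gamma> \<equiv> head (fst \<Gamma>)"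
abbreviation cverts :: "curve \<Rightarrow> nat set" where "cverts \<Gamma> \<equiv> verts (fst \<Gamma>)"

lemma curveD:
  assumes "is_curve \<Gamma>"
  shows "fin_digraph (fst \<Gamma>)" "Digraph_Component.connected (fst \<Gamma>)"
    "e \<in> carcs \<Gamma> \<Longrightarrow> 0 < len \<Gamma> e"
    "e \<in> carcs \<Gamma> \<Longrightarrow> ctail \<Gamma> e \<in> cverts \<Gamma>" "e \<in> carcs \<Gamma> \<Longrightarrow> chead \<Gamma> e \<in> cverts \<Gamma>"
    "finite (carcs \<Gamma>)" "finite (cverts \<Gamma>)" "cverts \<Gamma> \<noteq> {}"
    "e \<in> carcs \<Gamma> \<Longrightarrow> len \<Gamma> e = \<infinity> \<Longrightarrow> chead \<Gamma> e \<noteq> ctail \<Gamma> e"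
    "e \<in> carcs \<Gamma> \<Longrightarrow> len \<Gamma> e = \<infinity> \<Longrightarrow> e' \<in> carcs \<Gamma> \<Longrightarrow> chead \<Gamma> e \<noteq> ctail \<Gamma> e'"
    "e \<in> carcs \<Gamma> \<Longrightarrow> len \<Gamma> e = \<infinity> \<Longrightarrow> e' \<in> carcs \<Gamma> \<Longrightarrow> chead \<Gamma> e = chead \<Gamma> e' \<Longrightarrow> e' = e"
proof -
  show fd: "fin_digraph (fst \<Gamma>)" and c: "Digraph_Component.connected (fst \<Gamma>)"
    using assms unfolding is_curve_def by (auto simp: case_prod_unfold)
  interpret fin_digraph "fst \<Gamma>" by (rule fd)
  show "e \<in> carcs \<Gamma> \<Longrightarrow> ctail \<Gamma> e \<in> cverts \<Gamma>" "e \<in> carcs \<Gamma> \<Longrightarrow> chead \<Gamma> e \<in> cverts \<Gamma>"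
    "finite (carcs \<Gamma>)" "finite (cverts \<Gamma>)" by auto
  show "cverts \<Gamma> \<noteq> {}" using c unfolding connected_conv by auto
  show "e \<in> carcs \<Gamma> \<Longrightarrow> 0 < len \<Gamma> e"
    "e \<in> carcs \<Gamma> \<Longrightarrow> len \<Gamma> e = \<infinity> \<Longrightarrow> chead \<Gamma> e \<noteq> ctail \<Gamma> e"
    "e \<in> carcs \<Gamma> \<Longrightarrow> len \<Gamma> e = \<infinity> \<Longrightarrow> e' \<in> carcs \<Gamma> \<Longrightarrow> chead \<Gamma> e \<noteq> ctail \<Gamma> e'"
    "e \<in> carcs \<Gamma> \<Longrightarrow> len \<Gamma> e = \<infinity> \<Longrightarrow> e' \<in> carcs \<Gamma> \<Longrightarrow> chead \<Gamma> e = chead \<Gamma> e' \<Longrightarrow> e' = e"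
    using assms unfolding is_curve_def case_prod_unfold by metis+
qed

lemma points_eq: "points \<Gamma> = Vert ` cverts \<Gamma> \<union> {Inner e t | e t. e \<in> carcs \<Gamma> \<and> 0 < t \<and> ereal t < len \<Gamma> e}"
  unfolding points_def by (simp add: case_prod_unfold)

lemma infinite_points_eq: "infinite_points \<Gamma> = {Vert (chead \<Gamma> e) | e. e \<in> carcs \<Gamma> \<and> len \<Gamma> e = \<infinity>}"
  unfolding infinite_points_def by (simp add: case_prod_unfold)

lemma edge_point_eq: "edge_point \<Gamma> e t = (if t = 0 then Vert (ctail \<Gamma> e)
     else if t = len \<Gamma> e then Vert (chead \<Gamma> e) else Inner e (real_of_ereal t))"
  unfolding edge_point_def by (simp add: case_prod_unfold)

lemma ep_simps [simp]:
  "ep \<Gamma> e 0 = Vert (ctail \<Gamma> e)" "edge_point \<Gamma> e 0 = Vert (ctail \<Gamma> e)"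
  "0 < t \<Longrightarrow> ereal t < len \<Gamma> e \<Longrightarrow> ep \<Gamma> e t = Inner e t"
  "len \<Gamma> e = \<infinity> \<Longrightarrow> 0 < t \<Longrightarrow> ep \<Gamma> e t = Inner e t"
  "len \<Gamma> e = ereal L \<Longrightarrow> L \<noteq> 0 \<Longrightarrow> ep \<Gamma> e L = Vert (chead \<Gamma> e)"
  "len \<Gamma> e = \<infinity> \<Longrightarrow> edge_point \<Gamma> e \<infinity> = Vert (chead \<Gamma> e)"
  by (auto simp: edge_point_eq zero_ereal_def)

lemma edge_point_in_points:
  assumes "is_curve \<Gamma>" "e \<in> carcs \<Gamma>" "t \<in> {0..len \<Gamma> e}"
  shows "edge_point \<Gamma> e t \<in> points \<Gamma>"
proof -
  consider "t = 0" | "t = len \<Gamma> e" | "0 < t" "t < len \<Gamma> e" using assms(3) by fastforce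
  then show ?thesis
  proof cases
    case 3
    then obtain r where "t = ereal r" by (cases t) auto
    then show ?thesis using 3 assms(2) by (auto simp: points_eq edge_point_eq)
  qed (use curveD[OF assms(1)] assms(2) in \<open>auto simp: points_eq edge_point_eq\<close>)
qed

lemma finite_pointsD:
  assumes "is_curve \<Gamma>" "x \<in> finite_points \<Gamma>"
  obtains v where "x = Vert v" "v \<in> cverts \<Gamma>" "\<And>e. e \<in> carcs \<Gamma> \<Longrightarrow> len \<Gamma> e = \<infinity> \<Longrightarrow> v \<noteq> chead \<Gamma> e"
  | e t where "x = Inner e t" "e \<in> carcs \<Gamma>" "0 < t" "ereal t < len \<Gamma> e"
  using assms unfolding finite_points_def points_eq infinite_points_eq by blast

lemma Vert_finite_point:
  "v \<in> cverts \<Gamma> \<Longrightarrow> (\<And>e. e \<in> carcs \<Gamma> \<Longrightarrow> len \<Gamma> e = \<infinity> \<Longrightarrow> v \<noteq> chead \<Gamma> e) \<Longrightarrow> Vert v \<in> finite_points \<Gamma>"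
  unfolding finite_points_def points_eq infinite_points_eq by blast

lemma Inner_finite_point:
  "e \<in> carcs \<Gamma> \<Longrightarrow> 0 < t \<Longrightarrow> ereal t < len \<Gamma> e \<Longrightarrow> Inner e t \<in> finite_points \<Gamma>"
  unfolding finite_points_def points_eq infinite_points_eq by blast

lemma ep_finite_point:
  assumes "is_curve \<Gamma>" "e \<in> carcs \<Gamma>" "t \<in> icc 0 (len \<Gamma> e)"
  shows "ep \<Gamma> e t \<in> finite_points \<Gamma>"
proof -
  consider "t = 0" | "ereal t = len \<Gamma> e" "t \<noteq> 0" | "0 < t" "ereal t < len \<Gamma> e" using assms(3) unfolding icc_def by fastforce
  then show ?thesis
  proof cases
    case 1 then show ?thesis using Vert_finite_point[of "ctail \<Gamma> e" \<Gamma>] curveD[OF assms(1)] assms(2) by (metis ep_simps(1))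
  next
    case 2
    then have "len \<Gamma> e \<noteq> \<infinity>" by (metis PInfty_neq_ereal(1))
    then have "Vert (chead \<Gamma> e) \<in> finite_points \<Gamma>"
      using Vert_finite_point[of "chead \<Gamma> e" \<Gamma>] curveD[OF assms(1)] assms(2) by metis
    then show ?thesis using 2(2) by (simp add: edge_point_eq 2(1)[symmetric] zero_ereal_def)
  next
    case 3 then show ?thesis using Inner_finite_point assms(2) by simp
  qed
qed

lemma finite_points_subset: "finite_points \<Gamma> \<subseteq> points \<Gamma>" unfolding finite_points_def by auto

lemma finite_points_nonempty: assumes "is_curve \<Gamma>" shows "finite_points \<Gamma> \<noteq> {}"
proof (cases "\<exists>e. e \<in> carcs \<Gamma>")
  case True
  then obtain e where e: "e \<in> carcs \<Gamma>" by blast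
  have "0 \<in> icc 0 (len \<Gamma> e)" using curveD(3)[OF assms e] by (simp add: icc_def zero_ereal_def[symmetric])
  then show ?thesis using ep_finite_point[OF assms e] by blast
next
  case False
  obtain v where "v \<in> cverts \<Gamma>" using curveD(8)[OF assms] by blast
  then show ?thesis using Vert_finite_point[of v \<Gamma>] False by blast
qed

lemma infinite_pointD:
  assumes "x \<in> points \<Gamma>" "x \<notin> finite_points \<Gamma>"
  obtains e where "e \<in> carcs \<Gamma>" "len \<Gamma> e = \<infinity>" "x = Vert (chead \<Gamma> e)"
  using assms unfolding finite_points_def infinite_points_eq by blast

lemma head_infinite:
  assumes "e \<in> carcs \<Gamma>" "len \<Gamma> e = \<infinity>" shows "Vert (chead \<Gamma> e) \<notin> finite_points \<Gamma>"
  using assms unfolding finite_points_def infinite_points_eq by blast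

lemma openin_curve_top:
  "openin (curve_top \<Gamma>) U \<longleftrightarrow> U \<subseteq> points \<Gamma> \<and>
     (\<forall>e \<in> carcs \<Gamma>. openin (top_of_set {0..len \<Gamma> e}) {t \<in> {0..len \<Gamma> e}. edge_point \<Gamma> e t \<in> U})"
proof -
  define P where "P U \<longleftrightarrow> U \<subseteq> points \<Gamma> \<and>
     (\<forall>e \<in> carcs \<Gamma>. openin (top_of_set {0..len \<Gamma> e}) {t \<in> {0..len \<Gamma> e}. edge_point \<Gamma> e t \<in> U})" for U
  have "istopology P" unfolding istopology_def
  proof (intro conjI allI impI)
    fix S T assume ST: "P S" "P T"
    have "{t \<in> {0..len \<Gamma> e}. edge_point \<Gamma> e t \<in> S \<inter> T} =
      {t \<in> {0..len \<Gamma> e}. edge_point \<Gamma> e t \<in> S} \<inter> {t \<in> {0..len \<Gamma> e}. edge_point \<Gamma> e t \<in> T}" for e by blast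
    then show "P (S \<inter> T)" using ST unfolding P_def by (auto intro: openin_Int)
  next
    fix \<K> assume K: "\<forall>K\<in>\<K>. P K"
    have "{t \<in> {0..len \<Gamma> e}. edge_point \<Gamma> e t \<in> \<Union>\<K>} =
      \<Union>((\<lambda>K. {t \<in> {0..len \<Gamma> e}. edge_point \<Gamma> e t \<in> K}) ` \<K>)" for e by blast
    moreover have "openin (top_of_set {0..len \<Gamma> e}) (\<Union>((\<lambda>K. {t \<in> {0..len \<Gamma> e}. edge_point \<Gamma> e t \<in> K}) ` \<K>))"
      if "e \<in> carcs \<Gamma>" for e by (rule openin_Union) (use K that in \<open>auto simp: P_def\<close>)
    ultimately show "P (\<Union>\<K>)" using K unfolding P_def by auto
  qed
  moreover have "curve_top \<Gamma> = topology P"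
    unfolding curve_top_def P_def[abs_def] by (simp add: case_prod_unfold)
  ultimately show ?thesis using P_def by simp
qed

lemma topspace_curve_top:
  assumes "is_curve \<Gamma>" shows "topspace (curve_top \<Gamma>) = points \<Gamma>"
proof
  show "topspace (curve_top \<Gamma>) \<subseteq> points \<Gamma>" using openin_curve_top openin_topspace by blast
  have "{t \<in> {0..len \<Gamma> e}. edge_point \<Gamma> e t \<in> points \<Gamma>} = {0..len \<Gamma> e}" if "e \<in> carcs \<Gamma>" for e
    using edge_point_in_points[OF assms that] by blast
  then have "openin (curve_top \<Gamma>) (points \<Gamma>)" unfolding openin_curve_top by simp
  then show "points \<Gamma> \<subseteq> topspace (curve_top \<Gamma>)" by (rule openin_subset)
qed

lemma continuous_map_curve:
  fixes f :: "point \<Rightarrow> ereal"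
  assumes "is_curve \<Gamma>"
  shows "continuous_map (curve_top \<Gamma>) euclidean f \<longleftrightarrow> (\<forall>e\<in>carcs \<Gamma>. continuous_on {0..len \<Gamma> e} (\<lambda>t. f (edge_point \<Gamma> e t)))"
proof -
  have "{t \<in> {0..len \<Gamma> e}. edge_point \<Gamma> e t \<in> {x \<in> points \<Gamma>. f x \<in> U}} =
     {t \<in> {0..len \<Gamma> e}. f (edge_point \<Gamma> e t) \<in> U}" if "e \<in> carcs \<Gamma>" for e U
    using edge_point_in_points[OF assms that] by blast
  then show ?thesis
    unfolding continuous_map_def topspace_curve_top[OF assms] openin_curve_top
      continuous_map_iff_continuous[symmetric]
    by (simp add: Pi_iff) blast
qed

section \<open>Rational functions through their finite values\<close>

text \<open>A rational function is determined by its real values at the finite points; these values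
  are the objects to calculate with, as the operations on them are pointwise.\<close>

definition RFun :: "curve \<Rightarrow> (point \<Rightarrow> real) set" where
  "RFun \<Gamma> = {g. \<forall>e\<in>carcs \<Gamma>. pwa (\<lambda>t. g (ep \<Gamma> e t)) (icc 0 (len \<Gamma> e)) \<and>
     continuous_on (icc 0 (len \<Gamma> e)) (\<lambda>t. g (ep \<Gamma> e t))}"

text \<open>Near the point at infinity of an edge, \<open>u\<close> has slope
  \<open>m\<close>.\<close>

definition end_affine :: "(real \<Rightarrow> real) \<Rightarrow> int \<Rightarrow> real \<Rightarrow> bool" where
  "end_affine u m c \<longleftrightarrow> (\<exists>T. \<forall>t\<ge>T. u t = of_int m * t + c)"

lemma end_affine_unique:
  assumes "end_affine u m c" "end_affine u m' c'" shows "m = m' \<and> c = c'"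
proof -
  obtain T T' where "\<forall>t\<ge>T. u t = of_int m * t + c" "\<forall>t\<ge>T'. u t = of_int m' * t + c'"
    using assms unfolding end_affine_def by blast
  then have *: "of_int m * t + c = of_int m' * t + c'" if "t \<ge> max T T'" for t using that by (metis max.bounded_iff)
  have "of_int m * (max T T' + 1) + c = of_int m' * (max T T' + 1) + c'" "of_int m * max T T' + c = of_int m' * max T T' + c'"
    using *[of "max T T' + 1"] *[of "max T T'"] by auto
  then have "real_of_int m = of_int m'" by (simp add: algebra_simps)
  then show ?thesis using *[of "max T T'"] by simp
qed

lemma RFun_end_affine:
  assumes "is_curve \<Gamma>" "g \<in> RFun \<Gamma>" "e \<in> carcs \<Gamma>" "len \<Gamma> e = \<infinity>"
  shows "\<exists>m c. end_affine (\<lambda>t. g (ep \<Gamma> e t)) m c"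
proof -
  have g: "pwa (\<lambda>t. g (ep \<Gamma> e t)) (icc 0 \<infinity>)" "continuous_on (icc 0 \<infinity>) (\<lambda>t. g (ep \<Gamma> e t))"
    using assms(2-4) unfolding RFun_def by auto
  obtain B where B: "finite B"
    "\<And>a b. \<lbrakk>0 \<le> a; ereal a < b; b \<le> \<infinity>; ioo a b \<inter> B = {}\<rbrakk> \<Longrightarrow> \<exists>(m::int) c. \<forall>t\<in>icc a b. g (ep \<Gamma> e t) = of_int m * t + c"
    using pwa_cont_breaks[OF g] by blast
  define T where "T = Max (insert 0 B)"
  have "ioo T \<infinity> \<inter> B = {}"
  proof -
    have "b \<le> T" if "b \<in> B" for b unfolding T_def using B(1) that by auto
    then show ?thesis unfolding ioo_def by force
  qed
  moreover have "0 \<le> T" unfolding T_def using B(1) by auto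
  ultimately obtain m :: int and c where "\<forall>t\<in>icc T \<infinity>. g (ep \<Gamma> e t) = of_int m * t + c" using B(2)[of T \<infinity>] by auto
  then show ?thesis unfolding end_affine_def icc_def by auto
qed

definition slope :: "curve \<Rightarrow> (point \<Rightarrow> real) \<Rightarrow> nat \<Rightarrow> int" where
  "slope \<Gamma> g e = (THE m. \<exists>c. end_affine (\<lambda>t. g (ep \<Gamma> e t)) m c)"

text \<open>The limit of an eventually affine function; since \<open>0 * \<infinity> = 0\<close>,
  the formula is also right for slope 0.\<close>

definition end_value :: "(real \<Rightarrow> real) \<Rightarrow> ereal" where
  "end_value u = (THE y. \<exists>m c. end_affine u m c \<and> y = ereal (of_int m) * \<infinity> + ereal c)"

lemma slope_eqI: "end_affine (\<lambda>t. g (ep \<Gamma> e t)) m c \<Longrightarrow> slope \<Gamma> g e = m"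
  unfolding slope_def using end_affine_unique by blast

lemma end_value_eqI: "end_affine u m c \<Longrightarrow> end_value u = ereal (of_int m) * \<infinity> + ereal c"
  unfolding end_value_def using end_affine_unique by blast

definition ext :: "curve \<Rightarrow> (point \<Rightarrow> real) \<Rightarrow> point \<Rightarrow> ereal" where
  "ext \<Gamma> g = (\<lambda>x\<in>points \<Gamma>. if x \<in> finite_points \<Gamma> then ereal (g x)
     else end_value (\<lambda>t. g (ep \<Gamma> (THE e. e \<in> carcs \<Gamma> \<and> len \<Gamma> e = \<infinity> \<and> x = Vert (chead \<Gamma> e)) t)))"

lemma ext_finite: "x \<in> finite_points \<Gamma> \<Longrightarrow> ext \<Gamma> g x = ereal (g x)"
  unfolding ext_def using subsetD[OF finite_points_subset, of x \<Gamma>] by simp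

lemma ext_infinite:
  assumes "is_curve \<Gamma>" "e \<in> carcs \<Gamma>" "len \<Gamma> e = \<infinity>"
  shows "ext \<Gamma> g (Vert (chead \<Gamma> e)) = end_value (\<lambda>t. g (ep \<Gamma> e t))"
proof -
  have "(THE e'. e' \<in> carcs \<Gamma> \<and> len \<Gamma> e' = \<infinity> \<and> Vert (chead \<Gamma> e) = Vert (chead \<Gamma> e')) = e"
    by (rule the_equality) (use assms curveD(11)[OF assms(1)] in auto)
  moreover have "Vert (chead \<Gamma> e) \<in> points \<Gamma>" using assms curveD(5) by (auto simp: points_eq)
  ultimately show ?thesis using head_infinite[OF assms(2,3)] unfolding ext_def by simp
qed

lemma ext_cong:
  assumes "is_curve \<Gamma>" "\<And>x. x \<in> finite_points \<Gamma> \<Longrightarrow> g x = h x" shows "ext \<Gamma> g = ext \<Gamma> h"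
proof
  fix x
  show "ext \<Gamma> g x = ext \<Gamma> h x"
  proof (cases "x \<in> points \<Gamma> \<and> x \<notin> finite_points \<Gamma>")
    case True
    then obtain e where e: "e \<in> carcs \<Gamma>" "len \<Gamma> e = \<infinity>" "x = Vert (chead \<Gamma> e)" using infinite_pointD by blast
    have "g (ep \<Gamma> e t) = h (ep \<Gamma> e t)" if "t \<ge> 0" for t
      using assms(2) ep_finite_point[OF assms(1) e(1)] that e(2) by (simp add: icc_def)
    then have "end_affine (\<lambda>t. g (ep \<Gamma> e t)) m c \<longleftrightarrow> end_affine (\<lambda>t. h (ep \<Gamma> e t)) m c" for m c
      unfolding end_affine_def by (metis max.bounded_iff)
    then show ?thesis unfolding e(3) ext_infinite[OF assms(1) e(1,2)] end_value_def by simp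
  next
    case False
    then show ?thesis using assms(2) ext_finite unfolding ext_def by auto
  qed
qed

lemma ext_eq_iff:
  assumes "is_curve \<Gamma>" shows "ext \<Gamma> g = ext \<Gamma> h \<longleftrightarrow> (\<forall>x\<in>finite_points \<Gamma>. g x = h x)"
  using ext_cong[OF assms, of g h] ext_finite[of _ \<Gamma>] by (metis ereal.inject)

lemma continuous_on_ereal_compose:
  assumes "continuous_on (icc 0 (ereal L)) u"
  shows "continuous_on {0..ereal L} (\<lambda>s. ereal (u (real_of_ereal s)))"
proof -
  have fin: "s \<noteq> \<infinity> \<and> s \<noteq> -\<infinity>" if "s \<in> {0..ereal L}" for s using that by auto
  have "continuous_on {0..ereal L} real_of_ereal"
    by (rule continuous_on_subset[OF continuous_on_real]) (use fin in auto)
  moreover have "real_of_ereal ` {0..ereal L} \<subseteq> icc 0 (ereal L)"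
  proof
    fix r assume "r \<in> real_of_ereal ` {0..ereal L}"
    then obtain s where s: "s \<in> {0..ereal L}" "r = real_of_ereal s" by auto
    obtain r' where "s = ereal r'" by (cases s) (use fin[OF s(1)] in auto)
    then show "r \<in> icc 0 (ereal L)" using s by (auto simp: icc_def)
  qed
  ultimately have "continuous_on {0..ereal L} (\<lambda>s. u (real_of_ereal s))"
    using continuous_on_compose2[OF assms] by blast
  then show ?thesis by (rule continuous_on_ereal)
qed

lemma tendsto_add_const_ereal:
  assumes "(f \<longlongrightarrow> x) F" shows "((\<lambda>s. f s + ereal c) \<longlongrightarrow> x + ereal c) F"
  by (rule tendsto_add_ereal_general1) (use assms in auto)

text \<open>On an infinite edge the extension is continuous on a bounded part, like the given
  function, and on the remaining part it is an affine function on the extended reals.\<close>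

lemma ext_continuous_edge:
  assumes "is_curve \<Gamma>" "g \<in> RFun \<Gamma>" "e \<in> carcs \<Gamma>"
  shows "continuous_on {0..len \<Gamma> e} (\<lambda>t. ext \<Gamma> g (edge_point \<Gamma> e t))"
proof -
  let ?u = "\<lambda>t. g (ep \<Gamma> e t)"
  have cu: "continuous_on (icc 0 (len \<Gamma> e)) ?u" using assms(2,3) unfolding RFun_def by auto
  have fin: "ext \<Gamma> g (edge_point \<Gamma> e s) = ereal (?u (real_of_ereal s))" if s: "s \<in> {0..len \<Gamma> e}" "s \<noteq> \<infinity>" for s
  proof -
    obtain r where r: "s = ereal r" by (cases s) (use s in auto)
    then have "r \<in> icc 0 (len \<Gamma> e)" using s by (simp add: icc_def zero_ereal_def)
    then show ?thesis using ext_finite ep_finite_point[OF assms(1,3)] r by simp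
  qed
  show ?thesis
  proof (cases "len \<Gamma> e")
    case (real L)
    have "continuous_on {0..len \<Gamma> e} (\<lambda>s. ereal (?u (real_of_ereal s)))"
      using continuous_on_ereal_compose[of L ?u] cu real by simp
    then show ?thesis
    proof (rule continuous_on_eq)
      fix s assume s: "s \<in> {0..len \<Gamma> e}"
      then have "s \<noteq> \<infinity>" using real by auto
      then show "ereal (?u (real_of_ereal s)) = ext \<Gamma> g (edge_point \<Gamma> e s)" using fin[OF s] by simp
    qed
  next
    case PInf
    obtain m c where mc: "end_affine ?u m c" using RFun_end_affine[OF assms PInf] by blast
    then obtain T0 where T0: "\<forall>t\<ge>T0. ?u t = of_int m * t + c" unfolding end_affine_def by blast
    define T where "T = max 0 T0"
    have T: "\<forall>t\<ge>T. ?u t = of_int m * t + c" "0 \<le> T" using T0 unfolding T_def by auto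
    define w where "w s = ereal (of_int m) * s + ereal c" for s
    have cw: "continuous_on {ereal T..\<infinity>} w" unfolding w_def continuous_on_def
      by (intro ballI tendsto_add_const_ereal tendsto_cmult_ereal tendsto_ident_at) auto
    have cf: "continuous_on {0..ereal T} (\<lambda>s. ereal (?u (real_of_ereal s)))"
      by (rule continuous_on_ereal_compose[OF continuous_on_subset[OF cu]]) (auto simp: icc_def PInf)
    have eqw: "ext \<Gamma> g (edge_point \<Gamma> e s) = w s" if s: "s \<in> {ereal T..\<infinity>}" for s
    proof (cases "s = \<infinity>")
      case True
      then show ?thesis using ext_infinite[OF assms(1,3) PInf] end_value_eqI[OF mc] PInf by (simp add: w_def)
    next
      case False
      obtain r where r: "s = ereal r" "T \<le> r" by (cases s) (use False s in auto)
      have "0 \<le> s" using r T(2) by simp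
      then have "ext \<Gamma> g (edge_point \<Gamma> e s) = ereal (?u r)" using fin[of s] r PInf by simp
      then show ?thesis using T(1) r by (simp add: w_def)
    qed
    have "continuous_on ({0..ereal T} \<union> {ereal T..\<infinity>}) (\<lambda>s. ext \<Gamma> g (edge_point \<Gamma> e s))"
    proof (rule continuous_on_closed_Un)
      show "continuous_on {0..ereal T} (\<lambda>s. ext \<Gamma> g (edge_point \<Gamma> e s))"
      proof (rule continuous_on_eq[OF cf])
        fix s assume s: "s \<in> {0..ereal T}"
        then have "s \<noteq> \<infinity>" "s \<in> {0..len \<Gamma> e}" using PInf by auto
        then show "ereal (?u (real_of_ereal s)) = ext \<Gamma> g (edge_point \<Gamma> e s)" using fin by simp
      qed
      show "continuous_on {ereal T..\<infinity>} (\<lambda>s. ext \<Gamma> g (edge_point \<Gamma> e s))"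
        by (rule continuous_on_eq[OF cw]) (use eqw in auto)
    qed auto
    moreover have "{0..ereal T} \<union> {ereal T..\<infinity>} = {0..len \<Gamma> e}"
      unfolding PInf by (rule ivl_disj_un_two_touch(4)) (use T(2) in auto)
    ultimately show ?thesis by simp
  next
    case MInf
    then show ?thesis using curveD(3)[OF assms(1,3)] by auto
  qed
qed

lemma edge_piecewise_affine_iff:
  "edge_piecewise_affine \<Gamma> f e \<longleftrightarrow> (\<exists>\<I>. finite \<I> \<and> \<Union>\<I> = icc 0 (len \<Gamma> e) \<and>
     (\<forall>I\<in>\<I>. is_interval I \<and> (\<exists>(m::int) c. \<forall>t\<in>I. f (ep \<Gamma> e t) = ereal (of_int m * t + c))))"
  unfolding edge_piecewise_affine_def icc_def by simp

lemma ext_Rat: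
  assumes \<Gamma>: "is_curve \<Gamma>" and g: "g \<in> RFun \<Gamma>" shows "ext \<Gamma> g \<in> Rat_nonzero \<Gamma>"
  unfolding Rat_nonzero_def
proof (intro CollectI conjI ballI)
  show "ext \<Gamma> g \<in> extensional (points \<Gamma>)" unfolding ext_def by auto
  show "continuous_map (curve_top \<Gamma>) euclidean (ext \<Gamma> g)"
    unfolding continuous_map_curve[OF \<Gamma>] using ext_continuous_edge[OF \<Gamma> g] by blast
  show "ext \<Gamma> g x \<noteq> \<infinity>" "ext \<Gamma> g x \<noteq> - \<infinity>" if "x \<in> finite_points \<Gamma>" for x using ext_finite[OF that] by auto
  fix e assume e: "e \<in> carcs \<Gamma>"
  have "pwa (\<lambda>t. g (ep \<Gamma> e t)) (icc 0 (len \<Gamma> e))" using g e unfolding RFun_def by auto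
  then obtain \<I> where I: "finite \<I>" "\<Union>\<I> = icc 0 (len \<Gamma> e)"
    "\<forall>I\<in>\<I>. is_interval I \<and> (\<exists>(m::int) c. \<forall>t\<in>I. g (ep \<Gamma> e t) = of_int m * t + c)" unfolding pwa_def by blast
  have *: "ext \<Gamma> g (ep \<Gamma> e t) = ereal (g (ep \<Gamma> e t))" if "I \<in> \<I>" "t \<in> I" for I t
    using ext_finite ep_finite_point[OF \<Gamma> e] I(2) that by blast
  show "edge_piecewise_affine \<Gamma> (ext \<Gamma> g) e"
    unfolding edge_piecewise_affine_iff
  proof (intro exI[of _ \<I>] conjI ballI)
    fix I assume "I \<in> \<I>"
    then obtain m :: int and c where "\<forall>t\<in>I. g (ep \<Gamma> e t) = of_int m * t + c" using I(3) by blast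
    then show "\<exists>(m::int) c. \<forall>t\<in>I. ext \<Gamma> g (ep \<Gamma> e t) = ereal (of_int m * t + c)"
      using *[OF \<open>I \<in> \<I>\<close>] by (intro exI[of _ m] exI[of _ c]) simp
  qed (use I in auto)
qed

lemma continuous_on_extend_infinity:
  fixes F H :: "ereal \<Rightarrow> ereal"
  assumes "continuous_on {0..\<infinity>} F" "continuous_on {0..\<infinity>} H" "\<And>t. 0 \<le> t \<Longrightarrow> F (ereal t) = H (ereal t)"
  shows "F \<infinity> = H \<infinity>"
proof -
  have w: "at (\<infinity>::ereal) within {0..\<infinity>} = at_left \<infinity>" by (rule at_within_Icc_at_left) simp
  have "(F \<longlongrightarrow> F \<infinity>) (at_left \<infinity>)" "(H \<longlongrightarrow> H \<infinity>) (at_left \<infinity>)"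
    using assms(1,2) unfolding continuous_on_def w[symmetric] by auto
  then have "((\<lambda>t. F (ereal t)) \<longlongrightarrow> F \<infinity>) at_top" "((\<lambda>t. H (ereal t)) \<longlongrightarrow> H \<infinity>) at_top"
    unfolding at_left_PInf filterlim_filtermap by auto
  moreover have "\<forall>\<^sub>F t in at_top. F (ereal t) = H (ereal t)"
    using eventually_ge_at_top[of "0::real"] by (rule eventually_mono) (use assms(3) in auto)
  ultimately show ?thesis
    using tendsto_unique[of at_top] by (metis tendsto_cong trivial_limit_at_top_linorder)
qed

text \<open>Continuity leaves no choice for the values at infinity, because the points at infinity
  are limits of finite points.\<close>

lemma Rat_ext:
  assumes \<Gamma>: "is_curve \<Gamma>" and f: "f \<in> Rat_nonzero \<Gamma>"
  shows "(\<lambda>x. real_of_ereal (f x)) \<in> RFun \<Gamma>" "f = ext \<Gamma> (\<lambda>x. real_of_ereal (f x))"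
proof -
  let ?g = "\<lambda>x. real_of_ereal (f x)"
  have fin: "f x = ereal (?g x)" "\<bar>f x\<bar> \<noteq> \<infinity>" if "x \<in> finite_points \<Gamma>" for x
    using f that unfolding Rat_nonzero_def by (cases "f x"; auto)+
  have cf: "continuous_on {0..len \<Gamma> e} (\<lambda>t. f (edge_point \<Gamma> e t))" if "e \<in> carcs \<Gamma>" for e
    using f that continuous_map_curve[OF \<Gamma>] unfolding Rat_nonzero_def by blast
  show g: "?g \<in> RFun \<Gamma>" unfolding RFun_def
  proof (intro CollectI ballI conjI)
    fix e assume e: "e \<in> carcs \<Gamma>"
    have "edge_piecewise_affine \<Gamma> f e" using f e unfolding Rat_nonzero_def by blast
    then obtain \<I> where I: "finite \<I>" "\<Union>\<I> = icc 0 (len \<Gamma> e)"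
      "\<forall>I\<in>\<I>. is_interval I \<and> (\<exists>(m::int) c. \<forall>t\<in>I. f (ep \<Gamma> e t) = ereal (of_int m * t + c))"
      unfolding edge_piecewise_affine_iff by blast
    show "pwa (\<lambda>t. ?g (ep \<Gamma> e t)) (icc 0 (len \<Gamma> e))"
      unfolding pwa_def
    proof (intro exI[of _ \<I>] conjI ballI)
      fix I assume "I \<in> \<I>"
      then obtain m :: int and c where "\<forall>t\<in>I. f (ep \<Gamma> e t) = ereal (of_int m * t + c)" using I(3) by blast
      then show "\<exists>(m::int) c. \<forall>t\<in>I. ?g (ep \<Gamma> e t) = of_int m * t + c"
        by (intro exI[of _ m] exI[of _ c]) simp
    qed (use I in auto)
    have "continuous_on (icc 0 (len \<Gamma> e)) (\<lambda>t. f (ep \<Gamma> e t))"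
      by (rule continuous_on_compose2[OF cf[OF e]]) (auto intro!: continuous_on_ereal continuous_on_id simp: icc_def zero_ereal_def)
    then have "continuous_on (icc 0 (len \<Gamma> e)) (real_of_ereal \<circ> (\<lambda>t. f (ep \<Gamma> e t)))"
      by (subst continuous_on_iff_real[symmetric]) (use fin(2) ep_finite_point[OF \<Gamma> e] in auto)
    then show "continuous_on (icc 0 (len \<Gamma> e)) (\<lambda>t. ?g (ep \<Gamma> e t))" by (simp add: comp_def)
  qed
  show "f = ext \<Gamma> ?g"
  proof
    fix x
    consider "x \<notin> points \<Gamma>" | "x \<in> finite_points \<Gamma>" | "x \<in> points \<Gamma>" "x \<notin> finite_points \<Gamma>" by blast
    then show "f x = ext \<Gamma> ?g x"
    proof cases
      case 1
      then show ?thesis using f unfolding Rat_nonzero_def ext_def extensional_def by auto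
    next
      case 2 then show ?thesis using fin ext_finite by simp
    next
      case 3
      then obtain e where e: "e \<in> carcs \<Gamma>" "len \<Gamma> e = \<infinity>" "x = Vert (chead \<Gamma> e)" using infinite_pointD by blast
      have "f (edge_point \<Gamma> e \<infinity>) = ext \<Gamma> ?g (edge_point \<Gamma> e \<infinity>)"
      proof (rule continuous_on_extend_infinity)
        show "continuous_on {0..\<infinity>} (\<lambda>s. f (edge_point \<Gamma> e s))" using cf[OF e(1)] e(2) by simp
        show "continuous_on {0..\<infinity>} (\<lambda>s. ext \<Gamma> ?g (edge_point \<Gamma> e s))" using ext_continuous_edge[OF \<Gamma> g e(1)] e(2) by simp
        fix t :: real assume "0 \<le> t"
        then have "ep \<Gamma> e t \<in> finite_points \<Gamma>" using ep_finite_point[OF \<Gamma> e(1)] e(2) by (simp add: icc_def)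
        then show "f (ep \<Gamma> e t) = ext \<Gamma> ?g (ep \<Gamma> e t)" using fin ext_finite by simp
      qed
      then show ?thesis using e by simp
    qed
  qed
qed

lemma Rat_nonzero_eq: assumes "is_curve \<Gamma>" shows "Rat_nonzero \<Gamma> = ext \<Gamma> ` RFun \<Gamma>"
  using ext_Rat[OF assms] Rat_ext[OF assms] by blast

subsection \<open>The operations\<close>

lemma RFun_const: "(\<lambda>_. c) \<in> RFun \<Gamma>"
  unfolding RFun_def by (auto intro: pwa_affine[where m=0 and c=c])

lemma RFun_add: "g \<in> RFun \<Gamma> \<Longrightarrow> h \<in> RFun \<Gamma> \<Longrightarrow> (\<lambda>x. g x + h x) \<in> RFun \<Gamma>"
  unfolding RFun_def by (auto intro!: pwa_add continuous_intros)

lemma RFun_max: "g \<in> RFun \<Gamma> \<Longrightarrow> h \<in> RFun \<Gamma> \<Longrightarrow> (\<lambda>x. max (g x) (h x)) \<in> RFun \<Gamma>"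
  unfolding RFun_def by (auto intro!: pwa_max continuous_intros)

lemma Rat_lift_eqI:
  assumes \<Gamma>: "is_curve \<Gamma>" and k: "k \<in> Rat \<Gamma>" "\<And>x. x \<in> finite_points \<Gamma> \<Longrightarrow> k x = opn (f x) (g x)"
  shows "Rat_lift \<Gamma> opn f g = k"
  unfolding Rat_lift_def
proof (rule the_equality)
  show "k \<in> Rat \<Gamma> \<and> (\<forall>x\<in>finite_points \<Gamma>. k x = opn (f x) (g x))" using k by blast
  fix h assume h: "h \<in> Rat \<Gamma> \<and> (\<forall>x\<in>finite_points \<Gamma>. h x = opn (f x) (g x))"
  then have eq: "h x = k x" if "x \<in> finite_points \<Gamma>" for x using k that by simp
  obtain x0 where x0: "x0 \<in> finite_points \<Gamma>" using finite_points_nonempty[OF \<Gamma>] by blast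
  then have x0': "x0 \<in> points \<Gamma>" using finite_points_subset by blast
  consider "h = Rat_const \<Gamma> (-\<infinity>)" "k = Rat_const \<Gamma> (-\<infinity>)"
    | a where "h = Rat_const \<Gamma> (-\<infinity>)" "k = ext \<Gamma> a"
    | a where "h = ext \<Gamma> a" "k = Rat_const \<Gamma> (-\<infinity>)"
    | a b where "h = ext \<Gamma> a" "k = ext \<Gamma> b"
    using h k(1) unfolding Rat_def Rat_nonzero_eq[OF \<Gamma>] by blast
  then show "h = k"
  proof cases
    case 4
    then show ?thesis using eq ext_finite ext_eq_iff[OF \<Gamma>, of a b] by simp
  qed (use eq[OF x0] x0' ext_finite[OF x0] in \<open>auto simp: Rat_const_def\<close>)
qed

lemma Rat_const_eq: assumes "is_curve \<Gamma>" shows "Rat_const \<Gamma> (ereal c) = ext \<Gamma> (\<lambda>_. c)"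
proof
  fix x
  consider "x \<notin> points \<Gamma>" | "x \<in> finite_points \<Gamma>" | "x \<in> points \<Gamma>" "x \<notin> finite_points \<Gamma>" by blast
  then show "Rat_const \<Gamma> (ereal c) x = ext \<Gamma> (\<lambda>_. c) x"
  proof cases
    case 1 then show ?thesis by (simp add: Rat_const_def ext_def)
  next
    case 2 then show ?thesis using subsetD[OF finite_points_subset, of x \<Gamma>] by (simp add: Rat_const_def ext_finite)
  next
    case 3
    then obtain e where e: "e \<in> carcs \<Gamma>" "len \<Gamma> e = \<infinity>" "x = Vert (chead \<Gamma> e)" using infinite_pointD by blast
    have "end_affine (\<lambda>t. c) 0 c" unfolding end_affine_def by simp
    then show ?thesis using 3 end_value_eqI[of "\<lambda>t. c" 0 c] ext_infinite[OF assms e(1,2), of "\<lambda>_. c"] unfolding e(3)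
      by (simp add: Rat_const_def)
  qed
qed

abbreviation Rat_neginf :: "curve \<Rightarrow> point \<Rightarrow> ereal" where "Rat_neginf \<Gamma> \<equiv> Rat_const \<Gamma> (-\<infinity>)"

lemma Rat_neginf_finite: "x \<in> finite_points \<Gamma> \<Longrightarrow> Rat_neginf \<Gamma> x = -\<infinity>"
  using subsetD[OF finite_points_subset, of x \<Gamma>] by (simp add: Rat_const_def)

lemma ext_neq_neginf: assumes "is_curve \<Gamma>" shows "ext \<Gamma> g \<noteq> Rat_neginf \<Gamma>"
  using finite_points_nonempty[OF assms] ext_finite Rat_neginf_finite by (metis PInfty_neq_ereal(2) MInfty_neq_ereal(1) ex_in_conv uminus_ereal.simps(2))

lemma Rat_par_simps:
  assumes \<Gamma>: "is_curve \<Gamma>" and g: "g \<in> RFun \<Gamma>" and h: "h \<in> RFun \<Gamma>"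
  shows "ext \<Gamma> g \<otimes>\<^bsub>Rat_par \<Gamma> par\<^esub> ext \<Gamma> h = ext \<Gamma> (\<lambda>x. g x + h x)"
    "ext \<Gamma> g \<oplus>\<^bsub>Rat_par \<Gamma> par\<^esub> ext \<Gamma> h = ext \<Gamma> (\<lambda>x. max (g x) (h x))"
    "Rat_neginf \<Gamma> \<otimes>\<^bsub>Rat_par \<Gamma> par\<^esub> ext \<Gamma> g = Rat_neginf \<Gamma>"
    "ext \<Gamma> g \<otimes>\<^bsub>Rat_par \<Gamma> par\<^esub> Rat_neginf \<Gamma> = Rat_neginf \<Gamma>"
    "Rat_neginf \<Gamma> \<otimes>\<^bsub>Rat_par \<Gamma> par\<^esub> Rat_neginf \<Gamma> = Rat_neginf \<Gamma>"
    "Rat_neginf \<Gamma> \<oplus>\<^bsub>Rat_par \<Gamma> par\<^esub> ext \<Gamma> g = ext \<Gamma> g"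
    "ext \<Gamma> g \<oplus>\<^bsub>Rat_par \<Gamma> par\<^esub> Rat_neginf \<Gamma> = ext \<Gamma> g"
    "Rat_neginf \<Gamma> \<oplus>\<^bsub>Rat_par \<Gamma> par\<^esub> Rat_neginf \<Gamma> = Rat_neginf \<Gamma>"
    "\<one>\<^bsub>Rat_par \<Gamma> par\<^esub> = ext \<Gamma> (\<lambda>_. 0)" "\<zero>\<^bsub>Rat_par \<Gamma> par\<^esub> = Rat_neginf \<Gamma>"
proof -
  have R: "ext \<Gamma> k \<in> Rat \<Gamma>" if "k \<in> RFun \<Gamma>" for k using that by (simp add: Rat_def Rat_nonzero_eq[OF \<Gamma>])
  have N: "Rat_neginf \<Gamma> \<in> Rat \<Gamma>" by (simp add: Rat_def)
  show "ext \<Gamma> g \<otimes>\<^bsub>Rat_par \<Gamma> par\<^esub> ext \<Gamma> h = ext \<Gamma> (\<lambda>x. g x + h x)"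
    unfolding Rat_par_def by (simp, rule Rat_lift_eqI[OF \<Gamma> R[OF RFun_add[OF g h]]]) (simp add: ext_finite)
  show "ext \<Gamma> g \<oplus>\<^bsub>Rat_par \<Gamma> par\<^esub> ext \<Gamma> h = ext \<Gamma> (\<lambda>x. max (g x) (h x))"
    unfolding Rat_par_def by (simp, rule Rat_lift_eqI[OF \<Gamma> R[OF RFun_max[OF g h]]]) (simp add: ext_finite)
  show "Rat_neginf \<Gamma> \<otimes>\<^bsub>Rat_par \<Gamma> par\<^esub> ext \<Gamma> g = Rat_neginf \<Gamma>"
    "ext \<Gamma> g \<otimes>\<^bsub>Rat_par \<Gamma> par\<^esub> Rat_neginf \<Gamma> = Rat_neginf \<Gamma>"
    "Rat_neginf \<Gamma> \<otimes>\<^bsub>Rat_par \<Gamma> par\<^esub> Rat_neginf \<Gamma> = Rat_neginf \<Gamma>"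
    "Rat_neginf \<Gamma> \<oplus>\<^bsub>Rat_par \<Gamma> par\<^esub> Rat_neginf \<Gamma> = Rat_neginf \<Gamma>"
    unfolding Rat_par_def by (simp, rule Rat_lift_eqI[OF \<Gamma> N], simp add: ext_finite Rat_neginf_finite)+
  show "Rat_neginf \<Gamma> \<oplus>\<^bsub>Rat_par \<Gamma> par\<^esub> ext \<Gamma> g = ext \<Gamma> g"
    "ext \<Gamma> g \<oplus>\<^bsub>Rat_par \<Gamma> par\<^esub> Rat_neginf \<Gamma> = ext \<Gamma> g"
    unfolding Rat_par_def by (simp, rule Rat_lift_eqI[OF \<Gamma> R[OF g]], simp add: ext_finite Rat_neginf_finite)+
  show "\<one>\<^bsub>Rat_par \<Gamma> par\<^esub> = ext \<Gamma> (\<lambda>_. 0)" "\<zero>\<^bsub>Rat_par \<Gamma> par\<^esub> = Rat_neginf \<Gamma>"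
    unfolding Rat_par_def using Rat_const_eq[OF \<Gamma>, of 0] by (simp_all add: zero_ereal_def)
qed

section \<open>Rays\<close>

text \<open>Near time \<open>t\<close> the path \<open>P\<close> runs along the edge
  \<open>e\<close> with unit speed, in the orientation given by \<open>\<sigma>\<close>.\<close>

definition local_iso :: "(real \<Rightarrow> point) \<Rightarrow> real \<Rightarrow> nat \<Rightarrow> real \<Rightarrow> real \<Rightarrow> bool" where
  "local_iso P t e \<sigma> c \<longleftrightarrow> \<sigma> \<in> {1, -1} \<and> (\<forall>\<^sub>F s in nhds t. P s = Inner e (\<sigma> * s + c))"

lemma local_iso_unique:
  assumes "local_iso P t e \<sigma> c" "local_iso P t e' \<sigma>' c'" shows "e = e' \<and> \<sigma> = \<sigma>' \<and> c = c'"
proof -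
  have "\<forall>\<^sub>F s in nhds t. Inner e (\<sigma> * s + c) = Inner e' (\<sigma>' * s + c')"
    using assms unfolding local_iso_def by (auto elim: eventually_elim2)
  then obtain d where d: "d > 0" "\<And>s. dist s t < d \<Longrightarrow> Inner e (\<sigma> * s + c) = Inner e' (\<sigma>' * s + c')"
    unfolding eventually_nhds_metric by blast
  have 1: "e = e'" "\<sigma> * t + c = \<sigma>' * t + c'" using d(2)[of t] d(1) by auto
  have 2: "\<sigma> * (t + d/2) + c = \<sigma>' * (t + d/2) + c'" using d(2)[of "t + d/2"] d(1) by (auto simp: dist_real_def)
  have "\<sigma> * (d/2) = \<sigma>' * (d/2)" using 1(2) 2 unfolding distrib_left by linarith
  then have "\<sigma> = \<sigma>'" using d(1) by simp
  then show ?thesis using 1 by simp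
qed

text \<open>A path that is locally isometric and avoids the vertices stays on a single edge, because the
  local data (edge, orientation, offset) are locally constant.\<close>

lemma local_iso_global:
  assumes S: "Topological_Spaces.connected S" "open S" "t0 \<in> S" and loc: "\<And>t. t \<in> S \<Longrightarrow> \<exists>e \<sigma> c. local_iso P t e \<sigma> c"
  obtains e \<sigma> c where "\<sigma> \<in> {1, -1::real}" "\<And>t. t \<in> S \<Longrightarrow> P t = Inner e (\<sigma> * t + c)"
proof -
  define K where "K t = (SOME k. case k of (e, \<sigma>, c) \<Rightarrow> local_iso P t e \<sigma> c)" for t
  have K: "case K t of (e, \<sigma>, c) \<Rightarrow> local_iso P t e \<sigma> c" if "t \<in> S" for t
    unfolding K_def by (rule someI_ex) (use loc[OF that] in auto)
  have Keq: "K t = (e, \<sigma>, c)" if "t \<in> S" "local_iso P t e \<sigma> c" for t e \<sigma> c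
    using K[OF that(1)] local_iso_unique[OF _ that(2)] by (cases "K t") auto
  have const: "K t = K t0" if "t \<in> S" for t
  proof (rule connected_local_const[OF S(1) that S(3)], intro ballI)
    fix a assume a: "a \<in> S"
    obtain e \<sigma> c where ka: "K a = (e, \<sigma>, c)" "local_iso P a e \<sigma> c" using K[OF a] by (cases "K a") auto
    then have "\<forall>\<^sub>F s in nhds a. \<forall>\<^sub>F s' in nhds s. P s' = Inner e (\<sigma> * s' + c)"
      unfolding local_iso_def eventually_eventually by simp
    then have "\<forall>\<^sub>F s in nhds a. local_iso P s e \<sigma> c"
      using ka(2) unfolding local_iso_def by simp
    moreover have "\<forall>\<^sub>F s in nhds a. s \<in> S" using S(2) a by (rule eventually_nhds_in_open)
    ultimately have "\<forall>\<^sub>F s in nhds a. K a = K s"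
      by eventually_elim (use Keq ka in auto)
    then show "\<forall>\<^sub>F s in at a within S. K a = K s"
      unfolding eventually_at_filter by (rule eventually_mono) simp
  qed
  obtain e \<sigma> c where k0: "K t0 = (e, \<sigma>, c)" by (cases "K t0") auto
  have "local_iso P t e \<sigma> c" if "t \<in> S" for t using K[OF that] const[OF that] k0 by simp
  then have "\<sigma> \<in> {1, -1}" "\<And>t. t \<in> S \<Longrightarrow> P t = Inner e (\<sigma> * t + c)"
    using S(3) unfolding local_iso_def by (auto dest: eventually_nhds_x_imp_x)
  then show thesis using that by blast
qed

lemma open_ioo: "open (ioo a b)"
proof (cases b)
  case (real r)
  then have "ioo a b = {a<..<r}" by (auto simp: ioo_def)
  then show ?thesis by simp
next
  case PInf
  then have "ioo a b = {a<..}" by (auto simp: ioo_def)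
  then show ?thesis by simp
next
  case MInf then have "ioo a b = {}" by (auto simp: ioo_def)
  then show ?thesis by simp
qed

lemma connected_ioo: "Topological_Spaces.connected (ioo a b)"
  by (simp add: is_interval_connected)

text \<open>As the parametrization of a ray is injective, it meets the finitely many vertices at
  finitely many times \<open>N\<close>. In between it stays on a single edge, along which it runs
  with unit speed.\<close>

lemma ray_structure:
  assumes \<Gamma>: "is_curve \<Gamma>" and p: "ray_param \<Gamma> p"
  obtains N where "finite N" "\<And>t. 0 < t \<Longrightarrow> p (ereal t) \<in> points \<Gamma>"
    "\<And>a b. 0 \<le> a \<Longrightarrow> ereal a < b \<Longrightarrow> ioo a b \<inter> N = {} \<Longrightarrow>
      \<exists>e \<sigma> c. \<sigma> \<in> {1, -1::real} \<and> (\<forall>t\<in>ioo a b. p (ereal t) = Inner e (\<sigma> * t + c))"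
proof -
  obtain G' l' \<Phi> e' where m: "model_of \<Gamma> (G', l') \<Phi>" and e': "e' \<in> arcs G'" "l' e' = \<infinity>"
    and pe: "p = \<Phi> \<circ> edge_point (G', l') e'" using p unfolding ray_param_def by blast
  have \<Gamma>': "is_curve (G', l')" and hom: "homeomorphic_map (curve_top (G', l')) (curve_top \<Gamma>) \<Phi>"
    and loc: "\<And>e' s e t. Inner e' s \<in> points (G', l') \<Longrightarrow> Inner e t \<in> points \<Gamma> \<Longrightarrow> \<Phi> (Inner e' s) = Inner e t \<Longrightarrow>
        \<exists>\<sigma> \<in> {1, -1}. \<forall>\<^sub>F h in nhds 0. \<Phi> (Inner e' (s + h)) = Inner e (t + \<sigma> * h)"
    using m unfolding model_of_def by auto
  have inj: "inj_on \<Phi> (points (G', l'))" and im: "\<Phi> ` points (G', l') = points \<Gamma>"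
    using homeomorphic_imp_injective_map[OF hom] homeomorphic_imp_surjective_map[OF hom]
    unfolding topspace_curve_top[OF \<Gamma>] topspace_curve_top[OF \<Gamma>'] .
  define P where "P t = \<Phi> (Inner e' t)" for t
  have pP: "p (ereal t) = P t" and inp: "Inner e' t \<in> points (G', l')" if "t > 0" for t
    using that e' unfolding pe P_def points_eq by auto
  have Pp: "P t \<in> points \<Gamma>" if "t > 0" for t using inp[OF that] im unfolding P_def by blast
  define N where "N = {t. 0 < t \<and> P t \<in> Vert ` cverts \<Gamma>}"
  have "inj_on P {0<..}" using inj inp unfolding inj_on_def P_def by (metis greaterThan_iff point.inject(2))
  then have "inj_on P N" by (rule inj_on_subset) (auto simp: N_def)
  moreover have "finite (P ` N)"
    by (rule finite_subset[of _ "Vert ` cverts \<Gamma>"]) (use curveD(7)[OF \<Gamma>] in \<open>auto simp: N_def\<close>)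
  ultimately have "finite N" using finite_imageD by blast
  moreover have "\<exists>e \<sigma> c. \<sigma> \<in> {1, -1::real} \<and> (\<forall>t\<in>ioo a b. p (ereal t) = Inner e (\<sigma> * t + c))"
    if ab: "0 \<le> a" "ereal a < b" "ioo a b \<inter> N = {}" for a b
  proof -
    have pos: "0 < t" if "t \<in> ioo a b" for t using that ab(1) by (auto simp: ioo_def)
    obtain t0 where t0: "t0 \<in> ioo a b" using ioo_nonempty[OF ab(2)] by blast
    have "\<exists>e \<sigma> c. local_iso P t e \<sigma> c" if t: "t \<in> ioo a b" for t
    proof -
      have "P t \<in> points \<Gamma>" "P t \<notin> Vert ` cverts \<Gamma>" using Pp pos[OF t] ab(3) t unfolding N_def by auto
      then obtain e u where eu: "P t = Inner e u" unfolding points_eq by blast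
      then obtain \<sigma> where \<sigma>: "\<sigma> \<in> {1, -1}" "\<forall>\<^sub>F h in nhds 0. P (t + h) = Inner e (u + \<sigma> * h)"
        using loc[OF inp[OF pos[OF t]], of e u] Pp[OF pos[OF t]] unfolding P_def by metis
      then obtain d where d: "d > 0" "\<And>h. dist h 0 < d \<Longrightarrow> P (t + h) = Inner e (u + \<sigma> * h)"
        unfolding eventually_nhds_metric by blast
      have "P s = Inner e (\<sigma> * s + (u - \<sigma> * t))" if "dist s t < d" for s
        using d(2)[of "s - t"] that by (simp add: dist_real_def algebra_simps)
      then have "local_iso P t e \<sigma> (u - \<sigma> * t)" unfolding local_iso_def eventually_nhds_metric using \<sigma>(1) d(1) by blast
      then show ?thesis by blast
    qed
    then obtain e \<sigma> c where "\<sigma> \<in> {1, -1::real}" "\<And>t. t \<in> ioo a b \<Longrightarrow> P t = Inner e (\<sigma> * t + c)"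
      using local_iso_global[OF connected_ioo open_ioo t0] by metis
    then show ?thesis using pP pos by metis
  qed
  ultimately show thesis using that pP Pp by metis
qed

definition tail_in :: "curve \<Rightarrow> nat \<Rightarrow> point set \<Rightarrow> bool" where
  "tail_in \<Gamma> e L \<longleftrightarrow> e \<in> carcs \<Gamma> \<and> len \<Gamma> e = \<infinity> \<and> (\<exists>T. \<forall>t\<ge>T. Inner e t \<in> L)"

text \<open>After its last vertex the ray runs along one edge with unit speed for infinite time, so
  this edge is infinite and the ray runs towards infinity. Before, only bounded coordinates are
  reached, so the ray contains the end of no other infinite edge.\<close>

lemma ray_end:
  assumes \<Gamma>: "is_curve \<Gamma>" and p: "ray_param \<Gamma> p"
  obtains e c where "e \<in> carcs \<Gamma>" "len \<Gamma> e = \<infinity>" "\<forall>\<^sub>F t in at_top. p (ereal t) = Inner e (t + c)"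
    "\<And>e2. tail_in \<Gamma> e2 (p ` {0..\<infinity>}) \<longleftrightarrow> e2 = e"
proof -
  obtain N where N: "finite N" "\<And>t. 0 < t \<Longrightarrow> p (ereal t) \<in> points \<Gamma>"
    "\<And>a b. 0 \<le> a \<Longrightarrow> ereal a < b \<Longrightarrow> ioo a b \<inter> N = {} \<Longrightarrow>
      \<exists>e \<sigma> c. \<sigma> \<in> {1, -1::real} \<and> (\<forall>t\<in>ioo a b. p (ereal t) = Inner e (\<sigma> * t + c))"
    using ray_structure[OF \<Gamma> p] by blast
  define T where "T = Max (insert 0 N)"
  have T: "0 \<le> T" "\<And>t. t \<in> N \<Longrightarrow> t \<le> T" unfolding T_def using N(1) by auto
  have "ioo T \<infinity> \<inter> N = {}" using T(2) unfolding ioo_def by force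
  then obtain e \<sigma> c where ec: "\<sigma> \<in> {1, -1::real}" "\<forall>t\<in>ioo T \<infinity>. p (ereal t) = Inner e (\<sigma> * t + c)"
    using N(3)[OF T(1), of \<infinity>] by auto
  have inn: "e \<in> carcs \<Gamma>" "0 < \<sigma> * t + c" "ereal (\<sigma> * t + c) < len \<Gamma> e" if "t > T" for t
  proof -
    have "Inner e (\<sigma> * t + c) \<in> points \<Gamma>" using N(2)[of t] ec(2) that T(1) by (auto simp: ioo_def)
    then show "e \<in> carcs \<Gamma>" "0 < \<sigma> * t + c" "ereal (\<sigma> * t + c) < len \<Gamma> e" unfolding points_eq by auto
  qed
  have \<sigma>1: "\<sigma> = 1"
  proof (rule ccontr)
    assume "\<sigma> \<noteq> 1"
    then have "\<sigma> = -1" using ec(1) by simp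
    moreover have "T < max (T + 1) c" by simp
    ultimately have "max (T + 1) c < c" using inn(2)[of "max (T + 1) c"] by simp
    then show False by linarith
  qed
  have e: "e \<in> carcs \<Gamma>" using inn(1)[of "T + 1"] by simp
  have li: "len \<Gamma> e = \<infinity>"
  proof (cases "len \<Gamma> e")
    case (real L)
    then have "max (T + 1) (L - c) + c < L" using inn(3)[of "max (T + 1) (L - c)"] \<sigma>1 by simp
    then show ?thesis by linarith
  qed (use curveD(3)[OF \<Gamma> e] in auto)
  have pT: "p (ereal t) = Inner e (t + c)" if "t > T" for t using ec(2) \<sigma>1 that by (simp add: ioo_def)
  have tail: "tail_in \<Gamma> e (p ` {0..\<infinity>})" unfolding tail_in_def
  proof (intro conjI e li exI[of _ "T + 1 + c"] allI impI)
    fix t assume "T + 1 + c \<le> t"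
    then have "p (ereal (t - c)) = Inner e t" "ereal (t - c) \<in> {0..\<infinity>}" using pT[of "t - c"] T(1) by auto
    then show "Inner e t \<in> p ` {0..\<infinity>}" by (metis image_eqI)
  qed
  \<comment> \<open>Up to time \<open>T + 1\<close> the ray only runs through points with bounded edge coordinates.\<close>
  define Q where "Q = pieces N (ereal (T + 1))"
  have "0 < ereal (T + 1)" using T(1) by simp
  have "\<exists>M. \<forall>t\<in>ioo (fst q) (snd q). \<forall>e2 u. p (ereal t) = Inner e2 u \<longrightarrow> u \<le> M" if "q \<in> Q" for q
  proof -
    obtain a b where q: "q = (a, b)" by force
    note ab = piecesD[OF that[unfolded Q_def q] \<open>0 < ereal (T + 1)\<close>]
    obtain e3 \<sigma>' c' where *: "\<sigma>' \<in> {1, -1::real}" "\<forall>t\<in>ioo a b. p (ereal t) = Inner e3 (\<sigma>' * t + c')" using N(3)[OF ab(1,2,4)] by blast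
    have "u \<le> T + 1 + \<bar>c'\<bar>" if t: "t \<in> ioo a b" "p (ereal t) = Inner e2 u" for t e2 u
    proof -
      have "ereal t < b" using t(1) by (simp add: ioo_def)
      then have "ereal t < ereal (T + 1)" using ab(3) by (rule less_le_trans)
      then have "0 \<le> t" "t \<le> T + 1" using t(1) ab(1) by (auto simp: ioo_def)
      moreover have "u = \<sigma>' * t + c'" using *(2) t by auto
      ultimately show ?thesis using *(1) by auto
    qed
    then show ?thesis using q by auto
  qed
  then obtain M where M: "\<And>q t e2 u. q \<in> Q \<Longrightarrow> t \<in> ioo (fst q) (snd q) \<Longrightarrow> p (ereal t) = Inner e2 u \<Longrightarrow> u \<le> M q" by metis
  define E where "E = insert 0 N \<union> {T + 1}"
  define X where "X = insert (p \<infinity>) ((\<lambda>t. p (ereal t)) ` E)"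
  have "finite X" unfolding X_def E_def using N(1) by auto
  have "tail_in \<Gamma> e2 (p ` {0..\<infinity>}) \<longleftrightarrow> e2 = e" for e2
  proof
    assume "tail_in \<Gamma> e2 (p ` {0..\<infinity>})"
    then obtain T2 where T2: "\<And>t. t \<ge> T2 \<Longrightarrow> Inner e2 t \<in> p ` {0..\<infinity>}" unfolding tail_in_def by blast
    have finQ: "finite Q" unfolding Q_def by (rule finite_pieces[OF N(1)])
    define M' where "M' = Max (insert T2 (M ` Q))"
    have M': "T2 \<le> M'" "\<And>q. q \<in> Q \<Longrightarrow> M q \<le> M'" unfolding M'_def using finQ by auto
    have "infinite {M'<..}" by (rule infinite_Ioi)
    then have "infinite (Inner e2 ` {M'<..})" by (simp add: finite_image_iff inj_on_def)
    then have "\<not> Inner e2 ` {M'<..} \<subseteq> X" using \<open>finite X\<close> finite_subset by blast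
    then obtain t where t: "t > M'" "Inner e2 t \<notin> X" by blast
    obtain s where s: "s \<in> {0..\<infinity>}" "Inner e2 t = p s" using T2[of t] t M' by auto
    have "s \<noteq> \<infinity>" using t(2) s(2) unfolding X_def by auto
    then obtain r where r: "s = ereal r" by (cases s) (use s(1) in auto)
    then have r0: "0 \<le> r" "r \<notin> E" using s t(2) unfolding X_def by auto
    show "e2 = e"
    proof (cases "r > T")
      case True then show ?thesis using pT s r by auto
    next
      case False
      then have rT: "ereal r < ereal (T + 1)" "r \<in> icc 0 (ereal (T + 1))" using r0 by (auto simp: icc_def)
      obtain a b where ab: "(a, b) \<in> Q" "r \<in> icc a b" "ereal r < b"
        using pieces_cover[OF N(1) \<open>0 < ereal (T + 1)\<close> rT(2)] rT(1) unfolding Q_def by metis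
      have "a \<in> insert 0 N" using ab(1) unfolding Q_def pieces_def Let_def by auto
      then have "a \<noteq> r" using r0(2) unfolding E_def by auto
      then have "r \<in> ioo a b" using ab unfolding icc_def ioo_def by auto
      then have "t \<le> M (a, b)" using M[OF ab(1), of r e2 t] s r by simp
      then show ?thesis using M'(2)[OF ab(1)] t(1) by simp
    qed
  qed (use tail in simp)
  moreover have "\<forall>\<^sub>F t in at_top. p (ereal t) = Inner e (t + c)"
    using eventually_gt_at_top[of T] by (rule eventually_mono) (rule pT)
  ultimately show thesis using that e li by blast
qed

lemma ray_tail_unique:
  assumes "is_curve \<Gamma>" "L \<in> rays \<Gamma>" shows "\<exists>!e. tail_in \<Gamma> e L"
proof -
  obtain p where p: "ray_param \<Gamma> p" "L = p ` {0..\<infinity>}" using assms(2) unfolding rays_def by blast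
  obtain e where "\<And>e2. tail_in \<Gamma> e2 (p ` {0..\<infinity>}) \<longleftrightarrow> e2 = e" using ray_end[OF assms(1) p(1)] by metis
  then show ?thesis using p(2) by auto
qed

lemma slope_at_infinity_eq:
  assumes \<Gamma>: "is_curve \<Gamma>" and g: "g \<in> RFun \<Gamma>" and L: "L \<in> rays \<Gamma>" and e: "tail_in \<Gamma> e L"
  shows "slope_at_infinity \<Gamma> (ext \<Gamma> g) L = slope \<Gamma> g e"
proof -
  have ei: "e \<in> carcs \<Gamma>" "len \<Gamma> e = \<infinity>" using e unfolding tail_in_def by auto
  obtain m c where mc: "end_affine (\<lambda>t. g (ep \<Gamma> e t)) m c" using RFun_end_affine[OF \<Gamma> g ei] by blast
  then obtain T where T: "\<forall>t\<ge>T. g (ep \<Gamma> e t) = of_int m * t + c" unfolding end_affine_def by blast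
  have key: "\<exists>d. \<forall>\<^sub>F t in at_top. ext \<Gamma> g (p (ereal t)) = ereal (of_int m * t + d)"
    if p: "ray_param \<Gamma> p" "L = p ` {0..\<infinity>}" for p
  proof -
    obtain e2 d where e2: "\<forall>\<^sub>F t in at_top. p (ereal t) = Inner e2 (t + d)" "\<And>e3. tail_in \<Gamma> e3 (p ` {0..\<infinity>}) \<longleftrightarrow> e3 = e2"
      using ray_end[OF \<Gamma> p(1)] by metis
    have "e2 = e" using e e2(2)[of e] p(2) by simp
    then have "\<forall>\<^sub>F t in at_top. p (ereal t) = Inner e (t + d)" using e2(1) by simp
    moreover have "\<forall>\<^sub>F t in at_top. t > max 0 T - d" by (rule eventually_gt_at_top)
    ultimately have "\<forall>\<^sub>F t in at_top. ext \<Gamma> g (p (ereal t)) = ereal (of_int m * t + (of_int m * d + c))"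
    proof eventually_elim
      case (elim t)
      then have td: "t + d > 0" "t + d \<ge> T" by auto
      have "ext \<Gamma> g (Inner e (t + d)) = ereal (g (Inner e (t + d)))"
        by (rule ext_finite, rule Inner_finite_point) (use ei td in auto)
      also have "g (Inner e (t + d)) = of_int m * (t + d) + c" using T td ei by (metis ep_simps(4))
      finally show ?case using elim(1) by (simp add: algebra_simps)
    qed
    then show ?thesis by blast
  qed
  obtain p where p: "ray_param \<Gamma> p" "L = p ` {0..\<infinity>}" using L unfolding rays_def by blast
  have "slope_at_infinity \<Gamma> (ext \<Gamma> g) L = m" unfolding slope_at_infinity_def
  proof (rule the_equality)
    show "\<exists>p c. ray_param \<Gamma> p \<and> L = p ` {0..\<infinity>} \<and> (\<forall>\<^sub>F t in at_top. ext \<Gamma> g (p (ereal t)) = ereal (of_int m * t + c))"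
      using p key by blast
    fix m' assume "\<exists>p c. ray_param \<Gamma> p \<and> L = p ` {0..\<infinity>} \<and> (\<forall>\<^sub>F t in at_top. ext \<Gamma> g (p (ereal t)) = ereal (of_int m' * t + c))"
    then obtain p c' where p': "ray_param \<Gamma> p" "L = p ` {0..\<infinity>}" "\<forall>\<^sub>F t in at_top. ext \<Gamma> g (p (ereal t)) = ereal (of_int m' * t + c')" by blast
    obtain d where "\<forall>\<^sub>F t in at_top. ext \<Gamma> g (p (ereal t)) = ereal (of_int m * t + d)" using key[OF p'(1,2)] by blast
    with p'(3) have "\<forall>\<^sub>F t in at_top. of_int m' * t + c' = of_int m * t + d"
      by eventually_elim simp
    then have "end_affine (\<lambda>t. of_int m' * t + c') m d"
      unfolding end_affine_def eventually_at_top_linorder .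
    moreover have "end_affine (\<lambda>t. of_int m' * t + c') m' c'" unfolding end_affine_def by simp
    ultimately show "m' = m" using end_affine_unique by blast
  qed
  then show ?thesis using slope_eqI[of g \<Gamma> e m c] mc by simp
qed

text \<open>The condition imposed by parallel rays, expressed by the infinite edges on which the
  rays end.\<close>

definition slope_compatible :: "curve \<Rightarrow> (point set \<times> point set) set \<Rightarrow> (point \<Rightarrow> real) \<Rightarrow> bool" where
  "slope_compatible \<Gamma> par g \<longleftrightarrow> (\<forall>(L1, L2)\<in>par. \<forall>e1 e2. tail_in \<Gamma> e1 L1 \<longrightarrow> tail_in \<Gamma> e2 L2 \<longrightarrow> slope \<Gamma> g e1 = slope \<Gamma> g e2)"

lemma carrier_Rat_par:
  assumes "is_curve_with_parallel_rays \<Gamma> par"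
  shows "carrier (Rat_par \<Gamma> par) = insert (Rat_neginf \<Gamma>) (ext \<Gamma> ` {g \<in> RFun \<Gamma>. slope_compatible \<Gamma> par g})"
proof -
  have \<Gamma>: "is_curve \<Gamma>" and par: "par \<subseteq> rays \<Gamma> \<times> rays \<Gamma>"
    using assms unfolding is_curve_with_parallel_rays_def equiv_def refl_on_def by auto
  have *: "(\<forall>(L1, L2) \<in> par. slope_at_infinity \<Gamma> (ext \<Gamma> g) L1 = slope_at_infinity \<Gamma> (ext \<Gamma> g) L2) \<longleftrightarrow> slope_compatible \<Gamma> par g"
    if g: "g \<in> RFun \<Gamma>" for g
  proof -
    have "slope_at_infinity \<Gamma> (ext \<Gamma> g) L1 = slope_at_infinity \<Gamma> (ext \<Gamma> g) L2 \<longleftrightarrow>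
      (\<forall>e1 e2. tail_in \<Gamma> e1 L1 \<longrightarrow> tail_in \<Gamma> e2 L2 \<longrightarrow> slope \<Gamma> g e1 = slope \<Gamma> g e2)" if L: "L1 \<in> rays \<Gamma>" "L2 \<in> rays \<Gamma>" for L1 L2
    proof -
      obtain e1 where e1: "tail_in \<Gamma> e1 L1" "\<And>e. tail_in \<Gamma> e L1 \<Longrightarrow> e = e1" using ray_tail_unique[OF \<Gamma> L(1)] by blast
      obtain e2 where e2: "tail_in \<Gamma> e2 L2" "\<And>e. tail_in \<Gamma> e L2 \<Longrightarrow> e = e2" using ray_tail_unique[OF \<Gamma> L(2)] by blast
      show ?thesis using slope_at_infinity_eq[OF \<Gamma> g L(1) e1(1)] slope_at_infinity_eq[OF \<Gamma> g L(2) e2(1)] e1 e2 by metis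
    qed
    then show ?thesis unfolding slope_compatible_def using par by fast
  qed
  show ?thesis unfolding Rat_par_def Rat_nonzero_eq[OF \<Gamma>] using * by auto
qed

lemma edge_ray:
  assumes \<Gamma>: "is_curve \<Gamma>" and e: "e \<in> carcs \<Gamma>" "len \<Gamma> e = \<infinity>"
  shows "edge_point \<Gamma> e ` {0..\<infinity>} \<in> rays \<Gamma>" "tail_in \<Gamma> e (edge_point \<Gamma> e ` {0..\<infinity>})"
proof -
  have "\<exists>\<sigma>\<in>{1, - 1}. \<forall>\<^sub>F h in nhds 0. id (Inner e' (s + h)) = Inner e (t + \<sigma> * h)"
    if "id (Inner e' s) = Inner e t" for e' s e and t :: real
    by (rule bexI[of _ 1]) (use that in auto)
  then have "model_of \<Gamma> \<Gamma> id" unfolding model_of_def using \<Gamma> by auto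
  then have "ray_param \<Gamma> (edge_point \<Gamma> e)" unfolding ray_param_def using e
    by (intro exI[of _ "fst \<Gamma>"] exI[of _ "snd \<Gamma>"] exI[of _ id] exI[of _ e]) simp
  then show "edge_point \<Gamma> e ` {0..\<infinity>} \<in> rays \<Gamma>" unfolding rays_def by blast
  have "Inner e t \<in> edge_point \<Gamma> e ` {0..\<infinity>}" if "t \<ge> 1" for t
    by (rule image_eqI[of _ _ "ereal t"]) (use that e in auto)
  then show "tail_in \<Gamma> e (edge_point \<Gamma> e ` {0..\<infinity>})" unfolding tail_in_def using e by blast
qed

section \<open>Realizations of curves in real n-space\<close>

text \<open>The map \<open>F\<close> embeds the finite points by functions that belong to the curve
  with parallel rays. Its direction along the edges is primitive, so that lengths on the curve are
  lattice lengths in the image, and by the last condition edges with the same direction at infinity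
  cannot be told apart by the slopes of any function of the curve.\<close>

locale realization =
  fixes \<Gamma> :: curve and par :: "(point set \<times> point set) set" and n :: nat and F :: "point \<Rightarrow> nat \<Rightarrow> real"
  assumes curve_par: "is_curve_with_parallel_rays \<Gamma> par"
    and F_Rn: "F x \<in> Rn n"
    and F_RFun: "i < n \<Longrightarrow> (\<lambda>x. F x i) \<in> RFun \<Gamma>"
    and F_compatible: "i < n \<Longrightarrow> slope_compatible \<Gamma> par (\<lambda>x. F x i)"
    and F_inj: "inj_on F (finite_points \<Gamma>)"
    and F_primitive: "e \<in> carcs \<Gamma> \<Longrightarrow> \<exists>B. finite B \<and> (\<forall>a b. 0 \<le> a \<longrightarrow> ereal a < b \<longrightarrow> b \<le> len \<Gamma> e \<longrightarrow> ioo a b \<inter> B = {} \<longrightarrow>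
        (\<exists>q v w. prim n v w \<and> (\<forall>t\<in>icc a b. F (ep \<Gamma> e t) = pt q v t)))"
    and F_separates: "\<lbrakk>e1 \<in> carcs \<Gamma>; e2 \<in> carcs \<Gamma>; len \<Gamma> e1 = \<infinity>; len \<Gamma> e2 = \<infinity>;
        \<And>i. i < n \<Longrightarrow> slope \<Gamma> (\<lambda>x. F x i) e1 = slope \<Gamma> (\<lambda>x. F x i) e2;
        g \<in> RFun \<Gamma>; slope_compatible \<Gamma> par g\<rbrakk> \<Longrightarrow> slope \<Gamma> g e1 = slope \<Gamma> g e2"
begin

lemma curve: "is_curve \<Gamma>" using curve_par unfolding is_curve_with_parallel_rays_def by auto

abbreviation V :: "(nat \<Rightarrow> real) set" where "V \<equiv> F ` finite_points \<Gamma>"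

lemma icc_shift: "t \<in> icc 0 (b - ereal a) \<longleftrightarrow> a + t \<in> icc a b"
  by (cases b) (auto simp: icc_def)

lemma pt_shift: "pt q v (a + t) = pt (pt q v a) v t"
  by (auto simp: pt_def algebra_simps)

text \<open>Segments of the image along which \<open>g\<close>, transported to the image, is affine.
  For rays it is recorded that the slope and the direction are those at infinity along an edge of
  the curve.\<close>

definition good :: "(point \<Rightarrow> real) \<Rightarrow> seg \<Rightarrow> bool" where
  "good g s \<longleftrightarrow> seg_ok n s \<and> (\<exists>m c.
     (\<forall>t\<in>icc 0 (sl s). g (inv_into (finite_points \<Gamma>) F (pt (sp s) (sv s) t)) = real_of_int m * t + c) \<and>
     (sl s = \<infinity> \<longrightarrow> (\<exists>e\<in>carcs \<Gamma>. len \<Gamma> e = \<infinity> \<and> m = slope \<Gamma> g e \<and> (\<forall>i<n. sv s i = slope \<Gamma> (\<lambda>x. F x i) e))))"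

definition covered :: "(point \<Rightarrow> real) \<Rightarrow> (nat \<Rightarrow> real) set \<Rightarrow> bool" where
  "covered g W \<longleftrightarrow> (\<exists>\<S>. finite \<S> \<and> (\<forall>s\<in>\<S>. good g s) \<and> \<Union>(seg_pts ` \<S>) = W)"

lemma covered_Un: assumes "covered g W" "covered g W'" shows "covered g (W \<union> W')"
proof -
  obtain S T where "finite S" "\<forall>s\<in>S. good g s" "\<Union>(seg_pts ` S) = W" "finite T" "\<forall>s\<in>T. good g s" "\<Union>(seg_pts ` T) = W'"
    using assms unfolding covered_def by blast
  then show ?thesis unfolding covered_def by (intro exI[of _ "S \<union> T"]) auto
qed

lemma covered_UN: "finite I \<Longrightarrow> (\<And>i. i \<in> I \<Longrightarrow> covered g (W i)) \<Longrightarrow> covered g (\<Union>i\<in>I. W i)"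
proof (induction I rule: finite_induct)
  case empty show ?case unfolding covered_def by (intro exI[of _ "{}"]) auto
qed (auto intro: covered_Un)

lemma inv_F: "x \<in> finite_points \<Gamma> \<Longrightarrow> inv_into (finite_points \<Gamma>) F (F x) = x"
  using F_inj by simp

lemma covered_vertex: assumes "x \<in> finite_points \<Gamma>" shows "covered g {F x}"
proof -
  let ?s = "Seg (F x) (\<lambda>_. 0) (\<lambda>_. 0) 0"
  have "good g ?s" unfolding good_def
  proof (intro conjI exI[of _ "0::int"] exI[of _ "g x"])
    show "seg_ok n ?s" using F_Rn by (simp add: seg_ok_def)
    show "\<forall>t\<in>icc 0 (sl ?s). g (inv_into (finite_points \<Gamma>) F (pt (sp ?s) (sv ?s) t)) = real_of_int 0 * t + g x"
      using inv_F[OF assms] by (simp add: pt_def)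
  qed simp
  moreover have "seg_pts ?s = {F x}" by (simp add: seg_pts_def icc_zero_zero pt_def)
  ultimately show ?thesis unfolding covered_def by (intro exI[of _ "{?s}"]) simp
qed

text \<open>A piece of an edge on which \<open>F\<close> and \<open>g\<close> are affine is mapped
  to a single segment, with the parameter shifted by \<open>a\<close>.\<close>

lemma covered_piece:
  assumes e: "e \<in> carcs \<Gamma>" and ab: "0 \<le> a" "ereal a < b" "b \<le> len \<Gamma> e"
    and F: "prim n v w" "\<And>t. t \<in> icc a b \<Longrightarrow> F (ep \<Gamma> e t) = pt q v t"
    and g: "\<And>t. t \<in> icc a b \<Longrightarrow> g (ep \<Gamma> e t) = of_int m * t + c"
  shows "covered g ((\<lambda>t. F (ep \<Gamma> e t)) ` icc a b)"
proof -
  have a: "a \<in> icc a b" using ab by (auto simp: icc_def)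
  let ?s = "Seg (F (ep \<Gamma> e a)) v w (b - ereal a)"
  have F': "F (ep \<Gamma> e (a + t)) = pt (F (ep \<Gamma> e a)) v t" if "t \<in> icc 0 (b - ereal a)" for t
    using F(2)[of "a + t"] F(2)[OF a] that icc_shift by (simp add: pt_shift)
  have sub: "icc a b \<subseteq> icc 0 (len \<Gamma> e)" using ab icc_mono by blast
  have "good g ?s" unfolding good_def
  proof (intro conjI exI[of _ m] exI[of _ "of_int m * a + c"] ballI impI)
    have "0 \<le> b - ereal a" using ab by (cases b) auto
    then show "seg_ok n ?s" using F_Rn F(1) by (simp add: seg_ok_def prim_def)
  next
    fix t assume "t \<in> icc 0 (sl ?s)"
    then have t: "t \<in> icc 0 (b - ereal a)" "a + t \<in> icc a b" using icc_shift by auto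
    then have "ep \<Gamma> e (a + t) \<in> finite_points \<Gamma>" using ep_finite_point[OF curve e] sub by blast
    then have "inv_into (finite_points \<Gamma>) F (pt (sp ?s) (sv ?s) t) = ep \<Gamma> e (a + t)"
      using inv_F F'[OF t(1)] by (metis seg.sel(1) seg.sel(2))
    then show "g (inv_into (finite_points \<Gamma>) F (pt (sp ?s) (sv ?s) t)) = real_of_int m * t + (of_int m * a + c)"
      using g[OF t(2)] by (simp add: algebra_simps)
  next
    assume "sl ?s = \<infinity>"
    then have b: "b = \<infinity>" by (cases b) auto
    then have l: "len \<Gamma> e = \<infinity>" using ab(3) by simp
    have "end_affine (\<lambda>t. g (ep \<Gamma> e t)) m c" unfolding end_affine_def using g b by (auto simp: icc_def)
    then have "m = slope \<Gamma> g e" using slope_eqI[of g \<Gamma> e m c] by simp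
    moreover have "sv ?s i = slope \<Gamma> (\<lambda>x. F x i) e" for i
    proof -
      have "end_affine (\<lambda>t. F (ep \<Gamma> e t) i) (v i) (q i)" unfolding end_affine_def
        by (rule exI[of _ a]) (use F(2) b in \<open>auto simp: icc_def pt_def\<close>)
      then show ?thesis using slope_eqI[of "\<lambda>x. F x i" \<Gamma> e "v i" "q i"] by simp
    qed
    ultimately show "\<exists>e\<in>carcs \<Gamma>. len \<Gamma> e = \<infinity> \<and> m = slope \<Gamma> g e \<and> (\<forall>i<n. sv ?s i = slope \<Gamma> (\<lambda>x. F x i) e)"
      using e l by blast
  qed
  moreover have "seg_pts ?s = (\<lambda>t. F (ep \<Gamma> e t)) ` icc a b"
  proof (intro equalityI subsetI)
    fix x assume "x \<in> seg_pts ?s"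
    then obtain t where t: "t \<in> icc 0 (b - ereal a)" "x = pt (F (ep \<Gamma> e a)) v t" by (auto simp: seg_pts_def)
    show "x \<in> (\<lambda>t. F (ep \<Gamma> e t)) ` icc a b"
      by (rule image_eqI[of _ _ "a + t"]) (use t F'[OF t(1)] icc_shift in simp_all)
  next
    fix x assume "x \<in> (\<lambda>t. F (ep \<Gamma> e t)) ` icc a b"
    then obtain t where t: "t \<in> icc a b" "x = F (ep \<Gamma> e t)" by auto
    then have "t - a \<in> icc 0 (b - ereal a)" using icc_shift[of "t - a"] by simp
    moreover have "x = pt (F (ep \<Gamma> e a)) v (t - a)" using F'[OF calculation] t by simp
    ultimately show "x \<in> seg_pts ?s" by (simp add: seg_pts_def)
  qed
  ultimately show ?thesis unfolding covered_def by (intro exI[of _ "{?s}"]) simp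
qed

lemma covered_edge:
  assumes e: "e \<in> carcs \<Gamma>" and g: "g \<in> RFun \<Gamma>"
  shows "covered g ((\<lambda>t. F (ep \<Gamma> e t)) ` icc 0 (len \<Gamma> e))"
proof -
  have l: "0 < len \<Gamma> e" using curveD(3)[OF curve e] .
  have g': "pwa (\<lambda>t. g (ep \<Gamma> e t)) (icc 0 (len \<Gamma> e))" "continuous_on (icc 0 (len \<Gamma> e)) (\<lambda>t. g (ep \<Gamma> e t))"
    using g e unfolding RFun_def by auto
  obtain B1 where B1: "finite B1" "\<And>a b. \<lbrakk>0 \<le> a; ereal a < b; b \<le> len \<Gamma> e; ioo a b \<inter> B1 = {}\<rbrakk> \<Longrightarrow>
      \<exists>(m::int) c. \<forall>t\<in>icc a b. g (ep \<Gamma> e t) = of_int m * t + c" using pwa_cont_breaks[OF g'] by blast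
  obtain B2 where B2: "finite B2" "\<And>a b. \<lbrakk>0 \<le> a; ereal a < b; b \<le> len \<Gamma> e; ioo a b \<inter> B2 = {}\<rbrakk> \<Longrightarrow>
      \<exists>q v w. prim n v w \<and> (\<forall>t\<in>icc a b. F (ep \<Gamma> e t) = pt q v t)" using F_primitive[OF e] by blast
  let ?B = "B1 \<union> B2"
  have fB: "finite ?B" using B1 B2 by simp
  have "covered g (\<Union>p\<in>pieces ?B (len \<Gamma> e). (\<lambda>t. F (ep \<Gamma> e t)) ` icc (fst p) (snd p))"
  proof (rule covered_UN[OF finite_pieces[OF fB]])
    fix p assume p: "p \<in> pieces ?B (len \<Gamma> e)"
    obtain a b where ab: "p = (a, b)" by force
    note d = piecesD[OF p[unfolded ab] l]
    have d': "ioo a b \<inter> B1 = {}" "ioo a b \<inter> B2 = {}" using d(4) by blast+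
    obtain m :: int and c where "\<forall>t\<in>icc a b. g (ep \<Gamma> e t) = of_int m * t + c" using B1(2)[OF d(1-3) d'(1)] by blast
    moreover obtain q v w where "prim n v w" "\<forall>t\<in>icc a b. F (ep \<Gamma> e t) = pt q v t" using B2(2)[OF d(1-3) d'(2)] by blast
    ultimately show "covered g ((\<lambda>t. F (ep \<Gamma> e t)) ` icc (fst p) (snd p))" using covered_piece[OF e d(1-3)] ab by simp
  qed
  moreover have "(\<Union>p\<in>pieces ?B (len \<Gamma> e). icc (fst p) (snd p)) = icc 0 (len \<Gamma> e)"
  proof (intro equalityI subsetI)
    fix t assume "t \<in> icc 0 (len \<Gamma> e)"
    then obtain a b where "(a, b) \<in> pieces ?B (len \<Gamma> e)" "t \<in> icc a b" using pieces_cover[OF fB l] by blast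
    then show "t \<in> (\<Union>p\<in>pieces ?B (len \<Gamma> e). icc (fst p) (snd p))" by force
  next
    fix t assume "t \<in> (\<Union>p\<in>pieces ?B (len \<Gamma> e). icc (fst p) (snd p))"
    then obtain a b where ab: "(a, b) \<in> pieces ?B (len \<Gamma> e)" "t \<in> icc a b" by auto
    then show "t \<in> icc 0 (len \<Gamma> e)" using piecesD[OF ab(1) l] icc_mono by blast
  qed
  ultimately show ?thesis by (simp only: image_UN[symmetric])
qed

lemma finite_points_cover:
  "finite_points \<Gamma> = (\<Union>e\<in>carcs \<Gamma>. ep \<Gamma> e ` icc 0 (len \<Gamma> e)) \<union> (\<Union>v\<in>{v\<in>cverts \<Gamma>. Vert v \<in> finite_points \<Gamma>}. {Vert v})"
proof (intro equalityI subsetI)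
  fix x assume x: "x \<in> finite_points \<Gamma>"
  then show "x \<in> (\<Union>e\<in>carcs \<Gamma>. ep \<Gamma> e ` icc 0 (len \<Gamma> e)) \<union> (\<Union>v\<in>{v\<in>cverts \<Gamma>. Vert v \<in> finite_points \<Gamma>}. {Vert v})"
  proof (cases rule: finite_pointsD[OF curve x])
    case (2 e t)
    then have "t \<in> icc 0 (len \<Gamma> e)" "x = ep \<Gamma> e t" by (auto simp: icc_def)
    then show ?thesis using 2(2) by blast
  qed auto
next
  fix x assume "x \<in> (\<Union>e\<in>carcs \<Gamma>. ep \<Gamma> e ` icc 0 (len \<Gamma> e)) \<union> (\<Union>v\<in>{v\<in>cverts \<Gamma>. Vert v \<in> finite_points \<Gamma>}. {Vert v})"
  then show "x \<in> finite_points \<Gamma>" using ep_finite_point[OF curve] by blast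
qed

lemma covered_V: assumes "g \<in> RFun \<Gamma>" shows "covered g V"
proof -
  have "V = (\<Union>e\<in>carcs \<Gamma>. (\<lambda>t. F (ep \<Gamma> e t)) ` icc 0 (len \<Gamma> e)) \<union> (\<Union>v\<in>{v\<in>cverts \<Gamma>. Vert v \<in> finite_points \<Gamma>}. {F (Vert v)})"
    by (subst finite_points_cover) (simp add: image_Un image_UN image_image)
  moreover have "covered g \<dots>"
    by (intro covered_Un covered_UN covered_edge covered_vertex) (use assms curveD(6,7)[OF curve] in auto)
  ultimately show ?thesis by simp
qed

lemma V_seg_union: "seg_union n V"
proof -
  have "covered (\<lambda>_. 0) V" by (rule covered_V[OF RFun_const])
  then obtain \<S> where S: "finite \<S>" "\<And>s. s \<in> \<S> \<Longrightarrow> good (\<lambda>_. 0) s" "\<Union>(seg_pts ` \<S>) = V"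
    unfolding covered_def by blast
  then have "\<forall>s\<in>\<S>. seg_ok n s" unfolding good_def by blast
  then show ?thesis unfolding seg_union_def using S(1) S(3)[symmetric] by (intro exI[of _ \<S> ] conjI)
qed

lemma V_nonempty: "V \<noteq> {}" using finite_points_nonempty[OF curve] by simp

text \<open>The transported function is affine on each of finitely many segments, and rays in the
  same direction come from edges on which \<open>g\<close> has the same slope at infinity, so the
  extension property applies.\<close>

lemma surjective:
  assumes g: "g \<in> RFun \<Gamma>" "slope_compatible \<Gamma> par g"
  shows "\<exists>h\<in>PL n. \<forall>x\<in>finite_points \<Gamma>. h (F x) = g x"
proof -
  obtain \<S> where S: "finite \<S>" "\<forall>s\<in>\<S>. good g s" "\<Union>(seg_pts ` \<S>) = V" using covered_V[OF g(1)] unfolding covered_def by blast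
  let ?g = "\<lambda>y. g (inv_into (finite_points \<Gamma>) F y)"
  obtain m c where mc: "\<And>s. s \<in> \<S> \<Longrightarrow> seg_ok n s \<and> (\<forall>t\<in>icc 0 (sl s). ?g (pt (sp s) (sv s) t) = real_of_int (m s) * t + c s) \<and>
     (sl s = \<infinity> \<longrightarrow> (\<exists>e\<in>carcs \<Gamma>. len \<Gamma> e = \<infinity> \<and> m s = slope \<Gamma> g e \<and> (\<forall>i<n. sv s i = slope \<Gamma> (\<lambda>x. F x i) e)))"
    using S(2) unfolding good_def by metis
  have "\<exists>h\<in>PL n. \<forall>x\<in>\<Union>(seg_pts ` \<S>). h x = ?g x"
  proof (rule extension[OF S(1)])
    show "\<S> \<noteq> {}" using S(3) V_nonempty by auto
    show "seg_ok n s" if "s \<in> \<S>" for s using mc[OF that] by blast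
    show "?g (pt (sp s) (sv s) t) = real_of_int (m s) * t + c s" if "s \<in> \<S>" "t \<in> icc 0 (sl s)" for s t using mc that by blast
    show "m s = m r" if sr: "s \<in> \<S>" "r \<in> \<S>" "sl s = \<infinity>" "sl r = \<infinity>" "sv s = sv r" for s r
    proof -
      obtain e1 where e1: "e1 \<in> carcs \<Gamma>" "len \<Gamma> e1 = \<infinity>" "m s = slope \<Gamma> g e1" "\<forall>i<n. sv s i = slope \<Gamma> (\<lambda>x. F x i) e1"
        using mc[OF sr(1)] sr(3) by blast
      obtain e2 where e2: "e2 \<in> carcs \<Gamma>" "len \<Gamma> e2 = \<infinity>" "m r = slope \<Gamma> g e2" "\<forall>i<n. sv r i = slope \<Gamma> (\<lambda>x. F x i) e2"
        using mc[OF sr(2)] sr(4) by blast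
      show ?thesis using F_separates[OF e1(1) e2(1) e1(2) e2(2) _ g] e1 e2 sr(5) by metis
    qed
  qed
  then obtain h where "h \<in> PL n" "\<forall>x\<in>V. h x = ?g x" unfolding S(3) by blast
  then show ?thesis using inv_F by (intro bexI[of _ h]) auto
qed

lemma pullback_RFun: assumes "h \<in> PL n" shows "(\<lambda>x. h (F x)) \<in> RFun \<Gamma>"
  unfolding RFun_def
proof (intro CollectI ballI conjI)
  fix e assume e: "e \<in> carcs \<Gamma>"
  have F: "pwa (\<lambda>t. F (ep \<Gamma> e t) i) (icc 0 (len \<Gamma> e))" "continuous_on (icc 0 (len \<Gamma> e)) (\<lambda>t. F (ep \<Gamma> e t) i)" if "i < n" for i
    using F_RFun[OF that] e unfolding RFun_def by auto
  show "pwa (\<lambda>t. h (F (ep \<Gamma> e t))) (icc 0 (len \<Gamma> e))" by (rule PL_pwa[OF assms is_interval_icc F(1)])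
  show "continuous_on (icc 0 (len \<Gamma> e)) (\<lambda>t. h (F (ep \<Gamma> e t)))" by (rule PL_continuous_on[OF assms F(2)])
qed

text \<open>Along rays in the same direction an integral piecewise linear function has the same slope at
  infinity, because the rays stay within bounded distance and the function is Lipschitz.\<close>

lemma same_direction_same_slope:
  assumes h: "h \<in> PL n" and e: "e1 \<in> carcs \<Gamma>" "e2 \<in> carcs \<Gamma>" "len \<Gamma> e1 = \<infinity>" "len \<Gamma> e2 = \<infinity>"
    and eq: "\<And>i. i < n \<Longrightarrow> slope \<Gamma> (\<lambda>x. F x i) e1 = slope \<Gamma> (\<lambda>x. F x i) e2"
  shows "slope \<Gamma> (\<lambda>x. h (F x)) e1 = slope \<Gamma> (\<lambda>x. h (F x)) e2"
proof -
  obtain m1 c1 where m1: "end_affine (\<lambda>t. h (F (ep \<Gamma> e1 t))) m1 c1" using RFun_end_affine[OF curve pullback_RFun[OF h] e(1,3)] by blast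
  obtain m2 c2 where m2: "end_affine (\<lambda>t. h (F (ep \<Gamma> e2 t))) m2 c2" using RFun_end_affine[OF curve pullback_RFun[OF h] e(2,4)] by blast
  have "\<exists>d. \<forall>\<^sub>F t in at_top. F (ep \<Gamma> e1 t) i - F (ep \<Gamma> e2 t) i = d" if i: "i < n" for i
  proof -
    obtain k1 d1 where k1: "end_affine (\<lambda>t. F (ep \<Gamma> e1 t) i) k1 d1" using RFun_end_affine[OF curve F_RFun[OF i] e(1,3)] by blast
    obtain k2 d2 where k2: "end_affine (\<lambda>t. F (ep \<Gamma> e2 t) i) k2 d2" using RFun_end_affine[OF curve F_RFun[OF i] e(2,4)] by blast
    have "k1 = k2" using slope_eqI[of "\<lambda>x. F x i" \<Gamma> e1] slope_eqI[of "\<lambda>x. F x i" \<Gamma> e2] k1 k2 eq[OF i] by metis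
    have "\<forall>\<^sub>F t in at_top. F (ep \<Gamma> e1 t) i = of_int k1 * t + d1" "\<forall>\<^sub>F t in at_top. F (ep \<Gamma> e2 t) i = of_int k2 * t + d2"
      using k1 k2 unfolding end_affine_def eventually_at_top_linorder by auto
    then have "\<forall>\<^sub>F t in at_top. F (ep \<Gamma> e1 t) i - F (ep \<Gamma> e2 t) i = d1 - d2"
      by eventually_elim (simp add: \<open>k1 = k2\<close>)
    then show ?thesis by blast
  qed
  then obtain d where d: "\<And>i. i < n \<Longrightarrow> \<forall>\<^sub>F t in at_top. F (ep \<Gamma> e1 t) i - F (ep \<Gamma> e2 t) i = d i" by metis
  obtain L where L: "L \<ge> 0" "\<forall>x y. \<bar>h x - h y\<bar> \<le> L * l1 n x y" using PL_lipschitz[OF h] by blast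
  have "\<forall>\<^sub>F t in at_top. \<forall>i\<in>{..<n}. F (ep \<Gamma> e1 t) i - F (ep \<Gamma> e2 t) i = d i"
    by (intro eventually_ball_finite) (use d in auto)
  moreover have "\<forall>\<^sub>F t in at_top. h (F (ep \<Gamma> e1 t)) = of_int m1 * t + c1" "\<forall>\<^sub>F t in at_top. h (F (ep \<Gamma> e2 t)) = of_int m2 * t + c2"
    using m1 m2 unfolding end_affine_def eventually_at_top_linorder by auto
  ultimately have "\<forall>\<^sub>F t in at_top. \<bar>(of_int m1 * t + c1) - (of_int m2 * t + c2)\<bar> \<le> L * (\<Sum>i<n. \<bar>d i\<bar>)"
  proof eventually_elim
    case (elim t)
    have "l1 n (F (ep \<Gamma> e1 t)) (F (ep \<Gamma> e2 t)) = (\<Sum>i<n. \<bar>d i\<bar>)" unfolding l1_def using elim(1) by simp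
    then show ?case using L(2)[rule_format, of "F (ep \<Gamma> e1 t)" "F (ep \<Gamma> e2 t)"] elim by simp
  qed
  then obtain T where T: "\<And>t. t \<ge> T \<Longrightarrow> \<bar>(of_int m1 * t + c1) - (of_int m2 * t + c2)\<bar> \<le> L * (\<Sum>i<n. \<bar>d i\<bar>)"
    unfolding eventually_at_top_linorder by blast
  define K where "K = L * (\<Sum>i<n. \<bar>d i\<bar>)"
  define b where "b = of_int m1 * T + c1 - (of_int m2 * T + c2)"
  have bd: "\<bar>b + t * of_int (m1 - m2)\<bar> \<le> K" if "t \<ge> 0" for t
    using T[of "T + t"] that unfolding K_def b_def by (simp add: algebra_simps)
  have "real_of_int (m1 - m2) \<le> 0" by (rule bounded_affine_nonpos[of b _ K]) (use bd in \<open>auto simp: abs_le_iff\<close>)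
  moreover have "- real_of_int (m1 - m2) \<le> 0"
  proof (rule bounded_affine_nonpos[of "- b" _ K])
    fix t :: real assume "0 \<le> t"
    have "- b + t * - real_of_int (m1 - m2) = - (b + t * real_of_int (m1 - m2))" by (simp add: algebra_simps)
    then show "- b + t * - real_of_int (m1 - m2) \<le> K" using bd[OF \<open>0 \<le> t\<close>] by linarith
  qed
  ultimately have "m1 = m2" by linarith
  then show ?thesis using slope_eqI[of "\<lambda>x. h (F x)" \<Gamma> e1 m1 c1] slope_eqI[of "\<lambda>x. h (F x)" \<Gamma> e2 m2 c2] m1 m2 by simp
qed

lemma pullback_compatible: assumes "h \<in> PL n" shows "slope_compatible \<Gamma> par (\<lambda>x. h (F x))"
  unfolding slope_compatible_def
proof (intro ballI, clarify)
  fix L1 L2 e1 e2 assume *: "(L1, L2) \<in> par" "tail_in \<Gamma> e1 L1" "tail_in \<Gamma> e2 L2"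
  show "slope \<Gamma> (\<lambda>x. h (F x)) e1 = slope \<Gamma> (\<lambda>x. h (F x)) e2"
  proof (rule same_direction_same_slope[OF assms])
    show "slope \<Gamma> (\<lambda>x. F x i) e1 = slope \<Gamma> (\<lambda>x. F x i) e2" if "i < n" for i
      using F_compatible[OF that] * unfolding slope_compatible_def by blast
  qed (use * in \<open>auto simp: tail_in_def\<close>)
qed

text \<open>Restriction of tropical rational functions to the image of the curve.\<close>

definition \<kappa> :: "((nat \<Rightarrow> real) \<Rightarrow> ereal) \<Rightarrow> point \<Rightarrow> ereal" where
  "\<kappa> h = (if h = neginf n then Rat_neginf \<Gamma> else ext \<Gamma> (\<lambda>x. real_of_ereal (h (F x))))"

lemma \<kappa>_simps: "\<kappa> (neginf n) = Rat_neginf \<Gamma>" "\<kappa> (emb n a) = ext \<Gamma> (\<lambda>x. a (F x))"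
  unfolding \<kappa>_def using emb_neq_neginf[of n a] F_Rn by (auto simp: emb_def)

lemma \<kappa>_carrier: "h \<in> carrier (trop_rat n) \<Longrightarrow> \<kappa> h \<in> carrier (Rat_par \<Gamma> par)"
  unfolding carrier_Rat_par[OF curve_par] carrier_trop_rat
  using pullback_RFun pullback_compatible by (auto simp: \<kappa>_simps)

lemma \<kappa>_surj: "\<kappa> \<in> T_algebra_surj (trop_rat n) (trop_rat_const n) (Rat_par \<Gamma> par) (Rat_const \<Gamma>)"
  unfolding T_algebra_surj_def
proof (intro CollectI conjI)
  note R = Rat_par_simps[OF curve]
  show "\<kappa> \<in> T_algebra_hom (trop_rat n) (trop_rat_const n) (Rat_par \<Gamma> par) (Rat_const \<Gamma>)"
  proof (rule T_algebra_homI)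
    fix f g assume fg: "f \<in> carrier (trop_rat n)" "g \<in> carrier (trop_rat n)"
    show "\<kappa> (f \<otimes>\<^bsub>trop_rat n\<^esub> g) = \<kappa> f \<otimes>\<^bsub>Rat_par \<Gamma> par\<^esub> \<kappa> g"
      by (rule trop_rat_cases[OF fg(1)]; rule trop_rat_cases[OF fg(2)])
         (simp_all add: \<kappa>_simps trop_rat_simps R pullback_RFun R(5)[OF RFun_const[of 0] RFun_const[of 0]] R(3,4)[OF _ RFun_const[of 0]])
    show "\<kappa> (f \<oplus>\<^bsub>trop_rat n\<^esub> g) = \<kappa> f \<oplus>\<^bsub>Rat_par \<Gamma> par\<^esub> \<kappa> g"
      by (rule trop_rat_cases[OF fg(1)]; rule trop_rat_cases[OF fg(2)])
         (simp_all add: \<kappa>_simps trop_rat_simps R pullback_RFun R(8)[OF RFun_const[of 0] RFun_const[of 0]] R(6,7)[OF _ RFun_const[of 0]])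
  next
    show "\<kappa> \<one>\<^bsub>trop_rat n\<^esub> = \<one>\<^bsub>Rat_par \<Gamma> par\<^esub>" "\<kappa> \<zero>\<^bsub>trop_rat n\<^esub> = \<zero>\<^bsub>Rat_par \<Gamma> par\<^esub>"
      by (simp_all add: trop_rat_simps \<kappa>_simps R(9,10)[OF RFun_const[of 0] RFun_const[of 0]])
    show "\<kappa> (trop_rat_const n a) = Rat_const \<Gamma> a" if "a \<noteq> \<infinity>" for a
      using that by (cases a) (simp_all add: trop_rat_const_simps \<kappa>_simps Rat_const_eq[OF curve])
  qed (rule \<kappa>_carrier)
  show "\<kappa> ` carrier (trop_rat n) = carrier (Rat_par \<Gamma> par)"
  proof
    show "\<kappa> ` carrier (trop_rat n) \<subseteq> carrier (Rat_par \<Gamma> par)" using \<kappa>_carrier by blast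
    show "carrier (Rat_par \<Gamma> par) \<subseteq> \<kappa> ` carrier (trop_rat n)"
    proof
      fix f assume "f \<in> carrier (Rat_par \<Gamma> par)"
      then consider "f = Rat_neginf \<Gamma>" | g where "f = ext \<Gamma> g" "g \<in> RFun \<Gamma>" "slope_compatible \<Gamma> par g"
        unfolding carrier_Rat_par[OF curve_par] by blast
      then show "f \<in> \<kappa> ` carrier (trop_rat n)"
      proof cases
        case 1 then show ?thesis using \<kappa>_simps(1) neginf_carrier by (metis image_eqI)
      next
        case 2
        then obtain h where h: "h \<in> PL n" "\<forall>x\<in>finite_points \<Gamma>. h (F x) = g x" using surjective by blast
        then have "\<kappa> (emb n h) = f" using 2 ext_eq_iff[OF curve] by (simp add: \<kappa>_simps)
        then show ?thesis using emb_carrier[OF h(1)] by blast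
      qed
    qed
  qed
qed

lemma \<kappa>_Ker: "Ker (trop_rat n) \<kappa> = cong_of n V"
proof -
  obtain x0 where x0: "x0 \<in> finite_points \<Gamma>" using finite_points_nonempty[OF curve] by blast
  have "\<kappa> f = \<kappa> g \<longleftrightarrow> (\<forall>y\<in>V. f y = g y)" if f: "f \<in> carrier (trop_rat n)" and g: "g \<in> carrier (trop_rat n)" for f g
  proof (rule trop_rat_cases[OF f]; rule trop_rat_cases[OF g])
    fix a assume "f = neginf n" "g = emb n a"
    then have "\<kappa> f \<noteq> \<kappa> g" using ext_neq_neginf[OF curve, symmetric] by (simp add: \<kappa>_simps)
    moreover have "f (F x0) \<noteq> g (F x0)" using \<open>f = _\<close> \<open>g = _\<close> F_Rn by (simp add: emb_def)
    ultimately show ?thesis using x0 by blast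
  next
    fix a assume "g = neginf n" "f = emb n a"
    then have "\<kappa> f \<noteq> \<kappa> g" using ext_neq_neginf[OF curve] by (simp add: \<kappa>_simps)
    moreover have "f (F x0) \<noteq> g (F x0)" using \<open>f = _\<close> \<open>g = _\<close> F_Rn by (simp add: emb_def)
    ultimately show ?thesis using x0 by blast
  next
    fix a b assume "f = emb n a" "g = emb n b"
    then have "\<kappa> f = \<kappa> g \<longleftrightarrow> (\<forall>x\<in>finite_points \<Gamma>. a (F x) = b (F x))" by (simp add: \<kappa>_simps ext_eq_iff[OF curve])
    also have "\<dots> \<longleftrightarrow> (\<forall>y\<in>V. f y = g y)" using \<open>f = _\<close> \<open>g = _\<close> F_Rn by (simp add: emb_def)
    finally show ?thesis .
  qed auto
  then show ?thesis unfolding Ker_def cong_of_def by blast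
qed

subsection \<open>Connectedness\<close>

lemma edge_connected:
  assumes e: "e \<in> carcs \<Gamma>" and st: "s \<in> icc 0 (len \<Gamma> e)" "t \<in> icc 0 (len \<Gamma> e)"
  shows "connected_component_of (subtopology (Euclidean_space n) V) (F (ep \<Gamma> e s)) (F (ep \<Gamma> e t))"
proof -
  let ?I = "icc 0 (len \<Gamma> e)"
  have "continuous_map (top_of_set ?I) (Euclidean_space n) (\<lambda>t. F (ep \<Gamma> e t))"
    by (rule continuous_map_into_Euclidean_space) (use F_RFun e F_Rn in \<open>auto simp: RFun_def continuous_map_iff_continuous\<close>)
  moreover have "connectedin (top_of_set ?I) ?I"
    by (simp add: connectedin_subtopology is_interval_connected)
  ultimately have "connectedin (Euclidean_space n) ((\<lambda>t. F (ep \<Gamma> e t)) ` ?I)" by (rule connectedin_continuous_map_image)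
  moreover have "(\<lambda>t. F (ep \<Gamma> e t)) ` ?I \<subseteq> V" using ep_finite_point[OF curve e] by blast
  ultimately have "connectedin (subtopology (Euclidean_space n) V) ((\<lambda>t. F (ep \<Gamma> e t)) ` ?I)"
    by (simp add: connectedin_subtopology)
  then show ?thesis unfolding connected_component_of_def using st by blast
qed

text \<open>A leaf at infinity is represented by the other end of its edge.\<close>

definition anchor :: "nat \<Rightarrow> nat" where
  "anchor u = (if \<exists>e\<in>carcs \<Gamma>. len \<Gamma> e = \<infinity> \<and> u = chead \<Gamma> e
     then ctail \<Gamma> (SOME e. e \<in> carcs \<Gamma> \<and> len \<Gamma> e = \<infinity> \<and> u = chead \<Gamma> e) else u)"

lemma anchor_head: assumes "e \<in> carcs \<Gamma>" "len \<Gamma> e = \<infinity>" shows "anchor (chead \<Gamma> e) = ctail \<Gamma> e"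
proof -
  have "(SOME e'. e' \<in> carcs \<Gamma> \<and> len \<Gamma> e' = \<infinity> \<and> chead \<Gamma> e = chead \<Gamma> e') = e"
    by (rule some_equality) (use assms curveD(11)[OF curve] in auto)
  then show ?thesis unfolding anchor_def using assms by auto
qed

lemma anchor_finite: assumes "Vert u \<in> finite_points \<Gamma>" shows "anchor u = u"
proof -
  have "\<not> (\<exists>e\<in>carcs \<Gamma>. len \<Gamma> e = \<infinity> \<and> u = chead \<Gamma> e)" using assms head_infinite[of _ \<Gamma>] by blast
  then show ?thesis unfolding anchor_def by (simp only: if_False)
qed

lemma anchor_step:
  assumes e: "e \<in> carcs \<Gamma>"
  shows "connected_component_of (subtopology (Euclidean_space n) V) (F (Vert (anchor (ctail \<Gamma> e)))) (F (Vert (anchor (chead \<Gamma> e))))"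
proof -
  have l: "0 < len \<Gamma> e" using curveD(3)[OF curve e] .
  then have 0: "0 \<in> icc 0 (len \<Gamma> e)" by (simp add: icc_def zero_ereal_def[symmetric])
  have t: "anchor (ctail \<Gamma> e) = ctail \<Gamma> e" by (rule anchor_finite) (use ep_finite_point[OF curve e 0] in simp)
  show ?thesis
  proof (cases "len \<Gamma> e")
    case (real L)
    then have L: "L \<in> icc 0 (len \<Gamma> e)" "L \<noteq> 0" using l by (auto simp: icc_def)
    then have ep: "ep \<Gamma> e L = Vert (chead \<Gamma> e)" using real by simp
    have "anchor (chead \<Gamma> e) = chead \<Gamma> e" by (rule anchor_finite) (use ep_finite_point[OF curve e L(1)] ep in simp)
    then show ?thesis using edge_connected[OF e 0 L(1)] ep t by simp
  next
    case PInf
    then show ?thesis using edge_connected[OF e 0 0] anchor_head[OF e PInf] t by simp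
  qed (use l in auto)
qed

lemma V_connected: "connectedin (Euclidean_space n) V"
proof -
  let ?X = "subtopology (Euclidean_space n) V"
  have VR: "V \<subseteq> Rn n" using F_Rn by blast
  have path: "connected_component_of ?X (F (Vert (anchor u))) (F (Vert (anchor v)))"
    if uv: "(u, v) \<in> rtrancl_on (cverts \<Gamma>) ((arcs_ends (fst \<Gamma>))\<^sup>s)" "Vert u \<in> finite_points \<Gamma>" for u v
    using uv
  proof (induction rule: rtrancl_on.induct)
    case (rtrancl_on_refl a)
    then have "F (Vert (anchor a)) \<in> topspace ?X" using anchor_finite VR by auto
    then show ?case by (simp add: connected_component_of_refl)
  next
    case (rtrancl_on_into_rtrancl_on a b c)
    from rtrancl_on_into_rtrancl_on(2) obtain e where "e \<in> carcs \<Gamma>" "(b, c) = (ctail \<Gamma> e, chead \<Gamma> e) \<or> (c, b) = (ctail \<Gamma> e, chead \<Gamma> e)"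
      unfolding symcl_def arcs_ends_def arc_to_ends_def by auto
    then have "connected_component_of ?X (F (Vert (anchor b))) (F (Vert (anchor c)))"
      using anchor_step connected_component_of_sym by (metis prod.inject)
    then show ?case using rtrancl_on_into_rtrancl_on connected_component_of_trans by metis
  qed
  have vert: "connected_component_of ?X (F (Vert u)) (F (Vert v))" if "Vert u \<in> finite_points \<Gamma>" "Vert v \<in> finite_points \<Gamma>" for u v
  proof -
    have "u \<in> cverts \<Gamma>" "v \<in> cverts \<Gamma>" using that finite_points_subset unfolding points_eq by blast+
    then have "(u, v) \<in> rtrancl_on (cverts \<Gamma>) ((arcs_ends (fst \<Gamma>))\<^sup>s)" using curveD(2)[OF curve] unfolding connected_conv by blast
    then show ?thesis using path[of u v] that anchor_finite by simp
  qed
  have near: "\<exists>v. Vert v \<in> finite_points \<Gamma> \<and> connected_component_of ?X (F x) (F (Vert v))" if x: "x \<in> finite_points \<Gamma>" for x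
  proof (cases rule: finite_pointsD[OF curve x])
    case (1 v)
    then have "F (Vert v) \<in> topspace ?X" using x VR by auto
    then show ?thesis using 1 x by (auto simp: connected_component_of_refl)
  next
    case (2 e t)
    have 0: "0 \<in> icc 0 (len \<Gamma> e)" using curveD(3)[OF curve 2(2)] by (simp add: icc_def zero_ereal_def[symmetric])
    have "t \<in> icc 0 (len \<Gamma> e)" using 2 by (auto simp: icc_def)
    then show ?thesis using edge_connected[OF 2(2) _ 0] ep_finite_point[OF curve 2(2) 0] 2 by (metis ep_simps(1,3))
  qed
  have "connected_component_of ?X y z" if yz: "y \<in> V" "z \<in> V" for y z
  proof -
    obtain x x' where x: "y = F x" "x \<in> finite_points \<Gamma>" "z = F x'" "x' \<in> finite_points \<Gamma>" using yz by blast
    obtain v where v: "Vert v \<in> finite_points \<Gamma>" "connected_component_of ?X (F x) (F (Vert v))" using near[OF x(2)] by blast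
    obtain v' where v': "Vert v' \<in> finite_points \<Gamma>" "connected_component_of ?X (F x') (F (Vert v'))" using near[OF x(4)] by blast
    have "connected_component_of ?X (F (Vert v')) (F x')" using v'(2) by (subst connected_component_of_sym)
    then show ?thesis unfolding x(1,3)
      by (rule connected_component_of_trans[OF connected_component_of_trans[OF v(2) vert[OF v(1) v'(1)]]])
  qed
  moreover have "topspace ?X = V" using VR by auto
  ultimately have "connected_space ?X" unfolding connected_space_iff_connected_component by simp
  then show ?thesis unfolding connectedin_def using VR by simp
qed

end

section \<open>Every curve with parallel rays has a realization\<close>

lemma pwa_min: assumes "pwa f D" "pwa g D" shows "pwa (\<lambda>t. min (f t) (g t)) D"
proof -
  have "(\<lambda>t. min (f t) (g t)) = (\<lambda>t. - max (- f t) (- g t))" by (auto simp: min_def max_def)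
  then show ?thesis using pwa_neg[OF pwa_max[OF pwa_neg[OF assms(1)] pwa_neg[OF assms(2)]]] by simp
qed

lemma pwa_line: "is_interval D \<Longrightarrow> pwa (\<lambda>t. of_int m * t + c) D"
  by (rule pwa_affine) auto

lemma pwa_const: "is_interval D \<Longrightarrow> pwa (\<lambda>t. c) D"
  using pwa_line[of D 0 c] by simp

lemma pwa_id: "is_interval D \<Longrightarrow> pwa (\<lambda>t. t) D"
  using pwa_line[of D 1 0] by simp

lemma RFunI:
  assumes "\<And>e. e \<in> carcs \<Gamma> \<Longrightarrow> \<exists>\<phi>. (\<forall>t\<in>icc 0 (len \<Gamma> e). g (ep \<Gamma> e t) = \<phi> t) \<and>
     pwa \<phi> (icc 0 (len \<Gamma> e)) \<and> continuous_on (icc 0 (len \<Gamma> e)) \<phi>"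
  shows "g \<in> RFun \<Gamma>"
  unfolding RFun_def
proof (intro CollectI ballI conjI)
  fix e assume "e \<in> carcs \<Gamma>"
  then obtain \<phi> where \<phi>: "\<forall>t\<in>icc 0 (len \<Gamma> e). g (ep \<Gamma> e t) = \<phi> t"
     "pwa \<phi> (icc 0 (len \<Gamma> e))" "continuous_on (icc 0 (len \<Gamma> e)) \<phi>" using assms by blast
  show "pwa (\<lambda>t. g (ep \<Gamma> e t)) (icc 0 (len \<Gamma> e))" by (rule pwa_cong[OF \<phi>(2)]) (use \<phi>(1) in auto)
  show "continuous_on (icc 0 (len \<Gamma> e)) (\<lambda>t. g (ep \<Gamma> e t))"
    by (rule continuous_on_eq[OF \<phi>(3)]) (use \<phi>(1) in auto)
qed

fun edge_fun :: "(nat \<Rightarrow> real \<Rightarrow> real) \<Rightarrow> point \<Rightarrow> real" where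
  "edge_fun \<phi> (Vert v) = 0"
| "edge_fun \<phi> (Inner e t) = \<phi> e t"

lemma icc_cases:
  assumes "t \<in> icc 0 (len \<Gamma> e)"
  obtains "t = 0" | "len \<Gamma> e = ereal t" "t > 0" | "0 < t" "ereal t < len \<Gamma> e"
  using assms unfolding icc_def by fastforce

lemma edge_fun_ep:
  assumes "t \<in> icc 0 (len \<Gamma> e)" "\<phi> e 0 = 0" "\<And>L. len \<Gamma> e = ereal L \<Longrightarrow> \<phi> e L = 0"
  shows "edge_fun \<phi> (ep \<Gamma> e t) = \<phi> e t"
  by (rule icc_cases[OF assms(1)]) (use assms(2,3) in auto)

text \<open>A function may be prescribed on each edge separately if it vanishes at the ends.\<close>

lemma edge_fun_RFun:
  assumes "\<And>e. e \<in> carcs \<Gamma> \<Longrightarrow> pwa (\<phi> e) (icc 0 (len \<Gamma> e))" "\<And>e. e \<in> carcs \<Gamma> \<Longrightarrow> continuous_on (icc 0 (len \<Gamma> e)) (\<phi> e)"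
    "\<And>e. e \<in> carcs \<Gamma> \<Longrightarrow> \<phi> e 0 = 0" "\<And>e L. e \<in> carcs \<Gamma> \<Longrightarrow> len \<Gamma> e = ereal L \<Longrightarrow> \<phi> e L = 0"
  shows "edge_fun \<phi> \<in> RFun \<Gamma>"
  by (rule RFunI) (use assms edge_fun_ep[of _ \<Gamma> _ \<phi>] in blast)

lemma single_edge_fun_RFun:
  assumes "pwa \<phi> (icc 0 (len \<Gamma> e0))" "continuous_on (icc 0 (len \<Gamma> e0)) \<phi>"
    "\<phi> 0 = 0" "\<And>L. len \<Gamma> e0 = ereal L \<Longrightarrow> \<phi> L = 0"
  shows "edge_fun (\<lambda>e t. if e = e0 then \<phi> t else 0) \<in> RFun \<Gamma>"
proof (rule edge_fun_RFun)
  fix e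
  show "pwa (\<lambda>t. if e = e0 then \<phi> t else 0) (icc 0 (len \<Gamma> e))"
    using assms(1) by (cases "e = e0") (simp_all add: pwa_const)
  show "continuous_on (icc 0 (len \<Gamma> e)) (\<lambda>t. if e = e0 then \<phi> t else 0)"
    using assms(2) by (cases "e = e0") simp_all
qed (use assms(3,4) in auto)

lemma zero_slopeI: "(\<And>t. t \<ge> T \<Longrightarrow> u t = c) \<Longrightarrow> \<exists>c. end_affine u 0 c"
  unfolding end_affine_def by auto

lemma zero_slope_compatible:
  assumes "\<And>e. e \<in> carcs \<Gamma> \<Longrightarrow> len \<Gamma> e = \<infinity> \<Longrightarrow> \<exists>c. end_affine (\<lambda>t. g (ep \<Gamma> e t)) 0 c"
  shows "slope_compatible \<Gamma> par g"
proof -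
  have "slope \<Gamma> g e = 0" if "e \<in> carcs \<Gamma>" "len \<Gamma> e = \<infinity>" for e
    using assms[OF that] slope_eqI[of g \<Gamma> e 0] by blast
  then show ?thesis unfolding slope_compatible_def tail_in_def by fastforce
qed

context
  fixes \<Gamma> :: curve and par :: "(point set \<times> point set) set"
  assumes curve_par: "is_curve_with_parallel_rays \<Gamma> par"
begin

lemma curve: "is_curve \<Gamma>" using curve_par unfolding is_curve_with_parallel_rays_def by auto

definition arc_len :: "nat \<Rightarrow> real" where "arc_len e = real_of_ereal (len \<Gamma> e)"

lemma arc_len: "e \<in> carcs \<Gamma> \<Longrightarrow> len \<Gamma> e \<noteq> \<infinity> \<Longrightarrow> len \<Gamma> e = ereal (arc_len e)" "e \<in> carcs \<Gamma> \<Longrightarrow> len \<Gamma> e \<noteq> \<infinity> \<Longrightarrow> 0 < arc_len e"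
  using curveD(3)[OF curve, of e] unfolding arc_len_def by (cases "len \<Gamma> e"; auto)+

text \<open>Not larger than any finite edge, so that a bump of height \<open>\<delta>\<close> around
  one vertex vanishes at the others.\<close>

definition \<delta> :: real where "\<delta> = Min (insert 1 (arc_len ` {e\<in>carcs \<Gamma>. len \<Gamma> e \<noteq> \<infinity>}))"

lemma \<delta>: "0 < \<delta>" "e \<in> carcs \<Gamma> \<Longrightarrow> len \<Gamma> e \<noteq> \<infinity> \<Longrightarrow> \<delta> \<le> arc_len e"
proof -
  have fin: "finite (insert 1 (arc_len ` {e\<in>carcs \<Gamma>. len \<Gamma> e \<noteq> \<infinity>}))" using curveD(6)[OF curve] by auto
  show "0 < \<delta>" unfolding \<delta>_def using fin arc_len(2) by (subst Min_gr_iff) auto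
  show "e \<in> carcs \<Gamma> \<Longrightarrow> len \<Gamma> e \<noteq> \<infinity> \<Longrightarrow> \<delta> \<le> arc_len e" unfolding \<delta>_def using fin by (intro Min_le) auto
qed

definition bump_edge :: "nat \<Rightarrow> nat \<Rightarrow> real \<Rightarrow> real" where
  "bump_edge u e t = max 0 (max (if ctail \<Gamma> e = u then \<delta> - t else 0)
     (if chead \<Gamma> e = u \<and> len \<Gamma> e \<noteq> \<infinity> then \<delta> - (arc_len e - t) else 0))"

fun bump :: "nat \<Rightarrow> point \<Rightarrow> real" where
  "bump u (Vert v) = (if v = u then \<delta> else 0)"
| "bump u (Inner e t) = bump_edge u e t"

lemma bump_ep:
  assumes "e \<in> carcs \<Gamma>" "t \<in> icc 0 (len \<Gamma> e)" shows "bump u (ep \<Gamma> e t) = bump_edge u e t"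
proof (rule icc_cases[OF assms(2)])
  assume "t = 0"
  then show ?thesis using \<delta>(1) \<delta>(2)[OF assms(1)] by (auto simp: bump_edge_def)
next
  assume t: "len \<Gamma> e = ereal t" "t > 0"
  then have "arc_len e = t" by (simp add: arc_len_def)
  then show ?thesis using t \<delta>(1) \<delta>(2)[OF assms(1)] by (auto simp: bump_edge_def)
qed simp

lemma bump_RFun: "bump u \<in> RFun \<Gamma>"
proof (rule RFunI)
  fix e assume e: "e \<in> carcs \<Gamma>"
  have "pwa (\<lambda>t. if c then \<delta> - t else 0) (icc 0 (len \<Gamma> e))" for c
    using pwa_line[of "icc 0 (len \<Gamma> e)" "-1" \<delta>] pwa_const[of "icc 0 (len \<Gamma> e)" 0] by (cases c) auto
  moreover have "pwa (\<lambda>t. if c then \<delta> - (arc_len e - t) else 0) (icc 0 (len \<Gamma> e))" for c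
    using pwa_line[of "icc 0 (len \<Gamma> e)" 1 "\<delta> - arc_len e"] pwa_const[of "icc 0 (len \<Gamma> e)" 0] by (cases c) (auto simp: algebra_simps)
  ultimately have "pwa (bump_edge u e) (icc 0 (len \<Gamma> e))"
    unfolding bump_edge_def[abs_def] by (intro pwa_max pwa_const) auto
  moreover have "continuous_on (icc 0 (len \<Gamma> e)) (\<lambda>t. if c then \<delta> - t else 0)"
     "continuous_on (icc 0 (len \<Gamma> e)) (\<lambda>t. if c then \<delta> - (arc_len e - t) else 0)" for c
    by (cases c; auto intro!: continuous_intros)+
  then have "continuous_on (icc 0 (len \<Gamma> e)) (bump_edge u e)"
    unfolding bump_edge_def[abs_def] by (intro continuous_intros)
  ultimately show "\<exists>\<phi>. (\<forall>t\<in>icc 0 (len \<Gamma> e). bump u (ep \<Gamma> e t) = \<phi> t) \<and>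
     pwa \<phi> (icc 0 (len \<Gamma> e)) \<and> continuous_on (icc 0 (len \<Gamma> e)) \<phi>" using bump_ep[OF e] by blast
qed

lemma bump_compatible: "slope_compatible \<Gamma> par (bump u)"
proof (rule zero_slope_compatible)
  fix e assume e: "e \<in> carcs \<Gamma>" "len \<Gamma> e = \<infinity>"
  have "bump u (ep \<Gamma> e t) = 0" if "t \<ge> \<delta>" for t
    using bump_ep[OF e(1), of t u] that \<delta>(1) e(2) by (simp add: icc_def bump_edge_def)
  then show "\<exists>c. end_affine (\<lambda>t. bump u (ep \<Gamma> e t)) 0 c" by (rule zero_slopeI)
qed

text \<open>Two tents on a finite edge: at every point one of them has slope plus or minus one, and
  together they separate the points.\<close>

definition tent1 :: "nat \<Rightarrow> point \<Rightarrow> real" where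
  "tent1 e0 = edge_fun (\<lambda>e t. if e = e0 then min t (2 * arc_len e - 2 * t) else 0)"
definition tent2 :: "nat \<Rightarrow> point \<Rightarrow> real" where
  "tent2 e0 = edge_fun (\<lambda>e t. if e = e0 then min (2 * t) (arc_len e - t) else 0)"

text \<open>Positive exactly in the interior of the infinite edge \<open>e0\<close>, and constant
  near infinity.\<close>

definition ramp :: "nat \<Rightarrow> point \<Rightarrow> real" where
  "ramp e0 = edge_fun (\<lambda>e t. if e = e0 then min t 1 else 0)"

definition Rel :: "(nat \<times> nat) set" where
  "Rel = {(e1, e2). \<exists>L1 L2. (L1, L2) \<in> par \<and> tail_in \<Gamma> e1 L1 \<and> tail_in \<Gamma> e2 L2}"

text \<open>The coordinate on all infinite edges that are linked to \<open>e0\<close> by a chain of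
  parallel rays. Its slope at infinity is the indicator function of the class of
  \<open>e0\<close>.\<close>

definition class_fun :: "nat \<Rightarrow> point \<Rightarrow> real" where
  "class_fun e0 = edge_fun (\<lambda>e t. if len \<Gamma> e = \<infinity> \<and> (e0, e) \<in> Rel\<^sup>* then t else 0)"

lemma tents:
  assumes "e0 \<in> carcs \<Gamma>" "len \<Gamma> e0 \<noteq> \<infinity>"
  shows "tent1 e0 \<in> RFun \<Gamma>" "tent2 e0 \<in> RFun \<Gamma>"
    "slope_compatible \<Gamma> par (tent1 e0)" "slope_compatible \<Gamma> par (tent2 e0)"
    "t \<in> icc 0 (len \<Gamma> e0) \<Longrightarrow> tent1 e0 (ep \<Gamma> e0 t) = min t (2 * arc_len e0 - 2 * t)"
    "t \<in> icc 0 (len \<Gamma> e0) \<Longrightarrow> tent2 e0 (ep \<Gamma> e0 t) = min (2 * t) (arc_len e0 - t)"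
proof -
  have L: "arc_len e = L" if "len \<Gamma> e = ereal L" for e L using that by (simp add: arc_len_def)
  have p: "pwa (\<lambda>t. min t (2 * L - 2 * t)) (icc 0 l)" "pwa (\<lambda>t. min (2 * t) (L - t)) (icc 0 l)" for L l
    using pwa_min[OF pwa_id pwa_line[of "icc 0 l" "-2" "2*L"]] pwa_min[OF pwa_line[of "icc 0 l" 2 0] pwa_line[of "icc 0 l" "-1" L]]
    by (auto simp: algebra_simps)
  have eq: "(\<lambda>e t. if e = e0 then min t (2 * arc_len e - 2 * t) else 0) = (\<lambda>e t. if e = e0 then min t (2 * arc_len e0 - 2 * t) else 0)"
    "(\<lambda>e t. if e = e0 then min (2 * t) (arc_len e - t) else 0) = (\<lambda>e t. if e = e0 then min (2 * t) (arc_len e0 - t) else 0)"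
    by (auto simp: fun_eq_iff)
  have e0: "0 < arc_len e0" using arc_len(2)[OF assms] .
  show "tent1 e0 \<in> RFun \<Gamma>" unfolding tent1_def eq
    by (rule single_edge_fun_RFun[OF p(1)]) (use e0 in \<open>auto intro!: continuous_intros simp: L\<close>)
  show "tent2 e0 \<in> RFun \<Gamma>" unfolding tent2_def eq
    by (rule single_edge_fun_RFun[OF p(2)]) (use e0 in \<open>auto intro!: continuous_intros simp: L\<close>)
  have z: "ep \<Gamma> e t = Inner e t" if "len \<Gamma> e = \<infinity>" "t \<ge> 1" for e t using that by simp
  show "slope_compatible \<Gamma> par (tent1 e0)"
  proof (rule zero_slope_compatible)
    fix e assume e: "e \<in> carcs \<Gamma>" "len \<Gamma> e = \<infinity>"
    have "tent1 e0 (ep \<Gamma> e t) = 0" if "t \<ge> 1" for t using that e assms z by (auto simp: tent1_def)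
    then show "\<exists>c. end_affine (\<lambda>t. tent1 e0 (ep \<Gamma> e t)) 0 c" by (rule zero_slopeI)
  qed
  show "slope_compatible \<Gamma> par (tent2 e0)"
  proof (rule zero_slope_compatible)
    fix e assume e: "e \<in> carcs \<Gamma>" "len \<Gamma> e = \<infinity>"
    have "tent2 e0 (ep \<Gamma> e t) = 0" if "t \<ge> 1" for t using that e assms z by (auto simp: tent2_def)
    then show "\<exists>c. end_affine (\<lambda>t. tent2 e0 (ep \<Gamma> e t)) 0 c" by (rule zero_slopeI)
  qed
  show "tent1 e0 (ep \<Gamma> e0 t) = min t (2 * arc_len e0 - 2 * t)" if "t \<in> icc 0 (len \<Gamma> e0)"
    unfolding tent1_def by (subst edge_fun_ep[OF that]) (use arc_len(2)[OF assms] in \<open>auto simp: L\<close>)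
  show "tent2 e0 (ep \<Gamma> e0 t) = min (2 * t) (arc_len e0 - t)" if "t \<in> icc 0 (len \<Gamma> e0)"
    unfolding tent2_def by (subst edge_fun_ep[OF that]) (use arc_len(2)[OF assms] in \<open>auto simp: L\<close>)
qed

lemma ramp:
  assumes "e0 \<in> carcs \<Gamma>" "len \<Gamma> e0 = \<infinity>"
  shows "ramp e0 \<in> RFun \<Gamma>" "slope_compatible \<Gamma> par (ramp e0)"
proof -
  have p: "pwa (\<lambda>t. min t 1) (icc 0 l)" for l by (intro pwa_min pwa_id pwa_const) auto
  show "ramp e0 \<in> RFun \<Gamma>" unfolding ramp_def
    by (rule single_edge_fun_RFun[OF p]) (use assms in \<open>auto intro!: continuous_intros\<close>)
  show "slope_compatible \<Gamma> par (ramp e0)"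
  proof (rule zero_slope_compatible)
    fix e assume e: "e \<in> carcs \<Gamma>" "len \<Gamma> e = \<infinity>"
    have "ramp e0 (ep \<Gamma> e t) = (if e = e0 then 1 else 0)" if "t \<ge> 1" for t using that e by (simp add: ramp_def)
    then show "\<exists>c. end_affine (\<lambda>t. ramp e0 (ep \<Gamma> e t)) 0 c" by (rule zero_slopeI)
  qed
qed

lemma Rel_sym: "(e1, e2) \<in> Rel \<Longrightarrow> (e2, e1) \<in> Rel"
  using curve_par unfolding is_curve_with_parallel_rays_def equiv_def sym_def Rel_def by blast

lemma class_fun:
  assumes "e0 \<in> carcs \<Gamma>" "len \<Gamma> e0 = \<infinity>"
  shows "class_fun e0 \<in> RFun \<Gamma>" "slope_compatible \<Gamma> par (class_fun e0)"
    "\<And>t. t \<in> icc 0 \<infinity> \<Longrightarrow> class_fun e0 (ep \<Gamma> e0 t) = t"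
    "\<And>e. e \<in> carcs \<Gamma> \<Longrightarrow> len \<Gamma> e = \<infinity> \<Longrightarrow> slope \<Gamma> (class_fun e0) e = (if (e0, e) \<in> Rel\<^sup>* then 1 else 0)"
proof -
  show "class_fun e0 \<in> RFun \<Gamma>" unfolding class_fun_def
  proof (rule edge_fun_RFun)
    fix e
    show "pwa (\<lambda>t. if len \<Gamma> e = \<infinity> \<and> (e0, e) \<in> Rel\<^sup>* then t else 0) (icc 0 (len \<Gamma> e))"
      by (cases "len \<Gamma> e = \<infinity> \<and> (e0, e) \<in> Rel\<^sup>*") (simp_all only: if_True if_False simp_thms pwa_id pwa_const is_interval_icc)
    show "continuous_on (icc 0 (len \<Gamma> e)) (\<lambda>t. if len \<Gamma> e = \<infinity> \<and> (e0, e) \<in> Rel\<^sup>* then t else 0)"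
      by (cases "len \<Gamma> e = \<infinity> \<and> (e0, e) \<in> Rel\<^sup>*") (simp_all only: if_True if_False simp_thms continuous_on_id continuous_on_const)
  qed auto
  show sl: "slope \<Gamma> (class_fun e0) e = (if (e0, e) \<in> Rel\<^sup>* then 1 else 0)" if e: "e \<in> carcs \<Gamma>" "len \<Gamma> e = \<infinity>" for e
  proof (rule slope_eqI)
    have "class_fun e0 (ep \<Gamma> e t) = (if (e0, e) \<in> Rel\<^sup>* then t else 0)" if "t \<ge> 1" for t
      using that e by (simp add: class_fun_def)
    then show "end_affine (\<lambda>t. class_fun e0 (ep \<Gamma> e t)) (if (e0, e) \<in> Rel\<^sup>* then 1 else 0) 0"
      unfolding end_affine_def by (intro exI[of _ 1]) simp
  qed
  show "slope_compatible \<Gamma> par (class_fun e0)" unfolding slope_compatible_def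
  proof (intro ballI, clarify)
    fix L1 L2 e1 e2 assume *: "(L1, L2) \<in> par" "tail_in \<Gamma> e1 L1" "tail_in \<Gamma> e2 L2"
    then have r: "(e1, e2) \<in> Rel" unfolding Rel_def by blast
    then have "(e0, e1) \<in> Rel\<^sup>* \<longleftrightarrow> (e0, e2) \<in> Rel\<^sup>*" using Rel_sym by (meson rtrancl.rtrancl_into_rtrancl)
    then show "slope \<Gamma> (class_fun e0) e1 = slope \<Gamma> (class_fun e0) e2" using sl * by (simp add: tail_in_def)
  qed
  show "class_fun e0 (ep \<Gamma> e0 t) = t" if "t \<in> icc 0 \<infinity>" for t
    unfolding class_fun_def by (subst edge_fun_ep) (use that assms in auto)
qed

lemma slope_Rel:
  assumes "slope_compatible \<Gamma> par g" "(e1, e2) \<in> Rel\<^sup>*" shows "slope \<Gamma> g e1 = slope \<Gamma> g e2"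
  using assms(2)
proof (induction rule: rtrancl_induct)
  case (step e2 e3)
  then show ?case using assms(1) unfolding Rel_def slope_compatible_def by fastforce
qed simp

text \<open>The first tent determines the points up to two thirds of the edge, the second one the
  points from one third on, and the ratio of the two tents distinguishes the first third from the
  last one.\<close>

lemma tents_injective:
  fixes t s L :: real
  assumes "min t (2 * L - 2 * t) = min s (2 * L - 2 * s)" "min (2 * t) (L - t) = min (2 * s) (L - s)"
    "0 < t" "t < L" "0 < s" "s < L"
  shows "t = s"
  using assms unfolding min_def by (auto split: if_splits)

definition coord_funs :: "(point \<Rightarrow> real) set" where
  "coord_funs = bump ` cverts \<Gamma> \<union> (\<Union>e\<in>{e\<in>carcs \<Gamma>. len \<Gamma> e \<noteq> \<infinity>}. {tent1 e, tent2 e})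
     \<union> (\<Union>e\<in>{e\<in>carcs \<Gamma>. len \<Gamma> e = \<infinity>}. {ramp e, class_fun e})"

text \<open>Bumps distinguish vertices; tents and ramps detect the edge in whose interior a point
  lies, and then the two tents, or the class function of the edge, determine its position.\<close>

lemma coord_funs_separate:
  assumes x: "x \<in> finite_points \<Gamma>" and y: "y \<in> finite_points \<Gamma>" and eq: "\<And>f. f \<in> coord_funs \<Longrightarrow> f x = f y"
  shows "x = y"
proof -
  have pos: "\<exists>f\<in>coord_funs. f (Inner e t) > 0 \<and> (\<forall>v. f (Vert v) = 0) \<and> (\<forall>e' t'. e' \<noteq> e \<longrightarrow> f (Inner e' t') = 0)"
    if e: "e \<in> carcs \<Gamma>" "0 < t" "ereal t < len \<Gamma> e" for e t
  proof (cases "len \<Gamma> e = \<infinity>")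
    case True
    then have "ramp e \<in> coord_funs" using e unfolding coord_funs_def by blast
    then show ?thesis by (rule bexI[rotated]) (use e in \<open>auto simp: ramp_def\<close>)
  next
    case False
    then have "tent1 e \<in> coord_funs" using e unfolding coord_funs_def by blast
    moreover have "t < arc_len e" using e arc_len(1)[OF e(1) False] by simp
    ultimately show ?thesis by (intro bexI[of _ "tent1 e"]) (use e in \<open>auto simp: tent1_def\<close>)
  qed
  show ?thesis
  proof (cases rule: finite_pointsD[OF curve x]; cases rule: finite_pointsD[OF curve y])
    fix u v assume uv: "x = Vert u" "u \<in> cverts \<Gamma>" "y = Vert v"
    then have "bump u \<in> coord_funs" unfolding coord_funs_def by blast
    from eq[OF this] show ?thesis using uv \<delta>(1) by (auto split: if_splits)
  next
    fix u e t assume *: "x = Vert u" "y = Inner e t" "e \<in> carcs \<Gamma>" "0 < t" "ereal t < len \<Gamma> e"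
    then obtain f where "f \<in> coord_funs" "f y > 0" "f x = 0" using pos by blast
    then show ?thesis using eq[of f] by simp
  next
    fix u e t assume *: "y = Vert u" "x = Inner e t" "e \<in> carcs \<Gamma>" "0 < t" "ereal t < len \<Gamma> e"
    then obtain f where "f \<in> coord_funs" "f x > 0" "f y = 0" using pos by blast
    then show ?thesis using eq[of f] by simp
  next
    fix e t e' t' assume *: "x = Inner e t" "e \<in> carcs \<Gamma>" "0 < t" "ereal t < len \<Gamma> e"
      "y = Inner e' t'" "e' \<in> carcs \<Gamma>" "0 < t'" "ereal t' < len \<Gamma> e'"
    obtain f where f: "f \<in> coord_funs" "f x > 0" "\<And>e' t'. e' \<noteq> e \<Longrightarrow> f (Inner e' t') = 0" using pos * by metis
    have ee: "e' = e" using f eq[of f] *(5) by fastforce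
    have "t = t'"
    proof (cases "len \<Gamma> e = \<infinity>")
      case True
      then have "class_fun e \<in> coord_funs" using * unfolding coord_funs_def by blast
      from eq[OF this] show ?thesis using * ee True by (simp add: class_fun_def)
    next
      case False
      then have "tent1 e \<in> coord_funs" "tent2 e \<in> coord_funs" using * unfolding coord_funs_def by blast+
      then have "tent1 e x = tent1 e y" "tent2 e x = tent2 e y" using eq by blast+
      moreover have "t < arc_len e" "t' < arc_len e" using * ee arc_len(1)[OF *(2) False] by auto
      ultimately show ?thesis using * ee by (intro tents_injective[of t "arc_len e" t']) (auto simp: tent1_def tent2_def)
    qed
    then show ?thesis using * ee by simp
  qed
qed

lemma coord_funs_RFun: assumes "f \<in> coord_funs" shows "f \<in> RFun \<Gamma>" "slope_compatible \<Gamma> par f"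
  using assms bump_RFun bump_compatible tents ramp class_fun unfolding coord_funs_def by auto

lemma affine_slope:
  assumes "ereal a < b" "\<And>t. t \<in> icc a b \<Longrightarrow> q + t * real_of_int z = real_of_int k * t + c" shows "z = k"
proof -
  obtain r where r: "r \<in> ioo a b" using ioo_nonempty[OF assms(1)] by blast
  have "a \<in> icc a b" "r \<in> icc a b" "a < r" using assms(1) r by (auto simp: icc_def ioo_def)
  then have "q + a * z = k * a + c" "q + r * z = k * r + c" using assms(2) by blast+
  then have "(r - a) * (real_of_int z - real_of_int k) = 0" by (simp add: algebra_simps)
  then show ?thesis using \<open>a < r\<close> by simp
qed

lemma prim_unit:
  assumes "\<forall>i\<ge>n. z i = 0" "i < n" "z i = 1 \<or> z i = (-1::int)" shows "prim n z (\<lambda>j. if j = i then z i else 0)"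
proof -
  have "(\<Sum>j<n. (if j = i then z i else 0) * z j) = z i * z i" using assms(2) by (simp add: if_distrib[of "\<lambda>x. x * _"] cong: if_cong)
  then show ?thesis using assms unfolding prim_def by auto
qed

text \<open>On every piece of an edge one coordinate has slope plus or minus one, which makes the
  direction primitive: on a finite edge this is the first tent up to two thirds of the edge and the
  second tent afterwards, on an infinite edge its class function. The class functions also show that
  equal directions at infinity only occur within a class of edges.\<close>

lemma curve_realization: "\<exists>n F. realization \<Gamma> par n F"
proof -
  have "finite coord_funs" unfolding coord_funs_def using curveD(6,7)[OF curve] by auto
  then obtain fs where fs: "set fs = coord_funs" using finite_list by blast
  define n where "n = length fs"
  define F where "F x = (\<lambda>i. if i < n then (fs ! i) x else 0)" for x
  have fsi: "fs ! i \<in> coord_funs" if "i < n" for i using that fs unfolding n_def by (metis nth_mem)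
  have idx: "\<exists>i<n. fs ! i = f" if "f \<in> coord_funs" for f using that fs unfolding n_def by (metis in_set_conv_nth)
  have Fi: "(\<lambda>x. F x i) = fs ! i" if "i < n" for i using that by (auto simp: F_def)
  have "realization \<Gamma> par n F"
  proof (rule realization.intro)
    show "is_curve_with_parallel_rays \<Gamma> par" by (rule curve_par)
    show FR: "F x \<in> Rn n" for x by (simp add: F_def Rn_iff)
    show RF: "(\<lambda>x. F x i) \<in> RFun \<Gamma>" "slope_compatible \<Gamma> par (\<lambda>x. F x i)" if "i < n" for i
      using coord_funs_RFun[OF fsi[OF that]] Fi[OF that] by simp_all
    show "inj_on F (finite_points \<Gamma>)"
    proof (rule inj_onI)
      fix x y assume xy: "x \<in> finite_points \<Gamma>" "y \<in> finite_points \<Gamma>" "F x = F y"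
      have "f x = f y" if "f \<in> coord_funs" for f
        using idx[OF that] fun_cong[OF xy(3)] by (auto simp: F_def split: if_splits) metis
      then show "x = y" using coord_funs_separate[OF xy(1,2)] by blast
    qed
    show "slope \<Gamma> g e1 = slope \<Gamma> g e2" if e: "e1 \<in> carcs \<Gamma>" "e2 \<in> carcs \<Gamma>" "len \<Gamma> e1 = \<infinity>" "len \<Gamma> e2 = \<infinity>"
      and eq: "\<And>i. i < n \<Longrightarrow> slope \<Gamma> (\<lambda>x. F x i) e1 = slope \<Gamma> (\<lambda>x. F x i) e2"
      and g: "slope_compatible \<Gamma> par g" for e1 e2 g
    proof -
      have "class_fun e1 \<in> coord_funs" unfolding coord_funs_def using e by blast
      then obtain i where "i < n" "fs ! i = class_fun e1" using idx by blast
      then have "slope \<Gamma> (class_fun e1) e1 = slope \<Gamma> (class_fun e1) e2" using eq Fi by metis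
      then have "(e1, e2) \<in> Rel\<^sup>*" using class_fun(4)[OF e(1,3)] e by (auto split: if_splits)
      then show ?thesis using slope_Rel g by blast
    qed
    fix e assume e: "e \<in> carcs \<Gamma>"
    have c: "pwa (\<lambda>t. F (ep \<Gamma> e t) i) (icc 0 (len \<Gamma> e))" "continuous_on (icc 0 (len \<Gamma> e)) (\<lambda>t. F (ep \<Gamma> e t) i)" if "i < n" for i
      using RF(1)[OF that] e unfolding RFun_def by auto
    obtain B where B: "finite B" "\<And>a b. \<lbrakk>0 \<le> a; ereal a < b; b \<le> len \<Gamma> e; ioo a b \<inter> B = {}\<rbrakk> \<Longrightarrow>
      \<exists>q z. q \<in> Rn n \<and> (\<forall>i\<ge>n. z i = 0) \<and> (\<forall>t\<in>icc a b. F (ep \<Gamma> e t) = pt q z t)"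
      using path_common_breaks[of n "\<lambda>t. F (ep \<Gamma> e t)" "len \<Gamma> e", OF c FR] by blast
    show "\<exists>B. finite B \<and> (\<forall>a b. 0 \<le> a \<longrightarrow> ereal a < b \<longrightarrow> b \<le> len \<Gamma> e \<longrightarrow> ioo a b \<inter> B = {} \<longrightarrow>
        (\<exists>q v w. prim n v w \<and> (\<forall>t\<in>icc a b. F (ep \<Gamma> e t) = pt q v t)))"
    \<comment> \<open>Two thirds of a finite edge is where the first tent changes its slope.\<close>
    proof (intro exI[of _ "insert (2 * arc_len e / 3) B"] conjI allI impI)
      show "finite (insert (2 * arc_len e / 3) B)" using B(1) by simp
      fix a b assume ab: "0 \<le> a" "ereal a < b" "b \<le> len \<Gamma> e" "ioo a b \<inter> insert (2 * arc_len e / 3) B = {}"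
      have "ioo a b \<inter> B = {}" using ab(4) by blast
      then obtain q z where qz: "\<forall>i\<ge>n. z i = 0" "\<And>t. t \<in> icc a b \<Longrightarrow> F (ep \<Gamma> e t) = pt q z t" using B(2)[OF ab(1-3)] by blast
      have sub: "icc a b \<subseteq> icc 0 (len \<Gamma> e)" using ab icc_mono by blast
      have one: "\<exists>w. prim n z w" if f: "f \<in> coord_funs" and k: "k = 1 \<or> k = -1"
        and fk: "\<And>t. t \<in> icc a b \<Longrightarrow> f (ep \<Gamma> e t) = real_of_int k * t + c" for f k c
      proof -
        obtain i where i: "i < n" "fs ! i = f" using idx[OF f] by blast
        have "q i + t * real_of_int (z i) = real_of_int k * t + c" if t: "t \<in> icc a b" for t
        proof -
          have "F (ep \<Gamma> e t) i = q i + t * real_of_int (z i)" using qz(2)[OF t] by (simp add: pt_def)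
          moreover have "F (ep \<Gamma> e t) i = f (ep \<Gamma> e t)" using i by (simp add: F_def)
          ultimately show ?thesis using fk[OF t] by simp
        qed
        then have "z i = k" using affine_slope[OF ab(2)] by blast
        then show ?thesis using prim_unit[OF qz(1) i(1)] k by blast
      qed
      have "\<exists>w. prim n z w"
      proof (cases "len \<Gamma> e = \<infinity>")
        case True
        have "class_fun e \<in> coord_funs" unfolding coord_funs_def using e True by blast
        then show ?thesis by (rule one[of _ 1 0]) (use class_fun(3)[OF e True] sub True in auto)
      next
        case False
        have T: "tent1 e \<in> coord_funs" "tent2 e \<in> coord_funs" unfolding coord_funs_def using e False by blast+
        show ?thesis
        proof (cases "b \<le> ereal (2 * arc_len e / 3)")
          case True
          have "min t (2 * arc_len e - 2 * t) = t" if "t \<in> icc a b" for t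
          proof -
            have "ereal t \<le> b" using that by (simp add: icc_def)
            then have "ereal t \<le> ereal (2 * arc_len e / 3)" using True by (rule order_trans)
            then show ?thesis by simp
          qed
          then show ?thesis by (intro one[OF T(1), of 1 0]) (use tents(5)[OF e False] sub in auto)
        next
          case b: False
          have "2 * arc_len e / 3 \<notin> ioo a b" using ab(4) by blast
          then have "2 * arc_len e / 3 \<le> a" using b by (auto simp: ioo_def)
          then have "min (2 * t) (arc_len e - t) = - t + arc_len e" if "t \<in> icc a b" for t
            using that arc_len(2)[OF e False] by (auto simp: icc_def)
          then show ?thesis by (intro one[OF T(2), of "-1" "arc_len e"]) (use tents(6)[OF e False] sub in auto)
        qed
      qed
      then show "\<exists>q v w. prim n v w \<and> (\<forall>t\<in>icc a b. F (ep \<Gamma> e t) = pt q v t)" using qz(2) by blast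
    qed
  qed
  then show ?thesis by blast
qed

end

lemma curve_imp_four_conditions:
  assumes "is_curve_with_parallel_rays \<Gamma> par" "\<theta> \<in> T_algebra_iso (Rat_par \<Gamma> par) (Rat_const \<Gamma>) S \<iota>"
  shows "\<exists>n. \<exists>\<psi>\<in>T_algebra_surj (trop_rat n) (trop_rat_const n) S \<iota>. four_conditions n \<psi>"
proof -
  obtain n F where r: "realization \<Gamma> par n F" using curve_realization[OF assms(1)] by blast
  interpret realization \<Gamma> par n F by (rule r)
  have c: "trop_rat_const n a \<in> carrier (trop_rat n)" if "a \<noteq> \<infinity>" for a
    using that by (cases a) (auto simp: trop_rat_const_simps intro: neginf_carrier emb_carrier PL_const)
  note comp = surj_comp_iso[OF \<kappa>_surj assms(2) c]
  have "four_conditions n (\<theta> \<circ> \<kappa>)" unfolding four_conditions_iff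
    using V_seg_union V_nonempty V_connected comp(2) \<kappa>_Ker by (intro exI[of _ V]) simp
  then show ?thesis using comp(1) by blast
qed

section \<open>Connected unions of segments are realizations of curves\<close>

definition neg :: "(nat \<Rightarrow> int) \<Rightarrow> nat \<Rightarrow> int" where "neg v = (\<lambda>i. - v i)"

lemma neg_neg [simp]: "neg (neg v) = v" by (simp add: neg_def)

lemma pt_neg: "pt p (neg v) t = pt p v (- t)" by (simp add: pt_def neg_def)

lemma pt_pt: "pt (pt p v s) v t = pt p v (s + t)" by (auto simp: pt_def algebra_simps)

lemma prim_neg: "prim n v w \<Longrightarrow> prim n (neg v) (neg w)" by (simp add: prim_def neg_def)

lemma prim_nonzero: "prim n v w \<Longrightarrow> \<exists>i<n. v i \<noteq> 0"
proof (rule ccontr)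
  assume *: "prim n v w" "\<not> (\<exists>i<n. v i \<noteq> 0)"
  then have "(\<Sum>i<n. w i * v i) = 0" by (intro sum.neutral) auto
  then show False using * by (simp add: prim_def)
qed

lemma pt_inj: assumes "prim n v w" "pt p v s = pt p v t" shows "s = t"
proof -
  obtain i where "v i \<noteq> 0" using prim_nonzero[OF assms(1)] by blast
  moreover have "p i + s * v i = p i + t * v i" using fun_cong[OF assms(2), of i] by (simp add: pt_def)
  ultimately show ?thesis by simp
qed

lemma prim_parallel:
  assumes v: "prim n v w" and v': "prim n v' w'" and c: "\<And>i. real_of_int (v i) = c * real_of_int (v' i)"
  shows "v = v' \<or> v = neg v'"
proof -
  define m where "m = (\<Sum>i<n. w' i * v i)"
  define k where "k = (\<Sum>i<n. w i * v' i)"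
  have "real_of_int m = c * real_of_int (\<Sum>i<n. w' i * v' i)"
    unfolding m_def by (simp add: sum_distrib_left c mult_ac)
  then have mc: "real_of_int m = c" using v' by (simp add: prim_def del: of_int_sum of_int_mult)
  have "real_of_int (\<Sum>i<n. w i * v i) = c * real_of_int k"
    unfolding k_def by (simp add: sum_distrib_left c mult_ac)
  then have "real_of_int m * real_of_int k = 1" using v mc by (simp add: prim_def del: of_int_sum of_int_mult)
  then have "m * k = 1" by (metis of_int_1 of_int_eq_iff of_int_mult)
  then have "m = 1 \<or> m = -1" by (metis zmult_eq_1_iff)
  then have "c = 1 \<or> c = -1" using mc by auto
  then have "(\<forall>i. v i = v' i) \<or> (\<forall>i. v i = - v' i)"
  proof
    assume "c = 1" then show ?thesis using c by simp
  next
    assume "c = -1"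
    then have "real_of_int (v i) = real_of_int (- v' i)" for i using c[of i] by simp
    then have "v i = - v' i" for i by (simp only: of_int_eq_iff)
    then show ?thesis by blast
  qed
  then show ?thesis by (auto simp: neg_def)
qed

text \<open>One of the two primitive vectors on a line through the origin is lexicographically positive;
  this fixes an orientation of the finite edges.\<close>

definition positive :: "(nat \<Rightarrow> int) \<Rightarrow> bool" where
  "positive v \<longleftrightarrow> v (LEAST i. v i \<noteq> 0) > 0"

lemma positive_neg: assumes "prim n v w" shows "positive (neg v) \<longleftrightarrow> \<not> positive v"
proof -
  obtain i where "v i \<noteq> 0" using prim_nonzero[OF assms] by blast
  then have "v (LEAST i. v i \<noteq> 0) \<noteq> 0" by (rule LeastI)
  then show ?thesis unfolding positive_def neg_def by auto
qed

locale seg_system =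
  fixes n :: nat and \<S> :: "seg set"
  assumes finite_S: "finite \<S>" and ok: "s \<in> \<S> \<Longrightarrow> seg_ok n s" and nonempty: "\<S> \<noteq> {}"
begin

definition V :: "(nat \<Rightarrow> real) set" where "V = \<Union>(seg_pts ` \<S>)"

definition long :: "seg set" where "long = {s\<in>\<S>. sl s \<noteq> 0}"

lemma longD: assumes "s \<in> long" shows "s \<in> \<S>" "0 < sl s" "prim n (sv s) (sw s)"
  using assms ok[of s] unfolding long_def seg_ok_def by auto

definition parallel :: "seg \<Rightarrow> seg \<Rightarrow> bool" where
  "parallel s r \<longleftrightarrow> sv r = sv s \<or> sv r = neg (sv s)"

text \<open>Vertices: the ends of the segments and the points where segments of different directions
  meet.\<close>

definition B :: "(nat \<Rightarrow> real) set" where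
  "B = sp ` \<S> \<union> (\<lambda>s. pt (sp s) (sv s) (real_of_ereal (sl s))) ` {s\<in>\<S>. sl s \<noteq> \<infinity>}
     \<union> (\<Union>s\<in>long. \<Union>r\<in>{r\<in>long. \<not> parallel s r}. seg_pts s \<inter> seg_pts r)"

lemma meet_once:
  assumes "s \<in> long" "r \<in> long" "\<not> parallel s r" "x \<in> seg_pts s \<inter> seg_pts r" "y \<in> seg_pts s \<inter> seg_pts r"
  shows "x = y"
proof (rule ccontr)
  assume ne: "x \<noteq> y"
  obtain t1 t2 t3 t4 where t: "x = pt (sp s) (sv s) t1" "y = pt (sp s) (sv s) t2" "x = pt (sp r) (sv r) t3" "y = pt (sp r) (sv r) t4"
    using assms(4,5) unfolding seg_pts_def by blast
  have d: "(t1 - t2) * sv s i = (t3 - t4) * sv r i" for i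
    using fun_cong[OF t(1), of i] fun_cong[OF t(2), of i] fun_cong[OF t(3), of i] fun_cong[OF t(4), of i]
    by (simp add: pt_def algebra_simps)
  have "t3 \<noteq> t4" using ne t(3,4) by auto
  then have "real_of_int (sv r i) = ((t1 - t2) / (t3 - t4)) * real_of_int (sv s i)" for i
    using d[of i] by (simp add: field_simps)
  then show False using prim_parallel[OF longD(3)[OF assms(2)] longD(3)[OF assms(1)]] assms(3) unfolding parallel_def by blast
qed

lemma finite_B: "finite B"
proof -
  have fl: "finite long" using finite_S unfolding long_def by simp
  have fin: "finite (seg_pts s \<inter> seg_pts r)" if "s \<in> long" "r \<in> long" "\<not> parallel s r" for s r
  proof (cases "seg_pts s \<inter> seg_pts r = {}")
    case False
    then obtain x where "x \<in> seg_pts s \<inter> seg_pts r" by blast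
    then have "seg_pts s \<inter> seg_pts r \<subseteq> {x}" using meet_once[OF that] by blast
    then show ?thesis by (rule finite_subset) simp
  qed simp
  have "finite (\<Union>s\<in>long. \<Union>r\<in>{r\<in>long. \<not> parallel s r}. seg_pts s \<inter> seg_pts r)"
    by (intro finite_UN_I fl) (use fl fin in auto)
  moreover have "finite (sp ` \<S>)" "finite ((\<lambda>s. pt (sp s) (sv s) (real_of_ereal (sl s))) ` {s\<in>\<S>. sl s \<noteq> \<infinity>})"
    using finite_S by simp_all
  ultimately show ?thesis unfolding B_def by (simp only: finite_Un simp_thms)
qed

lemma start_B: "s \<in> \<S> \<Longrightarrow> sp s \<in> B" unfolding B_def by auto

lemma end_B: "s \<in> \<S> \<Longrightarrow> sl s = ereal L \<Longrightarrow> pt (sp s) (sv s) L \<in> B" unfolding B_def by force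

lemma B_V: "B \<subseteq> V"
proof
  fix x assume "x \<in> B"
  then consider s where "s \<in> \<S>" "x = sp s" | s where "s \<in> \<S>" "sl s \<noteq> \<infinity>" "x = pt (sp s) (sv s) (real_of_ereal (sl s))"
    | s where "s \<in> long" "x \<in> seg_pts s" unfolding B_def by blast
  then show "x \<in> V"
  proof cases
    case 1 then show ?thesis using sp_in_seg[OF ok] unfolding V_def by blast
  next
    case 2
    have "0 \<le> sl s" using ok[OF 2(1)] by (simp add: seg_ok_def)
    then have "real_of_ereal (sl s) \<in> icc 0 (sl s)" using 2(2) by (cases "sl s") (auto simp: icc_def)
    then show ?thesis using 2 unfolding V_def seg_pts_def by blast
  next
    case 3 then show ?thesis using longD(1) unfolding V_def by blast
  qed
qed

lemma V_Rn: "V \<subseteq> Rn n" unfolding V_def using seg_pts_Rn[OF ok] by blast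

lemma parallel_through:
  assumes "x \<notin> B" "s \<in> long" "r \<in> long" "x \<in> seg_pts s" "x \<in> seg_pts r" shows "parallel s r"
  using assms unfolding B_def by blast

text \<open>The germs of edges: a vertex with a direction that leads into one of the segments.\<close>

definition germ :: "(nat \<Rightarrow> real) \<Rightarrow> (nat \<Rightarrow> int) \<Rightarrow> seg \<Rightarrow> real \<Rightarrow> bool" where
  "germ a v s \<tau> \<longleftrightarrow> a \<in> B \<and> s \<in> long \<and> \<tau> \<in> icc 0 (sl s) \<and> a = pt (sp s) (sv s) \<tau> \<and>
     (v = sv s \<and> ereal \<tau> < sl s \<or> v = neg (sv s) \<and> 0 < \<tau>)"

text \<open>The length of the edge that leaves the vertex \<open>a\<close> in direction
  \<open>v\<close>: the parameter of the next vertex on the line.\<close>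

definition elen :: "(nat \<Rightarrow> real) \<Rightarrow> (nat \<Rightarrow> int) \<Rightarrow> ereal" where
  "elen a v = (if \<exists>t>0. pt a v t \<in> B then ereal (Min {t. 0 < t \<and> pt a v t \<in> B}) else \<infinity>)"

lemma germ_prim: assumes "germ a v s \<tau>" shows "\<exists>w. prim n v w"
  using assms longD(3) prim_neg unfolding germ_def by blast

lemma elen:
  assumes "prim n v w"
  shows "0 < elen a v" "0 < t \<Longrightarrow> ereal t < elen a v \<Longrightarrow> pt a v t \<notin> B"
    "elen a v = ereal l \<Longrightarrow> pt a v l \<in> B" "0 < t \<Longrightarrow> pt a v t \<in> B \<Longrightarrow> elen a v \<le> ereal t"
proof -
  let ?T = "{t. 0 < t \<and> pt a v t \<in> B}"
  have "inj_on (pt a v) ?T" using pt_inj[OF assms] unfolding inj_on_def by blast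
  moreover have "finite (pt a v ` ?T)" by (rule finite_subset[OF _ finite_B]) auto
  ultimately have fin: "finite ?T" using finite_imageD by blast
  have Min: "Min ?T \<in> ?T" if "\<exists>t>0. pt a v t \<in> B" by (rule Min_in[OF fin]) (use that in blast)
  show "0 < elen a v" using Min unfolding elen_def by auto
  show le: "elen a v \<le> ereal t" if "0 < t" "pt a v t \<in> B" for t
  proof -
    have "Min ?T \<le> t" by (rule Min_le[OF fin]) (use that in simp)
    then show ?thesis using that unfolding elen_def by auto
  qed
  show "pt a v t \<notin> B" if "0 < t" "ereal t < elen a v" using le[of t] that by (meson not_less)
  show "pt a v l \<in> B" if "elen a v = ereal l" using Min that unfolding elen_def by (auto split: if_splits)
qed

text \<open>The ends of segments are vertices, so an edge does not leave the segment that it starts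
  in.\<close>

lemma germ_edge:
  assumes g: "germ a v s \<tau>" and t: "t \<in> icc 0 (elen a v)" shows "pt a v t \<in> seg_pts s"
proof -
  obtain w where w: "prim n v w" using germ_prim[OF g] by blast
  have s: "s \<in> \<S>" "\<tau> \<in> icc 0 (sl s)" "a = pt (sp s) (sv s) \<tau>" using g longD(1) unfolding germ_def by auto
  have t0: "0 \<le> t" "ereal t \<le> elen a v" using t by (auto simp: icc_def)
  consider "v = sv s" "ereal \<tau> < sl s" | "v = neg (sv s)" "0 < \<tau>" using g unfolding germ_def by blast
  then show ?thesis
  proof cases
    case 1
    have "ereal (\<tau> + t) \<le> sl s"
    proof (cases "sl s")
      case (real L)
      have "pt a v (L - \<tau>) = pt (sp s) (sv s) L" using s(3) 1(1) by (simp add: pt_pt)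
      then have "pt a v (L - \<tau>) \<in> B" using end_B[OF s(1) real] by simp
      then have "elen a v \<le> ereal (L - \<tau>)" using elen(4)[OF w] 1(2) real by simp
      then have "ereal t \<le> ereal (L - \<tau>)" using t0(2) order_trans by blast
      then show ?thesis using real by simp
    qed (use 1 in auto)
    then have "\<tau> + t \<in> icc 0 (sl s)" using t0 s(2) by (auto simp: icc_def)
    then show ?thesis using s(3) 1(1) unfolding seg_pts_def by (auto simp: pt_pt)
  next
    case 2
    have "pt a v \<tau> = sp s" using s(3) 2(1) by (simp add: pt_neg pt_pt) (simp add: pt_def)
    then have "elen a v \<le> ereal \<tau>" using elen(4)[OF w 2(2), of a] start_B[OF s(1)] by simp
    then have "ereal t \<le> ereal \<tau>" using t0(2) order_trans by blast
    then have *: "ereal (\<tau> - t) \<le> ereal \<tau>" "0 \<le> \<tau> - t" using t0 by auto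
    have "ereal \<tau> \<le> sl s" using s(2) by (simp add: icc_def)
    with *(1) have "ereal (\<tau> - t) \<le> sl s" by (rule order_trans)
    then have "\<tau> - t \<in> icc 0 (sl s)" using *(2) by (simp add: icc_def)
    then show ?thesis using s(3) 2(1) unfolding seg_pts_def by (auto simp: pt_neg pt_pt)
  qed
qed

lemma germ_reverse:
  assumes g: "germ a v s \<tau>" and l: "elen a v = ereal l"
  shows "\<exists>\<tau>'. germ (pt a v l) (neg v) s \<tau>'" "elen (pt a v l) (neg v) = ereal l"
proof -
  obtain w where w: "prim n v w" using germ_prim[OF g] by blast
  have l0: "0 < l" using elen(1)[OF w, of a] l by simp
  have s: "s \<in> long" "\<tau> \<in> icc 0 (sl s)" "a = pt (sp s) (sv s) \<tau>" "a \<in> B" using g unfolding germ_def by auto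
  have b: "pt a v l \<in> B" using elen(3)[OF w l] .
  have "pt a v l \<in> seg_pts s" by (rule germ_edge[OF g]) (use l l0 in \<open>simp add: icc_def\<close>)
  then obtain \<tau>' where \<tau>': "\<tau>' \<in> icc 0 (sl s)" "pt a v l = pt (sp s) (sv s) \<tau>'" unfolding seg_pts_def by blast
  have "germ (pt a v l) (neg v) s \<tau>'"
  proof (cases "v = sv s \<and> ereal \<tau> < sl s")
    case True
    then have "pt (sp s) (sv s) \<tau>' = pt (sp s) (sv s) (\<tau> + l)" using \<tau>'(2) s(3) by (simp add: pt_pt)
    then have "\<tau>' = \<tau> + l" using pt_inj[OF longD(3)[OF s(1)]] by blast
    then have "0 < \<tau>'" using s(2) l0 by (simp add: icc_def)
    then show ?thesis using b s(1) \<tau>' True unfolding germ_def by simp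
  next
    case False
    then have v: "v = neg (sv s)" using g unfolding germ_def by blast
    then have "pt (sp s) (sv s) \<tau>' = pt (sp s) (sv s) (\<tau> - l)" using \<tau>'(2) s(3) by (simp add: pt_neg pt_pt)
    then have "\<tau>' = \<tau> - l" using pt_inj[OF longD(3)[OF s(1)]] by blast
    then have *: "ereal \<tau>' < ereal \<tau>" using l0 by simp
    have "ereal \<tau> \<le> sl s" using s(2) by (simp add: icc_def)
    with * have "ereal \<tau>' < sl s" by (rule less_le_trans)
    then show ?thesis using b s(1) \<tau>' v unfolding germ_def by simp
  qed
  then show "\<exists>\<tau>'. germ (pt a v l) (neg v) s \<tau>'" by blast
  have bk: "pt (pt a v l) (neg v) t = pt a v (l - t)" for t by (simp add: pt_neg pt_pt)
  have w': "prim n (neg v) (neg w)" using prim_neg[OF w] .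
  show "elen (pt a v l) (neg v) = ereal l"
  proof (rule antisym)
    show "elen (pt a v l) (neg v) \<le> ereal l"
      by (rule elen(4)[OF w' l0]) (use s(4) bk[of l] in \<open>simp add: pt_def\<close>)
    show "ereal l \<le> elen (pt a v l) (neg v)"
    proof (rule ccontr)
      assume "\<not> ereal l \<le> elen (pt a v l) (neg v)"
      then obtain m where m: "elen (pt a v l) (neg v) = ereal m" "m < l"
        using elen(1)[OF w', of "pt a v l"] by (cases "elen (pt a v l) (neg v)") auto
      have "0 < m" using elen(1)[OF w', of "pt a v l"] m by simp
      have "pt a v (l - m) \<in> B" using elen(3)[OF w' m(1)] bk by simp
      moreover have "pt a v (l - m) \<notin> B" by (rule elen(2)[OF w]) (use m(2) \<open>0 < m\<close> l in auto)
      ultimately show False by simp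
    qed
  qed
qed

text \<open>A finite edge has a germ at each of its two ends; only the one with positive direction
  is kept.\<close>

definition Ed :: "((nat \<Rightarrow> real) \<times> (nat \<Rightarrow> int)) set" where
  "Ed = {(a, v). (\<exists>s \<tau>. germ a v s \<tau>) \<and> (elen a v = \<infinity> \<or> positive v)}"

lemma finite_Ed: "finite Ed"
proof (rule finite_subset)
  show "Ed \<subseteq> B \<times> (sv ` \<S> \<union> (\<lambda>s. neg (sv s)) ` \<S>)" unfolding Ed_def germ_def using longD(1) by blast
qed (use finite_B finite_S in auto)

lemma EdD:
  assumes "(a, v) \<in> Ed"
  shows "a \<in> B" "\<exists>w. prim n v w" "t \<in> icc 0 (elen a v) \<Longrightarrow> pt a v t \<in> V" "0 < elen a v"
proof -
  obtain s \<tau> where g: "germ a v s \<tau>" using assms unfolding Ed_def by blast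
  show "a \<in> B" using g unfolding germ_def by blast
  show w: "\<exists>w. prim n v w" using germ_prim[OF g] .
  show "t \<in> icc 0 (elen a v) \<Longrightarrow> pt a v t \<in> V"
    using germ_edge[OF g] g longD(1) unfolding V_def germ_def by blast
  show "0 < elen a v" using w elen(1) by blast
qed

text \<open>By the choice of the vertices, two edges through a common point that is not a vertex lie
  on the same line. Neither contains an end of the other in its interior, so they coincide, and the
  choice of orientations leaves only one description.\<close>

lemma edges_disjoint:
  assumes e: "(a, v) \<in> Ed" "(a', v') \<in> Ed" and eq: "pt a v t = pt a' v' t'"
    and t: "0 < t" "ereal t < elen a v" "0 < t'" "ereal t' < elen a' v'"
  shows "a = a' \<and> v = v' \<and> t = t'"
proof -
  obtain s \<tau> where g: "germ a v s \<tau>" using e(1) unfolding Ed_def by blast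
  obtain s' \<tau>' where g': "germ a' v' s' \<tau>'" using e(2) unfolding Ed_def by blast
  obtain w where w: "prim n v w" using germ_prim[OF g] by blast
  obtain w' where w': "prim n v' w'" using germ_prim[OF g'] by blast
  have aB: "a \<in> B" "a' \<in> B" using g g' unfolding germ_def by auto
  have "pt a v t \<notin> B" using elen(2)[OF w t(1,2)] .
  moreover have "pt a v t \<in> seg_pts s" by (rule germ_edge[OF g]) (use t in \<open>simp add: icc_def\<close>)
  moreover have "pt a v t \<in> seg_pts s'" unfolding eq by (rule germ_edge[OF g']) (use t in \<open>simp add: icc_def\<close>)
  ultimately have "parallel s s'" using parallel_through g g' unfolding germ_def by blast
  moreover have "v = sv s \<or> v = neg (sv s)" "v' = sv s' \<or> v' = neg (sv s')" using g g' unfolding germ_def by blast+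
  ultimately consider "v' = v" | "v' = neg v" unfolding parallel_def by (metis neg_neg)
  then show ?thesis
  proof cases
    case 1
    have a': "a' = pt a v (t - t')" using eq 1 by (auto simp: pt_def fun_eq_iff algebra_simps)
    have a: "a = pt a' v' (t' - t)" using eq 1 by (auto simp: pt_def fun_eq_iff algebra_simps)
    have "ereal (t - t') < elen a v" "ereal (t' - t) < elen a' v'"
      using t by (auto intro: le_less_trans[of _ "ereal t"] le_less_trans[of _ "ereal t'"])
    then have "0 < t - t' \<Longrightarrow> a' \<notin> B" "0 < t' - t \<Longrightarrow> a \<notin> B"
      using elen(2)[OF w, of "t - t'" a] elen(2)[OF w', of "t' - t" a'] a[symmetric] a'[symmetric] by simp_all
    then have "\<not> 0 < t - t'" "\<not> 0 < t' - t" using aB by blast+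
    then have "t = t'" by simp
    then show ?thesis using 1 a' by (simp add: pt_def)
  next
    case 2
    have a': "a' = pt a v (t + t')" using eq 2 by (auto simp: pt_def neg_def fun_eq_iff algebra_simps)
    have a: "a = pt a' v' (t' + t)" using eq 2 by (auto simp: pt_def neg_def fun_eq_iff algebra_simps)
    have "elen a v \<noteq> \<infinity>" using elen(2)[OF w, of "t + t'" a] aB(2) a'[symmetric] t by auto
    moreover have "elen a' v' \<noteq> \<infinity>" using elen(2)[OF w', of "t' + t" a'] aB(1) a[symmetric] t by auto
    ultimately have "positive v" "positive (neg v)" using e 2 unfolding Ed_def by auto
    then show ?thesis using positive_neg[OF w] by blast
  qed
qed

text \<open>Starting from \<open>x\<close>, go back on its segment to the last vertex; if the edge
  found there has the wrong orientation, use its other end.\<close>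

lemma edges_cover:
  assumes x: "x \<in> V" "x \<notin> B"
  obtains a v t where "(a, v) \<in> Ed" "0 < t" "ereal t < elen a v" "x = pt a v t"
proof -
  obtain s where s: "s \<in> \<S>" "x \<in> seg_pts s" using x(1) unfolding V_def by blast
  obtain \<tau> where \<tau>: "\<tau> \<in> icc 0 (sl s)" "x = pt (sp s) (sv s) \<tau>" using s(2) unfolding seg_pts_def by blast
  have "\<tau> \<noteq> 0" using start_B[OF s(1)] x(2) \<tau>(2) by (auto simp: pt_def)
  then have \<tau>0: "0 < \<tau>" using \<tau>(1) by (simp add: icc_def)
  then have "sl s \<noteq> 0" using \<tau>(1) by (auto simp: icc_def zero_ereal_def)
  then have sl: "s \<in> long" using s(1) by (simp add: long_def)
  note pr = longD(3)[OF sl]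
  have \<tau>l: "ereal \<tau> < sl s"
  proof (rule ccontr)
    assume "\<not> ereal \<tau> < sl s"
    then have "sl s = ereal \<tau>" using \<tau>(1) by (simp add: icc_def)
    then show False using end_B[OF s(1)] \<tau>(2) x(2) by simp
  qed
  let ?T = "{\<sigma>. 0 \<le> \<sigma> \<and> \<sigma> \<le> \<tau> \<and> pt (sp s) (sv s) \<sigma> \<in> B}"
  have "inj_on (pt (sp s) (sv s)) ?T" using pt_inj[OF pr] unfolding inj_on_def by blast
  moreover have "finite (pt (sp s) (sv s) ` ?T)" by (rule finite_subset[OF _ finite_B]) auto
  ultimately have fin: "finite ?T" using finite_imageD by blast
  have "0 \<in> ?T" using start_B[OF s(1)] \<tau>0 by (simp add: pt_def)
  define \<tau>1 where "\<tau>1 = Max ?T"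
  have \<tau>1: "\<tau>1 \<in> ?T" unfolding \<tau>1_def by (rule Max_in[OF fin]) (use \<open>0 \<in> ?T\<close> in blast)
  have max: "\<sigma> \<le> \<tau>1" if "\<sigma> \<in> ?T" for \<sigma> unfolding \<tau>1_def by (rule Max_ge[OF fin that])
  have "\<tau>1 \<noteq> \<tau>" using \<tau>1 \<tau>(2) x(2) by auto
  then have lt: "\<tau>1 < \<tau>" using \<tau>1 by simp
  define a where "a = pt (sp s) (sv s) \<tau>1"
  define t where "t = \<tau> - \<tau>1"
  have xt: "x = pt a (sv s) t" unfolding a_def t_def pt_pt using \<tau>(2) by simp
  have t0: "0 < t" using lt by (simp add: t_def)
  have "ereal \<tau>1 < ereal \<tau>" using lt by simp
  then have \<tau>1l: "ereal \<tau>1 < sl s" using \<tau>l by (rule less_trans)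
  then have g: "germ a (sv s) s \<tau>1" using \<tau>1 sl unfolding germ_def a_def icc_def by auto
  have tl: "ereal t < elen a (sv s)"
  proof (rule ccontr)
    assume "\<not> ereal t < elen a (sv s)"
    then obtain l where l: "elen a (sv s) = ereal l" "l \<le> t" using elen(1)[OF pr, of a] by (cases "elen a (sv s)") auto
    have "0 < l" using elen(1)[OF pr, of a] l by simp
    have "pt a (sv s) l \<in> B" using elen(3)[OF pr l(1)] .
    then have "\<tau>1 + l \<in> ?T" using \<tau>1 l(2) \<open>0 < l\<close> unfolding a_def t_def by (simp add: pt_pt)
    then show False using max \<open>0 < l\<close> by fastforce
  qed
  show thesis
  proof (cases "elen a (sv s) = \<infinity> \<or> positive (sv s)")
    case True
    then have "(a, sv s) \<in> Ed" using g unfolding Ed_def by blast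
    then show thesis using that t0 tl xt by blast
  next
    case False
    then obtain l where l: "elen a (sv s) = ereal l" using elen(1)[OF pr, of a] by (cases "elen a (sv s)") auto
    note rev = germ_reverse[OF g l]
    have "positive (neg (sv s))" using positive_neg[OF pr] False by blast
    then have "(pt a (sv s) l, neg (sv s)) \<in> Ed" using rev(1) unfolding Ed_def by blast
    moreover have "x = pt (pt a (sv s) l) (neg (sv s)) (l - t)" unfolding xt by (simp add: pt_neg pt_pt)
    moreover have "0 < l - t" "ereal (l - t) < elen (pt a (sv s) l) (neg (sv s))" using tl l rev(2) t0 by auto
    ultimately show thesis using that by blast
  qed
qed

subsection \<open>The graph\<close>

definition N :: nat where "N = card B"
definition M :: nat where "M = card Ed"
definition vtx :: "nat \<Rightarrow> nat \<Rightarrow> real" where "vtx = (SOME h. bij_betw h {0..<N} B)"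
definition edg :: "nat \<Rightarrow> (nat \<Rightarrow> real) \<times> (nat \<Rightarrow> int)" where "edg = (SOME h. bij_betw h {0..<M} Ed)"

lemma vtx: "bij_betw vtx {0..<N} B"
  unfolding vtx_def N_def
  by (rule someI_ex[where P="\<lambda>h. bij_betw h {0..<card B} B"]) (rule ex_bij_betw_nat_finite[OF finite_B])

lemma edg: "bij_betw edg {0..<M} Ed"
  unfolding edg_def M_def
  by (rule someI_ex[where P="\<lambda>h. bij_betw h {0..<card Ed} Ed"]) (rule ex_bij_betw_nat_finite[OF finite_Ed])

definition num :: "(nat \<Rightarrow> real) \<Rightarrow> nat" where "num = inv_into {0..<N} vtx"

lemma num: assumes "x \<in> B" shows "num x < N" "vtx (num x) = x"
proof -
  have "x \<in> vtx ` {0..<N}" using assms vtx unfolding bij_betw_def by simp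
  then show "num x < N" "vtx (num x) = x" unfolding num_def using inv_into_into[of x vtx "{0..<N}"] f_inv_into_f[of x vtx "{0..<N}"] by auto
qed

lemma vtx_B: "u < N \<Longrightarrow> vtx u \<in> B" using vtx unfolding bij_betw_def by auto
lemma vtx_inj: "u < N \<Longrightarrow> u' < N \<Longrightarrow> vtx u = vtx u' \<Longrightarrow> u = u'" using vtx unfolding bij_betw_def inj_on_def by auto
lemma num_vtx: "u < N \<Longrightarrow> num (vtx u) = u" using num vtx_B vtx_inj by blast
lemma edg_inj: "j < M \<Longrightarrow> j' < M \<Longrightarrow> edg j = edg j' \<Longrightarrow> j = j'" using edg unfolding bij_betw_def inj_on_def by auto

definition ea :: "nat \<Rightarrow> nat \<Rightarrow> real" where "ea j = fst (edg j)"
definition ev :: "nat \<Rightarrow> nat \<Rightarrow> int" where "ev j = snd (edg j)"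
definition el :: "nat \<Rightarrow> ereal" where "el j = elen (ea j) (ev j)"

lemma edge_Ed: "j < M \<Longrightarrow> (ea j, ev j) \<in> Ed" using edg unfolding bij_betw_def ea_def ev_def by auto

lemma Ed_edge: assumes "(a, v) \<in> Ed" obtains j where "j < M" "a = ea j" "v = ev j"
proof -
  have "(a, v) \<in> edg ` {0..<M}" using assms edg unfolding bij_betw_def by simp
  then obtain j where "j < M" "edg j = (a, v)" by auto
  then show thesis using that unfolding ea_def ev_def by force
qed

lemma edge_prim: "j < M \<Longrightarrow> \<exists>w. prim n (ev j) w" using EdD(2)[OF edge_Ed] .

lemma el_pos: "j < M \<Longrightarrow> 0 < el j" unfolding el_def using EdD(4)[OF edge_Ed] .

lemma edge_start: "j < M \<Longrightarrow> ea j \<in> B" using EdD(1)[OF edge_Ed] .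

lemma edge_end: assumes "j < M" "el j = ereal l" shows "pt (ea j) (ev j) l \<in> B"
  using edge_prim[OF assms(1)] elen(3) assms(2) unfolding el_def by blast

lemma edge_inner: assumes "j < M" "0 < t" "ereal t < el j" shows "pt (ea j) (ev j) t \<notin> B"
  using edge_prim[OF assms(1)] elen(2) assms(2,3) unfolding el_def by blast

text \<open>The vertices of the set are numbered from 0 to \<open>N - 1\<close>, and
  \<open>N + j\<close> is the leaf at infinity of an infinite edge \<open>j\<close>.\<close>

definition \<Gamma> :: curve where
  "\<Gamma> = (\<lparr>verts = {0..<N} \<union> {N + j | j. j < M \<and> el j = \<infinity>}, arcs = {0..<M},
     tail = (\<lambda>j. num (ea j)),
     head = (\<lambda>j. if el j = \<infinity> then N + j else num (pt (ea j) (ev j) (real_of_ereal (el j))))\<rparr>, el)"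

definition F :: "point \<Rightarrow> nat \<Rightarrow> real" where
  "F x = (case x of Vert u \<Rightarrow> (if u < N then vtx u else (\<lambda>_. 0))
     | Inner j t \<Rightarrow> (if j < M then pt (ea j) (ev j) t else (\<lambda>_. 0)))"

lemma \<Gamma>_simps: "carcs \<Gamma> = {0..<M}" "len \<Gamma> = el" "ctail \<Gamma> j = num (ea j)"
  "chead \<Gamma> j = (if el j = \<infinity> then N + j else num (pt (ea j) (ev j) (real_of_ereal (el j))))"
  "cverts \<Gamma> = {0..<N} \<union> {N + j | j. j < M \<and> el j = \<infinity>}"
  by (simp_all add: \<Gamma>_def)

lemma head_finite: assumes "j < M" "el j = ereal l"
  shows "chead \<Gamma> j < N" "vtx (chead \<Gamma> j) = pt (ea j) (ev j) l"
  using num[OF edge_end[OF assms]] assms(2) by (simp_all add: \<Gamma>_simps)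

lemma head_less: "j < M \<Longrightarrow> el j \<noteq> \<infinity> \<Longrightarrow> chead \<Gamma> j < N"
  using head_finite(1)[of j] el_pos[of j] by (cases "el j") auto

lemma tail_less: "j < M \<Longrightarrow> num (ea j) < N" using num(1)[OF edge_start] .

lemma F_ep: assumes "j < M" "t \<in> icc 0 (el j)" shows "F (ep \<Gamma> j t) = pt (ea j) (ev j) t"
proof -
  have "t \<in> icc 0 (len \<Gamma> j)" using assms(2) by (simp add: \<Gamma>_simps)
  then show ?thesis
  proof (cases rule: icc_cases)
    case 1
    then show ?thesis using num[OF edge_start[OF assms(1)]] by (simp add: F_def \<Gamma>_simps) (simp add: pt_def)
  next
    case 2
    then have "ep \<Gamma> j t = Vert (chead \<Gamma> j)" "el j = ereal t" by (simp_all add: \<Gamma>_simps(2))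
    then show ?thesis using head_finite[OF assms(1)] by (simp add: F_def)
  next
    case 3
    then show ?thesis using assms(1) by (simp add: F_def)
  qed
qed

definition edge_set :: "nat \<Rightarrow> (nat \<Rightarrow> real) set" where "edge_set j = pt (ea j) (ev j) ` icc 0 (el j)"

lemma edge_set_seg_union: assumes "j < M" shows "seg_union n (edge_set j)"
proof -
  obtain w where w: "prim n (ev j) w" using edge_prim[OF assms] by blast
  have "ea j \<in> Rn n" using edge_start[OF assms] B_V V_Rn by blast
  then have "seg_ok n (Seg (ea j) (ev j) w (el j))" using w el_pos[OF assms] by (simp add: seg_ok_def prim_def)
  then show ?thesis using seg_union_seg[of n "Seg (ea j) (ev j) w (el j)"] by (simp add: seg_pts_def edge_set_def)
qed

lemma edge_set_V: "j < M \<Longrightarrow> edge_set j \<subseteq> V"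
  unfolding edge_set_def el_def using EdD(3)[OF edge_Ed] by blast

lemma edge_set_B:
  assumes "j < M" "x \<in> edge_set j" "x \<in> B" shows "x = vtx (ctail \<Gamma> j) \<or> el j \<noteq> \<infinity> \<and> x = vtx (chead \<Gamma> j)"
proof -
  obtain t where t: "t \<in> icc 0 (el j)" "x = pt (ea j) (ev j) t" using assms(2) unfolding edge_set_def by blast
  have "t \<in> icc 0 (len \<Gamma> j)" using t by (simp add: \<Gamma>_simps)
  then show ?thesis
  proof (cases rule: icc_cases)
    case 1 then show ?thesis using t num(2)[OF edge_start[OF assms(1)]] by (simp add: \<Gamma>_simps pt_def)
  next
    case 2
    then have "el j = ereal t" by (simp add: \<Gamma>_simps)
    then show ?thesis using t(2) head_finite(2)[OF assms(1)] by simp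
  next
    case 3 then show ?thesis using edge_inner[OF assms(1)] t assms(3) by (simp add: \<Gamma>_simps)
  qed
qed

lemma edge_set_inner:
  assumes "j < M" "j' < M" "x \<in> edge_set j" "x \<in> edge_set j'" "x \<notin> B" shows "j = j'"
proof -
  have inner: "\<exists>t. 0 < t \<and> ereal t < el j \<and> x = pt (ea j) (ev j) t" if j: "j < M" "x \<in> edge_set j" for j
  proof -
    obtain t where t: "t \<in> icc 0 (el j)" "x = pt (ea j) (ev j) t" using j(2) unfolding edge_set_def by blast
    have "t \<in> icc 0 (len \<Gamma> j)" using t by (simp add: \<Gamma>_simps)
    then show ?thesis
    proof (cases rule: icc_cases)
      case 1 then show ?thesis using t edge_start[OF j(1)] assms(5) by (simp add: pt_def)
    next
      case 2 then show ?thesis using t edge_end[OF j(1)] assms(5) by (simp add: \<Gamma>_simps)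
    next
      case 3 then show ?thesis using t by (auto simp: \<Gamma>_simps)
    qed
  qed
  obtain t t' where "0 < t" "ereal t < el j" "x = pt (ea j) (ev j) t" "0 < t'" "ereal t' < el j'" "x = pt (ea j') (ev j') t'"
    using inner assms by metis
  then have "ea j = ea j' \<and> ev j = ev j'"
    using edges_disjoint[OF edge_Ed[OF assms(1)] edge_Ed[OF assms(2)], of t t'] unfolding el_def by blast
  then show ?thesis using edg_inj[OF assms(1,2)] unfolding ea_def ev_def by (simp add: prod_eq_iff)
qed

lemma V_cover: assumes "x \<in> V" "x \<notin> B" obtains j where "j < M" "x \<in> edge_set j"
proof -
  obtain a v t where *: "(a, v) \<in> Ed" "0 < t" "ereal t < elen a v" "x = pt a v t" using edges_cover[OF assms] by blast
  obtain j where j: "j < M" "a = ea j" "v = ev j" using Ed_edge[OF *(1)] by blast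
  have "x \<in> edge_set j" unfolding edge_set_def el_def using * j by (auto simp: icc_def)
  then show thesis using that j by blast
qed

lemma closedin_seg_union: assumes "seg_union n W" shows "closedin (Euclidean_space n) W"
proof (cases "W = {}")
  case False
  obtain \<T> where S: "finite \<T>" "\<forall>s\<in>\<T>. seg_ok n s" "W = \<Union>(seg_pts ` \<T>)" using assms unfolding seg_union_def by blast
  then have ne: "\<T> \<noteq> {}" using False by auto
  have "closedin (Euclidean_space n) {x \<in> Rn n. union_dist n \<T> x \<in> {0}}"
    by (rule closedin_continuous_map_preimage[OF PL_continuous_map[OF union_dist_PL[OF S(1) ne]]]) simp
  moreover have "{x \<in> Rn n. union_dist n \<T> x \<in> {0}} = W"
    using union_dist_zero_iff[OF S(1) ne S(2)] S(3) seg_union_Rn[OF assms] by blast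
  ultimately show ?thesis by simp
qed simp

lemma B_nonempty: "B \<noteq> {}" using nonempty start_B by blast

text \<open>The graph is connected: otherwise the components would split the union of the segments into
  two disjoint nonempty closed sets.\<close>

lemma graph_connected:
  assumes con: "connectedin (Euclidean_space n) V"
  shows "Digraph_Component.connected (fst \<Gamma>)"
proof -
  define R where "R = rtrancl_on (cverts \<Gamma>) ((arcs_ends (fst \<Gamma>))\<^sup>s)"
  have "Relation.sym ((arcs_ends (fst \<Gamma>))\<^sup>s)" unfolding symcl_def by (rule symI) auto
  then have sym: "(u, v) \<in> R \<Longrightarrow> (v, u) \<in> R" for u v
    unfolding R_def using rtrancl_on_sym symD by fast
  have trans: "(u, v) \<in> R \<Longrightarrow> (v, w) \<in> R \<Longrightarrow> (u, w) \<in> R" for u v w unfolding R_def by (rule rtrancl_on_trans)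
  have tv: "ctail \<Gamma> j \<in> cverts \<Gamma>" and hv: "chead \<Gamma> j \<in> cverts \<Gamma>" if "j < M" for j
  proof -
    show "ctail \<Gamma> j \<in> cverts \<Gamma>" using tail_less[OF that] by (simp add: \<Gamma>_simps)
    show "chead \<Gamma> j \<in> cverts \<Gamma>"
    proof (cases "el j = \<infinity>")
      case True then show ?thesis using that by (simp add: \<Gamma>_simps)
    next
      case False then show ?thesis using head_less[OF that False] by (simp add: \<Gamma>_simps(5))
    qed
  qed
  have step: "(ctail \<Gamma> j, chead \<Gamma> j) \<in> R" if "j < M" for j
  proof -
    have "(ctail \<Gamma> j, chead \<Gamma> j) \<in> (arcs_ends (fst \<Gamma>))\<^sup>s"
      unfolding symcl_def arcs_ends_def arc_to_ends_def using that by (auto simp: \<Gamma>_simps(1))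
    then show ?thesis unfolding R_def using tv[OF that] hv[OF that] by (meson rtrancl_on.intros)
  qed
  obtain b0 where "b0 \<in> B" using B_nonempty by blast
  define u0 where "u0 = num b0"
  have u0: "u0 < N" unfolding u0_def using num(1)[OF \<open>b0 \<in> B\<close>] .
  \<comment> \<open>The closed set of all vertices with property \<open>P\<close> and all edges whose tail has property \<open>P\<close>.\<close>
  define W where "W P = (\<Union>u\<in>{u. u < N \<and> P u}. {vtx u}) \<union> (\<Union>j\<in>{j. j < M \<and> P (ctail \<Gamma> j)}. edge_set j)" for P
  let ?C = "\<lambda>u. (u0, u) \<in> R" and ?D = "\<lambda>u. (u0, u) \<notin> R"
  have cl: "closedin (Euclidean_space n) (W P)" for P
  proof (rule closedin_seg_union)
    have "vtx u \<in> Rn n" if "u < N" for u using vtx_B[OF that] B_V V_Rn by blast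
    then show "seg_union n (W P)" unfolding W_def
      by (intro seg_union_Un seg_union_UN) (auto intro: seg_union_point edge_set_seg_union)
  qed
  have cov: "V \<subseteq> W ?C \<union> W ?D"
  proof
    fix x assume x: "x \<in> V"
    show "x \<in> W ?C \<union> W ?D"
    proof (cases "x \<in> B")
      case True
      then have "num x < N" "x \<in> {vtx (num x)}" using num by auto
      then show ?thesis unfolding W_def by blast
    next
      case False
      then obtain j where "j < M" "x \<in> edge_set j" using V_cover[OF x] by blast
      then show ?thesis unfolding W_def by blast
    qed
  qed
  have WB: "P (num x)" if x: "x \<in> W P" "x \<in> B" and P: "\<And>j. j < M \<Longrightarrow> P (ctail \<Gamma> j) \<Longrightarrow> P (chead \<Gamma> j)" for P x
  proof -
    consider u where "u < N" "P u" "x = vtx u" | j where "j < M" "P (ctail \<Gamma> j)" "x \<in> edge_set j" using x(1) unfolding W_def by blast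
    then show ?thesis
    proof cases
      case 1 then show ?thesis using num_vtx by simp
    next
      case 2
      have "x = vtx (ctail \<Gamma> j) \<or> el j \<noteq> \<infinity> \<and> x = vtx (chead \<Gamma> j)" using edge_set_B[OF 2(1,3) x(2)] .
      then show ?thesis
      proof
        assume "x = vtx (ctail \<Gamma> j)"
        then show ?thesis using 2 num_vtx tail_less[OF 2(1)] by (simp add: \<Gamma>_simps(3))
      next
        assume *: "el j \<noteq> \<infinity> \<and> x = vtx (chead \<Gamma> j)"
        then have "num x = chead \<Gamma> j" using num_vtx head_less[OF 2(1)] by blast
        then show ?thesis using P[OF 2(1,2)] by simp
      qed
    qed
  qed
  have stepC: "?C (ctail \<Gamma> j) \<longleftrightarrow> ?C (chead \<Gamma> j)" if "j < M" for j
    using step[OF that] trans sym by blast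
  have disj: "W ?C \<inter> W ?D \<inter> V = {}"
  proof (rule ccontr)
    assume "W ?C \<inter> W ?D \<inter> V \<noteq> {}"
    then obtain x where x: "x \<in> W ?C" "x \<in> W ?D" by blast
    show False
    proof (cases "x \<in> B")
      case True
      then show False using WB[of x ?C] WB[of x ?D] x stepC by blast
    next
      case False
      then have "x \<noteq> vtx u" if "u < N" for u using vtx_B[OF that] by blast
      then obtain j j' where "j < M" "?C (ctail \<Gamma> j)" "x \<in> edge_set j" "j' < M" "?D (ctail \<Gamma> j')" "x \<in> edge_set j'"
        using x unfolding W_def by blast
      then show False using edge_set_inner False by blast
    qed
  qed
  have ne: "W ?C \<inter> V \<noteq> {}"
  proof -
    have "?C u0" unfolding R_def using u0 by (auto simp: \<Gamma>_simps(5))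
    then have "vtx u0 \<in> W ?C" unfolding W_def using u0 by blast
    moreover have "vtx u0 \<in> V" using vtx_B[OF u0] B_V by blast
    ultimately show ?thesis by blast
  qed
  have "W ?D \<inter> V = {}"
  proof (rule ccontr)
    assume "W ?D \<inter> V \<noteq> {}"
    then have "\<exists>E1 E2. closedin (Euclidean_space n) E1 \<and> closedin (Euclidean_space n) E2 \<and>
       V \<subseteq> E1 \<union> E2 \<and> E1 \<inter> E2 \<inter> V = {} \<and> E1 \<inter> V \<noteq> {} \<and> E2 \<inter> V \<noteq> {}"
      by (intro exI[of _ "W ?C"] exI[of _ "W ?D"] conjI cl cov disj ne)
    then show False using con unfolding connectedin_closedin by blast
  qed
  then have fin: "?C u" if "u < N" for u
  proof (rule_tac ccontr)
    assume "\<not> ?C u"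
    then have "vtx u \<in> W ?D" unfolding W_def using that by blast
    then show False using vtx_B[OF that] B_V \<open>W ?D \<inter> V = {}\<close> by blast
  qed
  have "?C u" if u: "u \<in> cverts \<Gamma>" for u
  proof -
    consider "u < N" | j where "j < M" "el j = \<infinity>" "u = N + j" using u by (auto simp: \<Gamma>_simps(5))
    then show ?thesis
    proof cases
      case 1 then show ?thesis by (rule fin)
    next
      case 2
      then have "u = chead \<Gamma> j" by (simp add: \<Gamma>_simps)
      moreover have "?C (ctail \<Gamma> j)" by (rule fin) (use tail_less[OF 2(1)] in \<open>simp add: \<Gamma>_simps(3)\<close>)
      ultimately show ?thesis using stepC[OF 2(1)] by blast
    qed
  qed
  then have "(u, v) \<in> R" if "u \<in> cverts \<Gamma>" "v \<in> cverts \<Gamma>" for u v using that sym trans by blast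
  moreover have "cverts \<Gamma> \<noteq> {}" using u0 by (auto simp: \<Gamma>_simps(5))
  ultimately show ?thesis unfolding connected_conv R_def by blast
qed

lemma is_curve_\<Gamma>:
  assumes con: "connectedin (Euclidean_space n) V" shows "is_curve \<Gamma>"
proof -
  have hd: "chead \<Gamma> j \<in> cverts \<Gamma>" if "j < M" for j
    using head_less[OF that] that by (cases "el j = \<infinity>") (auto simp: \<Gamma>_simps)
  have "fin_digraph (fst \<Gamma>)"
  proof
    show "ctail \<Gamma> e \<in> cverts \<Gamma>" if "e \<in> carcs \<Gamma>" for e using tail_less that by (simp add: \<Gamma>_simps)
    show "chead \<Gamma> e \<in> cverts \<Gamma>" if "e \<in> carcs \<Gamma>" for e using hd that by (simp add: \<Gamma>_simps(1))
    show "finite (cverts \<Gamma>)" "finite (carcs \<Gamma>)" by (simp_all add: \<Gamma>_simps)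
  qed
  moreover have "chead \<Gamma> e \<noteq> ctail \<Gamma> e \<and> (\<forall>e'\<in>carcs \<Gamma>. e' \<noteq> e \<longrightarrow> chead \<Gamma> e \<noteq> ctail \<Gamma> e' \<and> chead \<Gamma> e \<noteq> chead \<Gamma> e')"
    if e: "e \<in> carcs \<Gamma>" "len \<Gamma> e = \<infinity>" for e
  proof -
    have he: "chead \<Gamma> e = N + e" using e by (simp add: \<Gamma>_simps)
    have t: "ctail \<Gamma> e' < N" if "e' \<in> carcs \<Gamma>" for e' using tail_less that by (simp add: \<Gamma>_simps)
    have h: "chead \<Gamma> e' < N \<or> chead \<Gamma> e' = N + e'" if "e' \<in> carcs \<Gamma>" for e'
      using head_less[of e'] that by (cases "el e' = \<infinity>") (auto simp: \<Gamma>_simps)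
    show ?thesis unfolding he using t h e(1) by fastforce
  qed
  ultimately show ?thesis unfolding is_curve_def using graph_connected[OF con] el_pos
    by (auto simp: case_prod_unfold \<Gamma>_simps(1,2))
qed

definition par :: "(point set \<times> point set) set" where
  "par = {(L1, L2). L1 \<in> rays \<Gamma> \<and> L2 \<in> rays \<Gamma> \<and> (\<exists>e1 e2. tail_in \<Gamma> e1 L1 \<and> tail_in \<Gamma> e2 L2 \<and> ev e1 = ev e2)}"

text \<open>All edges are embedded affinely and in primitive direction, and by definition of
  parallelism two rays are parallel if and only if they end in the same direction.\<close>

lemma realization_\<Gamma>:
  assumes con: "connectedin (Euclidean_space n) V"
  shows "realization \<Gamma> par n F" "F ` finite_points \<Gamma> = V"
proof -
  note curve = is_curve_\<Gamma>[OF con]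
  have fpV: "\<And>u. Vert u \<in> finite_points \<Gamma> \<Longrightarrow> u < N"
  proof -
    fix u assume u: "Vert u \<in> finite_points \<Gamma>"
    then have "u \<in> cverts \<Gamma>" using finite_points_subset unfolding points_eq by blast
    moreover have "u \<noteq> N + j" if "j < M" "el j = \<infinity>" for j
      using head_infinite[of j \<Gamma>] that u by (auto simp: \<Gamma>_simps)
    ultimately show "u < N" by (auto simp: \<Gamma>_simps(5))
  qed
  have vfp: "Vert u \<in> finite_points \<Gamma>" if "u < N" for u
    using that by (intro Vert_finite_point) (auto simp: \<Gamma>_simps)
  have tail_unique: "e = e'" if "(L, L') \<in> par" "tail_in \<Gamma> e L" "tail_in \<Gamma> e' L" for e e' L L'
    using ray_tail_unique[OF curve, of L] that unfolding par_def by blast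
  have tail_unique': "e = e'" if "(L', L) \<in> par" "tail_in \<Gamma> e L" "tail_in \<Gamma> e' L" for e e' L L'
    using ray_tail_unique[OF curve, of L] that unfolding par_def by blast
  have par: "is_curve_with_parallel_rays \<Gamma> par"
    unfolding is_curve_with_parallel_rays_def
  proof (intro conjI ballI impI curve)
    show "equiv (rays \<Gamma>) par"
    proof (rule equivI)
      show "par \<subseteq> rays \<Gamma> \<times> rays \<Gamma>" unfolding par_def by blast
      show "refl_on (rays \<Gamma>) par" unfolding refl_on_def par_def using ray_tail_unique[OF curve] by blast
      show "sym par" unfolding sym_def par_def by force
      show "Relation.trans par"
      proof (rule transI)
        fix x y z assume xy: "(x, y) \<in> par" and yz: "(y, z) \<in> par"
        obtain e1 e2 where "x \<in> rays \<Gamma>" "tail_in \<Gamma> e1 x" "tail_in \<Gamma> e2 y" "ev e1 = ev e2" using xy unfolding par_def by blast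
        moreover obtain e3 e4 where "z \<in> rays \<Gamma>" "tail_in \<Gamma> e3 y" "tail_in \<Gamma> e4 z" "ev e3 = ev e4" using yz unfolding par_def by blast
        moreover have "e2 = e3" using tail_unique[OF yz] calculation by blast
        ultimately show "(x, z) \<in> par" unfolding par_def by auto
      qed
    qed
    fix L1 L2 assume L: "L1 \<in> rays \<Gamma>" "L2 \<in> rays \<Gamma>" "L1 \<subseteq> L2"
    obtain e where e: "tail_in \<Gamma> e L1" using ray_tail_unique[OF curve L(1)] by blast
    then have "tail_in \<Gamma> e L2" using L(3) unfolding tail_in_def by blast
    then show "(L1, L2) \<in> par" unfolding par_def using e L by blast
  qed
  have F_end: "slope \<Gamma> (\<lambda>x. F x i) e = ev e i" if "e \<in> carcs \<Gamma>" "len \<Gamma> e = \<infinity>" for e i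
  proof (rule slope_eqI)
    have "F (ep \<Gamma> e t) i = real_of_int (ev e i) * t + ea e i" if "t \<ge> 0" for t
      using F_ep[of e t] that \<open>e \<in> carcs \<Gamma>\<close> \<open>len \<Gamma> e = \<infinity>\<close> by (simp add: \<Gamma>_simps icc_def pt_def)
    then show "end_affine (\<lambda>t. F (ep \<Gamma> e t) i) (ev e i) (ea e i)" unfolding end_affine_def by blast
  qed
  show "realization \<Gamma> par n F"
  proof (rule realization.intro)
    show "is_curve_with_parallel_rays \<Gamma> par" by (rule par)
    show "F x \<in> Rn n" for x
    proof -
      have "vtx u \<in> Rn n" if "u < N" for u using vtx_B[OF that] B_V V_Rn by blast
      moreover have "pt (ea j) (ev j) t \<in> Rn n" if j: "j < M" for j t
      proof (rule pt_Rn)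
        show "ea j \<in> Rn n" using edge_start[OF j] B_V V_Rn by blast
        show "\<forall>i\<ge>n. ev j i = 0" using edge_prim[OF j] by (auto simp: prim_def)
      qed
      ultimately show ?thesis using Rn_zero by (auto simp: F_def split: point.split)
    qed
    show "(\<lambda>x. F x i) \<in> RFun \<Gamma>" for i
    proof (rule RFunI)
      fix e assume e: "e \<in> carcs \<Gamma>"
      have "F (ep \<Gamma> e t) i = real_of_int (ev e i) * t + ea e i" if "t \<in> icc 0 (len \<Gamma> e)" for t
        using F_ep[of e t] that e by (simp add: \<Gamma>_simps pt_def)
      moreover have "continuous_on (icc 0 (len \<Gamma> e)) (\<lambda>t. real_of_int (ev e i) * t + ea e i)" by (intro continuous_intros)
      ultimately show "\<exists>\<phi>. (\<forall>t\<in>icc 0 (len \<Gamma> e). F (ep \<Gamma> e t) i = \<phi> t) \<and> pwa \<phi> (icc 0 (len \<Gamma> e)) \<and> continuous_on (icc 0 (len \<Gamma> e)) \<phi>"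
        by (intro exI[of _ "\<lambda>t. real_of_int (ev e i) * t + ea e i"]) (simp add: pwa_line)
    qed
    show "slope_compatible \<Gamma> par (\<lambda>x. F x i)" for i unfolding slope_compatible_def
    proof (intro ballI, clarify)
      fix L1 L2 e1 e2 assume *: "(L1, L2) \<in> par" "tail_in \<Gamma> e1 L1" "tail_in \<Gamma> e2 L2"
      obtain e1' e2' where "tail_in \<Gamma> e1' L1" "tail_in \<Gamma> e2' L2" "ev e1' = ev e2'" using *(1) unfolding par_def by blast
      then have "ev e1 = ev e2" using tail_unique[OF *(1) *(2)] tail_unique'[OF *(1) *(3)] by blast
      then show "slope \<Gamma> (\<lambda>x. F x i) e1 = slope \<Gamma> (\<lambda>x. F x i) e2"
        using F_end[of e1 i] F_end[of e2 i] * by (simp add: tail_in_def)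
    qed
    show "inj_on F (finite_points \<Gamma>)"
    proof (rule inj_onI)
      fix x y assume x: "x \<in> finite_points \<Gamma>" and y: "y \<in> finite_points \<Gamma>" and eq: "F x = F y"
      show "x = y"
      proof (cases rule: finite_pointsD[OF curve x]; cases rule: finite_pointsD[OF curve y])
        fix u v assume "x = Vert u" "y = Vert v"
        then show ?thesis using eq fpV x y vtx_inj by (auto simp: F_def)
      next
        fix u e t assume *: "x = Vert u" "y = Inner e t" "e \<in> carcs \<Gamma>" "0 < t" "ereal t < len \<Gamma> e"
        then have "F x \<in> B" "F y \<notin> B" using fpV[of u] x vtx_B edge_inner[of e t] by (auto simp: F_def \<Gamma>_simps)
        then show ?thesis using eq by simp
      next
        fix u e t assume *: "y = Vert u" "x = Inner e t" "e \<in> carcs \<Gamma>" "0 < t" "ereal t < len \<Gamma> e"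
        then have "F y \<in> B" "F x \<notin> B" using fpV[of u] y vtx_B edge_inner[of e t] by (auto simp: F_def \<Gamma>_simps)
        then show ?thesis using eq by simp
      next
        fix e t e' t' assume *: "x = Inner e t" "e \<in> carcs \<Gamma>" "0 < t" "ereal t < len \<Gamma> e"
          "y = Inner e' t'" "e' \<in> carcs \<Gamma>" "0 < t'" "ereal t' < len \<Gamma> e'"
        then have M: "e < M" "e' < M" by (auto simp: \<Gamma>_simps)
        have "pt (ea e) (ev e) t = pt (ea e') (ev e') t'" using eq * M by (simp add: F_def)
        then have "ea e = ea e' \<and> ev e = ev e' \<and> t = t'"
          using edges_disjoint[OF edge_Ed[OF M(1)] edge_Ed[OF M(2)]] * by (simp add: \<Gamma>_simps el_def)
        then show ?thesis using edg_inj[OF M] * unfolding ea_def ev_def by (simp add: prod_eq_iff)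
      qed
    qed
    show "\<exists>B. finite B \<and> (\<forall>a b. 0 \<le> a \<longrightarrow> ereal a < b \<longrightarrow> b \<le> len \<Gamma> e \<longrightarrow> ioo a b \<inter> B = {} \<longrightarrow>
        (\<exists>q v w. prim n v w \<and> (\<forall>t\<in>icc a b. F (ep \<Gamma> e t) = pt q v t)))" if e: "e \<in> carcs \<Gamma>" for e
    proof (intro exI[of _ "{}"] conjI allI impI)
      fix a b assume ab: "0 \<le> a" "ereal a < b" "b \<le> len \<Gamma> e"
      obtain w where w: "prim n (ev e) w" using edge_prim[of e] e by (auto simp: \<Gamma>_simps)
      have "F (ep \<Gamma> e t) = pt (ea e) (ev e) t" if "t \<in> icc a b" for t
      proof -
        have "t \<in> icc 0 (len \<Gamma> e)" using that icc_mono[OF ab(1,3)] by blast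
        then show ?thesis using F_ep[of e t] e by (simp add: \<Gamma>_simps)
      qed
      then show "\<exists>q v w. prim n v w \<and> (\<forall>t\<in>icc a b. F (ep \<Gamma> e t) = pt q v t)" using w by blast
    qed simp
    show "slope \<Gamma> g e1 = slope \<Gamma> g e2" if e: "e1 \<in> carcs \<Gamma>" "e2 \<in> carcs \<Gamma>" "len \<Gamma> e1 = \<infinity>" "len \<Gamma> e2 = \<infinity>"
      and eq: "\<And>i. i < n \<Longrightarrow> slope \<Gamma> (\<lambda>x. F x i) e1 = slope \<Gamma> (\<lambda>x. F x i) e2"
      and g: "slope_compatible \<Gamma> par g" for e1 e2 g
    proof -
      have "ev e1 i = ev e2 i" for i
      proof (cases "i < n")
        case True then show ?thesis using eq[OF True] F_end e by simp
      next
        case False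
        have "e1 < M" "e2 < M" using e by (simp_all add: \<Gamma>_simps)
        then obtain w1 w2 where "prim n (ev e1) w1" "prim n (ev e2) w2" using edge_prim by blast
        then show ?thesis using False by (simp add: prim_def)
      qed
      then have "ev e1 = ev e2" by blast
      moreover have "edge_point \<Gamma> e1 ` {0..\<infinity>} \<in> rays \<Gamma>" "tail_in \<Gamma> e1 (edge_point \<Gamma> e1 ` {0..\<infinity>})"
        "edge_point \<Gamma> e2 ` {0..\<infinity>} \<in> rays \<Gamma>" "tail_in \<Gamma> e2 (edge_point \<Gamma> e2 ` {0..\<infinity>})"
        using edge_ray[OF curve] e by blast+
      ultimately have "(edge_point \<Gamma> e1 ` {0..\<infinity>}, edge_point \<Gamma> e2 ` {0..\<infinity>}) \<in> par"
         "tail_in \<Gamma> e1 (edge_point \<Gamma> e1 ` {0..\<infinity>})" "tail_in \<Gamma> e2 (edge_point \<Gamma> e2 ` {0..\<infinity>})"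
        unfolding par_def by blast+
      then show ?thesis using g unfolding slope_compatible_def by blast
    qed
  qed
  show "F ` finite_points \<Gamma> = V"
  proof (intro equalityI subsetI)
    fix y assume "y \<in> F ` finite_points \<Gamma>"
    then obtain x where x: "x \<in> finite_points \<Gamma>" "y = F x" by blast
    show "y \<in> V"
    proof (cases rule: finite_pointsD[OF curve x(1)])
      case (1 v)
      then have "v < N" using fpV x(1) by simp
      then show ?thesis using 1 x(2) vtx_B B_V by (auto simp: F_def)
    next
      case (2 e t)
      then have "e < M" "t \<in> icc 0 (el e)" by (auto simp: \<Gamma>_simps icc_def)
      then have "y \<in> edge_set e" using x(2) 2(1) by (simp add: F_def edge_set_def)
      then show ?thesis using edge_set_V \<open>e < M\<close> by blast
    qed
  next
    fix y assume y: "y \<in> V"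
    show "y \<in> F ` finite_points \<Gamma>"
    proof (cases "y \<in> B")
      case True
      then have "F (Vert (num y)) = y" using num by (simp add: F_def)
      then show ?thesis using vfp[OF num(1)[OF True]] by (metis image_eqI)
    next
      case False
      then obtain j where j: "j < M" "y \<in> edge_set j" using V_cover[OF y] by blast
      then obtain t where t: "t \<in> icc 0 (el j)" "y = pt (ea j) (ev j) t" unfolding edge_set_def by blast
      then have "y = F (ep \<Gamma> j t)" using F_ep[OF j(1)] by simp
      moreover have "ep \<Gamma> j t \<in> finite_points \<Gamma>" by (rule ep_finite_point[OF curve]) (use j t in \<open>simp_all add: \<Gamma>_simps\<close>)
      ultimately show ?thesis by blast
    qed
  qed
qed

end

text \<open>The restriction map of the realization and \<open>\<psi>\<close> are surjections with
  the same kernel.\<close>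

lemma four_conditions_imp_curve:
  assumes \<psi>: "\<psi> \<in> T_algebra_surj (trop_rat n) (trop_rat_const n) S \<iota>" and four: "four_conditions n \<psi>"
  shows "\<exists>\<Gamma> par. is_curve_with_parallel_rays \<Gamma> par \<and> T_algebra_iso (Rat_par \<Gamma> par) (Rat_const \<Gamma>) S \<iota> \<noteq> {}"
proof -
  obtain V where V: "seg_union n V" "V \<noteq> {}" "connectedin (Euclidean_space n) V" "Ker (trop_rat n) \<psi> = cong_of n V"
    using four unfolding four_conditions_iff by blast
  obtain \<S> where S: "finite \<S>" "\<forall>s\<in>\<S>. seg_ok n s" "V = \<Union>(seg_pts ` \<S>)" using V(1) unfolding seg_union_def by blast
  interpret S: seg_system n \<S> by unfold_locales (use S V(2) in auto)
  have SV: "S.V = V" using S(3) by (simp add: S.V_def)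
  note r = S.realization_\<Gamma>[unfolded SV, OF V(3)]
  interpret r: realization S.\<Gamma> S.par n S.F by (rule r(1))
  have "T_algebra_iso (Rat_par S.\<Gamma> S.par) (Rat_const S.\<Gamma>) S \<iota> \<noteq> {}"
  proof (rule same_kernel_iso[OF r.\<kappa>_surj \<psi>])
    show "Ker (trop_rat n) r.\<kappa> = Ker (trop_rat n) \<psi>" using r.\<kappa>_Ker r(2) V(4) by simp
    show "trop_rat_const n a \<in> carrier (trop_rat n)" if "a \<noteq> \<infinity>" for a
      using that by (cases a) (auto simp: trop_rat_const_simps intro: neginf_carrier emb_carrier PL_const)
  qed (auto simp: trop_rat_simps trop_rat_closed intro: neginf_carrier emb_carrier PL_const)
  then show ?thesis using r.curve_par by blast
qed

section \<open>The characterization of rational function semifields\<close>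

theorem theorem4p9:
  fixes S :: "('s, 'm) ring_scheme" and \<iota> :: "ereal \<Rightarrow> 's"
  assumes "T_algebra S \<iota>"
  shows "((\<exists>\<Gamma> par. is_curve_with_parallel_rays \<Gamma> par \<and>
            T_algebra_iso (Rat_par \<Gamma> par) (Rat_const \<Gamma>) S \<iota> \<noteq> {})
          \<longleftrightarrow> (\<exists>n. \<exists>\<psi> \<in> T_algebra_surj (trop_rat n) (trop_rat_const n) S \<iota>. four_conditions n \<psi>)) \<and>
         ((\<exists>n. \<exists>\<psi> \<in> T_algebra_surj (trop_rat n) (trop_rat_const n) S \<iota>. four_conditions n \<psi>)
          \<longleftrightarrow> (\<exists>n. T_algebra_surj (trop_rat n) (trop_rat_const n) S \<iota> \<noteq> {}) \<and>
              (\<forall>n. \<forall>\<psi> \<in> T_algebra_surj (trop_rat n) (trop_rat_const n) S \<iota>. four_conditions n \<psi>))"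
proof (intro conjI iffI)
  assume "\<exists>\<Gamma> par. is_curve_with_parallel_rays \<Gamma> par \<and> T_algebra_iso (Rat_par \<Gamma> par) (Rat_const \<Gamma>) S \<iota> \<noteq> {}"
  then show "\<exists>n. \<exists>\<psi> \<in> T_algebra_surj (trop_rat n) (trop_rat_const n) S \<iota>. four_conditions n \<psi>"
    using curve_imp_four_conditions by blast
next
  assume "\<exists>n. \<exists>\<psi> \<in> T_algebra_surj (trop_rat n) (trop_rat_const n) S \<iota>. four_conditions n \<psi>"
  then show "\<exists>\<Gamma> par. is_curve_with_parallel_rays \<Gamma> par \<and> T_algebra_iso (Rat_par \<Gamma> par) (Rat_const \<Gamma>) S \<iota> \<noteq> {}"
    using four_conditions_imp_curve by blast
next
  assume "\<exists>n. \<exists>\<psi> \<in> T_algebra_surj (trop_rat n) (trop_rat_const n) S \<iota>. four_conditions n \<psi>"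
  then show "\<exists>n. T_algebra_surj (trop_rat n) (trop_rat_const n) S \<iota> \<noteq> {}" by blast
next
  assume "\<exists>n. \<exists>\<psi> \<in> T_algebra_surj (trop_rat n) (trop_rat_const n) S \<iota>. four_conditions n \<psi>"
  then obtain n \<psi> where \<psi>: "\<psi> \<in> T_algebra_surj (trop_rat n) (trop_rat_const n) S \<iota>" "four_conditions n \<psi>" by blast
  show "\<forall>n. \<forall>\<psi> \<in> T_algebra_surj (trop_rat n) (trop_rat_const n) S \<iota>. four_conditions n \<psi>"
    using hom_four_conditions[OF assms \<psi>] unfolding T_algebra_surj_def by blast
next
  assume "(\<exists>n. T_algebra_surj (trop_rat n) (trop_rat_const n) S \<iota> \<noteq> {}) \<and>
              (\<forall>n. \<forall>\<psi> \<in> T_algebra_surj (trop_rat n) (trop_rat_const n) S \<iota>. four_conditions n \<psi>)"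
  then show "\<exists>n. \<exists>\<psi> \<in> T_algebra_surj (trop_rat n) (trop_rat_const n) S \<iota>. four_conditions n \<psi>" by blast
qed

end
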